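(* Let $R$ be a real closed field, let $X \subseteq R^n$ be an irreducible, non-singular algebraic variety, and let $f \in R(X)$. If there is a finite sequence of blow-ups with smooth centres, with composition $\phi : \widetilde{X}\to X$, such that $f\circ\phi$ is a regular function on $\widetilde X$ with values in $R$, then $f$ is locally bounded, i.e. $f\in R_b(X)$.
   Context: Algebraic varieties over the real closed field $R$ are taken in the sense of Bochnak–Coste–Roy (zero sets in $R^n$ of polynomials). $R(X)$ is the field of rational functions on $X$, i.e. quotients $p/q$ of polynomial functions with $q\neq 0$. For $f\in R(X)$, $\mathrm{dom}(f)$ is the largest dense Zariski open subset $U$ of $X$ on which $f$ is regular (given as a quotient of polynomials with nowhere vanishing denominator on $U$, hence $R$-valued). A rational function $f\in R(X)$ is locally bounded if every $x\in X$ has a neighbourhood $V_x$ in the euclidean topology (induced by the order of $R$) such that $f(V_x\cap \mathrm{dom}(f))$ is a bounded subset of $R$. $R_b(X)$ denotes the set of all locally bounded rational functions on $X$. "$f\circ\phi$ is regular with values in $R$" means that the rational function $f\circ\phi$ on $\widetilde X$ extends to a regular $R$-valued function on all of $\widetilde X$. *)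

theory Defs
  imports
    "HOL-Library.Poly_Mapping"
    "HOL-Library.Extended_Nat"
    "HOL-Algebra.QuotRing"
    "Jordan_Normal_Form.Matrix"
    "Jordan_Normal_Form.DL_Rank"
begin

section \<open>Real closed fields\<close>

class real_closed_field = linordered_field +
  assumes nonneg_has_sqrt: "0 \<le> a \<Longrightarrow> \<exists>b. b * b = a"
    and odd_degree_has_root: "odd n \<Longrightarrow> f n \<noteq> 0 \<Longrightarrow> \<exists>x. (\<Sum>k\<le>n. f k * x ^ k) = 0"


section \<open>Polynomials in finitely many variables\<close>

text \<open>A polynomial is a finitely supported function from monomials to coefficients, a monomial
  a finitely supported function from variables to exponents. The variables of a polynomial on
  \<open>R\<^sup>n\<close> are \<open>0, \<dots>, n - 1\<close>; points of \<open>R\<^sup>n\<close> are the elements of \<open>carrier_vec n\<close>.\<close>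

type_synonym 'a mpol = "(nat \<Rightarrow>\<^sub>0 nat) \<Rightarrow>\<^sub>0 'a"

definition mpol_vars :: "'a::zero mpol \<Rightarrow> nat set" where
  "mpol_vars p = (\<Union>m\<in>Poly_Mapping.keys p. Poly_Mapping.keys m)"

definition mpols :: "nat \<Rightarrow> 'a::zero mpol set" where
  "mpols n = {p. mpol_vars p \<subseteq> {..<n}}"

definition mpol_eval :: "'a::comm_semiring_1 mpol \<Rightarrow> 'a vec \<Rightarrow> 'a" where
  "mpol_eval p x = (\<Sum>m\<in>Poly_Mapping.keys p.
     Poly_Mapping.lookup p m * (\<Prod>i\<in>Poly_Mapping.keys m. (x $ i) ^ Poly_Mapping.lookup m i))"

text \<open>The formal partial derivative. A monomial without the variable \<open>i\<close> contributes \<open>0\<close>, so the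
  truncated difference of exponents does no harm.\<close>

definition mpol_deriv :: "nat \<Rightarrow> 'a::comm_semiring_1 mpol \<Rightarrow> 'a mpol" where
  "mpol_deriv i p = (\<Sum>m\<in>Poly_Mapping.keys p.
     Poly_Mapping.single (m - Poly_Mapping.single i 1)
       (of_nat (Poly_Mapping.lookup m i) * Poly_Mapping.lookup p m))"

definition mpol_ring :: "nat \<Rightarrow> 'a::comm_ring_1 mpol ring" where
  "mpol_ring n = \<lparr>carrier = mpols n, mult = (*), one = 1, zero = 0, add = (+)\<rparr>"


section \<open>Algebraic sets and the Zariski topology\<close>

definition algebraic_set :: "nat \<Rightarrow> 'a::comm_ring_1 vec set \<Rightarrow> bool" where
  "algebraic_set n V \<longleftrightarrow>
     (\<exists>S \<subseteq> mpols n. V = {x \<in> carrier_vec n. \<forall>p\<in>S. mpol_eval p x = 0})"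

definition vanishing_ideal :: "nat \<Rightarrow> 'a::comm_ring_1 vec set \<Rightarrow> 'a mpol set" where
  "vanishing_ideal n V = {p \<in> mpols n. \<forall>x\<in>V. mpol_eval p x = 0}"

definition coordinate_ring :: "nat \<Rightarrow> 'a::comm_ring_1 vec set \<Rightarrow> 'a mpol set ring" where
  "coordinate_ring n V = mpol_ring n Quot vanishing_ideal n V"

definition zariski_closure :: "nat \<Rightarrow> 'a::comm_ring_1 vec set \<Rightarrow> 'a vec set" where
  "zariski_closure n S = \<Inter>{V. algebraic_set n V \<and> S \<subseteq> V}"

definition irreducible_set :: "nat \<Rightarrow> 'a::comm_ring_1 vec set \<Rightarrow> bool" where
  "irreducible_set n V \<longleftrightarrow> algebraic_set n V \<and> V \<noteq> {} \<and>
     (\<forall>A B. algebraic_set n A \<and> algebraic_set n B \<and> V = A \<union> B \<longrightarrow> V = A \<or> V = B)"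

definition irreducible_component ::
    "nat \<Rightarrow> 'a::comm_ring_1 vec set \<Rightarrow> 'a vec set \<Rightarrow> bool" where
  "irreducible_component n V W \<longleftrightarrow> irreducible_set n W \<and> W \<subseteq> V \<and>
     (\<forall>W'. irreducible_set n W' \<and> W \<subseteq> W' \<and> W' \<subseteq> V \<longrightarrow> W' = W)"

definition zariski_open_in :: "nat \<Rightarrow> 'a::comm_ring_1 vec set \<Rightarrow> 'a vec set \<Rightarrow> bool" where
  "zariski_open_in n X U \<longleftrightarrow> (\<exists>A. algebraic_set n A \<and> U = X - A)"

definition zariski_dense_in :: "nat \<Rightarrow> 'a::comm_ring_1 vec set \<Rightarrow> 'a vec set \<Rightarrow> bool" where
  "zariski_dense_in n X U \<longleftrightarrow> U \<subseteq> X \<and> X \<subseteq> zariski_closure n U"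


section \<open>Dimension and non-singularity\<close>

definition krull_dim :: "('a, 'b) ring_scheme \<Rightarrow> enat" where
  "krull_dim A = Sup {enat k | k. \<exists>P :: nat \<Rightarrow> 'a set.
     (\<forall>i\<le>k. primeideal (P i) A) \<and> (\<forall>i<k. P i \<subset> P (Suc i))}"

definition jacobian :: "nat \<Rightarrow> 'a::comm_ring_1 mpol list \<Rightarrow> 'a vec \<Rightarrow> 'a mat" where
  "jacobian n ps x = mat (length ps) n (\<lambda>(i, j). mpol_eval (mpol_deriv j (ps ! i)) x)"

text \<open>The Jacobian criterion of Bochnak--Coste--Roy for a point of an irreducible algebraic set:
  the rank equals \<open>n\<close> minus the dimension, for a list of generators of the whole vanishing ideal.\<close>

definition nonsingular_point :: "nat \<Rightarrow> 'a::field vec set \<Rightarrow> 'a vec \<Rightarrow> bool" where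
  "nonsingular_point n V x \<longleftrightarrow> (\<exists>ps. set ps \<subseteq> mpols n \<and>
     vanishing_ideal n V = Idl\<^bsub>mpol_ring n\<^esub> (set ps) \<and>
     enat (vec_space.rank (length ps) (jacobian n ps x)) + krull_dim (coordinate_ring n V) = enat n)"

text \<open>An algebraic set that need not be irreducible is non-singular if every point lies on exactly
  one irreducible component and is a non-singular point of it. Components of different dimensions
  are allowed; the empty set is non-singular.\<close>

definition nonsingular :: "nat \<Rightarrow> 'a::field vec set \<Rightarrow> bool" where
  "nonsingular n V \<longleftrightarrow> algebraic_set n V \<and>
     (\<forall>x\<in>V. \<exists>W. irreducible_component n V W \<and> x \<in> W \<and>
        (\<forall>W'. irreducible_component n V W' \<and> x \<in> W' \<longrightarrow> W' = W) \<and> nonsingular_point n W x)"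


section \<open>Regular functions and regular maps\<close>

definition regular_function :: "nat \<Rightarrow> 'a::field vec set \<Rightarrow> ('a vec \<Rightarrow> 'a) \<Rightarrow> bool" where
  "regular_function n X h \<longleftrightarrow> (\<exists>p\<in>mpols n. \<exists>q\<in>mpols n.
     \<forall>x\<in>X. mpol_eval q x \<noteq> 0 \<and> h x = mpol_eval p x / mpol_eval q x)"

definition regular_map ::
    "nat \<Rightarrow> 'a::field vec set \<Rightarrow> nat \<Rightarrow> 'a vec set \<Rightarrow> ('a vec \<Rightarrow> 'a vec) \<Rightarrow> bool" where
  "regular_map m Y n X \<phi> \<longleftrightarrow> (\<forall>y\<in>Y. \<phi> y \<in> carrier_vec n) \<and> \<phi> ` Y \<subseteq> X \<and>
     (\<forall>i<n. regular_function m Y (\<lambda>y. \<phi> y $ i))"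

definition biregular ::
    "nat \<Rightarrow> 'a::field vec set \<Rightarrow> nat \<Rightarrow> 'a vec set \<Rightarrow> ('a vec \<Rightarrow> 'a vec) \<Rightarrow> bool" where
  "biregular m Y n X \<psi> \<longleftrightarrow> bij_betw \<psi> Y X \<and> regular_map m Y n X \<psi> \<and>
     regular_map n X m Y (inv_into Y \<psi>)"


section \<open>Rational functions\<close>

definition fractions :: "nat \<Rightarrow> 'a::field vec set \<Rightarrow> ('a mpol \<times> 'a mpol) set" where
  "fractions n X = mpols n \<times> (mpols n - vanishing_ideal n X)"

definition fraction_rel ::
    "nat \<Rightarrow> 'a::field vec set \<Rightarrow> (('a mpol \<times> 'a mpol) \<times> ('a mpol \<times> 'a mpol)) set" where
  "fraction_rel n X = {((p, q), (p', q')). (p, q) \<in> fractions n X \<and> (p', q') \<in> fractions n X \<and>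
     p * q' - p' * q \<in> vanishing_ideal n X}"

text \<open>For irreducible \<open>X\<close> this is the set \<open>R(X)\<close> underlying the fraction field of the ring of
  polynomial functions; a rational function is the class of all fractions that represent it.\<close>

definition rational_functions :: "nat \<Rightarrow> 'a::field vec set \<Rightarrow> ('a mpol \<times> 'a mpol) set set" where
  "rational_functions n X = fractions n X // fraction_rel n X"

definition rat_regular_on :: "('a::field mpol \<times> 'a mpol) set \<Rightarrow> 'a vec set \<Rightarrow> bool" where
  "rat_regular_on f U \<longleftrightarrow> (\<exists>(p, q)\<in>f. \<forall>x\<in>U. mpol_eval q x \<noteq> 0)"

text \<open>The union is the largest such set: \<open>p/q\<close> and \<open>p'/q'\<close> representing \<open>f\<close> can be merged into
  \<open>(pq + p'q')/(q\<^sup>2 + q'\<^sup>2)\<close>, and the Zariski topology is Noetherian.\<close>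

definition rat_dom ::
    "nat \<Rightarrow> 'a::field vec set \<Rightarrow> ('a mpol \<times> 'a mpol) set \<Rightarrow> 'a vec set" where
  "rat_dom n X f =
     \<Union>{U. zariski_open_in n X U \<and> zariski_dense_in n X U \<and> rat_regular_on f U}"

definition rat_value :: "('a::field mpol \<times> 'a mpol) set \<Rightarrow> 'a vec \<Rightarrow> 'a" where
  "rat_value f x =
     (THE v. \<exists>(p, q)\<in>f. mpol_eval q x \<noteq> 0 \<and> v = mpol_eval p x / mpol_eval q x)"

text \<open>The rational function \<open>f \<circ> \<phi>\<close> on \<open>Y\<close> extends to a regular function on all of \<open>Y\<close>.\<close>

definition regular_composition ::
    "nat \<Rightarrow> 'a::field vec set \<Rightarrow> ('a mpol \<times> 'a mpol) set \<Rightarrow>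
     nat \<Rightarrow> 'a vec set \<Rightarrow> ('a vec \<Rightarrow> 'a vec) \<Rightarrow> bool" where
  "regular_composition n X f m Y \<phi> \<longleftrightarrow> (\<exists>h. regular_function m Y h \<and>
     (\<forall>y\<in>Y. \<phi> y \<in> rat_dom n X f \<longrightarrow> h y = rat_value f (\<phi> y)))"


section \<open>The euclidean topology and locally bounded rational functions\<close>

definition euclidean_open :: "nat \<Rightarrow> 'a::linordered_field vec set \<Rightarrow> bool" where
  "euclidean_open n U \<longleftrightarrow> U \<subseteq> carrier_vec n \<and>
     (\<forall>x\<in>U. \<exists>r>0. {y \<in> carrier_vec n. (\<Sum>i<n. (y $ i - x $ i)\<^sup>2) < r\<^sup>2} \<subseteq> U)"

definition euclidean_nhd ::
    "nat \<Rightarrow> 'a::linordered_field vec set \<Rightarrow> 'a vec \<Rightarrow> 'a vec set \<Rightarrow> bool" where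
  "euclidean_nhd n X x V \<longleftrightarrow> V \<subseteq> X \<and> (\<exists>U. euclidean_open n U \<and> x \<in> U \<and> U \<inter> X \<subseteq> V)"

definition locally_bounded_functions ::
    "nat \<Rightarrow> 'a::linordered_field vec set \<Rightarrow> ('a mpol \<times> 'a mpol) set set" where
  "locally_bounded_functions n X = {f \<in> rational_functions n X. \<forall>x\<in>X. \<exists>V. euclidean_nhd n X x V \<and>
     bdd_above (rat_value f ` (V \<inter> rat_dom n X f)) \<and>
     bdd_below (rat_value f ` (V \<inter> rat_dom n X f))}"


section \<open>Blow-ups\<close>

text \<open>Projective space \<open>P\<^bsup>l-1\<^esup>(R)\<close> is an affine variety: the line through \<open>(u\<^sub>0, \<dots>, u\<^bsub>l-1\<^esub>)\<close>
  corresponds to the matrix \<open>(u\<^sub>i u\<^sub>j / \<Sum>\<^sub>k u\<^sub>k\<^sup>2)\<close> of the orthogonal projection onto it, which is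
  stored here as the vector of its \<open>l\<^sup>2\<close> entries, row by row.\<close>

definition projection_point :: "'a::field list \<Rightarrow> 'a vec" where
  "projection_point u = (let l = length u in
     vec (l * l) (\<lambda>k. u ! (k div l) * u ! (k mod l) / (\<Sum>i<l. (u ! i)\<^sup>2)))"

text \<open>The Zariski closure in \<open>X \<times> P\<^bsup>l-1\<^esup>(R)\<close> of the graph of \<open>[g\<^sub>0 : \<dots> : g\<^bsub>l-1\<^esub>]\<close> on \<open>X - Z\<close>, where
  \<open>gs\<close> generates the ideal of \<open>Z\<close> in the ring of polynomial functions on \<open>X\<close>.\<close>

definition blowup_model ::
    "nat \<Rightarrow> 'a::field vec set \<Rightarrow> 'a vec set \<Rightarrow> 'a mpol list \<Rightarrow> 'a vec set" where
  "blowup_model n X Z gs = zariski_closure (n + length gs * length gs)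
     {x @\<^sub>v projection_point (map (\<lambda>g. mpol_eval g x) gs) | x. x \<in> X - Z}"

text \<open>\<open>\<pi> : Y \<rightarrow> X\<close> is a blow-up with centre \<open>Z\<close>: an algebraic set over \<open>X\<close> that is biregularly
  isomorphic over \<open>X\<close> to the model above for some system of generators.\<close>

definition is_blowup ::
    "nat \<Rightarrow> 'a::field vec set \<Rightarrow> 'a vec set \<Rightarrow> nat \<Rightarrow> 'a vec set \<Rightarrow> ('a vec \<Rightarrow> 'a vec) \<Rightarrow> bool" where
  "is_blowup n X Z m Y \<pi> \<longleftrightarrow> algebraic_set m Y \<and> (\<exists>gs \<psi>. set gs \<subseteq> mpols n \<and>
     vanishing_ideal n Z = Idl\<^bsub>mpol_ring n\<^esub> (vanishing_ideal n X \<union> set gs) \<and>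
     biregular m Y (n + length gs * length gs) (blowup_model n X Z gs) \<psi> \<and>
     (\<forall>y\<in>Y. \<pi> y = vec_first (\<psi> y) n))"

text \<open>\<open>blowup_sequence n X m Y \<phi>\<close>: the map \<open>\<phi> : Y \<rightarrow> X\<close> is the composition of a finite sequence of
  blow-ups with smooth centres. A centre is a proper subset of the variety that is blown up:
  otherwise the blow-up would be empty.\<close>

inductive blowup_sequence ::
    "nat \<Rightarrow> 'a::field vec set \<Rightarrow> nat \<Rightarrow> 'a vec set \<Rightarrow> ('a vec \<Rightarrow> 'a vec) \<Rightarrow> bool"
  for n X where
  blowup_sequence_Nil: "blowup_sequence n X n X (\<lambda>x. x)"
| blowup_sequence_snoc:
    "blowup_sequence n X m Y \<phi> \<Longrightarrow> nonsingular m Z \<Longrightarrow> Z \<subset> Y \<Longrightarrow> is_blowup m Y Z k W \<pi> \<Longrightarrow>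
     blowup_sequence n X k W (\<phi> \<circ> \<pi>)"

end

theory Submission
  imports
    Defs
    "HOL-Algebra.Algebraic_Closure_Type"
    "HOL-Library.Function_Algebras"
    "Jordan_Normal_Form.Char_Poly"
begin

text \<open>
Let \<open>h\<close> be the regular function on \<open>Y\<close> that extends \<open>f \<circ> \<phi>\<close>. Three facts give local boundedness.

A composition of blow-ups is proper enough: \<open>h\<close> is bounded over some box around each point of \<open>X\<close>
(lemma \<open>bounded_over_blowup\<close>). The coordinates that a blow-up adds are the entries of an orthogonal
projection onto a line, so they have square sum \<open>1\<close>, and a positive polynomial is bounded away from
zero on a box (\<open>polyfun_bounded_below\<close>). The field need not be locally compact, so the latter is a
statement about real closed fields: signs of polynomials are studied one variable at a time, starting
from the intermediate value theorem and Rolle's theorem.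

A composition of blow-ups is generically invertible: it has a section that is rational on a nonempty
Zariski open subset of \<open>X\<close> (lemma \<open>generic_section_blowup\<close>). Hence \<open>f\<close> takes only values of \<open>h\<close>
outside a proper algebraic subset, so it is bounded there near every point.

The proper algebraic subset cannot contain a euclidean neighbourhood of a point of \<open>X\<close>
(\<open>nonsingular_dense\<close>); by continuity the bound therefore extends to all of the domain of \<open>f\<close>.
This is the only use of non-singularity, and it would fail for an isolated point of a singular
variety. By the Jacobian criterion, \<open>n - dim X\<close> elements of the ideal of \<open>X\<close> have independent
gradients at the point. Completed by linear functions they form a system of local coordinates
(\<open>solve_system\<close>), so their common zeros near the point look like an affine space, and the
polynomial functions vanishing on these zeros near the point form a prime ideal (\<open>germ_ideal\<close>).
A chain of primes as long as the dimension shows that this prime is the ideal of \<open>X\<close>: otherwise the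
chain could be lengthened, and \<open>polyfuns {..<n}\<close> would contain too many elements that are
algebraically independent modulo the smaller prime. A polynomial that does not vanish on \<open>X\<close> is thus
nonzero at points of \<open>X\<close> arbitrarily near the given one.
\<close>


hide_const (open) Polynomials.degree Polynomials.lead_coeff up_ring.coeff up_ring.monom
hide_const (open) Module.smult
no_notation Polynomials.var (\<open>X\<index>\<close>)
no_notation fps_nth (infixl \<open>$\<close> 75)

section \<open>The intermediate value theorem for polynomials\<close>

interpretation to_ac_hom: inj_idom_hom to_ac by unfold_locales auto
interpretation to_ac_poly_hom: map_poly_inj_idom_hom to_ac ..

abbreviation ac_poly :: "'a::field poly \<Rightarrow> 'a alg_closure poly" where
  "ac_poly \<equiv> map_poly to_ac"

lemma degree_ac_poly [simp]: "degree (ac_poly p) = degree p"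
  by (simp add: degree_map_poly)

lemma coeff_ac_poly [simp]: "coeff (ac_poly p) i = to_ac (coeff p i)"
  by (simp add: coeff_map_poly)

lemma ac_poly_pCons [simp]: "ac_poly (pCons a p) = pCons (to_ac a) (ac_poly p)"
  by (intro poly_eqI) (simp add: coeff_pCons split: nat.split)

lemma poly_eq_prod_roots:
  fixes p :: "'a::comm_ring_1 poly"
  assumes "p = smult c (\<Prod>x\<in>#A. [:-x, 1:])"
  shows "poly p y = c * (\<Prod>x\<in>#A. y - x)"
proof -
  have "poly (\<Prod>x\<in>#A. [:-x, 1:]) y = (\<Prod>x\<in>#A. y - x)"
    by (induction A) (auto simp: algebra_simps)
  then show ?thesis unfolding assms by simp
qed

lemma prod_mset_diff_swap:
  fixes A B :: "'a::comm_ring_1 multiset"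
  shows "(\<Prod>a\<in>#A. \<Prod>b\<in>#B. a - b) = (-1) ^ (size A * size B) * (\<Prod>b\<in>#B. \<Prod>a\<in>#A. b - a)"
proof -
  have 1: "(\<Prod>b\<in>#B. a - b) = (-1) ^ size B * (\<Prod>b\<in>#B. b - a)" for a
    by (induction B) (auto simp: algebra_simps)
  have "(\<Prod>a\<in>#A. \<Prod>b\<in>#B. a - b) = (\<Prod>a\<in>#A. (-1) ^ size B * (\<Prod>b\<in>#B. b - a))"
    by (simp only: 1)
  also have "\<dots> = (-1) ^ (size A * size B) * (\<Prod>a\<in>#A. \<Prod>b\<in>#B. b - a)"
    by (induction A) (auto simp: algebra_simps power_add)
  also have "(\<Prod>a\<in>#A. \<Prod>b\<in>#B. b - a) = (\<Prod>b\<in>#B. \<Prod>a\<in>#A. b - a)"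
    by (induction A) (auto simp: prod_mset.distrib)
  finally show ?thesis .
qed

text \<open>This product is a resultant up to a scalar: exchanging the roles of the two polynomials and
  dividing with remainder reduces it to smaller degrees, as in the Euclidean algorithm.\<close>

lemma prod_over_roots_in_base:
  fixes f h :: "'a::field poly"
  assumes "ac_poly f = smult (to_ac c) (\<Prod>a\<in>#A. [:-a, 1:])" "f \<noteq> 0"
  shows "(\<Prod>a\<in>#A. poly (ac_poly h) a) \<in> range to_ac"
  using assms
proof (induction "degree f" arbitrary: f c A h rule: less_induct)
  case less
  have c0: "c \<noteq> 0" using less.prems by auto
  have rootA: "poly (ac_poly f) a = 0" if "a \<in># A" for a
    using poly_eq_prod_roots[OF less.prems(1), of a] that
    by (auto simp: prod_mset_zero_iff)
  define g where "g = h mod f"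
  have "poly (ac_poly h) a = poly (ac_poly g) a" if "a \<in># A" for a
  proof -
    have "h = h div f * f + g" unfolding g_def by simp
    then have "ac_poly h = ac_poly (h div f) * ac_poly f + ac_poly g"
      by (metis to_ac_poly_hom.hom_add to_ac_poly_hom.hom_mult)
    then show ?thesis using rootA[OF that] by simp
  qed
  then have eq: "(\<Prod>a\<in>#A. poly (ac_poly h) a) = (\<Prod>a\<in>#A. poly (ac_poly g) a)"
    by (intro arg_cong[where f=prod_mset] image_mset_cong) auto
  show ?case
  proof (cases "degree g < degree f \<and> g \<noteq> 0")
    case True
    obtain B where B: "size B = degree (ac_poly g)"
      "ac_poly g = smult (lead_coeff (ac_poly g)) (\<Prod>b\<in>#B. [:-b, 1:])"
      using alg_closed_imp_factorization[of "ac_poly g"] True by auto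
    define e where "e = lead_coeff g"
    have B': "ac_poly g = smult (to_ac e) (\<Prod>b\<in>#B. [:-b, 1:])"
      using B by (simp add: e_def)
    have "(\<Prod>b\<in>#B. poly (ac_poly f) b) \<in> range to_ac"
      using less.hyps[of g e B f] True B' by auto
    then obtain r where r: "(\<Prod>b\<in>#B. poly (ac_poly f) b) = to_ac r" by auto
    have fb: "(\<Prod>b\<in>#B. poly (ac_poly f) b) = to_ac c ^ size B * (\<Prod>b\<in>#B. \<Prod>a\<in>#A. b - a)"
      by (simp add: poly_eq_prod_roots[OF less.prems(1)] prod_mset.distrib)
    have "(\<Prod>a\<in>#A. poly (ac_poly g) a) = to_ac e ^ size A * (\<Prod>a\<in>#A. \<Prod>b\<in>#B. a - b)"
      by (simp add: poly_eq_prod_roots[OF B'] prod_mset.distrib)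
    also have "(\<Prod>a\<in>#A. \<Prod>b\<in>#B. a - b) = (-1) ^ (size A * size B) * (\<Prod>b\<in>#B. \<Prod>a\<in>#A. b - a)"
      by (rule prod_mset_diff_swap)
    also have "(\<Prod>b\<in>#B. \<Prod>a\<in>#A. b - a) = to_ac (r / c ^ size B)"
      using fb r c0 by (simp add: field_simps)
    finally have "(\<Prod>a\<in>#A. poly (ac_poly g) a)
        = to_ac (e ^ size A * ((-1) ^ (size A * size B) * (r / c ^ size B)))"
      by simp
    then show ?thesis unfolding eq by (rule range_eqI)
  next
    case False
    have "g = 0 \<or> degree f = 0"
      using False less.prems degree_mod_less[of f h] unfolding g_def by auto
    then show ?thesis
    proof
      assume g: "g = 0"
      show ?thesis
      proof (cases "A = {#}")
        case True
        then show ?thesis using to_ac_1 by (metis image_mset_empty prod_mset_empty rangeI)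
      next
        case False
        then obtain a where "a \<in># A" by auto
        then have "(\<Prod>a\<in>#A. poly (ac_poly g) a) = 0"
          using g False by (auto simp: nonempty_has_size)
        then show ?thesis using eq by (metis rangeI to_ac_0)
      qed
    next
      assume "degree f = 0"
      moreover have "degree (\<Prod>a\<in>#A. [:-a, 1:]) = size A"
      proof (induction A)
        case (add x A)
        have "(\<Prod>a\<in>#A. [:-a, 1:]) \<noteq> 0" by (auto simp: prod_mset_zero_iff)
        then show ?case using add by (simp add: degree_mult_eq del: mult_pCons_left)
      qed simp
      ultimately have "size A = 0"
        using less.prems c0 by (metis degree_ac_poly degree_smult_eq to_ac_eq_0_iff)
      then show ?thesis using to_ac_1 by (metis size_eq_0_iff_empty image_mset_empty prod_mset_empty rangeI)
    qed
  qed
qed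

text \<open>Lagrange interpolation in sufficiently many points of the infinite base field.\<close>

lemma ac_poly_if_values_in_base:
  fixes P :: "'a::field_char_0 alg_closure poly"
  assumes "finite S" "\<And>x. x \<notin> S \<Longrightarrow> poly P (to_ac x) \<in> range to_ac"
  shows "P \<in> range ac_poly"
  using assms
proof (induction "degree P" arbitrary: P S rule: less_induct)
  case less
  obtain a where a: "a \<notin> S" using less.prems(1) ex_new_if_finite[OF infinite_UNIV_char_0] by blast
  obtain c where c: "poly P (to_ac a) = to_ac c" using less.prems(2)[OF a] by auto
  define Q where "Q = synthetic_div P (to_ac a)"
  have P: "P = [:-to_ac a, 1:] * Q + [:to_ac c:]"
    unfolding Q_def using synthetic_div_correct'[of "to_ac a" P] c by simp
  show ?case
  proof (cases "degree P = 0")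
    case True
    then obtain d where "P = [:d:]" by (rule degree_eq_zeroE)
    then have "P = ac_poly [:c:]" using c
      by (intro poly_eqI) (simp add: coeff_pCons split: nat.split)
    then show ?thesis by blast
  next
    case False
    have "degree Q < degree P" unfolding Q_def using False by (simp add: degree_synthetic_div)
    moreover have "poly Q (to_ac x) \<in> range to_ac" if "x \<notin> insert a S" for x
    proof -
      have "x \<notin> S" using that by simp
      then obtain v where v: "poly P (to_ac x) = to_ac v" using less.prems(2) by blast
      have "(to_ac x - to_ac a) * poly Q (to_ac x) = to_ac v - to_ac c"
        using v by (subst (asm) P) (simp add: algebra_simps)
      then have "poly Q (to_ac x) = to_ac ((v - c) / (x - a))"
        using that by (simp add: field_simps)
      then show ?thesis by blast
    qed
    ultimately obtain q where q: "Q = ac_poly q"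
      using less.hyps[of Q "insert a S"] less.prems(1) by auto
    have "P = ac_poly ([:-a, 1:] * q + [:c:])"
      unfolding P q to_ac_poly_hom.hom_add to_ac_poly_hom.hom_mult
      by (simp add: map_poly_pCons)
    then show ?thesis by blast
  qed
qed

text \<open>The coefficients of a monic square root are determined from the top downwards by rational
  operations.\<close>

lemma monic_sqrt_in_base:
  fixes G :: "'a::field_char_0 alg_closure poly"
  assumes "lead_coeff G = 1" "G * G \<in> range ac_poly"
  shows "G \<in> range ac_poly"
proof -
  define m where "m = degree G"
  obtain H where H: "G * G = ac_poly H" using assms by auto
  have c: "coeff G (m - k) \<in> range to_ac" if "k \<le> m" for k
    using that
  proof (induction k rule: less_induct)
    case (less k)
    show ?case
    proof (cases "k = 0")
      case True
      then show ?thesis using assms(1) by (metis diff_zero m_def rangeI to_ac_1)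
    next
      case False
      have k: "0 < k" "k \<le> m" using False less.prems by auto
      let ?t = "\<lambda>i. coeff G i * coeff G (2 * m - k - i)"
      have "to_ac (coeff H (2 * m - k)) = (\<Sum>i\<le>2 * m - k. ?t i)"
        using H coeff_mult[of G G "2 * m - k"] by (simp flip: coeff_ac_poly)
      also have "\<dots> = (\<Sum>i\<in>{m - k..m}. ?t i)"
      proof (rule sum.mono_neutral_right)
        show "\<forall>i\<in>{..2 * m - k} - {m - k..m}. ?t i = 0"
        proof
          fix i assume "i \<in> {..2 * m - k} - {m - k..m}"
          then have "i > m \<or> 2 * m - k - i > m" by auto
          then show "?t i = 0" unfolding m_def by (auto simp: coeff_eq_0)
        qed
      qed (use k in auto)
      also have "{m - k..m} = insert (m - k) (insert m {m - k<..<m})" using k by auto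
      also have "(\<Sum>i\<in>\<dots>. ?t i) = ?t (m - k) + (?t m + (\<Sum>i\<in>{m - k<..<m}. ?t i))"
        using k by (subst sum.insert) auto
      also have "\<dots> = coeff G (m - k) + (coeff G (m - k) + (\<Sum>i\<in>{m - k<..<m}. ?t i))"
        using k assms(1) by (simp add: m_def)
      finally have eq: "to_ac (coeff H (2 * m - k)) = coeff G (m - k) + (coeff G (m - k) + (\<Sum>i\<in>{m - k<..<m}. ?t i))" .
      have "\<exists>r. coeff G i = to_ac r" if "i \<in> {m - k<..<m}" for i
      proof -
        have "coeff G (m - (m - i)) \<in> range to_ac" using less.IH[of "m - i"] that k by auto
        then show ?thesis using that by (auto simp: image_iff)
      qed
      then obtain r where r: "\<And>i. i \<in> {m - k<..<m} \<Longrightarrow> coeff G i = to_ac (r i)" by metis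
      have "(\<Sum>i\<in>{m - k<..<m}. ?t i) = to_ac (\<Sum>i\<in>{m - k<..<m}. r i * r (2 * m - k - i))"
        unfolding to_ac_sum to_ac_mult
      proof (rule sum.cong[OF refl])
        fix i assume i: "i \<in> {m - k<..<m}"
        then have "2 * m - k - i \<in> {m - k<..<m}" using k by auto
        then show "?t i = to_ac (r i) * to_ac (r (2 * m - k - i))" using r i by simp
      qed
      then have "coeff G (m - k) * 2 = to_ac (coeff H (2 * m - k) - (\<Sum>i\<in>{m - k<..<m}. r i * r (2 * m - k - i)))"
        using eq by (simp add: algebra_simps)
      then have "coeff G (m - k) = to_ac ((coeff H (2 * m - k) - (\<Sum>i\<in>{m - k<..<m}. r i * r (2 * m - k - i))) / 2)"
        by (simp add: field_simps)
      then show ?thesis by blast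
    qed
  qed
  have "coeff G i \<in> range to_ac" for i
  proof (cases "i \<le> m")
    case True
    then show ?thesis using c[of "m - i"] by simp
  next
    case False
    then show ?thesis by (metis coeff_eq_0 linorder_not_le m_def rangeI to_ac_0)
  qed
  then have "G = ac_poly (map_poly of_ac G)"
    by (intro poly_eqI) (simp add: coeff_map_poly to_ac_of_ac)
  then show ?thesis by blast
qed


text \<open>The subfield \<open>R(i)\<close> of the algebraic closure.\<close>

definition complexes :: "'a::field alg_closure \<Rightarrow> 'a alg_closure set" where
  "complexes \<iota> = {to_ac a + \<iota> * to_ac b | a b. True}"

lemma complexes_base: "to_ac a \<in> complexes \<iota>"
  unfolding complexes_def by (rule CollectI, rule exI[of _ a], rule exI[of _ 0]) simp

lemma complexes_add:
  assumes "z \<in> complexes \<iota>" "w \<in> complexes \<iota>" shows "z + w \<in> complexes \<iota>"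
proof -
  obtain a b c d where "z = to_ac a + \<iota> * to_ac b" "w = to_ac c + \<iota> * to_ac d"
    using assms unfolding complexes_def by auto
  then have "z + w = to_ac (a + c) + \<iota> * to_ac (b + d)" by (simp add: algebra_simps)
  then show ?thesis unfolding complexes_def by blast
qed

lemma complexes_mult:
  assumes "\<iota> * \<iota> = -1" "z \<in> complexes \<iota>" "w \<in> complexes \<iota>" shows "z * w \<in> complexes \<iota>"
proof -
  obtain a b c d where zw: "z = to_ac a + \<iota> * to_ac b" "w = to_ac c + \<iota> * to_ac d"
    using assms(2,3) unfolding complexes_def by auto
  have "z * w = to_ac a * to_ac c + (\<iota> * \<iota>) * (to_ac b * to_ac d)
      + \<iota> * (to_ac a * to_ac d + to_ac b * to_ac c)"
    unfolding zw by (simp add: algebra_simps)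
  also have "\<dots> = to_ac (a * c - b * d) + \<iota> * to_ac (a * d + b * c)" unfolding assms(1) by simp
  finally show ?thesis unfolding complexes_def by blast
qed

lemma complexes_diff:
  assumes "\<iota> * \<iota> = -1" "z \<in> complexes \<iota>" "w \<in> complexes \<iota>" shows "z - w \<in> complexes \<iota>"
  using complexes_add[OF assms(2) complexes_mult[OF assms(1) complexes_base[of "-1"] assms(3)]] by simp

text \<open>Nonnegative elements have square roots, hence so do all elements of \<open>R(i)\<close>.\<close>

lemma complexes_sqrt:
  fixes z :: "'a::real_closed_field alg_closure"
  assumes i: "\<iota> * \<iota> = -1" and "z * z \<in> complexes \<iota>" shows "z \<in> complexes \<iota>"
proof -
  obtain a b where ab: "z * z = to_ac a + \<iota> * to_ac b"
    using assms(2) unfolding complexes_def by auto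
  obtain r0 where r0: "r0 * r0 = a * a + b * b"
    using nonneg_has_sqrt[of "a * a + b * b"] by auto
  define r where "r = \<bar>r0\<bar>"
  have r: "r * r = a * a + b * b" "r \<ge> 0" using r0 unfolding r_def by (auto simp flip: abs_mult)
  have "\<bar>a\<bar> \<le> r" using r by (metis abs_le_square_iff abs_of_nonneg le_add_same_cancel1 power2_eq_square zero_le_square)
  then have ra: "(r + a) / 2 \<ge> 0" "(r - a) / 2 \<ge> 0" by auto
  obtain u where u: "u * u = (r + a) / 2" using nonneg_has_sqrt[OF ra(1)] by auto
  obtain v0 where v0: "v0 * v0 = (r - a) / 2" using nonneg_has_sqrt[OF ra(2)] by auto
  have "(2 * u * v0)\<^sup>2 = 4 * (u * u) * (v0 * v0)" by (simp add: power2_eq_square algebra_simps)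
  also have "\<dots> = r * r - a * a" unfolding u v0 by (simp add: field_simps)
  also have "\<dots> = b\<^sup>2" using r by (simp add: power2_eq_square)
  finally have "2 * u * v0 = b \<or> 2 * u * v0 = - b" by (simp add: power2_eq_iff)
  then obtain v where v: "v * v = (r - a) / 2" "2 * u * v = b"
    using v0 by (metis minus_mult_minus mult_minus_right minus_minus)
  have uv: "u * u - v * v = a" unfolding u v by (simp add: field_simps)
  have "(to_ac u + \<iota> * to_ac v) * (to_ac u + \<iota> * to_ac v)
      = to_ac (u * u) + (\<iota> * \<iota>) * to_ac (v * v) + \<iota> * to_ac (2 * u * v)"
    by (simp add: algebra_simps)
  also have "\<dots> = to_ac (u * u - v * v) + \<iota> * to_ac (2 * u * v)" unfolding i by simp
  also have "\<dots> = z * z" unfolding uv v(2) ab ..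
  finally have "z = to_ac u + \<iota> * to_ac v \<or> z = - (to_ac u + \<iota> * to_ac v)"
    by (metis square_eq_iff)
  moreover have "- (to_ac u + \<iota> * to_ac v) = to_ac (-u) + \<iota> * to_ac (-v)" by simp
  ultimately show ?thesis unfolding complexes_def by blast
qed

lemma poly_homogenized:
  fixes f :: "'a::field poly"
  assumes "ac_poly f = (\<Prod>b\<in>#A. [:-b, 1:])" "degree f = size A"
  shows "(\<Prod>b\<in>#A. u - v * b) = (\<Sum>k\<le>degree f. to_ac (coeff f k) * u ^ k * v ^ (degree f - k))"
proof (cases "v = 0")
  case True
  have "lead_coeff (\<Prod>b\<in>#A. [:-b, 1:]) = 1" by (induction A) (auto simp: lead_coeff_mult simp del: mult_pCons_left)
  then have "coeff f (degree f) = 1" using assms by (metis coeff_ac_poly degree_ac_poly to_ac_1 to_ac_eq_iff)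
  moreover have "(\<Sum>k\<le>degree f. to_ac (coeff f k) * u ^ k * v ^ (degree f - k))
     = (\<Sum>k\<in>{degree f}. to_ac (coeff f k) * u ^ k * v ^ (degree f - k))"
    using True by (intro sum.mono_neutral_right) auto
  ultimately show ?thesis using True assms(2) by simp
next
  case False
  have 1: "poly (ac_poly f) (u / v) = (\<Prod>b\<in>#A. u / v - b)"
    using poly_eq_prod_roots[of "ac_poly f" 1 A "u / v"] assms(1) by simp
  have "(\<Prod>b\<in>#A. u - v * b) = (\<Prod>b\<in>#A. v * (u / v - b))"
    using False by (intro arg_cong[where f=prod_mset] image_mset_cong) (simp add: field_simps)
  also have "\<dots> = v ^ degree f * poly (ac_poly f) (u / v)"
    unfolding 1 assms(2) by (simp add: prod_mset.distrib)
  also have "\<dots> = (\<Sum>k\<le>degree f. v ^ degree f * (to_ac (coeff f k) * (u / v) ^ k))"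
    by (simp add: poly_altdef sum_distrib_left)
  also have "\<dots> = (\<Sum>k\<le>degree f. to_ac (coeff f k) * u ^ k * v ^ (degree f - k))"
    using False by (intro sum.cong) (auto simp: power_divide power_diff field_simps)
  finally show ?thesis .
qed

lemma nat_eq_two_power_times_odd: "n > 0 \<Longrightarrow> \<exists>k m. n = 2 ^ k * m \<and> odd (m::nat)"
proof (induction n rule: less_induct)
  case (less n)
  show ?case
  proof (cases "even n")
    case True
    then obtain h where h: "n = 2 * h" by auto
    then obtain k m where "h = 2 ^ k * m" "odd m" using less by (metis less_add_same_cancel1 mult_2 nat_0_less_mult_iff)
    then show ?thesis using h by (intro exI[of _ "Suc k"] exI[of _ m]) auto
  next
    case False
    then show ?thesis by (intro exI[of _ 0] exI[of _ n]) auto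
  qed
qed

text \<open>Laplace's resolvent of Gauss's second proof. The product over all ordered pairs is a
  resultant; without the diagonal factors it is a square, whose monic root is this resolvent.\<close>

lemma pair_resolvent_in_base:
  fixes f :: "'a::field_char_0 poly" and \<alpha> :: "nat \<Rightarrow> 'a alg_closure"
  assumes f: "ac_poly f = (\<Prod>i<n. [:-\<alpha> i, 1:])" "degree f = n"
  shows "(\<Prod>(i, j)\<in>{(i, j). i < j \<and> j < n}. [:-(\<alpha> i + \<alpha> j + of_nat c * \<alpha> i * \<alpha> j), 1:]) \<in> range ac_poly"
    (is "?G \<in> _")
proof -
  define A where "A = image_mset \<alpha> (mset_set {..<n})"
  have A: "ac_poly f = (\<Prod>b\<in>#A. [:-b, 1:])" "degree f = size A"
    using f by (simp_all add: A_def prod_unfold_prod_mset multiset.map_comp comp_def)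
  have f0: "f \<noteq> 0" using A(1) by (auto simp: prod_mset_zero_iff)
  have fA: "ac_poly f = smult (to_ac 1) (\<Prod>b\<in>#A. [:-b, 1:])" using A(1) by simp
  have prodA: "(\<Prod>b\<in>#A. g b) = (\<Prod>i<n. g (\<alpha> i))" for g :: "'a alg_closure \<Rightarrow> 'a alg_closure"
    unfolding A_def by (simp add: prod_unfold_prod_mset multiset.map_comp comp_def)
  define s where "s = (\<lambda>i j. \<alpha> i + \<alpha> j + of_nat c * \<alpha> i * \<alpha> j)"
  have all_pairs: "(\<Prod>i<n. \<Prod>j<n. to_ac x - s i j) \<in> range to_ac" for x
  proof -
    define h :: "'a poly" where
      "h = (\<Sum>k\<le>n. smult (coeff f k) ([:x, -1:] ^ k * [:1, of_nat c:] ^ (n - k)))"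
    have "poly (ac_poly h) a = (\<Prod>j<n. to_ac x - (a + \<alpha> j + of_nat c * a * \<alpha> j))" for a
    proof -
      have "poly (ac_poly h) a =
          (\<Sum>k\<le>n. to_ac (coeff f k) * (to_ac x - a) ^ k * (1 + of_nat c * a) ^ (n - k))"
        unfolding h_def
        by (simp add: to_ac_poly_hom.hom_sum to_ac_poly_hom.hom_mult to_ac_poly_hom.hom_power
           poly_sum map_poly_smult map_poly_pCons mult_ac)
      also have "\<dots> = (\<Prod>b\<in>#A. (to_ac x - a) - (1 + of_nat c * a) * b)"
        using poly_homogenized[OF A, of "to_ac x - a" "1 + of_nat c * a"] f(2) by simp
      finally show ?thesis unfolding prodA by (simp add: algebra_simps)
    qed
    then show ?thesis using prod_over_roots_in_base[OF fA f0, of h] unfolding prodA s_def by simp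
  qed
  have diagonal: "(\<Prod>i<n. to_ac x - s i i) \<in> range to_ac" for x
  proof -
    have e: "poly (ac_poly [:x, -2, - of_nat c:]) a = to_ac x - (a + a + of_nat c * a * a)" for a
      by (simp add: algebra_simps)
    show ?thesis
      using prod_over_roots_in_base[OF fA f0, of "[:x, -2, - of_nat c:]"] by (simp only: prodA e s_def)
  qed
  define S where "S = {x. to_ac x \<in> (\<lambda>i. s i i) ` {..<n}}"
  have "finite S" unfolding S_def
    by (intro finite_vimageI[OF finite_imageI, unfolded vimage_def]) (auto simp: inj_to_ac)
  moreover have "poly (?G * ?G) (to_ac x) \<in> range to_ac" if "x \<notin> S" for x
  proof -
    let ?t = "\<lambda>i j. to_ac x - s i j"
    let ?U = "{(i, j). i < j \<and> j < n}" and ?L = "{(i, j). j < i \<and> i < n}" and ?D = "{(i, j). i = j \<and> i < n}"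
    have fin: "finite ?U" "finite ?L" "finite ?D"
      by (rule finite_subset[of _ "{..<n} \<times> {..<n}"], auto)+
    have G: "poly ?G (to_ac x) = (\<Prod>(i, j)\<in>?U. ?t i j)"
      unfolding poly_prod by (rule prod.cong) (auto simp: s_def)
    have "{..<n} \<times> {..<n} = (?U \<union> ?L) \<union> ?D" by auto
    then have "(\<Prod>i<n. \<Prod>j<n. ?t i j) = (\<Prod>(i, j)\<in>(?U \<union> ?L) \<union> ?D. ?t i j)"
      by (simp add: prod.cartesian_product)
    also have "\<dots> = (\<Prod>(i, j)\<in>?U. ?t i j) * (\<Prod>(i, j)\<in>?L. ?t i j) * (\<Prod>(i, j)\<in>?D. ?t i j)"
    proof -
      have "(\<Prod>(i, j)\<in>?U \<union> ?L. ?t i j) = (\<Prod>(i, j)\<in>?U. ?t i j) * (\<Prod>(i, j)\<in>?L. ?t i j)"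
        using fin by (intro prod.union_disjoint) auto
      moreover have "(\<Prod>(i, j)\<in>(?U \<union> ?L) \<union> ?D. ?t i j)
          = (\<Prod>(i, j)\<in>?U \<union> ?L. ?t i j) * (\<Prod>(i, j)\<in>?D. ?t i j)"
        using fin by (intro prod.union_disjoint) auto
      ultimately show ?thesis by simp
    qed
    also have "(\<Prod>(i, j)\<in>?L. ?t i j) = (\<Prod>(i, j)\<in>?U. ?t i j)"
      by (rule prod.reindex_bij_witness[of _ "\<lambda>(i, j). (j, i)" "\<lambda>(i, j). (j, i)"]) (auto simp: s_def ac_simps)
    also have "(\<Prod>(i, j)\<in>?D. ?t i j) = (\<Prod>i<n. ?t i i)"
      by (rule prod.reindex_bij_witness[of _ "\<lambda>i. (i, i)" fst]) auto
    finally have eq: "(\<Prod>i<n. \<Prod>j<n. ?t i j) = poly ?G (to_ac x) * poly ?G (to_ac x) * (\<Prod>i<n. ?t i i)"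
      unfolding G .
    have "(\<Prod>i<n. ?t i i) \<noteq> 0" using that unfolding S_def by auto
    moreover obtain N D where "(\<Prod>i<n. \<Prod>j<n. ?t i j) = to_ac N" "(\<Prod>i<n. ?t i i) = to_ac D"
      using all_pairs diagonal by blast
    ultimately have "poly (?G * ?G) (to_ac x) = to_ac (N / D)" using eq by (simp add: field_simps)
    then show ?thesis by blast
  qed
  ultimately have "?G * ?G \<in> range ac_poly" by (rule ac_poly_if_values_in_base)
  moreover have "lead_coeff ?G = 1"
    by (subst lead_coeff_prod) (auto intro!: prod.neutral)
  ultimately show ?thesis using monic_sqrt_in_base by blast
qed


lemma odd_degree_poly_has_root:
  fixes f :: "'a::real_closed_field poly"
  assumes "odd (degree f)" shows "\<exists>x. poly f x = 0"
proof -
  have "coeff f (degree f) \<noteq> 0" using assms by auto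
  then show ?thesis using odd_degree_has_root[of "degree f" "coeff f"] assms by (simp add: poly_altdef)
qed

lemma card_ordered_pairs: "card {(i, j). i < j \<and> j < n} = n * (n - 1) div (2::nat)"
proof -
  have "card {(i, j). i < j \<and> j < n} = (\<Sum>j<n. j)"
  proof (induction n)
    case (Suc n)
    have "{(i, j). i < j \<and> j < Suc n} = {(i, j). i < j \<and> j < n} \<union> {..<n} \<times> {n}" by auto
    moreover have "finite {(i, j). i < j \<and> j < n}"
      by (rule finite_subset[of _ "{..<n} \<times> {..<n}"]) auto
    moreover have "card ({..<n} \<times> {n}) = n" by (simp add: card_cartesian_product)
    moreover have "card ({(i, j). i < j \<and> j < n} \<union> {..<n} \<times> {n})
        = card {(i, j). i < j \<and> j < n} + card ({..<n} \<times> {n})"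
      by (rule card_Un_disjoint) (use calculation in auto)
    ultimately show ?case using Suc by simp
  qed auto
  then show ?thesis by (simp add: Sum_Ico_nat lessThan_atLeast0)
qed

text \<open>Induction on the exponent of \<open>2\<close> in the degree. The resolvents for all \<open>c\<close> have degree
  \<open>n (n - 1) div 2\<close>, which contains one factor \<open>2\<close> less. For two values of \<open>c\<close> the roots found belong
  to the same pair of roots, whose sum and product therefore lie in \<open>R(i)\<close>; a quadratic equation
  remains.\<close>

theorem poly_has_complex_root:
  fixes f :: "'a::real_closed_field poly"
  assumes i: "\<iota> * \<iota> = -1" and "degree f > 0"
  shows "\<exists>z\<in>complexes \<iota>. poly (ac_poly f) z = 0"
proof -
  have "degree f = 2 ^ k * m \<Longrightarrow> odd m \<Longrightarrow> ?thesis" for k m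
    using assms(2)
  proof (induction k arbitrary: m f)
    case 0
    then obtain x where "poly f x = 0" using odd_degree_poly_has_root by auto
    then have "poly (ac_poly f) (to_ac x) = 0" by simp
    then show ?case using complexes_base by blast
  next
    case (Suc k)
    define n where "n = degree f"
    define g where "g = smult (inverse (lead_coeff f)) f"
    have "f \<noteq> 0" using Suc.prems by (metis degree_0 less_irrefl)
    then have lc: "lead_coeff f \<noteq> 0" by simp
    have g: "degree g = n" "lead_coeff g = 1" "g \<noteq> 0" using lc by (auto simp: g_def n_def)
    obtain A where A: "size A = n" "ac_poly g = smult (lead_coeff (ac_poly g)) (\<Prod>b\<in>#A. [:-b, 1:])"
      using alg_closed_imp_factorization[of "ac_poly g"] g by auto
    obtain as where as: "mset as = A" using ex_mset by auto
    define \<alpha> where "\<alpha> = (\<lambda>i. as ! i)"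
    have len: "length as = n" using as A(1) size_mset by metis
    have "ac_poly g = (\<Prod>b\<in>#mset as. [:-b, 1:])" using A(2) g as by simp
    also have "\<dots> = prod_list (map (\<lambda>b. [:-b, 1:]) as)"
      by (metis mset_map prod_mset_prod_list)
    also have "\<dots> = (\<Prod>i<n. [:-\<alpha> i, 1:])"
      unfolding prod.list_conv_set_nth by (simp add: \<alpha>_def len lessThan_atLeast0)
    finally have gp: "ac_poly g = (\<Prod>i<n. [:-\<alpha> i, 1:])" .
    let ?U = "{(i, j). i < j \<and> j < n}"
    have fin: "finite ?U" by (rule finite_subset[of _ "{..<n} \<times> {..<n}"]) auto
    have ev: "n = 2 ^ Suc k * m" using Suc.prems n_def by simp
    have "\<exists>p\<in>?U. \<alpha> (fst p) + \<alpha> (snd p) + of_nat c * \<alpha> (fst p) * \<alpha> (snd p) \<in> complexes \<iota>" for c :: nat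
    proof -
      obtain h where h: "(\<Prod>(i, j)\<in>?U. [:-(\<alpha> i + \<alpha> j + of_nat c * \<alpha> i * \<alpha> j), 1:]) = ac_poly h"
        using pair_resolvent_in_base[OF gp g(1), of c] by blast
      have "degree h = degree (ac_poly h)" by simp
      also have "\<dots> = (\<Sum>p\<in>?U. 1)"
        unfolding h[symmetric]
        by (subst degree_prod_eq_sum_degree, force, rule sum.cong) (auto split: prod.splits)
      also have "\<dots> = n * (n - 1) div 2" using card_ordered_pairs by simp
      also have "\<dots> = 2 ^ k * (m * (n - 1))" unfolding ev by simp
      finally have dh: "degree h = 2 ^ k * (m * (n - 1))" .
      have "odd (m * (n - 1))" using Suc.prems ev by (auto simp: odd_pos)
      moreover have "degree h > 0" using dh calculation by (cases "m * (n - 1)") auto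
      ultimately obtain z where z: "z \<in> complexes \<iota>" "poly (ac_poly h) z = 0"
        using Suc.IH[OF dh] by blast
      then show ?thesis using fin by (auto simp: h[symmetric] poly_prod prod_zero_iff algebra_simps split: prod.splits)
    qed
    then have "\<forall>c\<in>UNIV. \<exists>p\<in>?U. \<alpha> (fst p) + \<alpha> (snd p) + of_nat c * \<alpha> (fst p) * \<alpha> (snd p) \<in> complexes \<iota>" by blast
    from pigeonhole_infinite_rel[OF infinite_UNIV_nat fin this]
    obtain p where p: "p \<in> ?U" and inf: "infinite {c::nat \<in> UNIV. \<alpha> (fst p) + \<alpha> (snd p) + of_nat c * \<alpha> (fst p) * \<alpha> (snd p) \<in> complexes \<iota>}"
      by blast
    define a where "a = \<alpha> (fst p)"
    define b where "b = \<alpha> (snd p)"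
    obtain c d :: nat where cd: "c \<noteq> d" "a + b + of_nat c * a * b \<in> complexes \<iota>" "a + b + of_nat d * a * b \<in> complexes \<iota>"
    proof -
      define C where "C = {c::nat. a + b + of_nat c * a * b \<in> complexes \<iota>}"
      have "infinite C" using inf unfolding C_def a_def b_def by simp
      then obtain c where c: "c \<in> C" using infinite_imp_nonempty by blast
      have "infinite (C - {c})" using \<open>infinite C\<close> by simp
      then obtain d where "d \<in> C - {c}" using infinite_imp_nonempty by blast
      then show ?thesis using that[of c d] c unfolding C_def by auto
    qed
    have "a * b = to_ac (inverse (of_nat c - of_nat d)) * ((a + b + of_nat c * a * b) - (a + b + of_nat d * a * b))"
      using cd(1) by (simp add: field_simps)
    then have ab: "a * b \<in> complexes \<iota>"
      using complexes_mult[OF i complexes_base complexes_diff[OF i cd(2,3)]] by metis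
    have "a + b = (a + b + of_nat c * a * b) - to_ac (of_nat c) * (a * b)" by simp
    then have sum: "a + b \<in> complexes \<iota>"
      using complexes_diff[OF i cd(2) complexes_mult[OF i complexes_base ab]] by metis
    have "(a - b) * (a - b) = (a + b) * (a + b) - to_ac 4 * (a * b)" by (simp add: algebra_simps)
    then have "(a - b) * (a - b) \<in> complexes \<iota>"
      using complexes_diff[OF i complexes_mult[OF i sum sum] complexes_mult[OF i complexes_base ab]] by metis
    then have "a - b \<in> complexes \<iota>" by (rule complexes_sqrt[OF i])
    moreover have "a = to_ac (1 / 2) * ((a + b) + (a - b))" by simp
    ultimately have "a \<in> complexes \<iota>"
      using complexes_mult[OF i complexes_base complexes_add[OF sum]] by metis
    moreover have "poly (ac_poly g) a = 0"
      using p unfolding gp poly_prod a_def by (auto simp: prod_zero_iff)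
    then have "poly (ac_poly f) a = 0" using lc by (simp add: g_def map_poly_smult)
    ultimately show ?case by blast
  qed
  then show ?thesis using nat_eq_two_power_times_odd[OF assms(2)] by blast
qed

lemma neg_if_mult_pos_neg: "k * y < 0 \<Longrightarrow> 0 < k \<Longrightarrow> y < (0::'a::linordered_field)"
  by (simp add: mult_less_0_iff)

text \<open>The roots lie in \<open>R(i)\<close>, so a polynomial without a root between the two points is a product of
  factors that do not change sign there.\<close>

theorem poly_IVT:
  fixes f :: "'a::real_closed_field poly"
  assumes "a < b" "poly f a * poly f b < 0"
  shows "\<exists>c. a < c \<and> c < b \<and> poly f c = 0"
  using assms(2)
proof (induction "degree f" arbitrary: f rule: less_induct)
  case less
  obtain \<iota> :: "'a alg_closure" where i: "\<iota> * \<iota> = -1"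
    using nth_root_exists[of 2 "-1"] by (auto simp: power2_eq_square)
  have "degree f > 0"
  proof (rule ccontr)
    assume "\<not> degree f > 0"
    then obtain c where "f = [:c:]" by (auto elim: degree_eq_zeroE)
    then show False using less.prems by (simp add: mult_less_0_iff)
  qed
  then obtain u v where z: "poly (ac_poly f) (to_ac u + \<iota> * to_ac v) = 0"
    using poly_has_complex_root[OF i] unfolding complexes_def by blast
  show ?case
  proof (cases "v = 0")
    case True
    then have u: "poly f u = 0" using z by simp
    then obtain g where g: "f = [:-u, 1:] * g" by (auto simp: poly_eq_0_iff_dvd elim: dvdE)
    show ?thesis
    proof (cases "a < u \<and> u < b")
      case True
      then show ?thesis using u by blast
    next
      case False
      have ne: "a \<noteq> u" "b \<noteq> u" using less.prems u by auto
      then have pos: "(a - u) * (b - u) > 0" using False assms(1)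
        by (smt (verit) diff_gt_0_iff_gt linorder_not_less mult_neg_neg mult_pos_pos order.strict_trans linorder_neqE not_less_iff_gr_or_eq diff_less_0_iff_less)
      have "poly f a * poly f b = ((a - u) * (b - u)) * (poly g a * poly g b)"
        unfolding g by (simp add: algebra_simps)
      then have "poly g a * poly g b < 0" using less.prems pos neg_if_mult_pos_neg by metis
      moreover have "degree g < degree f"
      proof -
        have "g \<noteq> 0" using calculation by auto
        then show ?thesis unfolding g by (subst degree_mult_eq) auto
      qed
      ultimately obtain c where "a < c \<and> c < b \<and> poly g c = 0" using less.hyps by blast
      then show ?thesis unfolding g by auto
    qed
  next
    case False
    define q where "q = [:u * u + v * v, - 2 * u, 1:]"
    define r where "r = f mod q"
    have qpos: "poly q x > 0" for x
    proof -
      have "poly q x = (x - u) * (x - u) + v * v" unfolding q_def by (simp add: algebra_simps)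
      moreover have "v * v > 0" using False not_square_less_zero[of v] by (metis mult_eq_0_iff linorder_neqE)
      ultimately show ?thesis by (simp add: add_nonneg_pos)
    qed
    let ?z = "to_ac u + \<iota> * to_ac v"
    have qz: "poly (ac_poly q) ?z = 0"
    proof -
      have "poly (ac_poly q) ?z = to_ac (v * v) + (\<iota> * \<iota>) * to_ac (v * v)"
        unfolding q_def by (simp add: algebra_simps)
      then show ?thesis unfolding i by simp
    qed
    have "f = f div q * q + r" unfolding r_def by simp
    then have "ac_poly f = ac_poly (f div q) * ac_poly q + ac_poly r"
      by (metis to_ac_poly_hom.hom_add to_ac_poly_hom.hom_mult)
    then have rz: "poly (ac_poly r) ?z = 0" using z qz by simp
    have "degree r \<le> 1"
      using degree_mod_less[of q f] unfolding r_def q_def by auto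
    have "coeff r i = coeff [:coeff r 0, coeff r 1:] i" for i
    proof -
      consider "i = 0" | "i = 1" | "i > 1" by linarith
      then show ?thesis
        using \<open>degree r \<le> 1\<close> by cases (auto simp: coeff_eq_0 coeff_pCons split: nat.split)
    qed
    then obtain c0 c1 where r: "r = [:c0, c1:]" using poly_eqI by blast
    have "c1 = 0"
    proof (rule ccontr)
      assume "c1 \<noteq> 0"
      have "to_ac (c0 + u * c1) + \<iota> * to_ac (v * c1) = 0" using rz r by (simp add: algebra_simps)
      then have "\<iota> = to_ac (- (c0 + u * c1) / (v * c1))"
        using \<open>c1 \<noteq> 0\<close> False by (simp add: field_simps eq_neg_iff_add_eq_0)
      then obtain w where w: "\<iota> = to_ac w" by blast
      have "to_ac (w * w) = to_ac (- 1)" using i w by simp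
      then have "w * w = -1" unfolding to_ac_eq_iff .
      then show False using zero_le_square[of w] by simp
    qed
    then have "r = 0" using rz r by simp
    then have "q dvd f" unfolding r_def by (simp add: mod_eq_0_iff_dvd)
    then obtain g where g: "f = q * g" by (rule dvdE)
    have "poly f a * poly f b = (poly q a * poly q b) * (poly g a * poly g b)"
      unfolding g by (simp add: algebra_simps)
    then have gab: "poly g a * poly g b < 0"
      using less.prems mult_pos_pos[OF qpos qpos, of a b] neg_if_mult_pos_neg by metis
    then have "g \<noteq> 0" by auto
    moreover have "q \<noteq> 0" unfolding q_def by simp
    ultimately have "degree g < degree f" unfolding g by (subst degree_mult_eq) (auto simp: q_def)
    then obtain c where "a < c \<and> c < b \<and> poly g c = 0" using less.hyps gab by blast
    then show ?thesis unfolding g by auto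
  qed
qed

section \<open>Univariate polynomials over a real closed field\<close>

lemma sgn_poly_eq_if_no_root:
  fixes f :: "'a::real_closed_field poly"
  assumes "a \<le> b" "\<And>t. a \<le> t \<Longrightarrow> t \<le> b \<Longrightarrow> poly f t \<noteq> 0"
  shows "sgn (poly f a) = sgn (poly f b)"
proof (rule ccontr)
  assume ne: "sgn (poly f a) \<noteq> sgn (poly f b)"
  have nz: "poly f a \<noteq> 0" "poly f b \<noteq> 0" using assms by auto
  then have "poly f a * poly f b < 0"
    using ne by (auto simp: sgn_if mult_less_0_iff not_less_iff_gr_or_eq split: if_splits)
  moreover have "a < b" using ne assms(1) by (metis order_le_less)
  ultimately show False using poly_IVT[of a b f] assms(2) by (metis less_le)
qed

lemma poly_Rolle:
  fixes f :: "'a::real_closed_field poly"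
  assumes ab: "a < b" and fa: "poly f a = 0" "poly f b = 0"
  shows "\<exists>c. a < c \<and> c < b \<and> poly (pderiv f) c = 0"
proof (cases "f = 0")
  case True
  then show ?thesis using dense[OF ab] by auto
next
  case False
  define R where "R = {t. poly f t = 0} \<inter> {a<..}"
  have R: "finite R" "b \<in> R" using poly_roots_finite[OF False] fa ab unfolding R_def by auto
  define d where "d = Min R"
  have "d \<in> R" "d \<le> b" using Min_in[OF R(1)] Min_le[OF R] R(2) unfolding d_def by blast+
  then have d: "a < d" "d \<le> b" "poly f d = 0" unfolding R_def by auto
  have between: "poly f t \<noteq> 0" if "a < t" "t < d" for t
  proof
    assume "poly f t = 0"
    then have "t \<in> R" using that unfolding R_def by auto
    then have "d \<le> t" unfolding d_def using R by simp
    then show False using that by simp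
  qed
  obtain q where q: "f = [:-a, 1:] ^ order a f * q" "\<not> [:-a, 1:] dvd q"
    using order_decomp[OF False] by blast
  have "q \<noteq> 0" using q(2) by auto
  have qd: "poly q d = 0"
  proof -
    have "poly f d = (d - a) ^ order a f * poly q d" by (subst q(1)) simp
    then show ?thesis using d by simp
  qed
  obtain g where g: "q = [:-d, 1:] ^ order d q * g" "\<not> [:-d, 1:] dvd g"
    using order_decomp[OF \<open>q \<noteq> 0\<close>] by blast
  have "order a f \<noteq> 0" using fa False by (simp add: order_root)
  moreover have "order d q \<noteq> 0" using qd \<open>q \<noteq> 0\<close> by (simp add: order_root)
  ultimately obtain k l where kl: "order a f = Suc k" "order d q = Suc l" by (metis not0_implies_Suc)
  define A where "A = [:-a, 1:]"
  define B where "B = [:-d, 1:]"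
  have f: "f = A ^ Suc k * (B ^ Suc l * g)" unfolding A_def B_def using q(1) g(1) kl by simp
  define h where "h = smult (of_nat (Suc k)) (B * g) + smult (of_nat (Suc l)) (A * g) + A * B * pderiv g"
  have dA: "pderiv A = 1" "pderiv B = 1" unfolding A_def B_def by (simp_all add: pderiv_pCons)
  have f': "pderiv f = A ^ k * B ^ l * h"
    unfolding f h_def pderiv_mult pderiv_power_Suc dA by (simp add: algebra_simps)
  have gnz: "poly g t \<noteq> 0" if "a \<le> t" "t \<le> d" for t
  proof -
    from that consider "t = a" | "t = d" | "a < t" "t < d" by linarith
    then show ?thesis
    proof cases
      case 1
      have "poly q a \<noteq> 0" using q(2) by (simp add: poly_eq_0_iff_dvd)
      then show ?thesis using 1 by (subst (asm) g(1)) auto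
    next
      case 2
      then show ?thesis using g(2) by (simp add: poly_eq_0_iff_dvd)
    next
      case 3
      then show ?thesis using between[OF 3] unfolding f by auto
    qed
  qed
  then have "sgn (poly g a) = sgn (poly g d)" using d by (intro sgn_poly_eq_if_no_root) auto
  then have gg: "poly g a * poly g d > 0"
    using gnz[of a] gnz[of d] d by (auto simp: sgn_if zero_less_mult_iff split: if_splits)
  have "poly h a = of_nat (Suc k) * (a - d) * poly g a" unfolding h_def A_def B_def by (simp add: algebra_simps)
  moreover have "poly h d = of_nat (Suc l) * (d - a) * poly g d" unfolding h_def A_def B_def by (simp add: algebra_simps)
  ultimately have "poly h a * poly h d
      = (of_nat (Suc k) * (a - d) * poly g a) * (of_nat (Suc l) * (d - a) * poly g d)" by simp
  also have "\<dots> = - (of_nat (Suc k) * of_nat (Suc l) * ((d - a) * (d - a)) * (poly g a * poly g d))"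
    by (simp add: algebra_simps)
  also have "\<dots> < 0"
  proof -
    have "(of_nat (Suc k) :: 'a) > 0" "(of_nat (Suc l) :: 'a) > 0" "(d - a) * (d - a) > 0"
      using d by (simp_all del: of_nat_Suc)
    then show ?thesis using gg by (simp del: of_nat_Suc)
  qed
  finally obtain c where "a < c" "c < d" "poly h c = 0" using poly_IVT[OF d(1)] by blast
  then show ?thesis using f' d(2) by (intro exI[of _ c]) auto
qed

lemma poly_MVT:
  fixes f :: "'a::real_closed_field poly"
  assumes "a < b"
  shows "\<exists>c. a < c \<and> c < b \<and> poly f b - poly f a = (b - a) * poly (pderiv f) c"
proof -
  define s where "s = (poly f b - poly f a) / (b - a)"
  define g where "g = f - [:poly f a - s * a, s:]"
  have "s * (b - a) = poly f b - poly f a" using assms unfolding s_def by simp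
  then have "poly g a = 0" "poly g b = 0" unfolding g_def by (auto simp: algebra_simps)
  then obtain c where c: "a < c" "c < b" "poly (pderiv g) c = 0" using poly_Rolle[OF assms] by blast
  have "poly (pderiv f) c = s" using c(3) unfolding g_def by (simp add: pderiv_diff pderiv_pCons)
  then show ?thesis using c assms unfolding s_def by (intro exI[of _ c]) auto
qed

lemma poly_sign_change_at_root:
  fixes p :: "'a::real_closed_field poly"
  assumes "a < e" "e < b" "poly p e = 0"
    and nz: "\<And>t. a < t \<Longrightarrow> t < b \<Longrightarrow> poly (pderiv p) t \<noteq> 0"
  shows "poly p a * poly p b < 0"
proof -
  obtain c where c: "a < c" "c < e" "poly p e - poly p a = (e - a) * poly (pderiv p) c"
    using poly_MVT[OF assms(1)] by blast
  obtain d where d: "e < d" "d < b" "poly p b - poly p e = (b - e) * poly (pderiv p) d"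
    using poly_MVT[OF assms(2)] by blast
  have "sgn (poly (pderiv p) c) = sgn (poly (pderiv p) d)"
    using c d assms by (intro sgn_poly_eq_if_no_root nz) auto
  moreover have "poly (pderiv p) c \<noteq> 0" "poly (pderiv p) d \<noteq> 0" using c d assms by (auto intro!: nz)
  ultimately have pos: "poly (pderiv p) c * poly (pderiv p) d > 0"
    by (auto simp: sgn_if zero_less_mult_iff split: if_splits)
  have "poly p a = - ((e - a) * poly (pderiv p) c)" "poly p b = (b - e) * poly (pderiv p) d"
    using c(3) d(3) assms(3) by (auto simp: algebra_simps)
  then have "poly p a * poly p b = - ((e - a) * poly (pderiv p) c) * ((b - e) * poly (pderiv p) d)"
    by simp
  then have "poly p a * poly p b
      = - (((e - a) * (b - e)) * (poly (pderiv p) c * poly (pderiv p) d))"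
    by (simp add: algebra_simps)
  moreover have "((e - a) * (b - e)) * (poly (pderiv p) c * poly (pderiv p) d) > 0"
    using mult_pos_pos[OF mult_pos_pos[of "e - a" "b - e"] pos] assms by auto
  ultimately show ?thesis by simp
qed

lemma poly_unbounded_at_top:
  fixes p :: "'a::linordered_field poly"
  assumes "lead_coeff p > 0" "degree p > 0"
  shows "\<exists>B. \<forall>y\<ge>B. M \<le> poly p y"
  using assms
proof (induction p arbitrary: M)
  case (pCons a q)
  show ?case
  proof (cases "degree q = 0")
    case True
    then obtain c where q: "q = [:c:]" by (auto elim: degree_eq_zeroE)
    have c: "c > 0" using pCons.prems q by (auto split: if_splits)
    have "M \<le> poly (pCons a q) y" if "(M - a) / c \<le> y" for y
    proof -
      have "M - a \<le> y * c" using that c by (simp add: pos_divide_le_eq)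
      then show ?thesis unfolding q by (simp add: algebra_simps)
    qed
    then show ?thesis by blast
  next
    case False
    have "lead_coeff q > 0" using pCons.prems False by (auto split: if_splits)
    then obtain B where B: "\<forall>y\<ge>B. 1 \<le> poly q y" using pCons.IH[of 1] False by auto
    have "M \<le> poly (pCons a q) y" if "max B (max 0 (M - a)) \<le> y" for y
    proof -
      have "1 \<le> poly q y" "0 \<le> y" "M - a \<le> y" using that B by auto
      then have "y * 1 \<le> y * poly q y" by (intro mult_left_mono)
      then show ?thesis using \<open>M - a \<le> y\<close> by (simp add: algebra_simps)
    qed
    then show ?thesis by blast
  qed
qed simp

lemma sgn_poly_at_top:
  fixes p :: "'a::linordered_field poly"
  assumes "p \<noteq> 0"
  shows "\<exists>B. \<forall>y\<ge>B. sgn (poly p y) = sgn (lead_coeff p)"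
proof (cases "degree p = 0")
  case True
  then show ?thesis by (auto elim!: degree_eq_zeroE)
next
  case False
  define s where "s = sgn (lead_coeff p)"
  have s: "s = 1 \<or> s = -1" using assms unfolding s_def by (auto simp: sgn_if)
  have "lead_coeff (smult s p) > 0" using assms unfolding s_def by (auto simp: sgn_if)
  then obtain B where B: "\<forall>y\<ge>B. 1 \<le> poly (smult s p) y"
    using poly_unbounded_at_top[of "smult s p" 1] False s by auto
  have "sgn (poly p y) = s" if "B \<le> y" for y
  proof -
    have "1 \<le> s * poly p y" using B that by auto
    then show ?thesis using s by (auto simp: sgn_if)
  qed
  then show ?thesis unfolding s_def by blast
qed

lemma sgn_poly_at_bot:
  fixes p :: "'a::linordered_field poly"
  assumes "p \<noteq> 0"
  shows "\<exists>B. \<forall>y\<le>B. sgn (poly p y) = sgn ((-1) ^ degree p * lead_coeff p)"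
proof -
  define q where "q = pcompose p [:0, -1:]"
  have "lead_coeff q = lead_coeff p * (-1) ^ degree p"
    unfolding q_def by (subst lead_coeff_comp) auto
  moreover have "q \<noteq> 0" using calculation assms by auto
  ultimately obtain B where B: "\<forall>y\<ge>B. sgn (poly q y) = sgn ((-1) ^ degree p * lead_coeff p)"
    using sgn_poly_at_top[of q] by (metis mult.commute)
  have "sgn (poly p y) = sgn ((-1) ^ degree p * lead_coeff p)" if "y \<le> - B" for y
    using B[rule_format, of "- y"] that unfolding q_def by (simp add: poly_pcompose)
  then show ?thesis by blast
qed

section \<open>Sign patterns up to an order automorphism\<close>

definition order_auto :: "('a::linordered_field \<Rightarrow> 'a) \<Rightarrow> bool" where
  "order_auto \<theta> \<longleftrightarrow> strict_mono \<theta> \<and> surj \<theta>"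

lemma order_auto_id: "order_auto (\<lambda>x. x)"
  by (auto simp: order_auto_def strict_mono_def)

lemma order_auto_less_iff: "order_auto \<theta> \<Longrightarrow> \<theta> x < \<theta> y \<longleftrightarrow> x < y"
  unfolding order_auto_def by (metis strict_mono_less)

lemma order_auto_le_iff: "order_auto \<theta> \<Longrightarrow> \<theta> x \<le> \<theta> y \<longleftrightarrow> x \<le> y"
  unfolding order_auto_def by (metis strict_mono_less_eq)

lemma order_auto_inv:
  assumes "order_auto \<theta>" shows "order_auto (inv_into UNIV \<theta>)" "\<theta> (inv_into UNIV \<theta> x) = x" "inv_into UNIV \<theta> (\<theta> x) = x"
proof -
  have surj: "surj \<theta>" and inj: "inj \<theta>"
    using assms strict_mono_imp_inj_on unfolding order_auto_def by auto
  show 1: "\<theta> (inv_into UNIV \<theta> x) = x" for x by (rule surj_f_inv_f[OF surj])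
  show "inv_into UNIV \<theta> (\<theta> x) = x" by (rule inv_f_f[OF inj])
  show "order_auto (inv_into UNIV \<theta>)"
    unfolding order_auto_def strict_mono_def
  proof (intro conjI allI impI)
    fix x y :: 'a assume "x < y"
    then have "\<theta> (inv_into UNIV \<theta> x) < \<theta> (inv_into UNIV \<theta> y)" by (simp only: 1)
    then show "inv_into UNIV \<theta> x < inv_into UNIV \<theta> y" using order_auto_less_iff[OF assms] by blast
  qed (rule inj_imp_surj_inv[OF inj])
qed

lemma order_auto_extends_finite:
  fixes W :: "'a::linordered_field set"
  assumes "finite W" "strict_mono_on W \<beta>"
  shows "\<exists>\<theta>. order_auto \<theta> \<and> (\<forall>w\<in>W. \<theta> w = \<beta> w)"
  using assms
proof (induction W rule: finite_linorder_max_induct)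
  case empty
  then show ?case using order_auto_id by auto
next
  case (insert b A)
  show ?case
  proof (cases "A = {}")
    case True
    have "order_auto (\<lambda>y. y + (\<beta> b - b))"
      unfolding order_auto_def strict_mono_def surj_def by (auto intro: exI[of _ "_ - (\<beta> b - b)"])
    then show ?thesis using True by (intro exI[of _ "\<lambda>y. y + (\<beta> b - b)"]) auto
  next
    case False
    obtain \<theta> where \<theta>: "order_auto \<theta>" "\<And>w. w \<in> A \<Longrightarrow> \<theta> w = \<beta> w"
      using insert.IH insert.prems monotone_on_subset subset_insertI by meson
    define m where "m = Max A"
    have m: "m \<in> A" "\<And>a. a \<in> A \<Longrightarrow> a \<le> m" using False insert.hyps(1) unfolding m_def by auto
    have mb: "m < b" "\<beta> m < \<beta> b" using m insert by (auto simp: strict_mono_on_def)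
    define c where "c = (\<beta> b - \<beta> m) / (b - m)"
    have c: "c > 0" using mb unfolding c_def by simp
    define \<theta>' where "\<theta>' = (\<lambda>y. if y \<le> m then \<theta> y else \<beta> m + (y - m) * c)"
    have "strict_mono \<theta>'"
      unfolding strict_mono_def
    proof (intro allI impI)
      fix x y :: 'a assume xy: "x < y"
      consider "y \<le> m" | "x \<le> m" "m < y" | "m < x" using xy by linarith
      then show "\<theta>' x < \<theta>' y"
      proof cases
        case 1
        then show ?thesis using xy order_auto_less_iff[OF \<theta>(1)] unfolding \<theta>'_def by auto
      next
        case 2
        have "\<theta> x \<le> \<theta> m" using 2 order_auto_le_iff[OF \<theta>(1)] by auto
        then show ?thesis using 2 c \<theta>(2)[OF m(1)] unfolding \<theta>'_def
          by (auto intro: le_less_trans)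
      next
        case 3
        then show ?thesis using xy c unfolding \<theta>'_def by auto
      qed
    qed
    moreover have "surj \<theta>'"
      unfolding surj_def
    proof
      fix z
      show "\<exists>x. z = \<theta>' x"
      proof (cases "z \<le> \<beta> m")
        case True
        obtain x where x: "\<theta> x = z" using \<theta>(1) unfolding order_auto_def by (metis surj_def)
        then have "x \<le> m" using True \<theta> m(1) order_auto_le_iff by metis
        then show ?thesis using x unfolding \<theta>'_def by auto
      next
        case False
        then have "m + (z - \<beta> m) / c > m" using c by simp
        then show ?thesis using c unfolding \<theta>'_def
          by (intro exI[of _ "m + (z - \<beta> m) / c"]) auto
      qed
    qed
    moreover have "\<theta>' w = \<beta> w" if "w \<in> insert b A" for w
      using that mb m \<theta>(2) unfolding \<theta>'_def c_def by auto
    ultimately show ?thesis unfolding order_auto_def by blast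
  qed
qed


text \<open>By monotonicity \<open>p\<close> has a root in a gap between critical points exactly if it changes sign
  there, and the signs at the ends are shared by \<open>q\<close>.\<close>

lemma transfer_root:
  fixes p q :: "'a::real_closed_field poly"
  assumes \<theta>: "order_auto \<theta>" and Z: "finite Z"
    and sgn: "\<And>z. z \<in> Z \<Longrightarrow> sgn (poly p z) = sgn (poly q (\<theta> z))"
    and crit: "\<And>t. poly (pderiv p) t = 0 \<Longrightarrow> t \<in> Z"
    and e: "poly p e = 0" "e \<notin> Z" "l \<in> Z" "l < e" "u \<in> Z" "e < u"
  shows "\<exists>e'. poly q e' = 0 \<and> (\<forall>z\<in>Z. (z < e \<longleftrightarrow> \<theta> z < e') \<and> (e < z \<longleftrightarrow> e' < \<theta> z))"
proof -
  define a where "a = Max {z \<in> Z. z < e}"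
  define b where "b = Min {z \<in> Z. e < z}"
  have "a \<in> {z \<in> Z. z < e}" unfolding a_def using Z e by (intro Max_in) auto
  then have a: "a \<in> Z" "a < e" by auto
  have "b \<in> {z \<in> Z. e < z}" unfolding b_def using Z e by (intro Min_in) auto
  then have b: "b \<in> Z" "e < b" by auto
  have amax: "z \<le> a" if "z \<in> Z" "z < e" for z unfolding a_def using that Z by (intro Max_ge) auto
  have bmin: "b \<le> z" if "z \<in> Z" "e < z" for z unfolding b_def using that Z by (intro Min_le) auto
  have gap: "z \<le> a \<or> b \<le> z" if "z \<in> Z" for z
    using that amax bmin e(2) by (metis linorder_less_linear)
  have "poly (pderiv p) t \<noteq> 0" if "a < t" "t < b" for t using crit[of t] gap[of t] that by auto
  then have "poly p a * poly p b < 0" using poly_sign_change_at_root[OF a(2) b(2) e(1)] by blast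
  then have "poly q (\<theta> a) * poly q (\<theta> b) < 0"
    using sgn[OF a(1)] sgn[OF b(1)] by (metis sgn_less sgn_mult)
  moreover have "\<theta> a < \<theta> b" using order_auto_less_iff[OF \<theta>] a b by auto
  ultimately obtain e' where e': "\<theta> a < e'" "e' < \<theta> b" "poly q e' = 0" using poly_IVT by blast
  have "(z < e \<longleftrightarrow> \<theta> z < e') \<and> (e < z \<longleftrightarrow> e' < \<theta> z)" if "z \<in> Z" for z
  proof -
    from gap[OF that] consider "z \<le> a" | "b \<le> z" by blast
    then show ?thesis
    proof cases
      case 1
      then have "\<theta> z < e'" using e'(1) order_auto_le_iff[OF \<theta>] by (meson le_less_trans)
      then show ?thesis using 1 a by auto
    next
      case 2
      then have "e' < \<theta> z" using e'(2) order_auto_le_iff[OF \<theta>] by (meson less_le_trans)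
      then show ?thesis using 2 b by auto
    qed
  qed
  then show ?thesis using e'(3) by blast
qed

lemma same_root_if_same_gap:
  fixes p :: "'a::real_closed_field poly"
  assumes crit: "\<And>t. poly (pderiv p) t = 0 \<Longrightarrow> t \<in> Z"
    and e: "poly p e1 = 0" "poly p e2 = 0" "e1 \<notin> Z" "\<And>z. z \<in> Z \<Longrightarrow> e1 < z \<longleftrightarrow> e2 < z"
  shows "e1 = e2"
proof (rule ccontr)
  assume "e1 \<noteq> e2"
  then consider "e1 < e2" | "e2 < e1" by linarith
  then obtain c where "min e1 e2 < c" "c < max e1 e2" "poly (pderiv p) c = 0"
    using poly_Rolle[of e1 e2 p] poly_Rolle[of e2 e1 p] e by cases auto
  then show False using crit[of c] e(4)[of c] by (auto simp: min_def max_def split: if_splits)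
qed

text \<open>The data that fix the sign of \<open>p\<close> off a finite set \<open>W\<close> containing its roots and critical points.\<close>

lemma sgn_poly_between:
  fixes p :: "'a::real_closed_field poly"
  assumes W: "finite W" and roots: "\<And>t. poly p t = 0 \<Longrightarrow> t \<in> W" and crit: "\<And>t. poly (pderiv p) t = 0 \<Longrightarrow> t \<in> W"
    and w: "w \<in> W" "w < y" "\<And>z. z \<in> W \<Longrightarrow> z \<le> w \<or> y < z"
  shows "sgn (poly p y) = (if poly p w = 0 then sgn (poly (pderiv p) y) else sgn (poly p w))"
proof (cases "poly p w = 0")
  case True
  obtain c where c: "w < c" "c < y" "poly p y - poly p w = (y - w) * poly (pderiv p) c"
    using poly_MVT[OF w(2)] by blast
  have "sgn (poly (pderiv p) c) = sgn (poly (pderiv p) y)"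
    by (rule sgn_poly_eq_if_no_root) (use c crit w(3) in \<open>force+\<close>)
  moreover have "sgn (poly p y) = sgn (poly (pderiv p) c)" using c True by (simp add: sgn_mult)
  ultimately show ?thesis using True by simp
next
  case False
  have "sgn (poly p w) = sgn (poly p y)"
  proof (rule sgn_poly_eq_if_no_root)
    fix t assume "w \<le> t" "t \<le> y"
    then show "poly p t \<noteq> 0" using False roots[of t] w(3)[of t] by (cases "t = w") auto
  qed (use w in auto)
  then show ?thesis using False by simp
qed

text \<open>The step of the elimination procedure of Cohen and Hoermander: if the derivative is already
  matched, the sign behaviour of \<open>p\<close> is determined by its signs at the roots of the matched
  polynomials and at infinity.\<close>

lemma extend_order_auto_to_antiderivative:
  fixes p q :: "'a::real_closed_field poly"
  assumes \<theta>: "order_auto \<theta>" and K: "finite K"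
    and sgnK: "\<And>g h y. (g, h) \<in> K \<Longrightarrow> sgn (poly g y) = sgn (poly h (\<theta> y))"
    and nzK: "\<And>g h. (g, h) \<in> K \<Longrightarrow> g \<noteq> 0"
    and deriv: "(pderiv p, pderiv q) \<in> K"
    and at_roots: "\<And>g h y. (g, h) \<in> K \<Longrightarrow> poly g y = 0 \<Longrightarrow> sgn (poly p y) = sgn (poly q (\<theta> y))"
    and inf: "p \<noteq> 0" "q \<noteq> 0" "degree p = degree q" "sgn (lead_coeff p) = sgn (lead_coeff q)"
  shows "\<exists>\<theta>'. order_auto \<theta>' \<and>
    (\<forall>(g, h)\<in>insert (p, q) K. \<forall>y. sgn (poly g y) = sgn (poly h (\<theta>' y)))"
proof -
  let ?i = "inv_into UNIV \<theta>"
  note inv = order_auto_inv[OF \<theta>]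
  note lt = order_auto_less_iff[OF \<theta>] and le = order_auto_le_iff[OF \<theta>]
  define Z0 where "Z0 = (\<Union>(g, h)\<in>K. {y. poly g y = 0})"
  define R where "R = Z0 \<union> {y. poly p y = 0} \<union> {y. poly q (\<theta> y) = 0}"
  have "finite {y. poly q (\<theta> y) = 0}"
  proof (rule finite_subset)
    show "{y. poly q (\<theta> y) = 0} \<subseteq> ?i ` {y. poly q y = 0}" using inv(3) by (auto simp: image_iff) metis
  qed (use poly_roots_finite[OF inf(2)] in auto)
  then have fin: "finite Z0" "finite R"
    using K nzK poly_roots_finite inf(1) unfolding Z0_def R_def by (auto split: prod.splits)
  obtain B1 where B1: "\<forall>y\<ge>B1. sgn (poly p y) = sgn (lead_coeff p)" using sgn_poly_at_top inf(1) by blast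
  obtain B2 where B2: "\<forall>y\<ge>B2. sgn (poly q y) = sgn (lead_coeff q)" using sgn_poly_at_top inf(2) by blast
  obtain C1 where C1: "\<forall>y\<le>C1. sgn (poly p y) = sgn ((-1) ^ degree p * lead_coeff p)"
    using sgn_poly_at_bot inf(1) by blast
  obtain C2 where C2: "\<forall>y\<le>C2. sgn (poly q y) = sgn ((-1) ^ degree q * lead_coeff q)"
    using sgn_poly_at_bot inf(2) by blast
  define u where "u = Max (insert B1 (insert (?i B2) R)) + 1"
  define l where "l = Min (insert C1 (insert (?i C2) R)) - 1"
  have "Max (insert B1 (insert (?i B2) R)) < u" unfolding u_def by simp
  then have u: "B1 \<le> u" "?i B2 \<le> u" "\<And>r. r \<in> R \<Longrightarrow> r < u"
    using fin by (auto intro: less_imp_le)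
  have "l < Min (insert C1 (insert (?i C2) R))" unfolding l_def by simp
  then have l: "l \<le> C1" "l \<le> ?i C2" "\<And>r. r \<in> R \<Longrightarrow> l < r"
    using fin by (auto intro: less_imp_le)
  have su: "sgn (poly p u) = sgn (poly q (\<theta> u))"
  proof -
    have "\<theta> u \<ge> B2" using u(2) le inv(2) by metis
    then show ?thesis using B1 B2 u(1) inf(4) by auto
  qed
  have sl: "sgn (poly p y) = sgn (poly q (\<theta> y))" if "y \<le> l" for y
  proof -
    have "y \<le> ?i C2" using that l(2) by simp
    then have "\<theta> y \<le> C2" using le inv(2) by metis
    moreover have "sgn ((-1) ^ degree p * lead_coeff p) = sgn ((-1) ^ degree q * lead_coeff q)"
      using inf(3,4) by (simp add: sgn_mult)
    ultimately show ?thesis using C1 C2 l(1) that by auto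
  qed
  define Z where "Z = insert l (insert u Z0)"
  have Z: "finite Z" "l \<in> Z" "u \<in> Z" using fin unfolding Z_def by auto
  have sgnZ: "sgn (poly p z) = sgn (poly q (\<theta> z))" if "z \<in> Z" for z
    using that su sl[of l] at_roots unfolding Z_def Z0_def by auto
  have critp: "t \<in> Z" if "poly (pderiv p) t = 0" for t
    using that deriv unfolding Z_def Z0_def by auto
  have sgn0: "(poly g y = 0) = (poly h (\<theta> y) = 0)" if "(g, h) \<in> K" for g h y
    using sgnK[OF that, of y] by (metis sgn_eq_0_iff)
  have critq: "t \<in> \<theta> ` Z" if "poly (pderiv q) t = 0" for t
  proof -
    have "poly (pderiv p) (?i t) = 0" using sgn0[OF deriv, of "?i t"] that inv(2) by simp
    then show ?thesis using critp inv(2) by (metis image_eqI)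
  qed
  define E where "E = {e. poly p e = 0 \<and> e \<notin> Z}"
  define E' where "E' = {e. poly q e = 0 \<and> e \<notin> \<theta> ` Z}"
  have Eb: "l < e \<and> e < u" if "e \<in> E" for e using that l u unfolding E_def R_def by auto
  have Eb': "\<theta> l < e \<and> e < \<theta> u" if "e \<in> E'" for e
  proof -
    have "?i e \<in> R" using that inv(2) unfolding E'_def R_def by auto
    then have "l < ?i e" "?i e < u" using l u by auto
    then show ?thesis using lt inv(2) by metis
  qed
  have ex: "\<exists>e'. e' \<in> E' \<and> (\<forall>z\<in>Z. (z < e \<longleftrightarrow> \<theta> z < e') \<and> (e < z \<longleftrightarrow> e' < \<theta> z))" if "e \<in> E" for e
  proof -
    have "poly p e = 0" "e \<notin> Z" using that unfolding E_def by auto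
    from transfer_root[OF \<theta> Z(1) sgnZ critp this Z(2) _ Z(3)] Eb[OF that]
    obtain e' where e': "poly q e' = 0" "\<forall>z\<in>Z. (z < e \<longleftrightarrow> \<theta> z < e') \<and> (e < z \<longleftrightarrow> e' < \<theta> z)" by blast
    have "e' \<notin> \<theta> ` Z"
    proof
      assume "e' \<in> \<theta> ` Z"
      then obtain z where "z \<in> Z" "e' = \<theta> z" by blast
      then have "\<not> z < e" "\<not> e < z" using e'(2) by auto
      then show False using \<open>z \<in> Z\<close> \<open>e \<notin> Z\<close> by auto
    qed
    then show ?thesis using e' unfolding E'_def by blast
  qed
  then obtain \<beta>0 where \<beta>0: "\<And>e. e \<in> E \<Longrightarrow> \<beta>0 e \<in> E' \<and> (\<forall>z\<in>Z. (z < e \<longleftrightarrow> \<theta> z < \<beta>0 e) \<and> (e < z \<longleftrightarrow> \<beta>0 e < \<theta> z))"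
    by metis
  have ex': "\<exists>e\<in>E. \<beta>0 e = e'" if "e' \<in> E'" for e'
  proof -
    note bounds = Eb'[OF that]
    have "poly q e' = 0" "e' \<notin> \<theta> ` Z" using that unfolding E'_def by auto
    moreover have "sgn (poly q z) = sgn (poly p (?i z))" if "z \<in> \<theta> ` Z" for z
      using that sgnZ inv(3) by auto
    ultimately obtain e where e: "poly p e = 0" "\<forall>z\<in>\<theta> ` Z. (z < e' \<longleftrightarrow> ?i z < e) \<and> (e' < z \<longleftrightarrow> e < ?i z)"
      using transfer_root[OF inv(1) finite_imageI[OF Z(1), of \<theta>] _ critq, where q = p and e = e' and l = "\<theta> l" and u = "\<theta> u"]
        Z bounds by blast
    have pos: "(\<theta> z < e' \<longleftrightarrow> z < e) \<and> (e' < \<theta> z \<longleftrightarrow> e < z)" if "z \<in> Z" for z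
      using e(2) that inv(3) by auto
    have "e \<notin> Z"
    proof
      assume "e \<in> Z"
      then have "\<not> \<theta> e < e'" "\<not> e' < \<theta> e" using pos by auto
      then show False using \<open>e \<in> Z\<close> \<open>e' \<notin> \<theta> ` Z\<close> by (metis image_eqI linorder_neqE)
    qed
    then have eE: "e \<in> E" using e unfolding E_def by blast
    have "\<beta>0 e = e'"
    proof (rule same_root_if_same_gap[where p = q and Z = "\<theta> ` Z"])
      show "poly q (\<beta>0 e) = 0" "\<beta>0 e \<notin> \<theta> ` Z" using \<beta>0[OF eE] unfolding E'_def by auto
      show "(\<beta>0 e < z) = (e' < z)" if "z \<in> \<theta> ` Z" for z using that \<beta>0[OF eE] pos by auto
    qed (use critq \<open>poly q e' = 0\<close> in auto)
    then show ?thesis using eE by blast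
  qed
  define \<beta> where "\<beta> = (\<lambda>w. if w \<in> Z then \<theta> w else \<beta>0 w)"
  define W where "W = Z \<union> E"
  have finW: "finite W"
    using Z poly_roots_finite[OF inf(1)] unfolding W_def E_def by (auto intro: finite_subset[of _ "{y. poly p y = 0}"])
  have "strict_mono_on W \<beta>"
    unfolding monotone_on_def
  proof (intro ballI impI)
    fix x y assume xy: "x \<in> W" "y \<in> W" "x < y"
    consider "x \<in> Z" "y \<in> Z" | "x \<in> Z" "y \<in> E" | "x \<in> E" "y \<in> Z" | "x \<in> E" "y \<in> E"
      using xy unfolding W_def by blast
    then show "\<beta> x < \<beta> y"
    proof cases
      case 1
      then show ?thesis using xy lt unfolding \<beta>_def by auto
    next
      case 2
      then have "y \<notin> Z" unfolding E_def by auto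
      then show ?thesis using 2 xy \<beta>0[OF 2(2)] unfolding \<beta>_def by auto
    next
      case 3
      then have "x \<notin> Z" unfolding E_def by auto
      then show ?thesis using 3 xy \<beta>0[OF 3(1)] unfolding \<beta>_def by auto
    next
      case 4
      then have xyE: "poly p x = 0" "poly p y = 0" "x \<notin> Z" "y \<notin> Z" unfolding E_def by auto
      obtain z where z: "z \<in> Z" "(x < z) \<noteq> (y < z)"
        using same_root_if_same_gap[of p Z x y, OF critp xyE(1-3)] xy(3) by blast
      then have "x < z" "z < y" using xy(3) xyE(4) by (metis less_trans linorder_neqE)+
      then have "\<beta>0 x < \<theta> z" "\<theta> z < \<beta>0 y" using \<beta>0[OF 4(1)] \<beta>0[OF 4(2)] z(1) by auto
      then show ?thesis using xyE unfolding \<beta>_def by auto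
    qed
  qed
  then obtain \<theta>' where \<theta>': "order_auto \<theta>'" "\<And>w. w \<in> W \<Longrightarrow> \<theta>' w = \<beta> w"
    using order_auto_extends_finite[OF finW] by blast
  note lt' = order_auto_less_iff[OF \<theta>'(1)] and le' = order_auto_le_iff[OF \<theta>'(1)]
  have onZ: "\<theta>' z = \<theta> z" if "z \<in> Z" for z using that \<theta>'(2)[of z] unfolding W_def \<beta>_def by auto
  have sgnK': "sgn (poly g y) = sgn (poly h (\<theta>' y))" if gh: "(g, h) \<in> K" for g h y
  proof (cases "y \<in> Z")
    case True
    then show ?thesis using onZ sgnK[OF gh] by simp
  next
    case False
    have no_root: "poly h t \<noteq> 0" if "min (\<theta> y) (\<theta>' y) \<le> t" "t \<le> max (\<theta> y) (\<theta>' y)" for t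
    proof
      assume "poly h t = 0"
      then have "poly g (?i t) = 0" using sgn0[OF gh, of "?i t"] inv(2) by simp
      then have z: "?i t \<in> Z" using gh unfolding Z_def Z0_def by auto
      have "\<theta>' (?i t) = t" "\<theta> (?i t) = t" using onZ[OF z] inv(2) by auto
      then have "(?i t < y \<longleftrightarrow> t < \<theta> y) \<and> (?i t < y \<longleftrightarrow> t < \<theta>' y)" "?i t \<noteq> y"
        "(y < ?i t \<longleftrightarrow> \<theta> y < t) \<and> (y < ?i t \<longleftrightarrow> \<theta>' y < t)"
        using lt lt' z False by metis+
      then show False using that by (auto simp: min_def max_def split: if_splits)
    qed
    have "sgn (poly h (min (\<theta> y) (\<theta>' y))) = sgn (poly h (max (\<theta> y) (\<theta>' y)))"
      by (rule sgn_poly_eq_if_no_root) (use no_root in \<open>auto simp: min_def max_def split: if_splits\<close>)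
    then have "sgn (poly h (\<theta> y)) = sgn (poly h (\<theta>' y))" by (auto simp: min_def max_def split: if_splits)
    then show ?thesis using sgnK[OF gh] by simp
  qed
  have Wroots: "t \<in> W" if "poly p t = 0" for t using that unfolding W_def E_def by auto
  have sub: "\<theta> ` Z \<subseteq> \<theta>' ` W"
  proof
    fix t assume "t \<in> \<theta> ` Z"
    then obtain z where "z \<in> Z" "t = \<theta>' z" using onZ by auto
    then show "t \<in> \<theta>' ` W" unfolding W_def by blast
  qed
  have W'roots: "t \<in> \<theta>' ` W" if "poly q t = 0" for t
  proof (cases "t \<in> \<theta> ` Z")
    case True
    then show ?thesis using sub by blast
  next
    case False
    then have "t \<in> E'" using that unfolding E'_def by simp
    then obtain e where "e \<in> E" "\<beta>0 e = t" using ex' by blast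
    then have "\<theta>' e = t" using \<theta>'(2)[of e] unfolding W_def \<beta>_def E_def by auto
    then show ?thesis using \<open>e \<in> E\<close> unfolding W_def by auto
  qed
  have on_W: "sgn (poly p w) = sgn (poly q (\<theta>' w))" if "w \<in> W" for w
  proof (cases "w \<in> Z")
    case True
    then show ?thesis using sgnZ onZ by simp
  next
    case False
    then have "w \<in> E" using that unfolding W_def by auto
    then have "poly q (\<beta>0 w) = 0" "poly p w = 0" using \<beta>0 unfolding E'_def E_def by auto
    then show ?thesis using \<theta>'(2)[OF that] False unfolding \<beta>_def by simp
  qed
  have "sgn (poly p y) = sgn (poly q (\<theta>' y))" for y
  proof -
    consider "y \<in> W" | "y \<le> l" | "y \<notin> W" "l < y" by linarith
    then show ?thesis
    proof cases
      case 1
      then show ?thesis by (rule on_W)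
    next
      case 2
      have "sgn (poly p y) = sgn (poly p l)"
      proof (rule sgn_poly_eq_if_no_root[OF 2])
        fix t assume t: "y \<le> t" "t \<le> l"
        show "poly p t \<noteq> 0"
        proof
          assume "poly p t = 0"
          then have "t \<in> R" unfolding R_def by simp
          then show False using l(3)[of t] t by simp
        qed
      qed
      also have "\<dots> = sgn (poly q (\<theta>' l))" using on_W Z(2) unfolding W_def by auto
      also have "\<dots> = sgn (poly q (\<theta>' y))"
      proof (rule sgn_poly_eq_if_no_root[symmetric])
        show "\<theta>' y \<le> \<theta>' l" using 2 le' by blast
        fix t assume t: "\<theta>' y \<le> t" "t \<le> \<theta>' l"
        show "poly q t \<noteq> 0"
        proof
          assume "poly q t = 0"
          then have "?i t \<in> R" unfolding R_def using inv(2) by auto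
          then have "l < ?i t" using l by auto
          then have "\<theta> l < t" using lt inv(2) by metis
          then show False using t onZ[OF Z(2)] by auto
        qed
      qed
      finally show ?thesis .
    next
      case 3
      define w where "w = Max {w \<in> W. w < y}"
      have "w \<in> {w \<in> W. w < y}" unfolding w_def using finW 3 Z(2) by (intro Max_in) (auto simp: W_def)
      then have w: "w \<in> W" "w < y" by auto
      have wmax: "z \<le> w \<or> y < z" if "z \<in> W" for z
      proof (cases "z < y")
        case True
        then show ?thesis unfolding w_def using that finW by (auto intro: Max_ge)
      next
        case False
        then show ?thesis using that 3 by (metis linorder_neqE)
      qed
      have 1: "sgn (poly p y) = (if poly p w = 0 then sgn (poly (pderiv p) y) else sgn (poly p w))"
        by (rule sgn_poly_between[OF finW Wroots _ w wmax]) (use critp in \<open>auto simp: W_def\<close>)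
      have 2: "sgn (poly q (\<theta>' y)) = (if poly q (\<theta>' w) = 0 then sgn (poly (pderiv q) (\<theta>' y)) else sgn (poly q (\<theta>' w)))"
      proof (rule sgn_poly_between[of "\<theta>' ` W", OF finite_imageI[OF finW] W'roots])
        show "t \<in> \<theta>' ` W" if "poly (pderiv q) t = 0" for t
          using critq[OF that] sub by blast
        show "\<theta>' w \<in> \<theta>' ` W" "\<theta>' w < \<theta>' y" using w lt' by auto
        show "z \<le> \<theta>' w \<or> \<theta>' y < z" if "z \<in> \<theta>' ` W" for z
        proof -
          from that obtain x where "x \<in> W" "z = \<theta>' x" by blast
          then show ?thesis using wmax[of x] le' lt' by simp
        qed
      qed
      show ?thesis using 1 2 on_W[OF w(1)] sgnK'[OF deriv, of y] by (metis sgn_eq_0_iff)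
    qed
  qed
  then show ?thesis using \<theta>'(1) sgnK' by (intro exI[of _ \<theta>']) auto
qed

section \<open>Elimination of one quantifier\<close>

definition is_subring :: "'r::comm_ring_1 set \<Rightarrow> bool" where
  "is_subring S \<longleftrightarrow> 0 \<in> S \<and> 1 \<in> S \<and> (\<forall>a\<in>S. \<forall>b\<in>S. a + b \<in> S \<and> a - b \<in> S \<and> a * b \<in> S)"

lemma is_subringD:
  assumes "is_subring S"
  shows "0 \<in> S" "1 \<in> S" "a \<in> S \<Longrightarrow> b \<in> S \<Longrightarrow> a + b \<in> S" "a \<in> S \<Longrightarrow> b \<in> S \<Longrightarrow> a - b \<in> S"
    "a \<in> S \<Longrightarrow> b \<in> S \<Longrightarrow> a * b \<in> S" "a \<in> S \<Longrightarrow> - a \<in> S"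
    "a \<in> S \<Longrightarrow> a ^ n \<in> S"
proof -
  show pos: "0 \<in> S" "1 \<in> S" "a \<in> S \<Longrightarrow> b \<in> S \<Longrightarrow> a + b \<in> S" "a \<in> S \<Longrightarrow> b \<in> S \<Longrightarrow> a - b \<in> S"
    and mult: "a \<in> S \<Longrightarrow> b \<in> S \<Longrightarrow> a * b \<in> S" for a b
    using assms unfolding is_subring_def by auto
  show "a \<in> S \<Longrightarrow> - a \<in> S" using pos(1) pos(4)[of 0 a] by simp
  show "a \<in> S \<Longrightarrow> a ^ n \<in> S" by (induction n) (auto intro: pos mult)
qed

lemma is_subring_sum:
  assumes "is_subring S" "\<And>i. i \<in> I \<Longrightarrow> f i \<in> S" shows "sum f I \<in> S"
  using assms(2) by (induction I rule: infinite_finite_induct) (auto intro: is_subringD[OF assms(1)])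

lemma is_subring_of_nat:
  assumes "is_subring S" shows "of_nat k \<in> S"
  by (induction k) (auto intro: is_subringD[OF assms])

text \<open>A polynomial in one variable with coefficients depending on a parameter: a formal degree,
  which the specialisation need not have, together with the coefficient functions.\<close>

type_synonym ('p, 'a) ppoly = "nat \<times> (nat \<Rightarrow> 'p \<Rightarrow> 'a)"

definition spec :: "('p, 'a::comm_ring_1) ppoly \<Rightarrow> 'p \<Rightarrow> 'a poly" where
  "spec P x = (\<Sum>i\<le>fst P. monom (snd P i x) i)"

definition ppoly_over :: "('p \<Rightarrow> 'a) set \<Rightarrow> ('p, 'a) ppoly \<Rightarrow> bool" where
  "ppoly_over S P \<longleftrightarrow> (\<forall>i. snd P i \<in> S)"

lemma coeff_spec: "coeff (spec P x) i = (if i \<le> fst P then snd P i x else 0)"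
  unfolding spec_def by (auto simp: coeff_sum if_distrib cong: if_cong)

lemma poly_spec: "poly (spec P x) y = (\<Sum>i\<le>fst P. snd P i x * y ^ i)"
  unfolding spec_def by (simp add: poly_sum poly_monom)

lemma degree_spec: "snd P (fst P) x \<noteq> 0 \<Longrightarrow> degree (spec P x) = fst P"
  by (intro antisym degree_le le_degree) (auto simp: coeff_spec)

lemma spec_nonzero: "snd P (fst P) x \<noteq> 0 \<Longrightarrow> spec P x \<noteq> 0"
  by (metis coeff_spec coeff_0 order_refl)

lemma sum_fun_apply [simp]: "(\<Sum>i\<in>I. f i) x = (\<Sum>i\<in>I. f i x)"
  by (induction I rule: infinite_finite_induct) auto

lemma power_fun_apply [simp]: "(f ^ n) x = f x ^ n"
  by (induction n) auto

text \<open>Division without inverting the leading coefficient. The even power keeps the factor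
  nonnegative, so that at a root of the divisor the dividend and the remainder have equal signs.\<close>

lemma ppoly_pseudo_rem:
  fixes S :: "('p \<Rightarrow> 'a::comm_ring_1) set"
  assumes S: "is_subring S" and b: "\<And>i. b i \<in> S" and M: "M \<ge> 1"
  shows "(\<And>i. c i \<in> S) \<Longrightarrow> \<exists>e k. (\<forall>i. e i \<in> S) \<and>
    (\<forall>x. \<exists>q. smult (b M x ^ (2 * k)) (spec (N, c) x) = q * spec (M, b) x + spec (M - 1, e) x)"
proof (induction N arbitrary: c)
  case 0
  have "spec (0, c) x = spec (M - 1, \<lambda>i. if i \<le> 0 then c i else 0) x" for x
    by (intro poly_eqI) (auto simp: coeff_spec)
  then have "smult (b M x ^ (2 * 0)) (spec (0, c) x)
      = 0 * spec (M, b) x + spec (M - 1, \<lambda>i. if i \<le> 0 then c i else 0) x" for x by simp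
  moreover have "(if i \<le> 0 then c i else 0) \<in> S" for i using 0 is_subringD(1)[OF S] by auto
  ultimately show ?case by (intro exI[of _ "\<lambda>i. if i \<le> 0 then c i else 0"] exI[of _ 0]) blast
next
  case (Suc N)
  show ?case
  proof (cases "Suc N < M")
    case True
    let ?e = "\<lambda>i. if i \<le> Suc N then c i else 0"
    have "spec (Suc N, c) x = spec (M - 1, ?e) x" for x
      using True by (intro poly_eqI) (auto simp: coeff_spec)
    then have "smult (b M x ^ (2 * 0)) (spec (Suc N, c) x) = 0 * spec (M, b) x + spec (M - 1, ?e) x" for x
      by simp
    moreover have "?e i \<in> S" for i using Suc.prems is_subringD(1)[OF S] by auto
    ultimately show ?thesis by (intro exI[of _ ?e] exI[of _ 0]) blast
  next
    case False
    define D where "D = Suc N - M"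
    define c' where "c' = (\<lambda>i. b M * b M * c i - (if D \<le> i then b M * c (Suc N) * b (i - D) else 0))"
    have c'S: "c' i \<in> S" for i unfolding c'_def using Suc.prems b is_subringD[OF S] by auto
    from Suc.IH[of c', OF c'S] obtain e k where e: "\<And>i. e i \<in> S"
      and q: "\<And>x. \<exists>q. smult (b M x ^ (2 * k)) (spec (N, c') x) = q * spec (M, b) x + spec (M - 1, e) x"
      by blast
    have red: "spec (N, c') x = smult (b M x ^ 2) (spec (Suc N, c) x)
        - monom (b M x * c (Suc N) x) D * spec (M, b) x" for x
    proof (rule poly_eqI)
      fix i
      have cm: "coeff (monom (b M x * c (Suc N) x) D * spec (M, b) x) i
          = (if i < D then 0 else b M x * c (Suc N) x * coeff (spec (M, b) x) (i - D))"
        by (simp add: coeff_monom_mult)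
      consider "i < D" | "D \<le> i" "i \<le> N" | "i = Suc N" | "Suc N < i" by linarith
      then show "coeff (spec (N, c') x) i = coeff (smult (b M x ^ 2) (spec (Suc N, c) x)
        - monom (b M x * c (Suc N) x) D * spec (M, b) x) i"
        unfolding coeff_diff coeff_smult cm coeff_spec using False M
        by cases (auto simp: c'_def D_def power2_eq_square algebra_simps)
    qed
    have "\<exists>q. smult (b M x ^ (2 * Suc k)) (spec (Suc N, c) x) = q * spec (M, b) x + spec (M - 1, e) x" for x
    proof -
      obtain q where q: "smult (b M x ^ (2 * k)) (spec (N, c') x) = q * spec (M, b) x + spec (M - 1, e) x"
        using q by blast
      have "smult (b M x ^ (2 * Suc k)) (spec (Suc N, c) x)
          = smult (b M x ^ (2 * k)) (spec (N, c') x + monom (b M x * c (Suc N) x) D * spec (M, b) x)"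
        unfolding red by (simp add: power2_eq_square mult_ac)
      also have "\<dots> = (q + smult (b M x ^ (2 * k)) (monom (b M x * c (Suc N) x) D)) * spec (M, b) x + spec (M - 1, e) x"
        unfolding smult_add_right q by (simp add: algebra_simps)
      finally show ?thesis by blast
    qed
    then show ?thesis using e by blast
  qed
qed

definition same_signs :: "('p \<Rightarrow> 'a::linordered_field) set \<Rightarrow> 'p \<Rightarrow> 'p \<Rightarrow> bool" where
  "same_signs F x x' \<longleftrightarrow> (\<forall>f\<in>F. sgn (f x) = sgn (f x'))"

definition same_pattern :: "('p, 'a::linordered_field) ppoly list \<Rightarrow> 'p \<Rightarrow> 'p \<Rightarrow> bool" where
  "same_pattern Ps x x' \<longleftrightarrow> (\<exists>\<theta>. order_auto \<theta> \<and>
     (\<forall>P\<in>set Ps. \<forall>y. sgn (poly (spec P x) y) = sgn (poly (spec P x') (\<theta> y))))"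

lemma sgn_power_even_mult:
  fixes b c :: "'a::linordered_field"
  assumes "b \<noteq> 0" shows "sgn (b ^ (2 * k) * c) = sgn c"
proof -
  have "b ^ (2 * k) > 0" using assms by (simp add: zero_less_power_eq)
  then have "sgn (b ^ (2 * k)) = 1" by (simp only: sgn_1_pos)
  then show ?thesis by (simp only: sgn_mult mult_1_left)
qed

text \<open>The finite set consists of coefficients of the polynomials obtained from the given ones by
  derivatives and remainders; a leading coefficient of sign \<open>0\<close> is dropped.\<close>

theorem same_pattern_if_same_signs:
  fixes S :: "('p \<Rightarrow> 'a::real_closed_field) set"
  assumes S: "is_subring S" and "\<And>P. P \<in> set Ps \<Longrightarrow> ppoly_over S P"
  shows "\<exists>F. finite F \<and> F \<subseteq> S \<and> (\<forall>x x'. same_signs F x x' \<longrightarrow> same_pattern Ps x x')"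
  using assms(2)
proof (induction "mset (map fst Ps)" arbitrary: Ps rule: wf_induct_rule[OF wf_mult[OF wf_less_than]])
  case (1 Ps)
  show ?case
  proof (cases "Ps = []")
    case True
    then show ?thesis unfolding same_pattern_def using order_auto_id by (intro exI[of _ "{}"]) auto
  next
    case False
    have smaller: "(mset (map fst (remove1 P Ps @ Ks)), mset (map fst Ps)) \<in> mult less_than"
      if "P \<in> set Ps" "\<And>K. K \<in> set Ks \<Longrightarrow> fst K < fst P" for P Ks
    proof -
      have "mset (map fst Ps) = image_mset fst (mset (remove1 P Ps)) + {#fst P#}"
        using that(1) by (simp flip: image_mset_add_mset)
      moreover have "(image_mset fst (mset (remove1 P Ps)) + image_mset fst (mset Ks),
          image_mset fst (mset (remove1 P Ps)) + {#fst P#}) \<in> mult less_than"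
        by (rule one_step_implies_mult) (use that(2) in auto)
      ultimately show ?thesis by simp
    qed
    have over_remove: "ppoly_over S Q" if "Q \<in> set (remove1 P Ps)" for P Q
      using 1(2) that notin_set_remove1 by metis
    define tr where "tr = (\<lambda>P :: ('p, 'a) ppoly. remove1 P Ps @ (if fst P = 0 then [] else [(fst P - 1, snd P)]))"
    have "\<exists>F. finite F \<and> F \<subseteq> S \<and> (\<forall>x x'. same_signs F x x' \<longrightarrow> same_pattern (tr P) x x')"
      if P: "P \<in> set Ps" for P
    proof (rule 1(1))
      show "(mset (map fst (tr P)), mset (map fst Ps)) \<in> mult less_than"
        unfolding tr_def
      proof (rule smaller[OF P])
        fix K assume "K \<in> set (if fst P = 0 then [] else [(fst P - 1, snd P)])"
        then show "fst K < fst P" by (cases "fst P = 0") auto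
      qed
      show "ppoly_over S Q" if "Q \<in> set (tr P)" for Q
        using that over_remove[of Q P] 1(2)[OF P] unfolding tr_def
        by (auto simp: ppoly_over_def split: if_splits)
    qed
    then obtain Ft where Ft: "\<And>P. P \<in> set Ps \<Longrightarrow> finite (Ft P)" "\<And>P. P \<in> set Ps \<Longrightarrow> Ft P \<subseteq> S"
      "\<And>P x x'. P \<in> set Ps \<Longrightarrow> same_signs (Ft P) x x' \<Longrightarrow> same_pattern (tr P) x x'" by metis
    obtain P where P: "P \<in> set Ps" and Pmax: "\<And>Q. Q \<in> set Ps \<Longrightarrow> fst Q \<le> fst P"
    proof -
      have "Max (fst ` set Ps) \<in> fst ` set Ps" using False by (intro Max_in) auto
      then obtain P where "P \<in> set Ps" "fst P = Max (fst ` set Ps)" by auto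
      then show ?thesis using that[of P] by auto
    qed
    define P' :: "('p, 'a) ppoly" where "P' = (fst P - 1, \<lambda>i. of_nat (Suc i) * snd P (Suc i))"
    have P'over: "ppoly_over S P'"
      using 1(2)[OF P] is_subringD[OF S] is_subring_of_nat[OF S] unfolding ppoly_over_def P'_def by auto
    define Qs where "Qs = remove1 P Ps @ [P']"
    have Qover: "ppoly_over S Q" if "Q \<in> set Qs" for Q
      using that P'over over_remove[of Q P] unfolding Qs_def by auto
    have Qdeg: "fst Q \<le> fst P" if "Q \<in> set Qs" for Q
    proof (cases "Q = P'")
      case False
      then have "Q \<in> set Ps" using that set_remove1_subset[of P Ps] unfolding Qs_def by auto
      then show ?thesis by (rule Pmax)
    qed (simp add: P'_def)
    have "\<exists>R k. ppoly_over S R \<and> fst R = fst Q - 1 \<and> (\<forall>x. \<exists>q.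
        smult (snd Q (fst Q) x ^ (2 * k)) (spec P x) = q * spec Q x + spec R x)"
      if "Q \<in> set Qs" "fst Q \<ge> 1" for Q
    proof -
      have "\<exists>e k. (\<forall>i. e i \<in> S) \<and> (\<forall>x. \<exists>q. smult (snd Q (fst Q) x ^ (2 * k)) (spec (fst P, snd P) x)
          = q * spec (fst Q, snd Q) x + spec (fst Q - 1, e) x)"
        by (rule ppoly_pseudo_rem[OF S _ that(2)])
          (use Qover[OF that(1)] 1(2)[OF P] in \<open>auto simp: ppoly_over_def\<close>)
      then show ?thesis unfolding ppoly_over_def by (metis fst_conv snd_conv prod.collapse)
    qed
    then obtain rem k where rem: "\<And>Q. Q \<in> set Qs \<Longrightarrow> fst Q \<ge> 1 \<Longrightarrow> ppoly_over S (rem Q)"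
      "\<And>Q. Q \<in> set Qs \<Longrightarrow> fst Q \<ge> 1 \<Longrightarrow> fst (rem Q) = fst Q - 1"
      "\<And>Q x. Q \<in> set Qs \<Longrightarrow> fst Q \<ge> 1 \<Longrightarrow>
        \<exists>q. smult (snd Q (fst Q) x ^ (2 * k Q)) (spec P x) = q * spec Q x + spec (rem Q) x"
      by metis
    define Rs where "Rs = remove1 P Ps @ (P' # map rem (filter (\<lambda>Q. fst Q \<ge> 1) Qs))"
    have "\<exists>F. finite F \<and> F \<subseteq> S \<and> (fst P \<noteq> 0 \<longrightarrow> (\<forall>x x'. same_signs F x x' \<longrightarrow> same_pattern Rs x x'))"
    proof (cases "fst P = 0")
      case False
      have "\<exists>F. finite F \<and> F \<subseteq> S \<and> (\<forall>x x'. same_signs F x x' \<longrightarrow> same_pattern Rs x x')"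
      proof (rule 1(1))
        show "(mset (map fst Rs), mset (map fst Ps)) \<in> mult less_than"
          unfolding Rs_def
        proof (rule smaller[OF P])
          fix K assume "K \<in> set (P' # map rem (filter (\<lambda>Q. fst Q \<ge> 1) Qs))"
          then show "fst K < fst P" using False rem(2) Qdeg by (fastforce simp: P'_def)
        qed
        show "ppoly_over S Q" if "Q \<in> set Rs" for Q
          using that over_remove[of Q P] P'over rem(1) unfolding Rs_def by auto
      qed
      then show ?thesis by blast
    qed auto
    then obtain Fr where Fr: "finite Fr" "Fr \<subseteq> S"
      "\<And>x x'. fst P \<noteq> 0 \<Longrightarrow> same_signs Fr x x' \<Longrightarrow> same_pattern Rs x x'" by blast
    define F where "F = (\<lambda>P. snd P (fst P)) ` set Ps \<union> (\<Union>P\<in>set Ps. Ft P) \<union> Fr"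
    have "finite F" unfolding F_def using Ft(1) Fr(1) by auto
    moreover have "F \<subseteq> S"
      unfolding F_def using Ft(2) Fr(2) 1(2) by (auto simp: ppoly_over_def)
    moreover have "same_pattern Ps x x'" if ss: "same_signs F x x'" for x x'
    proof -
      have lcs: "sgn (snd Q (fst Q) x) = sgn (snd Q (fst Q) x')" if "Q \<in> set Ps" for Q
        using ss that unfolding same_signs_def F_def by auto
      show ?thesis
      proof (cases "\<exists>Q\<in>set Ps. snd Q (fst Q) x = 0")
        case True
        then obtain Q where Q: "Q \<in> set Ps" "snd Q (fst Q) x = 0" by blast
        then have Q': "snd Q (fst Q) x' = 0" using lcs[OF Q(1)] by (metis sgn_eq_0_iff)
        have "same_signs (Ft Q) x x'" using ss Q(1) unfolding same_signs_def F_def by auto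
        then obtain \<theta> where \<theta>: "order_auto \<theta>"
          "\<And>P y. P \<in> set (tr Q) \<Longrightarrow> sgn (poly (spec P x) y) = sgn (poly (spec P x') (\<theta> y))"
          using Ft(3)[OF Q(1)] unfolding same_pattern_def by blast
        have "sgn (poly (spec P x) y) = sgn (poly (spec P x') (\<theta> y))" if "P \<in> set Ps" for P y
        proof (cases "P = Q")
          case False
          then have "P \<in> set (tr Q)" using that unfolding tr_def by auto
          then show ?thesis by (rule \<theta>(2))
        next
          case PQ: True
          show ?thesis
          proof (cases "fst Q = 0")
            case True
            then have "spec Q x = 0" "spec Q x' = 0" using Q(2) Q' unfolding spec_def by auto
            then show ?thesis using PQ by simp
          next
            case False
            have "spec Q z = spec (fst Q - 1, snd Q) z" if "snd Q (fst Q) z = 0" for z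
            proof (rule poly_eqI)
              fix i show "coeff (spec Q z) i = coeff (spec (fst Q - 1, snd Q) z) i"
                using that False by (cases "i = fst Q") (auto simp: coeff_spec)
            qed
            moreover have "(fst Q - 1, snd Q) \<in> set (tr Q)" using False unfolding tr_def by auto
            ultimately show ?thesis using \<theta>(2) Q(2) Q' PQ by metis
          qed
        qed
        then show ?thesis using \<theta>(1) unfolding same_pattern_def by blast
      next
        case False
        then have nz: "snd Q (fst Q) x \<noteq> 0" "snd Q (fst Q) x' \<noteq> 0" if "Q \<in> set Ps" for Q
          using that lcs[OF that] by (auto simp: sgn_eq_0_iff)
        show ?thesis
        proof (cases "fst P = 0")
          case True
          then have "fst Q = 0" if "Q \<in> set Ps" for Q using Pmax[OF that] by simp
          then have "sgn (poly (spec Q x) y) = sgn (poly (spec Q x') y)" if "Q \<in> set Ps" for Q y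
            using lcs[OF that] that by (simp add: poly_spec)
          then show ?thesis unfolding same_pattern_def using order_auto_id by blast
        next
          case P0: False
          have "same_signs Fr x x'" using ss unfolding same_signs_def F_def by auto
          then obtain \<theta> where \<theta>: "order_auto \<theta>"
            "\<And>P y. P \<in> set Rs \<Longrightarrow> sgn (poly (spec P x) y) = sgn (poly (spec P x') (\<theta> y))"
            using Fr(3)[OF P0] unfolding same_pattern_def by blast
          have nzQ: "snd Q (fst Q) x \<noteq> 0" "snd Q (fst Q) x' \<noteq> 0" if "Q \<in> set Qs" for Q
          proof -
            have "snd Q (fst Q) z \<noteq> 0" if "z = x \<or> z = x'" for z
            proof (cases "Q = P'")
              case True
              have "(of_nat (fst P) :: 'a) \<noteq> 0" using P0 by simp
              then show ?thesis using True that nz[OF P] P0 unfolding P'_def by (auto simp del: of_nat_Suc)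
            next
              case False
              then have "Q \<in> set Ps" using \<open>Q \<in> set Qs\<close> set_remove1_subset[of P Ps] unfolding Qs_def by auto
              then show ?thesis using nz that by blast
            qed
            then show "snd Q (fst Q) x \<noteq> 0" "snd Q (fst Q) x' \<noteq> 0" by auto
          qed
          have deriv: "pderiv (spec P z) = spec P' z" for z
            using P0 by (intro poly_eqI) (auto simp: coeff_spec coeff_pderiv P'_def)
          define K where "K = (\<lambda>Q. (spec Q x, spec Q x')) ` set Qs"
          have P'Q: "P' \<in> set Qs" unfolding Qs_def by simp
          have QR: "Q \<in> set Rs" if "Q \<in> set Qs" for Q using that unfolding Qs_def Rs_def by auto
          have "\<exists>\<theta>'. order_auto \<theta>' \<and> (\<forall>(g, h)\<in>insert (spec P x, spec P x') K. \<forall>y. sgn (poly g y) = sgn (poly h (\<theta>' y)))"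
          proof (rule extend_order_auto_to_antiderivative[OF \<theta>(1)])
            show "finite K" unfolding K_def by simp
            show "sgn (poly g y) = sgn (poly h (\<theta> y))" if "(g, h) \<in> K" for g h y
              using that \<theta>(2)[OF QR] unfolding K_def by auto
            show "g \<noteq> 0" if "(g, h) \<in> K" for g h
              proof -
              from that obtain Q where Q: "Q \<in> set Qs" "g = spec Q x" unfolding K_def by auto
              show ?thesis unfolding Q(2) by (rule spec_nonzero[OF nzQ(1)[OF Q(1)]])
            qed
            show "(pderiv (spec P x), pderiv (spec P x')) \<in> K"
              using P'Q unfolding deriv K_def by auto
            show "spec P x \<noteq> 0" "spec P x' \<noteq> 0"
              by (rule spec_nonzero[OF nz(1)[OF P]], rule spec_nonzero[OF nz(2)[OF P]])
            have deg: "degree (spec P x) = fst P" "degree (spec P x') = fst P"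
              by (rule degree_spec[OF nz(1)[OF P]], rule degree_spec[OF nz(2)[OF P]])
            then show "degree (spec P x) = degree (spec P x')" by simp
            show "sgn (lead_coeff (spec P x)) = sgn (lead_coeff (spec P x'))"
              using deg lcs[OF P] by (simp add: coeff_spec)
            show "sgn (poly (spec P x) y) = sgn (poly (spec P x') (\<theta> y))" if gh: "(g, h) \<in> K" "poly g y = 0" for g h y
            proof -
              obtain Q where Q: "Q \<in> set Qs" "g = spec Q x" "h = spec Q x'" using gh unfolding K_def by auto
              have "fst Q \<noteq> 0"
              proof
                assume "fst Q = 0"
                then have "poly g y = snd Q (fst Q) x" unfolding Q by (simp add: poly_spec)
                then show False using gh(2) nzQ[OF Q(1)] by simp
              qed
              then have Q1: "fst Q \<ge> 1" by simp
              have h0: "poly h (\<theta> y) = 0"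
                using \<theta>(2)[OF QR[OF Q(1)], of y] gh(2) Q by (metis sgn_eq_0_iff)
              have red: "sgn (poly (spec P z) w) = sgn (poly (spec (rem Q) z) w)"
                if "snd Q (fst Q) z \<noteq> 0" "poly (spec Q z) w = 0" for z w
              proof -
                obtain q where "smult (snd Q (fst Q) z ^ (2 * k Q)) (spec P z) = q * spec Q z + spec (rem Q) z"
                  using rem(3)[OF Q(1) Q1] by blast
                then have "poly (smult (snd Q (fst Q) z ^ (2 * k Q)) (spec P z)) w = poly (q * spec Q z + spec (rem Q) z) w"
                  by simp
                then have "snd Q (fst Q) z ^ (2 * k Q) * poly (spec P z) w = poly (spec (rem Q) z) w"
                  using that(2) by simp
                then show ?thesis using sgn_power_even_mult[OF that(1)] by metis
              qed
              have "rem Q \<in> set Rs" using Q(1) Q1 unfolding Rs_def by auto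
              then show ?thesis
                using red[of x y] red[of x' "\<theta> y"] nzQ[OF Q(1)] gh(2) h0 Q \<theta>(2) by metis
            qed
          qed
          then obtain \<theta>' where \<theta>': "order_auto \<theta>'"
            "\<And>g h y. (g, h) \<in> insert (spec P x, spec P x') K \<Longrightarrow> sgn (poly g y) = sgn (poly h (\<theta>' y))" by blast
          have "sgn (poly (spec Q x) y) = sgn (poly (spec Q x') (\<theta>' y))" if "Q \<in> set Ps" for Q y
          proof (cases "Q = P")
            case False
            then have "Q \<in> set Qs" using that unfolding Qs_def by auto
            then show ?thesis using \<theta>'(2) unfolding K_def by auto
          qed (use \<theta>'(2) in auto)
          then show ?thesis using \<theta>'(1) unfolding same_pattern_def by blast
        qed
      qed
    qed
    ultimately show ?thesis by blast
  qed
qed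

section \<open>Polynomial functions and semialgebraic predicates\<close>

text \<open>The polynomial functions in the variables with index in \<open>A\<close>. Points are total functions
  \<open>nat \<Rightarrow> R\<close>, so that the number of variables can change within a proof.\<close>

inductive_set polyfuns :: "nat set \<Rightarrow> ((nat \<Rightarrow> 'a::comm_ring_1) \<Rightarrow> 'a) set" for A where
  polyfuns_const: "(\<lambda>x. c) \<in> polyfuns A"
| polyfuns_var: "i \<in> A \<Longrightarrow> (\<lambda>x. x i) \<in> polyfuns A"
| polyfuns_add: "f \<in> polyfuns A \<Longrightarrow> g \<in> polyfuns A \<Longrightarrow> (\<lambda>x. f x + g x) \<in> polyfuns A"
| polyfuns_mult: "f \<in> polyfuns A \<Longrightarrow> g \<in> polyfuns A \<Longrightarrow> (\<lambda>x. f x * g x) \<in> polyfuns A"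

lemma polyfuns_uminus: "f \<in> polyfuns A \<Longrightarrow> (\<lambda>x. - f x) \<in> polyfuns A"
  using polyfuns_mult[OF polyfuns_const[of "-1"]] by fastforce

lemma polyfuns_diff: "f \<in> polyfuns A \<Longrightarrow> g \<in> polyfuns A \<Longrightarrow> (\<lambda>x. f x - g x) \<in> polyfuns A"
  using polyfuns_add[OF _ polyfuns_uminus] by fastforce

lemma polyfuns_subring: "is_subring (polyfuns A)"
  unfolding is_subring_def plus_fun_def times_fun_def zero_fun_def one_fun_def fun_diff_def
  by (auto intro: polyfuns.intros polyfuns_diff)

lemma polyfuns_sum: "(\<And>i. i \<in> I \<Longrightarrow> f i \<in> polyfuns A) \<Longrightarrow> (\<lambda>x. \<Sum>i\<in>I. f i x) \<in> polyfuns A"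
  by (induction I rule: infinite_finite_induct) (auto intro: polyfuns.intros)

lemma polyfuns_prod: "(\<And>i. i \<in> I \<Longrightarrow> f i \<in> polyfuns A) \<Longrightarrow> (\<lambda>x. \<Prod>i\<in>I. f i x) \<in> polyfuns A"
  by (induction I rule: infinite_finite_induct) (auto intro: polyfuns.intros)

lemma polyfuns_power: "f \<in> polyfuns A \<Longrightarrow> (\<lambda>x. f x ^ k) \<in> polyfuns A"
  by (induction k) (auto intro: polyfuns.intros)

lemma polyfuns_if: "(c \<Longrightarrow> f \<in> polyfuns A) \<Longrightarrow> (\<lambda>x. if c then f x else 0) \<in> polyfuns A"
  by (cases c) (auto intro: polyfuns_const)

lemma polyfuns_mono: "f \<in> polyfuns A \<Longrightarrow> A \<subseteq> B \<Longrightarrow> f \<in> polyfuns B"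
  by (induction rule: polyfuns.induct) (auto intro: polyfuns.intros)

lemma polyfuns_cong: "f \<in> polyfuns A \<Longrightarrow> (\<And>i. i \<in> A \<Longrightarrow> x i = y i) \<Longrightarrow> f x = f y"
  by (induction rule: polyfuns.induct) auto

lemma polyfuns_compose:
  "f \<in> polyfuns A \<Longrightarrow> (\<And>i. i \<in> A \<Longrightarrow> g i \<in> polyfuns B) \<Longrightarrow> (\<lambda>x. f (\<lambda>i. g i x)) \<in> polyfuns B"
  by (induction rule: polyfuns.induct) (auto intro: polyfuns.intros)

lemma polyfuns_univariate:
  assumes "f \<in> polyfuns A"
  shows "\<exists>P. ppoly_over (polyfuns (A - {k})) P \<and> (\<forall>x. f x = poly (spec P x) (x k))"
  using assms
proof (induction rule: polyfuns.induct)
  case (polyfuns_const c)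
  show ?case
    by (intro exI[of _ "(0, \<lambda>i x. c)"]) (auto simp: ppoly_over_def poly_spec intro: polyfuns.intros)
next
  case (polyfuns_var i)
  show ?case
  proof (cases "i = k")
    case True
    then show ?thesis
      by (intro exI[of _ "(1, \<lambda>i x. if i = 1 then 1 else 0)"])
        (auto simp: ppoly_over_def poly_spec intro: polyfuns.intros)
  next
    case False
    then show ?thesis using polyfuns_var
      by (intro exI[of _ "(0, \<lambda>_ x. x i)"]) (auto simp: ppoly_over_def poly_spec intro: polyfuns.intros)
  qed
next
  case (polyfuns_add f g)
  let ?S = "polyfuns (A - {k})"
  obtain P Q where P: "ppoly_over ?S P" "\<And>x. f x = poly (spec P x) (x k)"
    and Q: "ppoly_over ?S Q" "\<And>x. g x = poly (spec Q x) (x k)" using polyfuns_add.IH by blast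
  define R where "R = (max (fst P) (fst Q),
    \<lambda>i x. (if i \<le> fst P then snd P i x else 0) + (if i \<le> fst Q then snd Q i x else 0))"
  have "spec R x = spec P x + spec Q x" for x
    by (intro poly_eqI) (auto simp: coeff_spec R_def)
  then have "f x + g x = poly (spec R x) (x k)" for x using P(2) Q(2) by simp
  moreover have "snd R i \<in> ?S" for i
    using P(1) Q(1) unfolding R_def ppoly_over_def snd_conv
    by (intro polyfuns.polyfuns_add polyfuns_if) auto
  then have "ppoly_over ?S R" unfolding ppoly_over_def by blast
  ultimately show ?case by blast
next
  case (polyfuns_mult f g)
  let ?S = "polyfuns (A - {k})"
  obtain P Q where P: "ppoly_over ?S P" "\<And>x. f x = poly (spec P x) (x k)"
    and Q: "ppoly_over ?S Q" "\<And>x. g x = poly (spec Q x) (x k)" using polyfuns_mult.IH by blast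
  define R where "R = (fst P + fst Q,
    \<lambda>i x. \<Sum>j\<le>i. (if j \<le> fst P then snd P j x else 0) * (if i - j \<le> fst Q then snd Q (i - j) x else 0))"
  have "spec R x = spec P x * spec Q x" for x
  proof (rule poly_eqI)
    fix i
    show "coeff (spec R x) i = coeff (spec P x * spec Q x) i"
    proof (cases "i \<le> fst P + fst Q")
      case True
      then show ?thesis by (simp add: coeff_mult coeff_spec R_def)
    next
      case False
      then have "coeff (spec P x * spec Q x) i = 0"
        unfolding coeff_mult coeff_spec by (intro sum.neutral) auto
      then show ?thesis using False by (simp add: coeff_spec R_def)
    qed
  qed
  then have "f x * g x = poly (spec R x) (x k)" for x using P(2) Q(2) by simp
  moreover have "snd R i \<in> ?S" for i
    using P(1) Q(1) unfolding R_def ppoly_over_def snd_conv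
    by (intro polyfuns_sum polyfuns.polyfuns_mult polyfuns_if) auto
  then have "ppoly_over ?S R" unfolding ppoly_over_def by blast
  ultimately show ?case by blast
qed

text \<open>A predicate is semialgebraic if the signs of finitely many polynomial functions decide it.
  Put this way, closure under Boolean operations is trivial.\<close>

definition semialg :: "((nat \<Rightarrow> 'a::linordered_field) \<Rightarrow> bool) \<Rightarrow> bool" where
  "semialg P \<longleftrightarrow> (\<exists>F. finite F \<and> F \<subseteq> polyfuns UNIV \<and> (\<forall>x x'. same_signs F x x' \<longrightarrow> P x = P x'))"

lemma same_signs_mono: "same_signs F x x' \<Longrightarrow> G \<subseteq> F \<Longrightarrow> same_signs G x x'"
  unfolding same_signs_def by blast

lemma semialg_const: "semialg (\<lambda>x. c)"
  unfolding semialg_def by (intro exI[of _ "{}"]) auto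

lemma semialg_not: "semialg P \<Longrightarrow> semialg (\<lambda>x. \<not> P x)"
  unfolding semialg_def by meson

lemma semialg_conj:
  assumes "semialg P" "semialg Q" shows "semialg (\<lambda>x. P x \<and> Q x)"
proof -
  obtain F G where F: "finite F" "F \<subseteq> polyfuns UNIV" "\<And>x x'. same_signs F x x' \<Longrightarrow> P x = P x'"
    and G: "finite G" "G \<subseteq> polyfuns UNIV" "\<And>x x'. same_signs G x x' \<Longrightarrow> Q x = Q x'"
    using assms unfolding semialg_def by blast
  have "(P x \<and> Q x) = (P x' \<and> Q x')" if "same_signs (F \<union> G) x x'" for x x'
    using F(3)[OF same_signs_mono[OF that]] G(3)[OF same_signs_mono[OF that]] by simp
  then show ?thesis unfolding semialg_def using F(1,2) G(1,2) by (intro exI[of _ "F \<union> G"]) auto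
qed

lemma semialg_ball:
  "finite I \<Longrightarrow> (\<And>i. i \<in> I \<Longrightarrow> semialg (P i)) \<Longrightarrow> semialg (\<lambda>x. \<forall>i\<in>I. P i x)"
  by (induction I rule: finite_induct) (auto intro: semialg_conj semialg_const)

lemma semialg_pos:
  assumes "f \<in> polyfuns UNIV" shows "semialg (\<lambda>x. 0 < f x)"
proof -
  have "(0 < f x) = (0 < f x')" if "sgn (f x) = sgn (f x')" for x x'
    using that by (metis sgn_greater)
  then have "\<forall>x x'. same_signs {f} x x' \<longrightarrow> (0 < f x) = (0 < f x')"
    unfolding same_signs_def by blast
  then show ?thesis unfolding semialg_def using assms by blast
qed

lemma semialg_less:
  assumes "f \<in> polyfuns UNIV" "g \<in> polyfuns UNIV" shows "semialg (\<lambda>x. f x < g x)"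
  using semialg_pos[OF polyfuns_diff[OF assms(2,1)]] by simp

lemma semialg_le:
  assumes "f \<in> polyfuns UNIV" "g \<in> polyfuns UNIV" shows "semialg (\<lambda>x. f x \<le> g x)"
  using semialg_not[OF semialg_less[OF assms(2,1)]] by (simp add: not_less)

lemma ex_ppoly_list:
  assumes "finite F" "F \<subseteq> polyfuns UNIV"
  shows "\<exists>g. (\<forall>f\<in>F. ppoly_over (polyfuns (UNIV - {k})) (g f) \<and>
    (\<forall>x y. f (x(k := y)) = poly (spec (g f) x) y))"
proof -
  have "\<exists>P. ppoly_over (polyfuns (UNIV - {k})) P \<and> (\<forall>x y. f (x(k := y)) = poly (spec P x) y)"
    if "f \<in> F" for f
  proof -
    have "f \<in> polyfuns UNIV" using that assms by blast
    from polyfuns_univariate[OF this, of k] obtain P where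
      P: "ppoly_over (polyfuns (UNIV - {k})) P" "\<And>x. f x = poly (spec P x) (x k)" by blast
    have "snd P i (x(k := y)) = snd P i x" for i x y
      by (rule polyfuns_cong[of _ "UNIV - {k}"]) (use P(1) in \<open>auto simp: ppoly_over_def\<close>)
    then have "spec P (x(k := y)) = spec P x" for x y unfolding spec_def by simp
    then show ?thesis using P by (intro exI[of _ P]) auto
  qed
  then show ?thesis by (intro bchoice) blast
qed

text \<open>The order automorphism that matches the sign patterns over two parameters carries a witness
  for one to a witness for the other.\<close>

theorem semialg_ex:
  fixes P :: "(nat \<Rightarrow> 'a::real_closed_field) \<Rightarrow> bool"
  assumes "semialg P" shows "semialg (\<lambda>x. \<exists>y. P (x(k := y)))"
proof -
  obtain F where F: "finite F" "F \<subseteq> polyfuns UNIV" "\<And>x x'. same_signs F x x' \<Longrightarrow> P x = P x'"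
    using assms unfolding semialg_def by blast
  obtain g where g: "\<And>f. f \<in> F \<Longrightarrow> ppoly_over (polyfuns (UNIV - {k})) (g f)"
    "\<And>f x y. f \<in> F \<Longrightarrow> f (x(k := y)) = poly (spec (g f) x) y"
    using ex_ppoly_list[OF F(1,2)] by metis
  obtain Fs where Fs: "set Fs = F" using finite_list[OF F(1)] by blast
  obtain G where G: "finite G" "G \<subseteq> polyfuns (UNIV - {k})"
    "\<And>x x'. same_signs G x x' \<Longrightarrow> same_pattern (map g Fs) x x'"
  proof -
    have "ppoly_over (polyfuns (UNIV - {k})) Q" if "Q \<in> set (map g Fs)" for Q
      using that g(1) Fs by auto
    from same_pattern_if_same_signs[OF polyfuns_subring this] show ?thesis using that by blast
  qed
  have imp: "\<exists>y. P (x'(k := y))" if "same_signs G x x'" "P (x(k := y))" for x x' y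
  proof -
    have "same_pattern (map g Fs) x x'" using G(3) that(1) .
    then obtain \<theta> where \<theta>: "\<And>f y. f \<in> F \<Longrightarrow> sgn (poly (spec (g f) x) y) = sgn (poly (spec (g f) x') (\<theta> y))"
      using Fs unfolding same_pattern_def by auto
    have "same_signs F (x(k := y)) (x'(k := \<theta> y))"
      unfolding same_signs_def using \<theta> g(2) by simp
    then show ?thesis using F(3) that(2) by blast
  qed
  have "same_signs G x' x" if "same_signs G x x'" for x x' using that unfolding same_signs_def by simp
  then have "(\<exists>y. P (x(k := y))) = (\<exists>y. P (x'(k := y)))" if "same_signs G x x'" for x x'
    using imp that by blast
  moreover have "G \<subseteq> polyfuns UNIV" using G(2) polyfuns_mono by blast
  ultimately show ?thesis unfolding semialg_def using G(1) by blast
qed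

lemma semialg_ex_many:
  fixes P :: "(nat \<Rightarrow> 'a::real_closed_field) \<Rightarrow> bool"
  assumes "semialg P" shows "semialg (\<lambda>v. \<exists>x. P (\<lambda>i. if i < n then x i else v i))"
proof (induction n)
  case 0
  then show ?case using assms by simp
next
  case (Suc n)
  have eq: "(\<lambda>i. if i < Suc n then x i else v i) = (\<lambda>i. if i < n then x i else (v(n := x n)) i)" for x v :: "nat \<Rightarrow> 'a"
    by (auto simp: less_Suc_eq)
  have eq2: "(\<lambda>i. if i < n then x i else (v(n := y)) i) = (\<lambda>i. if i < Suc n then (x(n := y)) i else v i)"
    for x v :: "nat \<Rightarrow> 'a" and y
    by (auto simp: less_Suc_eq)
  have "(\<exists>x. P (\<lambda>i. if i < Suc n then x i else v i))
      = (\<exists>y x. P (\<lambda>i. if i < n then x i else (v(n := y)) i))" for v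
    using eq eq2 by metis
  then show ?case using semialg_ex[OF Suc, of n] by presburger
qed

theorem semialg_sup:
  fixes P :: "(nat \<Rightarrow> 'a::real_closed_field) \<Rightarrow> bool"
  assumes "semialg P" and ne: "P (x(k := s0))" and bd: "\<And>y. P (x(k := y)) \<Longrightarrow> y \<le> B"
  shows "\<exists>s. (\<forall>y. P (x(k := y)) \<longrightarrow> y \<le> s) \<and> (\<forall>b. (\<forall>y. P (x(k := y)) \<longrightarrow> y \<le> b) \<longrightarrow> s \<le> b)"
proof -
  obtain F where F: "finite F" "F \<subseteq> polyfuns UNIV" "\<And>x x'. same_signs F x x' \<Longrightarrow> P x = P x'"
    using assms unfolding semialg_def by blast
  obtain g where g: "\<And>f x y. f \<in> F \<Longrightarrow> f (x(k := y)) = poly (spec (g f) x) y"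
    using ex_ppoly_list[OF F(1,2)] by metis
  define Z where "Z = (\<Union>f\<in>{f \<in> F. spec (g f) x \<noteq> 0}. {y. poly (spec (g f) x) y = 0})"
  have Z: "finite Z" unfolding Z_def using F(1) poly_roots_finite by auto
  have const: "P (x(k := y)) = P (x(k := y'))" if "y \<le> y'" "\<And>z. z \<in> Z \<Longrightarrow> z < y \<or> y' < z" for y y'
  proof (rule F(3))
    have "sgn (poly (spec (g f) x) y) = sgn (poly (spec (g f) x) y')" if "f \<in> F" for f
    proof (cases "spec (g f) x = 0")
      case False
      show ?thesis
      proof (rule sgn_poly_eq_if_no_root[OF \<open>y \<le> y'\<close>])
        fix t assume "y \<le> t" "t \<le> y'"
        then have "t \<notin> Z" using \<open>\<And>z. z \<in> Z \<Longrightarrow> z < y \<or> y' < z\<close>[of t] by auto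
        then show "poly (spec (g f) x) t \<noteq> 0" using \<open>f \<in> F\<close> False unfolding Z_def by auto
      qed
    qed simp
    then show "same_signs F (x(k := y)) (x(k := y'))" unfolding same_signs_def using g by simp
  qed
  define U where "U = {z \<in> Z. \<forall>y. P (x(k := y)) \<longrightarrow> y \<le> z}"
  have below: "\<exists>s. P (x(k := s)) \<and> (\<forall>z\<in>Z. z \<notin> U \<longrightarrow> z < s)"
  proof -
    have "\<exists>s. P (x(k := s)) \<and> z < s" if "z \<in> Z - U" for z using that unfolding U_def by force
    then obtain w where w: "\<And>z. z \<in> Z - U \<Longrightarrow> P (x(k := w z)) \<and> z < w z" by metis
    define s where "s = Max (insert s0 (w ` (Z - U)))"
    have "s \<in> insert s0 (w ` (Z - U))" unfolding s_def using Z by (intro Max_in) auto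
    then have "P (x(k := s))" using ne w by auto
    moreover have "z < s" if "z \<in> Z" "z \<notin> U" for z
    proof -
      have "w z \<le> s" unfolding s_def using Z that by (intro Max_ge) auto
      then show ?thesis using w[of z] that by auto
    qed
    ultimately show ?thesis by blast
  qed
  then obtain s where s: "P (x(k := s))" "\<And>z. z \<in> Z \<Longrightarrow> z \<notin> U \<Longrightarrow> z < s" by blast
  have "U \<noteq> {}"
  proof
    assume "U = {}"
    have "s \<le> B" using bd[OF s(1)] .
    then have "P (x(k := s)) = P (x(k := B + 1))"
      using s(2) \<open>U = {}\<close> by (intro const) auto
    then have "B + 1 \<le> B" using bd s(1) by blast
    then show False by simp
  qed
  define u where "u = Min U"
  have fU: "finite U" using Z unfolding U_def by simp
  have u: "u \<in> U" unfolding u_def using fU \<open>U \<noteq> {}\<close> by (rule Min_in)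
  have "u \<le> b" if b: "\<forall>y. P (x(k := y)) \<longrightarrow> y \<le> b" for b
  proof (rule ccontr)
    assume "\<not> u \<le> b"
    then have bu: "b < u" by simp
    obtain m where m: "b < m" "m < u" using dense[OF bu] by blast
    have sb: "s \<le> b" using b s(1) by blast
    have "P (x(k := s)) = P (x(k := m))"
    proof (rule const)
      show "s \<le> m" using sb m by simp
      fix z assume z: "z \<in> Z"
      show "z < s \<or> m < z"
      proof (cases "z \<in> U")
        case True
        then have "u \<le> z" unfolding u_def using fU by simp
        then show ?thesis using m by simp
      qed (use s(2) z in auto)
    qed
    then have "m \<le> b" using b s(1) by blast
    then show False using m by simp
  qed
  then show ?thesis using u unfolding U_def by blast
qed


section \<open>Extreme values of polynomials on boxes\<close>

definition in_box :: "nat \<Rightarrow> 'a::linordered_field \<Rightarrow> (nat \<Rightarrow> 'a) \<Rightarrow> (nat \<Rightarrow> 'a) \<Rightarrow> bool" where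
  "in_box n r c x \<longleftrightarrow> (\<forall>i<n. \<bar>x i - c i\<bar> \<le> r)"

lemma in_box_mono: "in_box n r c x \<Longrightarrow> r \<le> s \<Longrightarrow> in_box n s c x"
  unfolding in_box_def by (meson order_trans)

lemma polyfuns_bounded:
  fixes f :: "(nat \<Rightarrow> 'a::linordered_field) \<Rightarrow> 'a"
  assumes "f \<in> polyfuns {..<n}"
  shows "\<exists>C>0. \<forall>x. in_box n r c x \<longrightarrow> \<bar>f x\<bar> \<le> C"
  using assms
proof (induction rule: polyfuns.induct)
  case (polyfuns_const d)
  show ?case by (intro exI[of _ "\<bar>d\<bar> + 1"]) auto
next
  case (polyfuns_var i)
  have "\<bar>x i\<bar> \<le> \<bar>c i\<bar> + \<bar>r\<bar> + 1" if "in_box n r c x" for x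
  proof -
    have "\<bar>x i - c i\<bar> \<le> r" using that polyfuns_var unfolding in_box_def by simp
    then show ?thesis by (simp add: abs_if split: if_splits)
  qed
  moreover have "\<bar>c i\<bar> + \<bar>r\<bar> + 1 > 0" by (simp add: add_nonneg_pos)
  ultimately show ?case by blast
next
  case (polyfuns_add f g)
  then obtain C D where "C > 0" "D > 0" and C: "\<And>x. in_box n r c x \<Longrightarrow> \<bar>f x\<bar> \<le> C"
    and D: "\<And>x. in_box n r c x \<Longrightarrow> \<bar>g x\<bar> \<le> D" by blast
  have "\<bar>f x + g x\<bar> \<le> C + D" if "in_box n r c x" for x
    using C[OF that] D[OF that] abs_triangle_ineq[of "f x" "g x"] by linarith
  then show ?case using \<open>C > 0\<close> \<open>D > 0\<close> by (intro exI[of _ "C + D"]) auto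
next
  case (polyfuns_mult f g)
  then obtain C D where "C > 0" "D > 0" and C: "\<And>x. in_box n r c x \<Longrightarrow> \<bar>f x\<bar> \<le> C"
    and D: "\<And>x. in_box n r c x \<Longrightarrow> \<bar>g x\<bar> \<le> D" by blast
  have "\<bar>f x * g x\<bar> \<le> C * D" if "in_box n r c x" for x
    using C[OF that] D[OF that] \<open>C > 0\<close> by (auto simp: abs_mult intro!: mult_mono)
  then show ?case using \<open>C > 0\<close> \<open>D > 0\<close> by (intro exI[of _ "C * D"]) auto
qed

lemma polyfuns_continuous:
  fixes f :: "(nat \<Rightarrow> 'a::linordered_field) \<Rightarrow> 'a"
  assumes "f \<in> polyfuns {..<n}" "0 < e"
  shows "\<exists>d>0. \<forall>x. in_box n d c x \<longrightarrow> \<bar>f x - f c\<bar> \<le> e"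
  using assms
proof (induction arbitrary: e rule: polyfuns.induct)
  case (polyfuns_const d)
  then show ?case by (intro exI[of _ 1]) auto
next
  case (polyfuns_var i)
  then show ?case by (intro exI[of _ e]) (auto simp: in_box_def)
next
  case (polyfuns_add f g)
  have e: "e / 2 > 0" using polyfuns_add.prems by simp
  obtain d1 d2 where d: "d1 > 0" "d2 > 0" "\<And>x. in_box n d1 c x \<Longrightarrow> \<bar>f x - f c\<bar> \<le> e / 2"
    "\<And>x. in_box n d2 c x \<Longrightarrow> \<bar>g x - g c\<bar> \<le> e / 2"
    using polyfuns_add.IH(1)[OF e] polyfuns_add.IH(2)[OF e] by blast
  have "\<bar>(f x + g x) - (f c + g c)\<bar> \<le> e" if "in_box n (min d1 d2) c x" for x
  proof -
    have "\<bar>f x - f c\<bar> \<le> e / 2" "\<bar>g x - g c\<bar> \<le> e / 2"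
      using d(3)[OF in_box_mono[OF that]] d(4)[OF in_box_mono[OF that]] by auto
    then have "\<bar>(f x - f c) + (g x - g c)\<bar> \<le> e / 2 + e / 2" by (intro order_trans[OF abs_triangle_ineq add_mono])
    then show ?thesis by (simp add: algebra_simps)
  qed
  then show ?case using d by (intro exI[of _ "min d1 d2"]) auto
next
  case (polyfuns_mult f g)
  obtain C where C: "C > 0" "\<And>x. in_box n 1 c x \<Longrightarrow> \<bar>f x\<bar> \<le> C"
    using polyfuns_bounded[OF polyfuns_mult.hyps(1), of 1 c] by blast
  define D where "D = \<bar>g c\<bar> + 1"
  have D: "D > 0" unfolding D_def by (simp add: add_nonneg_pos)
  have e: "e / (2 * D) > 0" "e / (2 * C) > 0" using polyfuns_mult.prems C D by simp_all
  obtain d1 d2 where d: "d1 > 0" "d2 > 0" "\<And>x. in_box n d1 c x \<Longrightarrow> \<bar>f x - f c\<bar> \<le> e / (2 * D)"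
    "\<And>x. in_box n d2 c x \<Longrightarrow> \<bar>g x - g c\<bar> \<le> e / (2 * C)"
    using polyfuns_mult.IH(1)[OF e(1)] polyfuns_mult.IH(2)[OF e(2)] by blast
  have "\<bar>f x * g x - f c * g c\<bar> \<le> e" if x: "in_box n (min 1 (min d1 d2)) c x" for x
  proof -
    have b: "\<bar>f x\<bar> \<le> C" "\<bar>f x - f c\<bar> \<le> e / (2 * D)" "\<bar>g x - g c\<bar> \<le> e / (2 * C)"
      using C(2)[OF in_box_mono[OF x]] d(3)[OF in_box_mono[OF x]] d(4)[OF in_box_mono[OF x]] by auto
    have b1: "\<bar>f x * (g x - g c)\<bar> \<le> C * (e / (2 * C))"
      unfolding abs_mult using b C by (intro mult_mono) auto
    have b2: "\<bar>(f x - f c) * g c\<bar> \<le> e / (2 * D) * D"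
      unfolding abs_mult using b D e by (intro mult_mono) (auto simp: D_def)
    have eq: "f x * g x - f c * g c = f x * (g x - g c) + (f x - f c) * g c" by (simp add: algebra_simps)
    have "\<bar>f x * g x - f c * g c\<bar> \<le> C * (e / (2 * C)) + e / (2 * D) * D"
      unfolding eq by (rule order_trans[OF abs_triangle_ineq add_mono[OF b1 b2]])
    also have "\<dots> = e" using C D by (simp add: field_simps)
    finally show ?thesis .
  qed
  then show ?case using d by (intro exI[of _ "min 1 (min d1 d2)"]) auto
qed

text \<open>A replacement for compactness: the coordinates of a limit point are found one at a time as
  suprema of semialgebraic sets.\<close>

lemma polyfun_attains_zero:
  fixes H :: "(nat \<Rightarrow> 'a::real_closed_field) \<Rightarrow> 'a"
  assumes H: "H \<in> polyfuns {..<n}"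
    and small: "\<And>d. d > 0 \<Longrightarrow> \<exists>x. in_box n r a x \<and> H x < d"
  shows "\<exists>x. in_box n r a x \<and> H x \<le> 0"
proof -
  have step: "j \<le> n \<Longrightarrow> \<exists>c. \<forall>d>0. \<exists>x. in_box n r a x \<and> H x < d \<and> (\<forall>i<j. \<bar>x i - c i\<bar> < d)" for j
  proof (induction j)
    case 0
    then show ?case using small by simp
  next
    case (Suc j)
    then obtain c where c: "\<And>d. d > 0 \<Longrightarrow> \<exists>x. in_box n r a x \<and> H x < d \<and> (\<forall>i<j. \<bar>x i - c i\<bar> < d)" by auto
    have jn: "j < n" using Suc.prems by simp
    define near where "near = (\<lambda>d x. in_box n r a x \<and> H x < d \<and> (\<forall>i<j. \<bar>x i - c i\<bar> < d))"
    define low where "low = (\<lambda>t. \<exists>d>0. \<forall>x. near d x \<longrightarrow> t \<le> x j)"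
    define bad where "bad = (\<lambda>w. near (w (Suc n)) w \<and> \<not> w n \<le> w j)"
    have abs_le: "\<bar>u\<bar> \<le> v \<longleftrightarrow> u \<le> v \<and> - u \<le> v" for u v :: 'a by (auto simp: abs_if)
    have abs_lt: "\<bar>u\<bar> < v \<longleftrightarrow> u < v \<and> - u < v" for u v :: 'a by (auto simp: abs_if)
    have HU: "H \<in> polyfuns UNIV" by (rule polyfuns_mono[OF H]) simp
    have "semialg (\<lambda>w. (\<forall>i\<in>{..<n}. w i - a i \<le> r \<and> - (w i - a i) \<le> r) \<and> H w < w (Suc n) \<and>
        (\<forall>i\<in>{..<j}. w i - c i < w (Suc n) \<and> - (w i - c i) < w (Suc n)) \<and> \<not> w n \<le> w j)"
      by (intro semialg_conj semialg_ball semialg_le semialg_less semialg_not HU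
          polyfuns_diff polyfuns_uminus polyfuns.intros) auto
    then have sbad: "semialg bad"
      unfolding bad_def near_def in_box_def abs_le abs_lt by (simp add: Ball_def conj_assoc)
    define E where "E = (\<lambda>w. 0 < w (Suc n) \<and> \<not> (\<exists>x. bad (\<lambda>i. if i < n then x i else w i)))"
    have "semialg E" unfolding E_def
      by (intro semialg_conj semialg_not semialg_ex_many sbad semialg_less polyfuns.intros) auto
    then have sD: "semialg (\<lambda>v. \<exists>d. E (v(Suc n := d)))" by (rule semialg_ex)
    have near_cong: "near d x = near d y" if "\<And>i. i < n \<Longrightarrow> x i = y i" for d x y
      using that jn polyfuns_cong[OF H, of x y] unfolding near_def in_box_def by auto
    have low_eq: "low t \<longleftrightarrow> (\<exists>d. E ((v(n := t))(Suc n := d)))" for t v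
    proof -
      have "E ((v(n := t))(Suc n := d)) \<longleftrightarrow> d > 0 \<and> (\<forall>x. near d x \<longrightarrow> t \<le> x j)" for d
      proof -
        have "bad (\<lambda>i. if i < n then x i else ((v(n := t))(Suc n := d)) i) \<longleftrightarrow> near d x \<and> \<not> t \<le> x j" for x
          using jn near_cong[of "\<lambda>i. if i < n then x i else ((v(n := t))(Suc n := d)) i" x d]
          unfolding bad_def by simp
        then show ?thesis unfolding E_def by auto
      qed
      then show ?thesis unfolding low_def by blast
    qed
    have "low (a j - r)"
      unfolding low_def near_def in_box_def using jn by (intro exI[of _ 1]) (auto simp: abs_le)
    moreover have "t \<le> a j + r" if "low t" for t
    proof -
      from that obtain d where d: "d > 0" "\<And>x. near d x \<Longrightarrow> t \<le> x j" unfolding low_def by blast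
      obtain x where "near d x" using c[OF d(1)] unfolding near_def by blast
      then have "t \<le> x j" "x j - a j \<le> r" using d(2) jn unfolding near_def in_box_def by (auto simp: abs_le)
      then show ?thesis by simp
    qed
    ultimately obtain s where s: "\<And>t. low t \<Longrightarrow> t \<le> s" "\<And>b. (\<And>t. low t \<Longrightarrow> t \<le> b) \<Longrightarrow> s \<le> b"
      using semialg_sup[OF sD, of undefined n "a j - r" "a j + r"] low_eq by metis
    have "\<exists>x. near d x \<and> \<bar>x j - s\<bar> < d" if "d > 0" for d
    proof -
      have "\<not> (\<forall>t. low t \<longrightarrow> t \<le> s - d / 2)" using s(2)[of "s - d / 2"] that by auto
      then obtain t where t: "low t" "s - d / 2 < t" by force
      then obtain e where e: "e > 0" "\<And>x. near e x \<Longrightarrow> t \<le> x j" unfolding low_def by blast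
      have "\<not> low (s + d / 2)" using s(1)[of "s + d / 2"] that by auto
      moreover have "min d e > 0" using that e(1) by simp
      ultimately have "\<not> (\<forall>x. near (min d e) x \<longrightarrow> s + d / 2 \<le> x j)" unfolding low_def by blast
      then obtain x where x: "near (min d e) x" "x j < s + d / 2" using not_le by blast
      have "near d x" "near e x" using x(1) unfolding near_def by auto
      moreover have "d / 2 < d" using that by simp
      ultimately have "x j - s < d" "- (x j - s) < d" using x(2) t(2) e(2)[of x] by linarith+
      then show ?thesis using \<open>near d x\<close> by (auto simp: abs_lt)
    qed
    then have ex: "\<exists>x. in_box n r a x \<and> H x < d \<and> (\<forall>i<j. \<bar>x i - c i\<bar> < d) \<and> \<bar>x j - s\<bar> < d" if "d > 0" for d
      using that unfolding near_def by (simp only: conj_assoc)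
    have eq: "(\<forall>i<Suc j. \<bar>x i - (c(j := s)) i\<bar> < d) \<longleftrightarrow> (\<forall>i<j. \<bar>x i - c i\<bar> < d) \<and> \<bar>x j - s\<bar> < d" for x d
      by (auto simp: less_Suc_eq)
    have "\<forall>d>0. \<exists>x. in_box n r a x \<and> H x < d \<and> (\<forall>i<Suc j. \<bar>x i - (c(j := s)) i\<bar> < d)"
      unfolding eq using ex by blast
    then show ?case by blast
  qed
  obtain c where c: "\<And>d. d > 0 \<Longrightarrow> \<exists>x. in_box n r a x \<and> H x < d \<and> (\<forall>i<n. \<bar>x i - c i\<bar> < d)"
    using step[of n] by auto
  have "in_box n r a c"
    unfolding in_box_def
  proof (intro allI impI)
    fix i assume i: "i < n"
    show "\<bar>c i - a i\<bar> \<le> r"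
    proof (rule ccontr)
      assume "\<not> \<bar>c i - a i\<bar> \<le> r"
      then have "\<bar>c i - a i\<bar> - r > 0" by simp
      then obtain x where "in_box n r a x" "\<bar>x i - c i\<bar> < \<bar>c i - a i\<bar> - r" using c i by blast
      moreover have "\<bar>x i - a i\<bar> \<le> r" using calculation(1) i unfolding in_box_def by blast
      ultimately show False by (auto simp: abs_if split: if_splits)
    qed
  qed
  moreover have "H c \<le> 0"
  proof (rule ccontr)
    assume "\<not> H c \<le> 0"
    then have Hc: "H c / 2 > 0" by simp
    obtain d where d: "d > 0" "\<And>x. in_box n d c x \<Longrightarrow> \<bar>H x - H c\<bar> \<le> H c / 2"
      using polyfuns_continuous[OF H Hc] by blast
    obtain x where x: "H x < min d (H c / 2)" "\<forall>i<n. \<bar>x i - c i\<bar> < min d (H c / 2)"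
      using c[of "min d (H c / 2)"] d Hc by auto
    have "in_box n d c x" using x(2) unfolding in_box_def by (auto intro: less_imp_le)
    then have "\<bar>H x - H c\<bar> \<le> H c / 2" by (rule d(2))
    then have "H c - H x \<le> H c / 2" using abs_le_D2 by fastforce
    moreover have "H x < H c / 2" using x(1) by simp
    moreover have "H c / 2 + H c / 2 = H c" by simp
    ultimately show False by linarith
  qed
  ultimately show ?thesis by blast
qed

text \<open>A positive polynomial with arbitrarily small values on the box would have a zero there.\<close>

theorem polyfun_bounded_below:
  fixes H :: "(nat \<Rightarrow> 'a::real_closed_field) \<Rightarrow> 'a"
  assumes "H \<in> polyfuns {..<n}" "\<And>x. in_box n r a x \<Longrightarrow> H x > 0"
  shows "\<exists>e>0. \<forall>x. in_box n r a x \<longrightarrow> e \<le> H x"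
proof (rule ccontr)
  assume "\<not> ?thesis"
  then have "\<exists>x. in_box n r a x \<and> H x < d" if "d > 0" for d using that by force
  then obtain x where "in_box n r a x" "H x \<le> 0" using polyfun_attains_zero[OF assms(1)] by blast
  then show False using assms(2)[of x] by simp
qed

theorem polyfun_attains_min:
  fixes H :: "(nat \<Rightarrow> 'a::real_closed_field) \<Rightarrow> 'a"
  assumes H: "H \<in> polyfuns {..<n}" and "r \<ge> 0"
  shows "\<exists>x. in_box n r a x \<and> (\<forall>y. in_box n r a y \<longrightarrow> H x \<le> H y)"
proof -
  obtain C where C: "\<And>x. in_box n r a x \<Longrightarrow> \<bar>H x\<bar> \<le> C" using polyfuns_bounded[OF H] by blast
  define low where "low = (\<lambda>t. \<forall>x. in_box n r a x \<longrightarrow> t \<le> H x)"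
  have abs_le: "\<bar>u\<bar> \<le> v \<longleftrightarrow> u \<le> v \<and> - u \<le> v" for u v :: 'a by (auto simp: abs_if)
  have HU: "H \<in> polyfuns UNIV" by (rule polyfuns_mono[OF H]) simp
  define bad where "bad = (\<lambda>w. in_box n r a w \<and> \<not> w n \<le> H w)"
  have "semialg (\<lambda>w. (\<forall>i\<in>{..<n}. w i - a i \<le> r \<and> - (w i - a i) \<le> r) \<and> \<not> w n \<le> H w)"
    by (intro semialg_conj semialg_ball semialg_le semialg_less semialg_not HU
        polyfuns_diff polyfuns_uminus polyfuns.intros) auto
  then have "semialg bad" unfolding bad_def in_box_def abs_le by (simp add: Ball_def conj_assoc)
  then have sD: "semialg (\<lambda>v. \<not> (\<exists>x. bad (\<lambda>i. if i < n then x i else v i)))"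
    by (intro semialg_not semialg_ex_many)
  have low_eq: "low t \<longleftrightarrow> \<not> (\<exists>x. bad (\<lambda>i. if i < n then x i else (v(n := t)) i))" for t v
  proof -
    have "bad (\<lambda>i. if i < n then x i else (v(n := t)) i) \<longleftrightarrow> in_box n r a x \<and> \<not> t \<le> H x" for x
      using polyfuns_cong[OF H, of "\<lambda>i. if i < n then x i else (v(n := t)) i" x]
      unfolding bad_def in_box_def by simp
    then show ?thesis unfolding low_def by blast
  qed
  have aa: "in_box n r a a" using \<open>r \<ge> 0\<close> unfolding in_box_def by simp
  have lC: "low (- C)"
    unfolding low_def
  proof (intro allI impI)
    fix x assume "in_box n r a x"
    then have "- H x \<le> C" using C abs_le by blast
    then show "- C \<le> H x" by simp
  qed
  have lH: "t \<le> H a" if "low t" for t using that aa unfolding low_def by blast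
  obtain s where s: "\<And>t. low t \<Longrightarrow> t \<le> s" "\<And>b. (\<And>t. low t \<Longrightarrow> t \<le> b) \<Longrightarrow> s \<le> b"
    using semialg_sup[OF sD, of undefined n "- C" "H a", folded low_eq[of _ undefined], OF lC lH] by blast
  have "\<exists>x. in_box n r a x \<and> H x - s < d" if "d > 0" for d
  proof -
    have "\<not> low (s + d)" using s(1)[of "s + d"] that by auto
    then show ?thesis unfolding low_def by (auto simp: algebra_simps not_le)
  qed
  then obtain x where x: "in_box n r a x" "H x - s \<le> 0"
    using polyfun_attains_zero[OF polyfuns_diff[OF H polyfuns_const[of s]]] by blast
  have "s \<le> H y" if "in_box n r a y" for y using s(2)[of "H y"] that unfolding low_def by blast
  then show ?thesis using x by (intro exI[of _ x]) force
qed

section \<open>Ideals and the Hilbert basis theorem\<close>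

definition is_ideal :: "'r::comm_ring_1 set \<Rightarrow> 'r set \<Rightarrow> bool" where
  "is_ideal S I \<longleftrightarrow> I \<subseteq> S \<and> 0 \<in> I \<and> (\<forall>a\<in>I. \<forall>b\<in>I. a + b \<in> I) \<and> (\<forall>s\<in>S. \<forall>a\<in>I. s * a \<in> I)"

lemma is_idealD:
  assumes "is_ideal S I"
  shows "I \<subseteq> S" "0 \<in> I" "a \<in> I \<Longrightarrow> b \<in> I \<Longrightarrow> a + b \<in> I" "s \<in> S \<Longrightarrow> a \<in> I \<Longrightarrow> s * a \<in> I"
  using assms unfolding is_ideal_def by auto

lemma is_ideal_diff:
  assumes "is_subring S" "is_ideal S I" "a \<in> I" "b \<in> I" shows "a - b \<in> I"
proof -
  have "-1 \<in> S" using is_subringD(2,6)[OF assms(1)] by blast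
  then have "-1 * b \<in> I" using is_idealD(4)[OF assms(2)] assms(4) by blast
  then show ?thesis using is_idealD(3)[OF assms(2,3)] by fastforce
qed

lemma is_ideal_sum:
  assumes "is_ideal S I" "\<And>i. i \<in> A \<Longrightarrow> f i \<in> I" shows "sum f A \<in> I"
  using assms(2) by (induction A rule: infinite_finite_induct) (auto intro: is_idealD(2,3)[OF assms(1)])

inductive_set ideal_gen :: "'r::comm_ring_1 set \<Rightarrow> 'r set \<Rightarrow> 'r set" for S F where
  ideal_gen_0: "0 \<in> ideal_gen S F"
| ideal_gen_add: "s \<in> S \<Longrightarrow> f \<in> F \<Longrightarrow> g \<in> ideal_gen S F \<Longrightarrow> s * f + g \<in> ideal_gen S F"

lemma ideal_gen_plus: "a \<in> ideal_gen S F \<Longrightarrow> b \<in> ideal_gen S F \<Longrightarrow> a + b \<in> ideal_gen S F"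
  by (induction rule: ideal_gen.induct) (auto simp: add.assoc intro: ideal_gen.intros)

lemma ideal_gen_mult:
  assumes "is_subring S" "t \<in> S" "a \<in> ideal_gen S F" shows "t * a \<in> ideal_gen S F"
  using assms(3)
proof (induction rule: ideal_gen.induct)
  case (ideal_gen_add s f g)
  have "(t * s) * f + t * g \<in> ideal_gen S F"
    using ideal_gen_add is_subringD(5)[OF assms(1,2)] by (intro ideal_gen.ideal_gen_add) auto
  then show ?case by (simp add: algebra_simps)
qed (simp add: ideal_gen.intros)

lemma ideal_gen_superset: "is_subring S \<Longrightarrow> f \<in> F \<Longrightarrow> f \<in> ideal_gen S F"
  using ideal_gen_add[OF is_subringD(2) _ ideal_gen_0, of S f F] by simp

lemma ideal_gen_least: "is_ideal S I \<Longrightarrow> F \<subseteq> I \<Longrightarrow> ideal_gen S F \<subseteq> I"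
proof
  fix a assume I: "is_ideal S I" "F \<subseteq> I" and "a \<in> ideal_gen S F"
  from this(3) show "a \<in> I"
    by (induction rule: ideal_gen.induct) (use I in \<open>auto intro!: is_idealD(2-4)[OF I(1)]\<close>)
qed

lemma is_ideal_ideal_gen: "is_subring S \<Longrightarrow> F \<subseteq> S \<Longrightarrow> is_ideal S (ideal_gen S F)"
proof -
  assume S: "is_subring S" and F: "F \<subseteq> S"
  have "is_ideal S S" using S unfolding is_ideal_def by (auto intro: is_subringD[OF S])
  from ideal_gen_least[OF this F] show ?thesis
    unfolding is_ideal_def using ideal_gen_plus ideal_gen_mult[OF S] ideal_gen_0 by blast
qed

lemma ideal_gen_mono: "is_subring S \<Longrightarrow> G \<subseteq> S \<Longrightarrow> F \<subseteq> G \<Longrightarrow> ideal_gen S F \<subseteq> ideal_gen S G"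
  by (intro ideal_gen_least is_ideal_ideal_gen) (auto intro: ideal_gen_superset)

lemma ideal_gen_mono_ring: "S \<subseteq> T \<Longrightarrow> F \<subseteq> G \<Longrightarrow> ideal_gen S F \<subseteq> ideal_gen T G"
proof
  fix a assume ST: "S \<subseteq> T" "F \<subseteq> G" and "a \<in> ideal_gen S F"
  from this(3) show "a \<in> ideal_gen T G"
    by (induction rule: ideal_gen.induct) (use ST in \<open>auto intro: ideal_gen.intros\<close>)
qed

lemma ideal_gen_sequence:
  assumes "is_subring S" "g \<in> ideal_gen S (h ` {..<N::nat})"
  shows "\<exists>c. (\<forall>i. c i \<in> S) \<and> g = (\<Sum>i<N. c i * h i)"
  using assms(2)
proof (induction rule: ideal_gen.induct)
  case ideal_gen_0
  then show ?case using is_subringD(1)[OF assms(1)] by (intro exI[of _ "\<lambda>_. 0"]) auto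
next
  case (ideal_gen_add s f g)
  then obtain c i where c: "\<And>i. c i \<in> S" "g = (\<Sum>i<N. c i * h i)" and i: "i < N" "f = h i" by auto
  have "s * f + g = (\<Sum>k<N. (c k + (if k = i then s else 0)) * h k)"
    using i by (simp add: c(2) distrib_right sum.distrib if_distrib[of "\<lambda>t. t * _"] cong: if_cong)
  moreover have "c k + (if k = i then s else 0) \<in> S" for k
    using c(1) ideal_gen_add(1) is_subringD[OF assms(1)] by auto
  ultimately show ?case by (intro exI[of _ "\<lambda>k. c k + (if k = i then s else 0)"]) simp
qed

definition noetherian :: "'r::comm_ring_1 set \<Rightarrow> bool" where
  "noetherian S \<longleftrightarrow> (\<forall>h. (\<forall>i. h i \<in> S) \<longrightarrow> (\<exists>N::nat. h N \<in> ideal_gen S (h ` {..<N})))"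

lemma greedy_sequence:
  assumes "\<And>F. finite F \<Longrightarrow> F \<subseteq> I \<Longrightarrow> ch F \<in> I"
  shows "\<exists>h :: nat \<Rightarrow> 'r. \<forall>n. h n = ch (h ` {..<n}) \<and> h n \<in> I"
proof -
  define A where "A = rec_nat {} (\<lambda>_ A. insert (ch A) A)"
  have A: "A 0 = {}" "A (Suc n) = insert (ch (A n)) (A n)" for n unfolding A_def by auto
  define h where "h = (\<lambda>n. ch (A n))"
  have im: "A n = h ` {..<n}" for n
    by (induction n) (auto simp: A h_def lessThan_Suc)
  have "finite (A n) \<and> A n \<subseteq> I" for n
    by (induction n) (auto simp: A intro: assms)
  then have "h n \<in> I" for n unfolding h_def using assms by blast
  moreover have "h n = ch (h ` {..<n})" for n by (simp only: im[symmetric]) (simp add: h_def)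
  ultimately show ?thesis by (intro exI[of _ h] allI conjI)
qed

lemma noetherian_fg:
  fixes S :: "'r::comm_ring_1 set"
  assumes S: "is_subring S" and "noetherian S" and I: "is_ideal S I"
  shows "\<exists>F. finite F \<and> F \<subseteq> I \<and> I \<subseteq> ideal_gen S F"
proof (rule ccontr)
  assume "\<not> ?thesis"
  then have "\<exists>a. a \<in> I \<and> a \<notin> ideal_gen S F" if "finite F" "F \<subseteq> I" for F using that by blast
  then obtain ch where ch: "\<And>F. finite F \<Longrightarrow> F \<subseteq> I \<Longrightarrow> ch F \<in> I \<and> ch F \<notin> ideal_gen S F" by metis
  have "ch F \<in> I" if "finite F" "F \<subseteq> I" for F using ch[OF that] by blast
  from greedy_sequence[of I ch, OF this] obtain h :: "nat \<Rightarrow> 'r"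
    where hh: "\<forall>n. h n = ch (h ` {..<n}) \<and> h n \<in> I" ..
  note h = hh[rule_format, THEN conjunct1] hh[rule_format, THEN conjunct2]
  obtain N where N: "h N \<in> ideal_gen S (h ` {..<N})"
    using assms(2) h(2) is_idealD(1)[OF I] unfolding noetherian_def by blast
  have "ch (h ` {..<N}) \<notin> ideal_gen S (h ` {..<N})" using ch[of "h ` {..<N}"] h(2) by blast
  then show False using N h(1)[of N] by metis
qed

definition adjoin_lt :: "'r::comm_ring_1 set \<Rightarrow> 'r \<Rightarrow> nat \<Rightarrow> 'r set" where
  "adjoin_lt S y d = {\<Sum>i<d. c i * y ^ i | c. \<forall>i. c i \<in> S}"

definition adjoin :: "'r::comm_ring_1 set \<Rightarrow> 'r \<Rightarrow> 'r set" where
  "adjoin S y = (\<Union>d. adjoin_lt S y d)"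

lemma adjoin_ltI: "(\<And>i. c i \<in> S) \<Longrightarrow> (\<Sum>i<d. c i * y ^ i) \<in> adjoin_lt S y d"
  unfolding adjoin_lt_def by blast

text \<open>Among the elements of an ideal outside the ideal generated so far one takes one of least
  degree; the leading coefficients then generate an ideal of the coefficient ring.\<close>

theorem hilbert_basis:
  assumes S: "is_subring S" and noeth: "noetherian S" and T: "is_subring (adjoin S y)"
    and sub: "S \<subseteq> adjoin S y" and y: "y \<in> adjoin S y"
  shows "noetherian (adjoin S y)"
  unfolding noetherian_def
proof (intro allI impI, rule ccontr)
  let ?T = "adjoin S y"
  fix h :: "nat \<Rightarrow> 'a" assume hT: "\<forall>i. h i \<in> ?T" and "\<not> (\<exists>N. h N \<in> ideal_gen ?T (h ` {..<N}))"
  then have bad: "h N \<notin> ideal_gen ?T (h ` {..<N})" for N by blast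
  define I where "I = (\<Union>N. ideal_gen ?T (h ` {..<N}))"
  have hs: "h ` {..<N} \<subseteq> ?T" for N using hT by auto
  have mono: "ideal_gen ?T (h ` {..<N}) \<subseteq> ideal_gen ?T (h ` {..<M})" if "N \<le> M" for N M
    by (rule ideal_gen_mono[OF T hs]) (use that in auto)
  note idN = is_ideal_ideal_gen[OF T hs]
  have I: "is_ideal ?T I"
    unfolding is_ideal_def
  proof (intro conjI ballI)
    show "I \<subseteq> ?T" unfolding I_def using is_idealD(1)[OF idN] by blast
    show "0 \<in> I" unfolding I_def using ideal_gen_0 by blast
    fix a assume a: "a \<in> I"
    then obtain N where N: "a \<in> ideal_gen ?T (h ` {..<N})" unfolding I_def by blast
    show "s * a \<in> I" if "s \<in> ?T" for s using ideal_gen_mult[OF T that N] unfolding I_def by blast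
    fix b assume "b \<in> I"
    then obtain M where M: "b \<in> ideal_gen ?T (h ` {..<M})" unfolding I_def by blast
    have "a \<in> ideal_gen ?T (h ` {..<max N M})" "b \<in> ideal_gen ?T (h ` {..<max N M})"
      using mono N M by (meson max.cobounded1 max.cobounded2 subsetD)+
    then show "a + b \<in> I" using ideal_gen_plus unfolding I_def by blast
  qed
  have outside: "\<exists>a. a \<in> I \<and> a \<notin> ideal_gen ?T F" if F: "finite F" "F \<subseteq> I" for F
  proof -
    have "\<exists>N. F \<subseteq> ideal_gen ?T (h ` {..<N})"
      using F
    proof (induction F rule: finite_induct)
      case (insert a F)
      then obtain N where N: "F \<subseteq> ideal_gen ?T (h ` {..<N})" by auto
      obtain M where M: "a \<in> ideal_gen ?T (h ` {..<M})" using insert.prems unfolding I_def by auto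
      have "insert a F \<subseteq> ideal_gen ?T (h ` {..<max N M})"
        using mono[of N "max N M"] mono[of M "max N M"] N M by auto
      then show ?case by blast
    qed auto
    then obtain N where "ideal_gen ?T F \<subseteq> ideal_gen ?T (h ` {..<N})"
      using ideal_gen_least[OF idN] by blast
    then have "h N \<notin> ideal_gen ?T F" using bad by blast
    moreover have "h N \<in> ideal_gen ?T (h ` {..<Suc N})" by (rule ideal_gen_superset[OF T]) auto
    ultimately show ?thesis unfolding I_def by blast
  qed
  define P where "P = (\<lambda>F d g. g \<in> I \<and> g \<notin> ideal_gen ?T F \<and> g \<in> adjoin_lt S y d)"
  define dg where "dg = (\<lambda>F. LEAST d. \<exists>g. P F d g)"
  define ch where "ch = (\<lambda>F. SOME g. P F (dg F) g)"
  have ex: "\<exists>d g. P F d g" if "finite F" "F \<subseteq> I" for F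
    using outside[OF that] is_idealD(1)[OF I] unfolding P_def adjoin_def by blast
  have ch: "P F (dg F) (ch F)" if "finite F" "F \<subseteq> I" for F
  proof -
    have "\<exists>g. P F (dg F) g" unfolding dg_def using ex[OF that] by (rule LeastI_ex)
    then show ?thesis unfolding ch_def by (rule someI_ex)
  qed
  have minimal: "dg F \<le> d" if "P F d g" for F d g unfolding dg_def using that by (auto intro: Least_le)
  have "ch F \<in> I" if "finite F" "F \<subseteq> I" for F using ch[OF that] unfolding P_def by blast
  from greedy_sequence[of I ch, OF this] obtain g :: "nat \<Rightarrow> 'a"
    where gg: "\<forall>n. g n = ch (g ` {..<n}) \<and> g n \<in> I" ..
  note g = gg[rule_format, THEN conjunct1] gg[rule_format, THEN conjunct2]
  define d where "d = (\<lambda>n. dg (g ` {..<n}))"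
  have Pg: "P (g ` {..<n}) (d n) (g n)" for n
    unfolding d_def g(1)[of n] using ch[of "g ` {..<n}"] g(2) by blast
  have gT: "g n \<in> ?T" for n using g(2) is_idealD(1)[OF I] by blast
  have dmono: "d n \<le> d m" if "n \<le> m" for n m
  proof -
    have "ideal_gen ?T (g ` {..<n}) \<subseteq> ideal_gen ?T (g ` {..<m})"
      by (rule ideal_gen_mono[OF T]) (use that gT in auto)
    then have "P (g ` {..<n}) (d m) (g m)" using Pg[of m] unfolding P_def by blast
    then show ?thesis unfolding d_def by (rule minimal)
  qed
  have "\<forall>n. \<exists>c. (\<forall>i. c i \<in> S) \<and> g n = (\<Sum>i<d n. c i * y ^ i)"
    using Pg unfolding P_def adjoin_lt_def by blast
  then obtain c where c: "\<And>n i. c n i \<in> S" "\<And>n. g n = (\<Sum>i<d n. c n i * y ^ i)" by metis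
  have dpos: "d n > 0" for n
  proof (rule ccontr)
    assume "\<not> d n > 0"
    then have "g n = 0" using c(2)[of n] by simp
    then show False using Pg[of n] ideal_gen_0[of ?T "g ` {..<n}"] unfolding P_def by metis
  qed
  define a where "a = (\<lambda>n. c n (d n - 1))"
  have "\<forall>i. a i \<in> S" unfolding a_def using c(1) by blast
  then have "\<exists>N. a N \<in> ideal_gen S (a ` {..<N})" using noeth unfolding noetherian_def by metis
  then obtain N where "a N \<in> ideal_gen S (a ` {..<N})" ..
  then obtain e where e: "\<And>i. e i \<in> S" "a N = (\<Sum>i<N. e i * a i)"
    using ideal_gen_sequence[OF S] by blast
  define D where "D = d N"
  define g' where "g' = g N - (\<Sum>n<N. e n * y ^ (D - d n) * g n)"
  have yT: "y ^ k \<in> ?T" for k using is_subringD(7)[OF T y] .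
  have coefT: "e n * y ^ (D - d n) \<in> ?T" for n using e(1) sub yT is_subringD(5)[OF T] by blast
  have g'I: "g' \<in> I" unfolding g'_def
    by (intro is_ideal_diff[OF T I] is_ideal_sum[OF I] is_idealD(4)[OF I] g(2) coefT)
  have "(\<Sum>n<N. e n * y ^ (D - d n) * g n) \<in> ideal_gen ?T (g ` {..<N})"
  proof (rule is_ideal_sum[OF is_ideal_ideal_gen[OF T]])
    show "g ` {..<N} \<subseteq> ?T" using gT by auto
    show "e n * y ^ (D - d n) * g n \<in> ideal_gen ?T (g ` {..<N})" if "n \<in> {..<N}" for n
      using that by (intro ideal_gen_mult[OF T coefT] ideal_gen_superset[OF T]) auto
  qed
  then have "g N \<in> ideal_gen ?T (g ` {..<N})" if "g' \<in> ideal_gen ?T (g ` {..<N})"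
    using ideal_gen_plus[OF that] unfolding g'_def by fastforce
  then have g'out: "g' \<notin> ideal_gen ?T (g ` {..<N})" using Pg[of N] unfolding P_def by blast
  define c' where "c' = (\<lambda>j. c N j - (\<Sum>n<N. if D - d n \<le> j then e n * c n (j - (D - d n)) else 0))"
  have c'S: "c' j \<in> S" for j unfolding c'_def
    using c(1) e(1) by (intro is_subringD(4)[OF S] is_subring_sum[OF S]) (auto intro: is_subringD[OF S])
  have shift: "y ^ (D - d n) * g n = (\<Sum>j<D. (if D - d n \<le> j then c n (j - (D - d n)) else 0) * y ^ j)" if "n < N" for n
  proof -
    have dn: "d n \<le> D" using dmono[of n N] that unfolding D_def by simp
    have "(\<Sum>j<D. (if D - d n \<le> j then c n (j - (D - d n)) else 0) * y ^ j)
        = (\<Sum>j\<in>{D - d n..<D}. c n (j - (D - d n)) * y ^ j)"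
      by (rule sum.mono_neutral_cong_right) auto
    also have "\<dots> = (\<Sum>i<d n. c n i * y ^ (i + (D - d n)))"
      by (rule sum.reindex_bij_witness[of _ "\<lambda>i. i + (D - d n)" "\<lambda>j. j - (D - d n)"]) (use dn in auto)
    also have "\<dots> = y ^ (D - d n) * g n"
      unfolding c(2)[of n] by (simp add: sum_distrib_left power_add mult_ac)
    finally show ?thesis by simp
  qed
  have "(\<Sum>n<N. e n * y ^ (D - d n) * g n)
      = (\<Sum>n<N. \<Sum>j<D. (if D - d n \<le> j then e n * c n (j - (D - d n)) else 0) * y ^ j)"
  proof (rule sum.cong[OF refl])
    fix n assume "n \<in> {..<N}"
    then have "e n * y ^ (D - d n) * g n = e n * (\<Sum>j<D. (if D - d n \<le> j then c n (j - (D - d n)) else 0) * y ^ j)"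
      using shift[of n] by (simp add: mult.assoc)
    also have "\<dots> = (\<Sum>j<D. (if D - d n \<le> j then e n * c n (j - (D - d n)) else 0) * y ^ j)"
      unfolding sum_distrib_left by (rule sum.cong) (auto simp: mult.assoc)
    finally show "e n * y ^ (D - d n) * g n = (\<Sum>j<D. (if D - d n \<le> j then e n * c n (j - (D - d n)) else 0) * y ^ j)" .
  qed
  also have "\<dots> = (\<Sum>j<D. (\<Sum>n<N. if D - d n \<le> j then e n * c n (j - (D - d n)) else 0) * y ^ j)"
    by (subst sum.swap) (simp add: sum_distrib_right)
  finally have gform: "g' = (\<Sum>j<D. c' j * y ^ j)"
    unfolding g'_def c(2)[of N] c'_def D_def[symmetric]
    by (simp add: left_diff_distrib sum_subtractf)
  have ctop: "c' (D - 1) = 0"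
  proof -
    have "(if D - d n \<le> D - 1 then e n * c n (D - 1 - (D - d n)) else 0) = e n * a n" if "n < N" for n
    proof -
      have "d n \<le> D" "d n > 0" using dmono[of n N] that dpos unfolding D_def by auto
      then have "D - 1 - (D - d n) = d n - 1" "D - d n \<le> D - 1" by auto
      then show ?thesis unfolding a_def by simp
    qed
    then show ?thesis using e(2) unfolding c'_def a_def D_def by simp
  qed
  obtain D' where D': "D = Suc D'" using dpos[of N] unfolding D_def by (metis gr0_implies_Suc)
  have "g' = (\<Sum>j<D - 1. c' j * y ^ j)" unfolding gform using ctop unfolding D' by simp
  then have "g' \<in> adjoin_lt S y (D - 1)" using c'S by (auto intro: adjoin_ltI)
  then have "P (g ` {..<N}) (D - 1) g'" using g'I g'out unfolding P_def by blast
  then have "D \<le> D - 1" unfolding D_def d_def by (rule minimal)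
  then show False using dpos[of N] unfolding D_def by simp
qed

lemma polyfuns_Suc_adjoin:
  "polyfuns {..<Suc n} = adjoin (polyfuns {..<n}) (\<lambda>x. x n :: 'a::comm_ring_1)"
proof
  show "polyfuns {..<Suc n} \<subseteq> adjoin (polyfuns {..<n}) (\<lambda>x. x n :: 'a)"
  proof
    fix f :: "(nat \<Rightarrow> 'a) \<Rightarrow> 'a" assume "f \<in> polyfuns {..<Suc n}"
    from polyfuns_univariate[OF this, of n] obtain P
      where P: "ppoly_over (polyfuns ({..<Suc n} - {n})) P" "\<And>x. f x = poly (spec P x) (x n)" by blast
    have "{..<Suc n} - {n} = {..<n}" by auto
    then have "snd P i \<in> polyfuns {..<n}" for i using P(1) unfolding ppoly_over_def by simp
    moreover have "f = (\<Sum>i<Suc (fst P). snd P i * (\<lambda>x. x n) ^ i)"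
      using P(2) by (intro ext) (simp add: poly_spec lessThan_Suc_atMost)
    ultimately show "f \<in> adjoin (polyfuns {..<n}) (\<lambda>x. x n)"
      unfolding adjoin_def using adjoin_ltI[of "snd P"] by blast
  qed
  show "adjoin (polyfuns {..<n}) (\<lambda>x. x n :: 'a) \<subseteq> polyfuns {..<Suc n}"
  proof
    fix f :: "(nat \<Rightarrow> 'a) \<Rightarrow> 'a" assume "f \<in> adjoin (polyfuns {..<n}) (\<lambda>x. x n)"
    then obtain d c where c: "\<And>i. c i \<in> polyfuns {..<n}" "f = (\<Sum>i<d. c i * (\<lambda>x. x n) ^ i)"
      unfolding adjoin_def adjoin_lt_def by blast
    have "(\<lambda>x. x n) \<in> polyfuns {..<Suc n}" by (auto intro: polyfuns.intros)
    moreover have "c i \<in> polyfuns {..<Suc n}" for i using c(1) by (rule polyfuns_mono) auto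
    ultimately show "f \<in> polyfuns {..<Suc n}"
      unfolding c(2) by (intro is_subring_sum[OF polyfuns_subring] is_subringD(5,7)[OF polyfuns_subring])
  qed
qed

lemma polyfuns_noetherian:
  "noetherian (polyfuns {..<n} :: ((nat \<Rightarrow> 'a::field) \<Rightarrow> 'a) set)"
proof (induction n)
  case 0
  have const: "f \<in> polyfuns {} \<Longrightarrow> \<exists>c. f = (\<lambda>x. c)" for f :: "(nat \<Rightarrow> 'a) \<Rightarrow> 'a"
    by (induction rule: polyfuns.induct) auto
  show ?case unfolding noetherian_def
  proof (intro allI impI)
    fix h :: "nat \<Rightarrow> (nat \<Rightarrow> 'a) \<Rightarrow> 'a" assume h: "\<forall>i. h i \<in> polyfuns {..<0}"
    obtain c e where ce: "h 0 = (\<lambda>x. c)" "h 1 = (\<lambda>x. e)" using h const by (metis lessThan_0)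
    show "\<exists>N. h N \<in> ideal_gen (polyfuns {..<0}) (h ` {..<N})"
    proof (cases "c = 0")
      case True
      then have "h 0 = 0" using ce by (simp add: zero_fun_def)
      then show ?thesis using ideal_gen_0 by metis
    next
      case False
      have "(\<lambda>x. e / c) * h 0 + 0 \<in> ideal_gen (polyfuns {..<0}) (h ` {..<1})"
        by (rule ideal_gen_add) (auto intro: polyfuns.intros ideal_gen.intros)
      moreover have "(\<lambda>x. e / c) * h 0 + 0 = h 1" using False ce by (auto simp: fun_eq_iff)
      ultimately show ?thesis by metis
    qed
  qed
next
  case (Suc n)
  let ?T = "adjoin (polyfuns {..<n}) (\<lambda>x. x n :: 'a)"
  have "is_subring ?T" unfolding polyfuns_Suc_adjoin[symmetric] by (rule polyfuns_subring)
  moreover have "polyfuns {..<n} \<subseteq> ?T"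
    unfolding polyfuns_Suc_adjoin[symmetric] by (auto intro: polyfuns_mono)
  moreover have "(\<lambda>x. x n) \<in> ?T"
    unfolding polyfuns_Suc_adjoin[symmetric] by (auto intro: polyfuns.intros)
  ultimately show ?case
    unfolding polyfuns_Suc_adjoin by (rule hilbert_basis[OF polyfuns_subring Suc])
qed

section \<open>Prime ideals and algebraic independence\<close>

definition is_prime :: "'r::comm_ring_1 set \<Rightarrow> 'r set \<Rightarrow> bool" where
  "is_prime S P \<longleftrightarrow> is_ideal S P \<and> 1 \<notin> P \<and> (\<forall>a\<in>S. \<forall>b\<in>S. a * b \<in> P \<longrightarrow> a \<in> P \<or> b \<in> P)"

lemma is_primeD:
  assumes "is_prime S P"
  shows "is_ideal S P" "1 \<notin> P" "a \<in> S \<Longrightarrow> b \<in> S \<Longrightarrow> a * b \<in> P \<Longrightarrow> a \<in> P \<or> b \<in> P"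
  using assms unfolding is_prime_def by auto

text \<open>A chain of primes of length \<open>k\<close> yields \<open>k\<close> elements that are algebraically independent
  modulo the smallest one: a member of \<open>P\<^sub>1 - P\<^sub>0\<close> is transcendental over elements independent
  modulo \<open>P\<^sub>1\<close>, because the constant term of a relation would lie in \<open>P\<^sub>1\<close>.\<close>

lemma independent_if_prime_chain:
  fixes P :: "nat \<Rightarrow> ((nat \<Rightarrow> 'a::field) \<Rightarrow> 'a) set"
  assumes "\<And>i. i \<le> k \<Longrightarrow> is_prime (polyfuns {..<n}) (P i)" "\<And>i. i < k \<Longrightarrow> P i \<subset> P (Suc i)"
  shows "\<exists>y. (\<forall>i<k. y i \<in> polyfuns {..<n}) \<and>
    (\<forall>F\<in>polyfuns {..<k}. (\<lambda>x. F (\<lambda>i. y i x)) \<in> P 0 \<longrightarrow> (\<forall>c. F c = 0))"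
  using assms
proof (induction k arbitrary: P)
  case 0
  let ?S = "polyfuns {..<n} :: ((nat \<Rightarrow> 'a) \<Rightarrow> 'a) set"
  note P0 = is_primeD[OF "0.prems"(1)[OF order_refl]]
  have const: "F \<in> polyfuns {} \<Longrightarrow> \<exists>c. F = (\<lambda>x. c)" for F :: "(nat \<Rightarrow> 'a) \<Rightarrow> 'a"
    by (induction rule: polyfuns.induct) auto
  have "c = 0" if "(\<lambda>x. c) \<in> P 0" for c :: 'a
  proof (rule ccontr)
    assume "c \<noteq> 0"
    have "(\<lambda>x. inverse c) * (\<lambda>x. c) \<in> P 0"
      using is_idealD(4)[OF P0(1) polyfuns_const that] .
    moreover have "(\<lambda>x. inverse c) * (\<lambda>x. c) = (1 :: (nat \<Rightarrow> 'a) \<Rightarrow> 'a)"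
      using \<open>c \<noteq> 0\<close> by (auto simp: fun_eq_iff)
    ultimately show False using P0(2) by simp
  qed
  then show ?case using const by (intro exI[of _ "\<lambda>_ _. 0"]) fastforce
next
  case (Suc k)
  let ?S = "polyfuns {..<n} :: ((nat \<Rightarrow> 'a) \<Rightarrow> 'a) set"
  have "is_prime ?S (P (Suc i))" if "i \<le> k" for i using Suc.prems(1)[of "Suc i"] that by simp
  moreover have "P (Suc i) \<subset> P (Suc (Suc i))" if "i < k" for i using Suc.prems(2)[of "Suc i"] that by simp
  ultimately obtain y where y: "\<And>i. i < k \<Longrightarrow> y i \<in> ?S"
    "\<And>F c. F \<in> polyfuns {..<k} \<Longrightarrow> (\<lambda>x. F (\<lambda>i. y i x)) \<in> P (Suc 0) \<Longrightarrow> F c = 0"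
    using Suc.IH[of "\<lambda>i. P (Suc i)"] by blast
  have P0: "is_prime ?S (P 0)" and P1: "is_prime ?S (P (Suc 0))" and sub: "P 0 \<subset> P (Suc 0)"
    using Suc.prems by auto
  note I0 = is_primeD(1)[OF P0] and I1 = is_primeD(1)[OF P1]
  obtain a where a: "a \<in> P (Suc 0)" "a \<notin> P 0" using sub by blast
  have aS: "a \<in> ?S" using a(1) is_idealD(1)[OF I1] by blast
  define z where "z = y(k := a)"
  have zS: "z i \<in> ?S" if "i < Suc k" for i using y(1) aS that unfolding z_def by (auto simp: less_Suc_eq)
  have zy: "c (\<lambda>i. z i x) = c (\<lambda>i. y i x)" if "c \<in> polyfuns {..<k}" for c x
    by (rule polyfuns_cong[OF that]) (auto simp: z_def)
  have coeffs: "\<forall>i<d. \<forall>v. c i v = 0"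
    if "\<And>i. c i \<in> polyfuns {..<k}" "(\<lambda>x. \<Sum>i<d. c i (\<lambda>i. y i x) * a x ^ i) \<in> P 0" for c d
    using that
  proof (induction d arbitrary: c)
    case (Suc d)
    define T where "T = (\<lambda>x. \<Sum>i<d. c (Suc i) (\<lambda>i. y i x) * a x ^ i)"
    have eS: "(\<lambda>x. c i (\<lambda>i. y i x)) \<in> ?S" for i
      using polyfuns_compose[OF Suc.prems(1)] y(1) by blast
    have TS: "T \<in> ?S" unfolding T_def using eS aS
      by (intro polyfuns_sum polyfuns.polyfuns_mult polyfuns_power)
    have eq: "(\<lambda>x. \<Sum>i<Suc d. c i (\<lambda>i. y i x) * a x ^ i) = (\<lambda>x. c 0 (\<lambda>i. y i x)) + T * a"
      unfolding T_def sum.lessThan_Suc_shift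
      by (auto simp: fun_eq_iff sum_distrib_left mult_ac)
    have "T * a \<in> P (Suc 0)" using is_idealD(4)[OF I1 TS a(1)] .
    moreover have "(\<lambda>x. c 0 (\<lambda>i. y i x)) + T * a \<in> P (Suc 0)" using Suc.prems(2) sub unfolding eq by blast
    ultimately have "(\<lambda>x. c 0 (\<lambda>i. y i x)) \<in> P (Suc 0)"
      using is_ideal_diff[OF polyfuns_subring I1] by fastforce
    then have c0: "c 0 v = 0" for v using y(2)[OF Suc.prems(1)] by blast
    then have "T * a \<in> P 0" using Suc.prems(2) unfolding eq by (simp add: plus_fun_def times_fun_def)
    then have "T \<in> P 0" using is_primeD(3)[OF P0 TS aS] a(2) by blast
    then have "\<forall>i<d. \<forall>v. c (Suc i) v = 0" unfolding T_def by (intro Suc.IH Suc.prems(1))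
    then show ?case using c0 by (metis less_Suc_eq_0_disj)
  qed simp
  have "F c = 0" if F: "F \<in> polyfuns {..<Suc k}" "(\<lambda>x. F (\<lambda>i. z i x)) \<in> P 0" for F c
  proof -
    have "F \<in> adjoin (polyfuns {..<k}) (\<lambda>x. x k)" using F(1) unfolding polyfuns_Suc_adjoin .
    then obtain d e where e: "\<And>i. e i \<in> polyfuns {..<k}" "F = (\<Sum>i<d. e i * (\<lambda>x. x k) ^ i)"
      unfolding adjoin_def adjoin_lt_def by blast
    have "(\<lambda>x. F (\<lambda>i. z i x)) = (\<lambda>x. \<Sum>i<d. e i (\<lambda>i. y i x) * a x ^ i)"
      unfolding e(2) using zy[OF e(1)] by (auto simp: fun_eq_iff z_def)
    then have "\<forall>i<d. \<forall>v. e i v = 0" using F(2) coeffs[OF e(1)] by simp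
    then show ?thesis unfolding e(2) by simp
  qed
  then show ?case using zS by blast
qed

text \<open>Generically a prime is generated by a triangular system with one member for each algebraic
  generator; transcendental ones contribute nothing.\<close>

definition generically_generated :: "'r::comm_ring_1 set \<Rightarrow> 'r set \<Rightarrow> 'r set \<Rightarrow> bool" where
  "generically_generated S Q Ps \<longleftrightarrow> Ps \<subseteq> Q \<inter> S \<and>
     (\<forall>F\<in>Q \<inter> S. \<exists>w\<in>S - Q. w * F \<in> ideal_gen S Ps)"

lemma generically_generated_adjoin:
  assumes S: "is_subring S" and T: "is_subring (adjoin S y)" and ST: "S \<subseteq> adjoin S y" and y: "y \<in> adjoin S y"
    and R: "is_subring R" "adjoin S y \<subseteq> R" and Q: "is_prime R Q"
    and gen: "generically_generated S Q Ps"
  shows "\<exists>P\<in>Q \<inter> adjoin S y. generically_generated (adjoin S y) Q (insert P Ps)"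
proof -
  let ?T = "adjoin S y"
  note I = is_primeD(1)[OF Q]
  have Psub: "Ps \<subseteq> Q \<inter> S" and Pgen: "\<And>F. F \<in> Q \<Longrightarrow> F \<in> S \<Longrightarrow> \<exists>w\<in>S - Q. w * F \<in> ideal_gen S Ps"
    using gen unfolding generically_generated_def by auto
  have prime: "a * b \<notin> Q" if "a \<in> ?T - Q" "b \<in> ?T - Q" for a b
    using is_primeD(3)[OF Q, of a b] that R(2) by blast
  have one: "1 \<in> ?T - Q" using is_subringD(2)[OF T] is_primeD(2)[OF Q] by blast
  have powT: "y ^ k \<in> ?T" for k using is_subringD(7)[OF T y] .
  have small: "\<exists>w\<in>?T - Q. w * (\<Sum>i<d. c i * y ^ i) \<in> ideal_gen ?T G"
    if cS: "\<And>i. c i \<in> S" and cQ: "\<And>i. i < d \<Longrightarrow> c i \<in> Q" and G: "Ps \<subseteq> G" for c d G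
    using cQ
  proof (induction d)
    case 0
    then show ?case using one ideal_gen_0 by auto
  next
    case (Suc d)
    then obtain w where w: "w \<in> ?T - Q" "w * (\<Sum>i<d. c i * y ^ i) \<in> ideal_gen ?T G" by auto
    obtain v where v: "v \<in> S - Q" "v * c d \<in> ideal_gen S Ps" using Pgen[of "c d"] Suc.prems cS by blast
    have v': "v \<in> ?T - Q" "v * c d \<in> ideal_gen ?T G"
      using v ST ideal_gen_mono_ring[OF ST G] by auto
    have "v * (w * (\<Sum>i<d. c i * y ^ i)) + (w * y ^ d) * (v * c d) \<in> ideal_gen ?T G"
      by (rule ideal_gen_plus[OF ideal_gen_mult[OF T _ w(2)] ideal_gen_mult[OF T _ v'(2)]])
        (use w v' powT in \<open>auto intro: is_subringD(5)[OF T]\<close>)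
    moreover have "v * (w * (\<Sum>i<d. c i * y ^ i)) + (w * y ^ d) * (v * c d) = (v * w) * (\<Sum>i<Suc d. c i * y ^ i)"
      by (simp add: algebra_simps)
    moreover have "v * w \<in> ?T - Q" using prime v'(1) w(1) is_subringD(5)[OF T] by blast
    ultimately show ?case by auto
  qed
  define rel where "rel = (\<lambda>N. \<exists>c. (\<forall>i. c i \<in> S) \<and> c N \<notin> Q \<and> (\<Sum>i<Suc N. c i * y ^ i) \<in> Q)"
  show ?thesis
  proof (cases "\<exists>N. rel N")
    case False
    have allQ: "i < d \<Longrightarrow> c i \<in> Q" if cS: "\<And>i. c i \<in> S" and "(\<Sum>i<d. c i * y ^ i) \<in> Q" for c d i
      using that(2)
    proof (induction d)
      case (Suc d)
      have cd: "c d \<in> Q" using False cS Suc.prems(2) unfolding rel_def by blast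
      have "y ^ d * c d \<in> Q" using is_idealD(4)[OF I _ cd] powT R(2) by blast
      then have "(\<Sum>i<d. c i * y ^ i) \<in> Q"
        using is_ideal_diff[OF R(1) I Suc.prems(2)] by (fastforce simp: mult.commute)
      then show ?case using Suc cd by (auto simp: less_Suc_eq)
    qed simp
    have "\<exists>w\<in>?T - Q. w * F \<in> ideal_gen ?T (insert 0 Ps)" if F: "F \<in> Q \<inter> ?T" for F
    proof -
      obtain d c where c: "\<And>i. c i \<in> S" "F = (\<Sum>i<d. c i * y ^ i)"
        using F unfolding adjoin_def adjoin_lt_def by blast
      have "c i \<in> Q" if "i < d" for i using allQ[of c d i, OF c(1)] F c(2) that by blast
      then show ?thesis unfolding c(2) by (intro small[OF c(1)]) auto
    qed
    moreover have "0 \<in> Q \<inter> ?T" using is_idealD(2)[OF I] is_subringD(1)[OF T] by blast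
    ultimately show ?thesis using Psub ST unfolding generically_generated_def by blast
  next
    case True
    define N where "N = (LEAST N. rel N)"
    have "rel N" unfolding N_def using True by (rule LeastI_ex)
    then obtain b where b: "\<And>i. b i \<in> S" "b N \<notin> Q" "(\<Sum>i<Suc N. b i * y ^ i) \<in> Q" unfolding rel_def by blast
    define P where "P = (\<Sum>i<Suc N. b i * y ^ i)"
    have PQ: "P \<in> Q" using b(3) unfolding P_def .
    have PT: "P \<in> ?T" unfolding P_def adjoin_def using adjoin_ltI[of b] b(1) by blast
    have least: "c M \<in> Q" if "M < N" "\<And>i. c i \<in> S" "(\<Sum>i<Suc M. c i * y ^ i) \<in> Q" for c M
      using not_less_Least[of M rel] that unfolding N_def rel_def by blast
    have allQ: "i < d \<Longrightarrow> c i \<in> Q" if cS: "\<And>i. c i \<in> S" and "d \<le> N" "(\<Sum>i<d. c i * y ^ i) \<in> Q" for c d i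
      using that(2,3)
    proof (induction d)
      case (Suc d)
      have cd: "c d \<in> Q" using least[of d c] cS Suc.prems by simp
      have "y ^ d * c d \<in> Q" using is_idealD(4)[OF I _ cd] powT R(2) by blast
      then have "(\<Sum>i<d. c i * y ^ i) \<in> Q"
        using is_ideal_diff[OF R(1) I Suc.prems(3)] by (fastforce simp: mult.commute)
      then show ?case using Suc cd by (auto simp: less_Suc_eq)
    qed simp
    let ?G = "insert P Ps"
    have reduce: "\<exists>w\<in>?T - Q. w * (\<Sum>i<d. c i * y ^ i) \<in> ideal_gen ?T ?G"
      if "\<And>i. c i \<in> S" "(\<Sum>i<d. c i * y ^ i) \<in> Q" for c d
      using that
    proof (induction d arbitrary: c)
      case 0
      then show ?case using one ideal_gen_0 by auto
    next
      case (Suc d)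
      show ?case
      proof (cases "Suc d \<le> N")
        case True
        have "c i \<in> Q" if "i < Suc d" for i using allQ[OF Suc.prems(1) True Suc.prems(2) that] .
        then show ?thesis by (intro small[OF Suc.prems(1)]) auto
      next
        case False
        define c' where "c' = (\<lambda>i. b N * c i - (if d - N \<le> i then c d * b (i - (d - N)) else 0))"
        have c'S: "c' i \<in> S" for i unfolding c'_def using b(1) Suc.prems(1) by (auto intro: is_subringD[OF S])
        have "(\<Sum>i<Suc d. (if d - N \<le> i then c d * b (i - (d - N)) else 0) * y ^ i)
            = (\<Sum>i\<in>{d - N..<Suc d}. c d * b (i - (d - N)) * y ^ i)"
          by (rule sum.mono_neutral_cong_right) auto
        also have "\<dots> = (\<Sum>i<Suc N. c d * b i * y ^ (i + (d - N)))"
          by (rule sum.reindex_bij_witness[of _ "\<lambda>i. i + (d - N)" "\<lambda>j. j - (d - N)"]) (use False in auto)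
        also have "\<dots> = c d * y ^ (d - N) * P"
          unfolding P_def by (simp add: sum_distrib_left power_add mult_ac del: sum.lessThan_Suc)
        finally have sh: "(\<Sum>i<Suc d. (if d - N \<le> i then c d * b (i - (d - N)) else 0) * y ^ i) = c d * y ^ (d - N) * P" .
        have "(\<Sum>i<Suc d. c' i * y ^ i) = b N * (\<Sum>i<Suc d. c i * y ^ i) - c d * y ^ (d - N) * P"
          unfolding sh[symmetric] c'_def
          by (simp add: left_diff_distrib sum_subtractf sum_distrib_left mult.assoc del: sum.lessThan_Suc)
        moreover have "c' d = 0" using False by (simp add: c'_def algebra_simps)
        ultimately have red: "(\<Sum>i<d. c' i * y ^ i) = b N * (\<Sum>i<Suc d. c i * y ^ i) - c d * y ^ (d - N) * P"
          by simp
        have cyT: "c d * y ^ (d - N) \<in> ?T" using Suc.prems(1) ST powT by (auto intro: is_subringD(5)[OF T])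
        have bT: "b N \<in> ?T - Q" using b ST by blast
        have "(\<Sum>i<d. c' i * y ^ i) \<in> Q"
          unfolding red
        proof (rule is_ideal_diff[OF R(1) I])
          show "b N * (\<Sum>i<Suc d. c i * y ^ i) \<in> Q" using is_idealD(4)[OF I _ Suc.prems(2)] bT R(2) by blast
          show "c d * y ^ (d - N) * P \<in> Q" using is_idealD(4)[OF I _ PQ] cyT R(2) by blast
        qed
        then obtain w where w: "w \<in> ?T - Q" "w * (\<Sum>i<d. c' i * y ^ i) \<in> ideal_gen ?T ?G"
          using Suc.IH[of c', OF c'S] by blast
        have "w * (c d * y ^ (d - N)) * P \<in> ideal_gen ?T ?G"
          using w(1) cyT by (intro ideal_gen_mult[OF T] ideal_gen_superset[OF T]) (auto intro: is_subringD(5)[OF T])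
        then have "w * (\<Sum>i<d. c' i * y ^ i) + w * (c d * y ^ (d - N)) * P \<in> ideal_gen ?T ?G"
          using w(2) by (intro ideal_gen_plus)
        moreover have "w * (\<Sum>i<d. c' i * y ^ i) + w * (c d * y ^ (d - N)) * P = (w * b N) * (\<Sum>i<Suc d. c i * y ^ i)"
          unfolding red by (simp add: algebra_simps del: sum.lessThan_Suc)
        moreover have "w * b N \<in> ?T - Q" using prime[OF w(1) bT] w(1) bT is_subringD(5)[OF T] by blast
        ultimately show ?thesis by auto
      qed
    qed
    have "\<exists>w\<in>?T - Q. w * F \<in> ideal_gen ?T ?G" if F: "F \<in> Q \<inter> ?T" for F
    proof -
      obtain d c where c: "\<And>i. c i \<in> S" "F = (\<Sum>i<d. c i * y ^ i)"
        using F unfolding adjoin_def adjoin_lt_def by blast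
      then show ?thesis using reduce[of c d, OF c(1)] F by blast
    qed
    then show ?thesis using Psub ST PQ PT unfolding generically_generated_def by blast
  qed
qed

lemma generically_generated_polyfuns:
  fixes Q :: "((nat \<Rightarrow> 'a::field) \<Rightarrow> 'a) set"
  assumes Q: "is_prime (polyfuns {..<e + n}) Q"
    and indep: "\<And>F. F \<in> polyfuns {..<e} \<Longrightarrow> F \<in> Q \<Longrightarrow> F = 0"
  shows "j \<le> n \<Longrightarrow> \<exists>Ps. finite Ps \<and> card Ps \<le> j \<and> generically_generated (polyfuns {..<e + j}) Q Ps"
proof (induction j)
  case 0
  have "1 \<in> polyfuns {..<e} - Q" using is_subringD(2)[OF polyfuns_subring] is_primeD(2)[OF Q] by blast
  then have "generically_generated (polyfuns {..<e + 0}) Q {}"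
    using indep ideal_gen_0 unfolding generically_generated_def by force
  then show ?case by (intro exI[of _ "{}"]) auto
next
  case (Suc j)
  then obtain Ps where Ps: "finite Ps" "card Ps \<le> j" "generically_generated (polyfuns {..<e + j}) Q Ps" by auto
  let ?y = "(\<lambda>x. x (e + j)) :: (nat \<Rightarrow> 'a) \<Rightarrow> 'a"
  have eq: "polyfuns {..<e + Suc j} = adjoin (polyfuns {..<e + j}) ?y"
    using polyfuns_Suc_adjoin[of "e + j"] by simp
  have "\<exists>P\<in>Q \<inter> adjoin (polyfuns {..<e + j}) ?y. generically_generated (adjoin (polyfuns {..<e + j}) ?y) Q (insert P Ps)"
  proof (rule generically_generated_adjoin[OF polyfuns_subring _ _ _ polyfuns_subring _ Q Ps(3)])
    show "is_subring (adjoin (polyfuns {..<e + j}) ?y)" unfolding eq[symmetric] by (rule polyfuns_subring)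
    show "polyfuns {..<e + j} \<subseteq> adjoin (polyfuns {..<e + j}) ?y"
      unfolding eq[symmetric] by (auto intro: polyfuns_mono)
    show "?y \<in> adjoin (polyfuns {..<e + j}) ?y"
      unfolding eq[symmetric] by (auto intro: polyfuns.intros)
    show "adjoin (polyfuns {..<e + j}) ?y \<subseteq> polyfuns {..<e + n}"
      unfolding eq[symmetric] using Suc.prems by (auto intro: polyfuns_mono)
  qed
  then obtain P where "generically_generated (polyfuns {..<e + Suc j}) Q (insert P Ps)" unfolding eq by blast
  then show ?case using Ps(1,2) by (intro exI[of _ "insert P Ps"]) (auto simp: card_insert_if)
qed

section \<open>Powers of a maximal ideal and Krull's intersection theorem\<close>

primrec ideal_power :: "nat \<Rightarrow> (nat \<Rightarrow> 'a::field) \<Rightarrow> nat \<Rightarrow> ((nat \<Rightarrow> 'a) \<Rightarrow> 'a) set" where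
  "ideal_power n a 0 = polyfuns {..<n}"
| "ideal_power n a (Suc k) = {\<Sum>i<n. (\<lambda>x. x i - a i) * g i | g. \<forall>i. g i \<in> ideal_power n a k}"

lemma polyfuns_centred: "i < n \<Longrightarrow> (\<lambda>x. x i - a i) \<in> polyfuns {..<n}"
  by (intro polyfuns_diff polyfuns.intros) auto

lemma is_ideal_ideal_power: "is_ideal (polyfuns {..<n}) (ideal_power n a k)"
proof (induction k)
  case 0
  then show ?case using is_subringD[OF polyfuns_subring] unfolding is_ideal_def by auto
next
  case (Suc k)
  note I = is_idealD[OF Suc]
  show ?case unfolding is_ideal_def
  proof (intro conjI ballI)
    show "ideal_power n a (Suc k) \<subseteq> polyfuns {..<n}"
      using I(1) by (auto intro!: is_subring_sum[OF polyfuns_subring] is_subringD(5)[OF polyfuns_subring] polyfuns_centred)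
    show "0 \<in> ideal_power n a (Suc k)" using I(2) by (auto intro!: exI[of _ "\<lambda>_. 0"])
    fix f assume "f \<in> ideal_power n a (Suc k)"
    then obtain g where g: "\<And>i. g i \<in> ideal_power n a k" "f = (\<Sum>i<n. (\<lambda>x. x i - a i) * g i)" by auto
    show "s * f \<in> ideal_power n a (Suc k)" if "s \<in> polyfuns {..<n}" for s
    proof -
      have "s * f = (\<Sum>i<n. (\<lambda>x. x i - a i) * (s * g i))"
        unfolding g(2) by (simp add: sum_distrib_left mult_ac)
      moreover have "s * g i \<in> ideal_power n a k" for i using I(4)[OF that g(1)] .
      ultimately show ?thesis by (auto intro!: exI[of _ "\<lambda>i. s * g i"])
    qed
    fix f' assume "f' \<in> ideal_power n a (Suc k)"
    then obtain g' where g': "\<And>i. g' i \<in> ideal_power n a k" "f' = (\<Sum>i<n. (\<lambda>x. x i - a i) * g' i)" by auto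
    have "f + f' = (\<Sum>i<n. (\<lambda>x. x i - a i) * (g i + g' i))"
      unfolding g(2) g'(2) by (simp add: sum.distrib distrib_left)
    moreover have "g i + g' i \<in> ideal_power n a k" for i using I(3)[OF g(1) g'(1)] .
    ultimately show "f + f' \<in> ideal_power n a (Suc k)" by (auto intro!: exI[of _ "\<lambda>i. g i + g' i"])
  qed
qed

lemmas ideal_powerD = is_idealD[OF is_ideal_ideal_power]

lemma ideal_power_Suc_subset: "ideal_power n a (Suc k) \<subseteq> ideal_power n a k"
proof
  fix f assume "f \<in> ideal_power n a (Suc k)"
  then obtain g where g: "\<And>i. g i \<in> ideal_power n a k" "f = (\<Sum>i<n. (\<lambda>x. x i - a i) * g i)" by auto
  show "f \<in> ideal_power n a k" unfolding g(2)
    by (intro is_ideal_sum[OF is_ideal_ideal_power] ideal_powerD(4) polyfuns_centred g(1)) auto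
qed

lemma ideal_power_antimono: "k \<le> l \<Longrightarrow> ideal_power n a l \<subseteq> ideal_power n a k"
  by (induction l rule: dec_induct) (use ideal_power_Suc_subset in blast)+

lemma ideal_power_centred_mult:
  assumes "i < n" "g \<in> ideal_power n a k" shows "(\<lambda>x. x i - a i) * g \<in> ideal_power n a (Suc k)"
proof -
  have "(\<lambda>x. x i - a i) * g = (\<Sum>j<n. (\<lambda>x. x j - a j) * (if j = i then g else 0))"
    using assms(1) by (simp add: if_distrib[of "\<lambda>t. _ * t"] cong: if_cong)
  moreover have "(if j = i then g else 0) \<in> ideal_power n a k" for j using assms(2) ideal_powerD(2) by auto
  ultimately show ?thesis by (auto intro!: exI[of _ "\<lambda>j. if j = i then g else 0"])
qed

lemma ideal_power_mult:
  "f \<in> ideal_power n a k \<Longrightarrow> g \<in> ideal_power n a l \<Longrightarrow> f * g \<in> ideal_power n a (k + l)"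
proof (induction k arbitrary: f)
  case 0
  then have "f * g \<in> ideal_power n a l" by (intro ideal_powerD(4)) simp_all
  then show ?case by (simp only: add_0)
next
  case (Suc k)
  then obtain h where h: "\<And>i. h i \<in> ideal_power n a k" "f = (\<Sum>i<n. (\<lambda>x. x i - a i) * h i)" by auto
  have "f * g = (\<Sum>i<n. (\<lambda>x. x i - a i) * (h i * g))"
    unfolding h(2) by (simp add: sum_distrib_right mult.assoc)
  moreover have "h i * g \<in> ideal_power n a (k + l)" for i using Suc.IH[OF h(1) Suc.prems(2)] .
  ultimately show ?case by (auto intro!: exI[of _ "\<lambda>i. h i * g"])
qed

lemma ideal_power_bound:
  fixes a :: "nat \<Rightarrow> 'a::linordered_field"
  assumes "f \<in> ideal_power n a k"
  shows "\<exists>C>0. \<forall>r x. 0 \<le> r \<longrightarrow> r \<le> 1 \<longrightarrow> in_box n r a x \<longrightarrow> \<bar>f x\<bar> \<le> C * r ^ k"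
  using assms
proof (induction k arbitrary: f)
  case 0
  then obtain C where "C > 0" "\<And>x. in_box n 1 a x \<Longrightarrow> \<bar>f x\<bar> \<le> C" using polyfuns_bounded[of f n 1 a] by auto
  then show ?case by (intro exI[of _ C]) (auto dest: in_box_mono[of n _ a _ 1])
next
  case (Suc k)
  then obtain g where g: "\<And>i. g i \<in> ideal_power n a k" "f = (\<Sum>i<n. (\<lambda>x. x i - a i) * g i)" by auto
  from Suc.IH[OF g(1)] obtain C where C: "\<And>i. C i > 0"
    "\<And>i r x. 0 \<le> r \<Longrightarrow> r \<le> 1 \<Longrightarrow> in_box n r a x \<Longrightarrow> \<bar>g i x\<bar> \<le> C i * r ^ k" by metis
  have "\<bar>f x\<bar> \<le> ((\<Sum>i<n. C i) + 1) * r ^ Suc k" if r: "0 \<le> r" "r \<le> 1" "in_box n r a x" for r x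
  proof -
    have "\<bar>f x\<bar> \<le> (\<Sum>i<n. \<bar>(x i - a i) * g i x\<bar>)" unfolding g(2) by simp
    also have "\<dots> \<le> (\<Sum>i<n. r * (C i * r ^ k))"
      unfolding abs_mult using C r by (intro sum_mono mult_mono) (auto simp: in_box_def)
    also have "\<dots> = (\<Sum>i<n. C i) * r ^ Suc k"
      unfolding sum_distrib_right by (rule sum.cong) (auto simp: mult_ac)
    also have "\<dots> \<le> ((\<Sum>i<n. C i) + 1) * r ^ Suc k" using r by (intro mult_right_mono) auto
    finally show ?thesis .
  qed
  moreover have "(\<Sum>i<n. C i) + 1 > 0" using C(1) by (intro add_nonneg_pos sum_nonneg) (auto intro: less_imp_le)
  ultimately show ?case by blast
qed

text \<open>Perdry's proof of Krull's theorem: write \<open>b\<close> as a form \<open>h\<^sub>k\<close> of degree \<open>k\<close> in the generators of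
  the maximal ideal, for every \<open>k\<close>. Replacing the generators by new variables, the Hilbert basis theorem
  expresses some \<open>h\<^sub>N\<close> through its predecessors with coefficients of positive degree.\<close>

primrec forms_over :: "nat \<Rightarrow> nat \<Rightarrow> ((nat \<Rightarrow> 'a::field) \<Rightarrow> 'a) set" where
  "forms_over n 0 = polyfuns {..<n}"
| "forms_over n (Suc k) = {(\<lambda>v. \<Sum>i<n. v (n + i) * g i v) | g. \<forall>i. g i \<in> forms_over n k}"

lemma forms_over_polyfuns: "B \<in> forms_over n k \<Longrightarrow> B \<in> polyfuns {..<n + n}"
proof (induction k arbitrary: B)
  case 0
  then show ?case by (auto intro: polyfuns_mono)
next
  case (Suc k)
  then show ?case by (auto intro!: polyfuns_sum polyfuns.polyfuns_mult intro: polyfuns.intros)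
qed

lemma forms_over_scale:
  "B \<in> forms_over n k \<Longrightarrow> B (\<lambda>i. if i < n then v i else s * v i) = s ^ k * B v"
proof (induction k arbitrary: B)
  case 0
  then have "B (\<lambda>i. if i < n then v i else s * v i) = B v"
    by (intro polyfuns_cong[of B "{..<n}"]) auto
  then show ?case by simp
next
  case (Suc k)
  then obtain g where g: "\<And>i. g i \<in> forms_over n k" "B = (\<lambda>v. \<Sum>i<n. v (n + i) * g i v)" by auto
  have "B (\<lambda>i. if i < n then v i else s * v i) = (\<Sum>i<n. (s * v (n + i)) * (s ^ k * g i v))"
    unfolding g(2) using Suc.IH[OF g(1)] by simp
  also have "\<dots> = s ^ Suc k * B v"
    unfolding g(2) sum_distrib_left by (rule sum.cong) (auto simp: mult_ac)
  finally show ?case .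
qed

lemma ideal_power_form:
  "h \<in> ideal_power n a k \<Longrightarrow> \<exists>B\<in>forms_over n k. \<forall>x. B (\<lambda>i. if i < n then x i else x (i - n) - a (i - n)) = h x"
proof (induction k arbitrary: h)
  case 0
  then have "h (\<lambda>i. if i < n then x i else x (i - n) - a (i - n)) = h x" for x
    by (auto intro: polyfuns_cong)
  then show ?case using 0 by auto
next
  case (Suc k)
  then obtain g where g: "\<And>i. g i \<in> ideal_power n a k" "h = (\<Sum>i<n. (\<lambda>x. x i - a i) * g i)" by auto
  from Suc.IH[OF g(1)] obtain B where B: "\<And>i. B i \<in> forms_over n k"
    "\<And>i x. B i (\<lambda>i. if i < n then x i else x (i - n) - a (i - n)) = g i x" by metis
  show ?case
    by (intro bexI[of _ "\<lambda>v. \<Sum>i<n. v (n + i) * B i v"]) (use B g(2) in auto)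
qed

theorem krull_intersection:
  fixes a :: "nat \<Rightarrow> 'a::linordered_field"
  assumes J: "is_ideal (polyfuns {..<n}) J" and b: "b \<in> polyfuns {..<n}"
    and near: "\<And>k. \<exists>h\<in>ideal_power n a k. b - h \<in> J"
  shows "\<exists>w\<in>polyfuns {..<n}. w a = 1 \<and> w * b \<in> J"
proof -
  let ?S = "polyfuns {..<n} :: ((nat \<Rightarrow> 'a) \<Rightarrow> 'a) set" and ?T = "polyfuns {..<n + n} :: ((nat \<Rightarrow> 'a) \<Rightarrow> 'a) set"
  define \<sigma> where "\<sigma> = (\<lambda>x i. if i < n then x i else x (i - n) - a (i - n))"
  obtain h where h: "\<And>k. h k \<in> ideal_power n a k" "\<And>k. b - h k \<in> J" using near by metis
  obtain B where B: "\<And>k. B k \<in> forms_over n k" "\<And>k x. B k (\<sigma> x) = h k x"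
    using ideal_power_form[OF h(1)] unfolding \<sigma>_def by metis
  obtain N where "B N \<in> ideal_gen ?T (B ` {..<N})"
    using polyfuns_noetherian[of "n + n"] forms_over_polyfuns[OF B(1)] unfolding noetherian_def by blast
  then obtain Q where Q: "\<And>i. Q i \<in> ?T" "B N = (\<Sum>i<N. Q i * B i)"
    using ideal_gen_sequence[OF polyfuns_subring] by blast
  have "\<exists>P. ppoly_over ?T P \<and> (\<forall>v s. Q i (\<lambda>k. if k < n then v k else s * v k) = poly (spec P v) s)" for i
  proof -
    have "(\<lambda>v. Q i (\<lambda>k. if k < n then v k else v (n + n) * v k)) \<in> polyfuns {..<Suc (n + n)}"
    proof (rule polyfuns_compose[OF Q(1)])
      show "(\<lambda>v. if k < n then v k else v (n + n) * v k) \<in> polyfuns {..<Suc (n + n)}" if "k \<in> {..<n + n}" for k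
        using that by (cases "k < n") (auto intro!: polyfuns.polyfuns_mult intro: polyfuns.intros)
    qed
    from polyfuns_univariate[OF this, of "n + n"] obtain P where P: "ppoly_over (polyfuns ({..<Suc (n + n)} - {n + n})) P"
      "\<And>v. Q i (\<lambda>k. if k < n then v k else v (n + n) * v k) = poly (spec P v) (v (n + n))" by blast
    have "{..<Suc (n + n)} - {n + n} = {..<n + n}" by auto
    then have PT: "ppoly_over ?T P" using P(1) by simp
    have "Q i (\<lambda>k. if k < n then v k else s * v k) = poly (spec P v) s" for v s
    proof -
      let ?v = "v(n + n := s)"
      have "Q i (\<lambda>k. if k < n then v k else s * v k) = Q i (\<lambda>k. if k < n then ?v k else ?v (n + n) * ?v k)"
        by (rule polyfuns_cong[OF Q(1)]) auto
      also have "\<dots> = poly (spec P ?v) s" using P(2)[of ?v] by simp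
      also have "spec P ?v = spec P v"
      proof -
        have "snd P j ?v = snd P j v" for j
          by (rule polyfuns_cong[of _ "{..<n + n}"]) (use PT in \<open>auto simp: ppoly_over_def\<close>)
        then show ?thesis unfolding spec_def by simp
      qed
      finally show ?thesis .
    qed
    then show ?thesis using PT by blast
  qed
  then obtain P where P: "\<And>i. ppoly_over ?T (P i)"
    "\<And>i v s. Q i (\<lambda>k. if k < n then v k else s * v k) = poly (spec (P i) v) s" by metis
  define q where "q = (\<lambda>i v. coeff (spec (P i) v) (N - i))"
  have qT: "q i \<in> ?T" for i
    unfolding q_def coeff_spec using P(1)[of i] unfolding ppoly_over_def by (intro polyfuns_if) auto
  have BN: "B N v = (\<Sum>i<N. q i v * B i v)" for v
  proof -
    have "poly (monom (B N v) N) s = poly (\<Sum>i<N. spec (P i) v * monom (B i v) i) s" for s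
    proof -
      let ?v = "\<lambda>k. if k < n then v k else s * v k"
      have "poly (monom (B N v) N) s = B N ?v" using forms_over_scale[OF B(1), of N v s] by (simp add: poly_monom mult.commute)
      also have "\<dots> = (\<Sum>i<N. Q i ?v * B i ?v)" by (subst Q(2)) simp
      also have "\<dots> = (\<Sum>i<N. poly (spec (P i) v) s * (s ^ i * B i v))"
        using P(2) forms_over_scale[OF B(1)] by simp
      also have "\<dots> = poly (\<Sum>i<N. spec (P i) v * monom (B i v) i) s"
        by (simp add: poly_sum poly_monom mult_ac)
      finally show ?thesis .
    qed
    then have "monom (B N v) N = (\<Sum>i<N. spec (P i) v * monom (B i v) i)"
      by (simp add: poly_eq_poly_eq_iff[symmetric] fun_eq_iff)
    then have "coeff (monom (B N v) N) N = coeff (\<Sum>i<N. spec (P i) v * monom (B i v) i) N" by simp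
    also have "\<dots> = (\<Sum>i<N. coeff (spec (P i) v * monom (B i v) i) N)" by (rule coeff_sum)
    also have "\<dots> = (\<Sum>i<N. q i v * B i v)"
    proof (rule sum.cong[OF refl])
      fix i assume "i \<in> {..<N}"
      then have "coeff (monom (B i v) i * spec (P i) v) N = B i v * q i v"
        by (simp add: coeff_monom_mult q_def)
      then show "coeff (spec (P i) v * monom (B i v) i) N = q i v * B i v"
        by (simp only: mult.commute)
    qed
    finally show ?thesis by simp
  qed
  have q0: "q i (\<sigma> a) = 0" if "i < N" for i
  proof -
    have "poly (spec (P i) (\<sigma> a)) s = poly [:Q i (\<sigma> a):] s" for s
    proof -
      have "poly (spec (P i) (\<sigma> a)) s = Q i (\<lambda>k. if k < n then \<sigma> a k else s * \<sigma> a k)" using P(2) by simp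
      also have "\<dots> = Q i (\<sigma> a)" by (intro arg_cong[where f="Q i"]) (auto simp: \<sigma>_def)
      finally show ?thesis by simp
    qed
    then have "spec (P i) (\<sigma> a) = [:Q i (\<sigma> a):]" by (simp add: poly_eq_poly_eq_iff[symmetric] fun_eq_iff)
    then show ?thesis using that unfolding q_def by (simp add: coeff_pCons split: nat.split)
  qed
  define r where "r = (\<lambda>i x. q i (\<sigma> x))"
  have rS: "r i \<in> ?S" for i
    unfolding r_def
  proof (rule polyfuns_compose[OF qT, where g = "\<lambda>i x. \<sigma> x i"])
    show "(\<lambda>x. \<sigma> x k) \<in> ?S" if "k \<in> {..<n + n}" for k
      unfolding \<sigma>_def using that by (cases "k < n") (auto intro!: polyfuns_diff intro: polyfuns.intros)
  qed
  define w where "w = 1 - (\<Sum>i<N. r i)"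
  have wS: "w \<in> ?S"
    unfolding w_def by (intro is_subringD(2,4)[OF polyfuns_subring] is_subring_sum[OF polyfuns_subring] rS)
  have "w a = 1" unfolding w_def r_def using q0 by simp
  moreover have "w * b \<in> J"
  proof -
    have hN: "h N = (\<Sum>i<N. r i * h i)"
      using BN B(2) unfolding r_def by (intro ext) (metis (no_types, lifting) sum.cong sum_fun_apply times_fun_apply)
    have "w * b = (b - h N) - (\<Sum>i<N. r i * (b - h i))"
      unfolding w_def
      by (simp add: left_diff_distrib right_diff_distrib sum_subtractf sum_distrib_right hN[symmetric])
    moreover have "\<dots> \<in> J"
      by (intro is_ideal_diff[OF polyfuns_subring J] is_ideal_sum[OF J] is_idealD(4)[OF J] h(2) rS)
    ultimately show ?thesis by simp
  qed
  ultimately show ?thesis using wS by blast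
qed

section \<open>Strict differentiability\<close>

definition linear_within ::
    "nat \<Rightarrow> ((nat \<Rightarrow> 'a::linordered_field) \<Rightarrow> 'a) \<Rightarrow> (nat \<Rightarrow> 'a) \<Rightarrow> (nat \<Rightarrow> 'a) \<Rightarrow> 'a \<Rightarrow> 'a \<Rightarrow> bool" where
  "linear_within n f a g e d \<longleftrightarrow> (\<forall>x y r. in_box n d a x \<longrightarrow> in_box n d a y \<longrightarrow> in_box n r y x \<longrightarrow>
     0 \<le> r \<longrightarrow> \<bar>f x - f y - (\<Sum>i<n. g i * (x i - y i))\<bar> \<le> e * r)"

definition has_gradient :: "nat \<Rightarrow> ((nat \<Rightarrow> 'a::linordered_field) \<Rightarrow> 'a) \<Rightarrow> (nat \<Rightarrow> 'a) \<Rightarrow> (nat \<Rightarrow> 'a) \<Rightarrow> bool" where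
  "has_gradient n f a g \<longleftrightarrow> (\<forall>e>0. \<exists>d>0. linear_within n f a g e d)"

lemma linear_withinD:
  assumes "linear_within n f a g e d" "in_box n d a x" "in_box n d a y" "in_box n r y x" "0 \<le> r"
  shows "\<bar>f x - f y - (\<Sum>i<n. g i * (x i - y i))\<bar> \<le> e * r"
  using assms unfolding linear_within_def by blast

lemma has_gradientE:
  assumes "has_gradient n f a g" "0 < e"
  obtains d where "d > 0" "linear_within n f a g e d"
  using assms unfolding has_gradient_def by blast

lemma abs_sum_mult_le:
  fixes g :: "nat \<Rightarrow> 'a::linordered_field"
  assumes "\<And>i. i < n \<Longrightarrow> \<bar>u i\<bar> \<le> r" shows "\<bar>\<Sum>i<n. g i * u i\<bar> \<le> (\<Sum>i<n. \<bar>g i\<bar>) * r"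
proof -
  have "\<bar>\<Sum>i<n. g i * u i\<bar> \<le> (\<Sum>i<n. \<bar>g i * u i\<bar>)" by (rule sum_abs)
  also have "\<dots> \<le> (\<Sum>i<n. \<bar>g i\<bar> * r)"
    unfolding abs_mult using assms by (intro sum_mono mult_left_mono) auto
  finally show ?thesis by (simp add: sum_distrib_right)
qed

lemma has_gradient_const: "has_gradient n (\<lambda>x. c) a (\<lambda>_. 0)"
  unfolding has_gradient_def linear_within_def by (auto intro!: exI[of _ 1])

lemma has_gradient_var: "i < n \<Longrightarrow> has_gradient n (\<lambda>x. x i) a (\<lambda>j. if j = i then 1 else 0)"
  unfolding has_gradient_def linear_within_def by (auto intro!: exI[of _ 1] simp: if_distrib[of "\<lambda>t. t * _"] cong: if_cong)

lemma has_gradient_add: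
  assumes "has_gradient n f a g" "has_gradient n f' a g'"
  shows "has_gradient n (\<lambda>x. f x + f' x) a (\<lambda>i. g i + g' i)"
  unfolding has_gradient_def
proof (intro allI impI)
  fix e :: 'a assume "e > 0"
  then have e: "e / 2 > 0" by simp
  obtain d where d0: "d > 0" and dl: "linear_within n f a g (e / 2) d"
    by (rule has_gradientE[OF assms(1) e])
  note d = d0 linear_withinD[OF dl]
  obtain d' where d'0: "d' > 0" and d'l: "linear_within n f' a g' (e / 2) d'"
    by (rule has_gradientE[OF assms(2) e])
  note d' = d'0 linear_withinD[OF d'l]
  have "\<bar>(f x + f' x) - (f y + f' y) - (\<Sum>i<n. (g i + g' i) * (x i - y i))\<bar> \<le> e * r"
    if x: "in_box n (min d d') a x" "in_box n (min d d') a y" "in_box n r y x" "0 \<le> r" for x y r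
  proof -
    have 1: "\<bar>f x - f y - (\<Sum>i<n. g i * (x i - y i))\<bar> \<le> e / 2 * r"
      using d(2)[OF in_box_mono[OF x(1)] in_box_mono[OF x(2)] x(3,4)] by simp
    have 2: "\<bar>f' x - f' y - (\<Sum>i<n. g' i * (x i - y i))\<bar> \<le> e / 2 * r"
      using d'(2)[OF in_box_mono[OF x(1)] in_box_mono[OF x(2)] x(3,4)] by simp
    have eq: "(f x + f' x) - (f y + f' y) - (\<Sum>i<n. (g i + g' i) * (x i - y i))
      = (f x - f y - (\<Sum>i<n. g i * (x i - y i))) + (f' x - f' y - (\<Sum>i<n. g' i * (x i - y i)))"
      by (simp add: distrib_right sum.distrib)
    have "\<bar>(f x + f' x) - (f y + f' y) - (\<Sum>i<n. (g i + g' i) * (x i - y i))\<bar> \<le> e / 2 * r + e / 2 * r"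
      unfolding eq by (rule order_trans[OF abs_triangle_ineq add_mono[OF 1 2]])
    then show ?thesis by (simp add: field_simps)
  qed
  then show "\<exists>d>0. linear_within n (\<lambda>x. f x + f' x) a (\<lambda>i. g i + g' i) e d"
    using d(1) d'(1) unfolding linear_within_def by (intro exI[of _ "min d d'"] conjI allI impI) auto
qed

lemma has_gradient_mult:
  fixes f h :: "(nat \<Rightarrow> 'a::linordered_field) \<Rightarrow> 'a"
  assumes f: "has_gradient n f a f'" "f \<in> polyfuns {..<n}" and h: "has_gradient n h a h'" "h \<in> polyfuns {..<n}"
  shows "has_gradient n (\<lambda>x. f x * h x) a (\<lambda>i. f a * h' i + h a * f' i)"
  unfolding has_gradient_def
proof (intro allI impI)
  fix e :: 'a assume e: "e > 0"
  obtain C0 where C0: "C0 > 0" "\<And>x. in_box n 1 a x \<Longrightarrow> \<bar>f x\<bar> \<le> C0" using polyfuns_bounded[OF f(2)] by blast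
  obtain C1 where C1: "C1 > 0" "\<And>x. in_box n 1 a x \<Longrightarrow> \<bar>h x\<bar> \<le> C1" using polyfuns_bounded[OF h(2)] by blast
  define C where "C = C0 + C1"
  have C: "C > 0" "\<And>x. in_box n 1 a x \<Longrightarrow> \<bar>f x\<bar> \<le> C" "\<And>x. in_box n 1 a x \<Longrightarrow> \<bar>h x\<bar> \<le> C"
    using C0 C1 unfolding C_def by (auto simp: add_increasing add_increasing2)
  define M where "M = (\<Sum>i<n. \<bar>f' i\<bar>) + (\<Sum>i<n. \<bar>h' i\<bar>) + 1"
  have Mpos: "M > 0" unfolding M_def by (intro add_nonneg_pos add_nonneg_nonneg sum_nonneg) auto
  have Mle: "(\<Sum>i<n. \<bar>f' i\<bar>) \<le> M" "(\<Sum>i<n. \<bar>h' i\<bar>) \<le> M"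
    unfolding M_def by (simp_all add: add_increasing add_increasing2 sum_nonneg)
  define e1 where "e1 = e / (4 * C)"
  define e2 where "e2 = e / (4 * M)"
  have e12: "e1 > 0" "e2 > 0" using e C Mpos unfolding e1_def e2_def by auto
  obtain d1 where d10: "d1 > 0" and d1l: "linear_within n f a f' e1 d1"
    by (rule has_gradientE[OF f(1) e12(1)])
  note d1 = d10 linear_withinD[OF d1l]
  obtain d2 where d20: "d2 > 0" and d2l: "linear_within n h a h' e1 d2"
    by (rule has_gradientE[OF h(1) e12(1)])
  note d2 = d20 linear_withinD[OF d2l]
  obtain d3 where d3: "d3 > 0" "\<And>x. in_box n d3 a x \<Longrightarrow> \<bar>f x - f a\<bar> \<le> e2"
    using polyfuns_continuous[OF f(2) e12(2)] by blast
  obtain d4 where d4: "d4 > 0" "\<And>x. in_box n d4 a x \<Longrightarrow> \<bar>h x - h a\<bar> \<le> e2"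
    using polyfuns_continuous[OF h(2) e12(2)] by blast
  define d where "d = min 1 (min (min d1 d2) (min d3 d4))"
  have d: "d > 0" "d \<le> 1" "d \<le> d1" "d \<le> d2" "d \<le> d3" "d \<le> d4"
    using d1(1) d2(1) d3(1) d4(1) unfolding d_def by auto
  have "\<bar>f x * h x - f y * h y - (\<Sum>i<n. (f a * h' i + h a * f' i) * (x i - y i))\<bar> \<le> e * r"
    if x: "in_box n d a x" "in_box n d a y" "in_box n r y x" "0 \<le> r" for x y r
  proof -
    define A where "A = f x - f y - (\<Sum>i<n. f' i * (x i - y i))"
    define B where "B = h x - h y - (\<Sum>i<n. h' i * (x i - y i))"
    define L where "L = (\<Sum>i<n. f' i * (x i - y i))"
    define K where "K = (\<Sum>i<n. h' i * (x i - y i))"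
    have xy: "\<bar>x i - y i\<bar> \<le> r" if "i < n" for i using x(3) that unfolding in_box_def by blast
    have bA: "\<bar>A\<bar> \<le> e1 * r" unfolding A_def using d1(2)[OF in_box_mono[OF x(1)] in_box_mono[OF x(2)] x(3,4)] d by blast
    have bB: "\<bar>B\<bar> \<le> e1 * r" unfolding B_def using d2(2)[OF in_box_mono[OF x(1)] in_box_mono[OF x(2)] x(3,4)] d by blast
    have bL: "\<bar>L\<bar> \<le> M * r" unfolding L_def
      using abs_sum_mult_le[of n "\<lambda>i. x i - y i" r f'] xy mult_right_mono[OF Mle(1) x(4)] by (meson order_trans)
    have bK: "\<bar>K\<bar> \<le> M * r" unfolding K_def
      using abs_sum_mult_le[of n "\<lambda>i. x i - y i" r h'] xy mult_right_mono[OF Mle(2) x(4)] by (meson order_trans)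
    have bf: "\<bar>f y\<bar> \<le> C" "\<bar>f y - f a\<bar> \<le> e2" using C(2) d3(2) in_box_mono[OF x(2)] d by blast+
    have bh: "\<bar>h x\<bar> \<le> C" "\<bar>h x - h a\<bar> \<le> e2" using C(3) d4(2) in_box_mono[OF x(1)] d by blast+
    have eq0: "f x = f y + L + A" "h y = h x - K - B" unfolding A_def B_def L_def K_def by simp_all
    have "(\<Sum>i<n. (f a * h' i + h a * f' i) * (x i - y i)) = f a * K + h a * L"
      unfolding K_def L_def sum_distrib_left sum.distrib[symmetric]
      by (rule sum.cong) (auto simp: algebra_simps)
    then have eq: "f x * h x - f y * h y - (\<Sum>i<n. (f a * h' i + h a * f' i) * (x i - y i))
        = (A * h x + L * (h x - h a)) + (f y * B + (f y - f a) * K)"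
      unfolding eq0 by (simp add: algebra_simps)
    have t1: "\<bar>A * h x\<bar> \<le> (e1 * r) * C" unfolding abs_mult using bA bh e12 x(4) by (intro mult_mono) auto
    have t2: "\<bar>L * (h x - h a)\<bar> \<le> (M * r) * e2" unfolding abs_mult using bL bh Mpos x(4) by (intro mult_mono) auto
    have t3: "\<bar>f y * B\<bar> \<le> C * (e1 * r)" unfolding abs_mult using bB bf C(1) by (intro mult_mono) auto
    have t4: "\<bar>(f y - f a) * K\<bar> \<le> e2 * (M * r)" unfolding abs_mult using bK bf e12 by (intro mult_mono) auto
    have "\<bar>f x * h x - f y * h y - (\<Sum>i<n. (f a * h' i + h a * f' i) * (x i - y i))\<bar>
        \<le> ((e1 * r) * C + (M * r) * e2) + (C * (e1 * r) + e2 * (M * r))"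
      unfolding eq
      by (rule order_trans[OF abs_triangle_ineq add_mono[OF
          order_trans[OF abs_triangle_ineq add_mono[OF t1 t2]] order_trans[OF abs_triangle_ineq add_mono[OF t3 t4]]]])
    also have "\<dots> = e * r" using C(1) Mpos unfolding e1_def e2_def by (simp add: field_simps)
    finally show ?thesis .
  qed
  then show "\<exists>d>0. linear_within n (\<lambda>x. f x * h x) a (\<lambda>i. f a * h' i + h a * f' i) e d"
    using d(1) unfolding linear_within_def by (intro exI[of _ d] conjI allI impI)
qed

lemma has_gradient_unique:
  assumes "has_gradient n f a g" "has_gradient n f a h" "i < n" shows "g i = h i"
proof (rule ccontr)
  assume "g i \<noteq> h i"
  define e where "e = \<bar>g i - h i\<bar> / 3"
  have e: "e > 0" using \<open>g i \<noteq> h i\<close> unfolding e_def by simp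
  obtain d1 where d10: "d1 > 0" and d1l: "linear_within n f a g e d1"
    by (rule has_gradientE[OF assms(1) e])
  note d1 = d10 linear_withinD[OF d1l]
  obtain d2 where d20: "d2 > 0" and d2l: "linear_within n f a h e d2"
    by (rule has_gradientE[OF assms(2) e])
  note d2 = d20 linear_withinD[OF d2l]
  define r where "r = min d1 d2"
  define x where "x = a(i := a i + r)"
  have r: "r > 0" "r \<le> d1" "r \<le> d2" using d1(1) d2(1) unfolding r_def by auto
  have boxes: "in_box n r a x" "in_box n r a a" using r unfolding in_box_def x_def by auto
  have s: "(\<Sum>j<n. k j * (x j - a j)) = k i * r" for k :: "nat \<Rightarrow> 'a"
  proof -
    have "(\<Sum>j<n. k j * (x j - a j)) = (\<Sum>j\<in>{i}. k j * (x j - a j))"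
      using assms(3) by (intro sum.mono_neutral_right) (auto simp: x_def)
    then show ?thesis by (simp add: x_def)
  qed
  have "\<bar>f x - f a - g i * r\<bar> \<le> e * r"
    using d1(2)[OF in_box_mono[OF boxes(1) r(2)] in_box_mono[OF boxes(2) r(2)] boxes(1)] r s by simp
  moreover have "\<bar>f x - f a - h i * r\<bar> \<le> e * r"
    using d2(2)[OF in_box_mono[OF boxes(1) r(3)] in_box_mono[OF boxes(2) r(3)] boxes(1)] r s by simp
  ultimately have "\<bar>(f x - f a - h i * r) - (f x - f a - g i * r)\<bar> \<le> e * r + e * r"
    by (intro order_trans[OF abs_triangle_ineq4 add_mono])
  then have "\<bar>(g i - h i) * r\<bar> \<le> 2 * e * r" by (simp add: algebra_simps)
  then have "\<bar>g i - h i\<bar> \<le> 2 * e" using r(1) by (simp add: abs_mult)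
  then show False using e unfolding e_def by simp
qed

lemma polyfuns_has_gradient:
  fixes f :: "(nat \<Rightarrow> 'a::linordered_field) \<Rightarrow> 'a"
  assumes "f \<in> polyfuns B" "B \<subseteq> {..<n}"
  shows "\<exists>g. has_gradient n f a g \<and> (\<forall>i. i \<notin> B \<longrightarrow> g i = 0) \<and>
    f - (\<lambda>_. f a) - (\<Sum>i<n. (\<lambda>x. g i * (x i - a i))) \<in> ideal_power n a 2"
  using assms
proof (induction rule: polyfuns.induct)
  case (polyfuns_const c)
  have eq: "(\<lambda>x. c) - (\<lambda>_. c) - (\<Sum>i<n. (\<lambda>x. 0 * (x i - a i))) = 0" by (auto simp: fun_eq_iff)
  have "(\<lambda>x. c) - (\<lambda>_. c) - (\<Sum>i<n. (\<lambda>x. 0 * (x i - a i))) \<in> ideal_power n a 2"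
    unfolding eq by (rule ideal_powerD(2))
  then show ?case using has_gradient_const[of n c a] by (intro exI[of _ "\<lambda>_. 0"] conjI) blast+
next
  case (polyfuns_var i)
  then have i: "i < n" by auto
  have eq: "(\<lambda>x. x i) - (\<lambda>_. a i) - (\<Sum>j<n. (\<lambda>x. (if j = i then 1 else 0) * (x j - a j))) = 0"
    using i by (auto simp: fun_eq_iff if_distrib[of "\<lambda>t. t * _"] cong: if_cong)
  have "(\<lambda>x. x i) - (\<lambda>_. a i) - (\<Sum>j<n. (\<lambda>x. (if j = i then 1 else 0) * (x j - a j))) \<in> ideal_power n a 2"
    unfolding eq by (rule ideal_powerD(2))
  moreover have "\<forall>j. j \<notin> B \<longrightarrow> (if j = i then 1 else 0) = (0 :: 'a)" using polyfuns_var by auto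
  ultimately show ?case using has_gradient_var[OF i, of a]
    by (intro exI[of _ "\<lambda>j. if j = i then 1 else 0"] conjI)
next
  case (polyfuns_add f h)
  obtain f' where f': "has_gradient n f a f'" "\<And>i. i \<notin> B \<Longrightarrow> f' i = 0"
    "f - (\<lambda>_. f a) - (\<Sum>i<n. (\<lambda>x. f' i * (x i - a i))) \<in> ideal_power n a 2" using polyfuns_add by blast
  obtain h' where h': "has_gradient n h a h'" "\<And>i. i \<notin> B \<Longrightarrow> h' i = 0"
    "h - (\<lambda>_. h a) - (\<Sum>i<n. (\<lambda>x. h' i * (x i - a i))) \<in> ideal_power n a 2" using polyfuns_add by blast
  have eq: "(\<lambda>x. f x + h x) - (\<lambda>_. f a + h a) - (\<Sum>i<n. (\<lambda>x. (f' i + h' i) * (x i - a i)))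
      = (f - (\<lambda>_. f a) - (\<Sum>i<n. (\<lambda>x. f' i * (x i - a i)))) + (h - (\<lambda>_. h a) - (\<Sum>i<n. (\<lambda>x. h' i * (x i - a i))))"
    by (auto simp: fun_eq_iff distrib_right sum.distrib)
  have "(\<lambda>x. f x + h x) - (\<lambda>_. f a + h a) - (\<Sum>i<n. (\<lambda>x. (f' i + h' i) * (x i - a i))) \<in> ideal_power n a 2"
    unfolding eq by (rule ideal_powerD(3)[OF f'(3) h'(3)])
  moreover have "\<forall>i. i \<notin> B \<longrightarrow> f' i + h' i = 0" using f'(2) h'(2) by simp
  ultimately show ?case using has_gradient_add[OF f'(1) h'(1)]
    by (intro exI[of _ "\<lambda>i. f' i + h' i"] conjI)
next
  case (polyfuns_mult f h)
  have fS: "f \<in> polyfuns {..<n}" "h \<in> polyfuns {..<n}" using polyfuns_mult polyfuns_mono by blast+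
  obtain f' where f': "has_gradient n f a f'" "\<And>i. i \<notin> B \<Longrightarrow> f' i = 0"
    "f - (\<lambda>_. f a) - (\<Sum>i<n. (\<lambda>x. f' i * (x i - a i))) \<in> ideal_power n a 2" using polyfuns_mult by blast
  obtain h' where h': "has_gradient n h a h'" "\<And>i. i \<notin> B \<Longrightarrow> h' i = 0"
    "h - (\<lambda>_. h a) - (\<Sum>i<n. (\<lambda>x. h' i * (x i - a i))) \<in> ideal_power n a 2" using polyfuns_mult by blast
  define L where "L = (\<Sum>i<n. (\<lambda>x. f' i * (x i - a i)))"
  define K where "K = (\<Sum>i<n. (\<lambda>x. h' i * (x i - a i)))"
  have lin: "(\<Sum>i<n. (\<lambda>x. g i * (x i - a i))) \<in> ideal_power n a 1" for g
  proof -
    have "(\<lambda>x. g i * (x i - a i)) = (\<lambda>x. x i - a i) * (\<lambda>_. g i)" for i by (auto simp: fun_eq_iff)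
    moreover have "(\<lambda>_. g i) \<in> polyfuns {..<n}" for i by (rule polyfuns.intros)
    ultimately have "\<exists>g'. (\<Sum>i<n. (\<lambda>x. g i * (x i - a i))) = (\<Sum>i<n. (\<lambda>x. x i - a i) * g' i) \<and>
        (\<forall>i. g' i \<in> polyfuns {..<n})" by (intro exI[of _ "\<lambda>i _. g i"]) simp
    then show ?thesis by (auto simp: One_nat_def)
  qed
  have LK: "L * K \<in> ideal_power n a 2"
    using ideal_power_mult[OF lin lin, of f' h'] unfolding L_def K_def by (simp add: numeral_2_eq_2)
  have c: "(\<lambda>_. c) \<in> polyfuns {..<n}" for c :: 'a by (rule polyfuns.intros)
  define F where "F = f - (\<lambda>_. f a) - L"
  define H where "H = h - (\<lambda>_. h a) - K"
  have F: "F \<in> ideal_power n a 2" and H: "H \<in> ideal_power n a 2"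
    using f'(3) h'(3) unfolding F_def H_def L_def K_def by auto
  have Kp: "K \<in> polyfuns {..<n}" using lin[of h'] ideal_powerD(1) unfolding K_def by blast
  have e0: "(\<Sum>i<n. (\<lambda>x. (f a * h' i + h a * f' i) * (x i - a i))) = (\<lambda>_. f a) * K + (\<lambda>_. h a) * L"
    unfolding K_def L_def sum_distrib_left sum.distrib[symmetric]
    by (rule sum.cong) (auto simp: fun_eq_iff algebra_simps)
  have "(\<lambda>x. f x * h x) - (\<lambda>_. f a * h a) - (\<Sum>i<n. (\<lambda>x. (f a * h' i + h a * f' i) * (x i - a i)))
      = (h * F + L * K) + (L * H + (\<lambda>_. f a) * H)"
    unfolding e0 F_def H_def by (auto simp: fun_eq_iff algebra_simps)
  moreover have "\<dots> \<in> ideal_power n a 2"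
  proof (intro ideal_powerD(3))
    show "h * F \<in> ideal_power n a 2" using ideal_powerD(4)[OF fS(2) F] .
    show "L * K \<in> ideal_power n a 2" by (rule LK)
    show "L * H \<in> ideal_power n a 2" using ideal_powerD(4)[OF _ H] lin[of f'] ideal_powerD(1) unfolding L_def by blast
    show "(\<lambda>_. f a) * H \<in> ideal_power n a 2" using ideal_powerD(4)[OF c H] .
  qed
  ultimately have "(\<lambda>x. f x * h x) - (\<lambda>_. f a * h a) - (\<Sum>i<n. (\<lambda>x. (f a * h' i + h a * f' i) * (x i - a i))) \<in> ideal_power n a 2"
    by (simp only:)
  moreover have "\<forall>i. i \<notin> B \<longrightarrow> f a * h' i + h a * f' i = 0" using f'(2) h'(2) by simp
  ultimately show ?case using has_gradient_mult[OF f'(1) fS(1) h'(1) fS(2)]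
    by (intro exI[of _ "\<lambda>i. f a * h' i + h a * f' i"] conjI)
qed

section \<open>Branches through a point with independent gradients\<close>

lemma linear_within_mono: "linear_within n f a g e d \<Longrightarrow> d' \<le> d \<Longrightarrow> linear_within n f a g e d'"
  unfolding linear_within_def using in_box_mono by blast

lemma ex_common_radius:
  fixes P :: "'i \<Rightarrow> 'a::linordered_field \<Rightarrow> bool"
  assumes "finite I" "\<And>i. i \<in> I \<Longrightarrow> \<exists>d>0. P i d" "\<And>i d d'. P i d \<Longrightarrow> d' \<le> d \<Longrightarrow> P i d'"
  shows "\<exists>d>0. \<forall>i\<in>I. P i d"
  using assms(1,2)
proof (induction I rule: finite_induct)
  case empty
  show ?case by (intro exI[of _ 1]) auto
next
  case (insert j I)
  then obtain d where d: "d > 0" "\<forall>i\<in>I. P i d" by auto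
  obtain d' where d': "d' > 0" "P j d'" using insert.prems by auto
  have "P i (min d d')" if "i \<in> insert j I" for i
    using that d(2) d'(2) assms(3)[of i d "min d d'"] assms(3)[of j d' "min d d'"] by auto
  then show ?case using d(1) d'(1) by (intro exI[of _ "min d d'"]) auto
qed

lemma ex_max_abs:
  fixes v :: "nat \<Rightarrow> 'a::linordered_field"
  assumes "n > 0" shows "\<exists>i<n. \<forall>j<n. \<bar>v j\<bar> \<le> \<bar>v i\<bar>"
proof -
  have "Max ((\<lambda>i. \<bar>v i\<bar>) ` {..<n}) \<in> (\<lambda>i. \<bar>v i\<bar>) ` {..<n}" using assms by (intro Max_in) auto
  then obtain i where i: "i < n" "\<bar>v i\<bar> = Max ((\<lambda>i. \<bar>v i\<bar>) ` {..<n})" by auto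
  have "\<bar>v j\<bar> \<le> \<bar>v i\<bar>" if "j < n" for j unfolding i(2) using that by (intro Max_ge) auto
  then show ?thesis using i(1) by blast
qed

lemma polyfuns_common_nonzero:
  fixes f g :: "(nat \<Rightarrow> 'a::linordered_field) \<Rightarrow> 'a"
  assumes "f \<in> polyfuns A" "g \<in> polyfuns A" "f u \<noteq> 0" "g v \<noteq> 0"
  shows "\<exists>t. f t \<noteq> 0 \<and> g t \<noteq> 0"
proof -
  have line: "\<exists>p. \<forall>s. h (\<lambda>i. u i + s * (v i - u i)) = poly p s" if "h \<in> polyfuns A" for h
  proof -
    have "(\<lambda>x. h (\<lambda>i. u i + x 0 * (v i - u i))) \<in> polyfuns {0}"
      by (rule polyfuns_compose[OF that]) (auto intro!: polyfuns.intros)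
    from polyfuns_univariate[OF this, of 0] obtain P where P: "ppoly_over (polyfuns ({0} - {0})) P"
      "\<And>x. h (\<lambda>i. u i + x 0 * (v i - u i)) = poly (spec P x) (x 0)" by blast
    have "snd P i x = snd P i y" for i x y
      by (rule polyfuns_cong[of _ "{0} - {0}"]) (use P(1) in \<open>auto simp: ppoly_over_def\<close>)
    then have "spec P x = spec P (\<lambda>_. 0)" for x unfolding spec_def by metis
    then have "h (\<lambda>i. u i + s * (v i - u i)) = poly (spec P (\<lambda>_. 0)) s" for s
      using P(2)[of "\<lambda>_. s"] by metis
    then show ?thesis by blast
  qed
  obtain p where p: "\<And>s. f (\<lambda>i. u i + s * (v i - u i)) = poly p s" using line[OF assms(1)] by blast
  obtain p' where p': "\<And>s. g (\<lambda>i. u i + s * (v i - u i)) = poly p' s" using line[OF assms(2)] by blast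
  have "p \<noteq> 0" "p' \<noteq> 0" using p[of 0] p'[of 1] assms(3,4) by auto
  then have "finite ({s. poly p s = 0} \<union> {s. poly p' s = 0})" using poly_roots_finite by blast
  then obtain s where "s \<notin> {s. poly p s = 0} \<union> {s. poly p' s = 0}"
    using ex_new_if_finite[OF infinite_UNIV_char_0] by blast
  then show ?thesis using p p' by (intro exI[of _ "\<lambda>i. u i + s * (v i - u i)"]) auto
qed

lemma ex_kernel_vector:
  fixes c :: "'i \<Rightarrow> 'p \<Rightarrow> 'a::field"
  assumes "finite P" "finite I" "card P < card I"
  shows "\<exists>l. (\<exists>i\<in>I. l i \<noteq> 0) \<and> (\<forall>p\<in>P. (\<Sum>i\<in>I. l i * c i p) = 0)"
  using assms
proof (induction P arbitrary: I c rule: finite_induct)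
  case empty
  then have "I \<noteq> {}" by auto
  then show ?case by (intro exI[of _ "\<lambda>_. 1"]) auto
next
  case (insert p P)
  show ?case
  proof (cases "\<forall>i\<in>I. c i p = 0")
    case True
    have "card P < card I" using insert by simp
    then obtain l where l: "\<exists>i\<in>I. l i \<noteq> 0" "\<forall>p\<in>P. (\<Sum>i\<in>I. l i * c i p) = 0"
      using insert.IH[OF insert.prems(1)] by blast
    then show ?thesis using True by (intro exI[of _ l]) auto
  next
    case False
    then obtain k where k: "k \<in> I" "c k p \<noteq> 0" by blast
    define c' where "c' = (\<lambda>i q. c i q - c i p / c k p * c k q)"
    have "card P < card (I - {k})" using insert k by simp
    then obtain l where l: "\<exists>i\<in>I - {k}. l i \<noteq> 0" "\<forall>q\<in>P. (\<Sum>i\<in>I - {k}. l i * c' i q) = 0"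
      using insert.IH[of "I - {k}" c'] insert.prems(1) by blast
    define m where "m = l(k := - (\<Sum>i\<in>I - {k}. l i * (c i p / c k p)))"
    have m: "(\<Sum>i\<in>I. m i * c i q) = (\<Sum>i\<in>I - {k}. l i * c' i q)" for q
    proof -
      have "(\<Sum>i\<in>I. m i * c i q) = m k * c k q + (\<Sum>i\<in>I - {k}. m i * c i q)"
        using insert.prems(1) k(1) by (rule sum.remove)
      also have "(\<Sum>i\<in>I - {k}. m i * c i q) = (\<Sum>i\<in>I - {k}. l i * c i q)"
        by (rule sum.cong) (auto simp: m_def)
      also have "m k * c k q = - (\<Sum>i\<in>I - {k}. l i * (c i p / c k p) * c k q)"
        unfolding m_def by (simp add: sum_distrib_right)
      finally show ?thesis unfolding c'_def by (simp add: right_diff_distrib sum_subtractf mult.assoc)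
    qed
    have "(\<Sum>i\<in>I. m i * c i p) = 0" unfolding m c'_def using k(2) by simp
    moreover have "\<exists>i\<in>I. m i \<noteq> 0" using l(1) unfolding m_def by auto
    ultimately show ?thesis using m l(2) by (intro exI[of _ m]) auto
  qed
qed

locale regular_system =
  fixes n r :: nat and a :: "nat \<Rightarrow> 'a::real_closed_field" and q :: "nat \<Rightarrow> (nat \<Rightarrow> 'a) \<Rightarrow> 'a"
    and G B :: "nat \<Rightarrow> nat \<Rightarrow> 'a"
  assumes rn: "r \<le> n"
    and q_poly: "\<And>k. k < n \<Longrightarrow> q k \<in> polyfuns {..<n}"
    and q_grad: "\<And>k. k < n \<Longrightarrow> has_gradient n (q k) a (G k)"
    and q_zero: "\<And>k. k < n \<Longrightarrow> q k a = 0"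
    and BG: "\<And>i j. i < n \<Longrightarrow> j < n \<Longrightarrow> (\<Sum>k<n. B i k * G k j) = (if i = j then 1 else 0)"
    and GB: "\<And>i j. i < n \<Longrightarrow> j < n \<Longrightarrow> (\<Sum>k<n. G i k * B k j) = (if i = j then 1 else 0)"
begin

abbreviation "S \<equiv> polyfuns {..<n} :: ((nat \<Rightarrow> 'a) \<Rightarrow> 'a) set"

definition \<beta> where "\<beta> = (\<Sum>i<n. \<Sum>k<n. \<bar>B i k\<bar>) + 1"

lemma \<beta>_pos: "\<beta> > 0"
  unfolding \<beta>_def by (intro add_nonneg_pos sum_nonneg) auto

lemma B_row_le: "i < n \<Longrightarrow> (\<Sum>k<n. \<bar>B i k\<bar>) \<le> \<beta>"
proof -
  assume i: "i < n"
  have "(\<Sum>k<n. \<bar>B i k\<bar>) \<le> (\<Sum>i<n. \<Sum>k<n. \<bar>B i k\<bar>)"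
    using i by (intro member_le_sum) (auto intro: sum_nonneg)
  then show ?thesis unfolding \<beta>_def by simp
qed

lemma B_le: "i < n \<Longrightarrow> k < n \<Longrightarrow> \<bar>B i k\<bar> \<le> \<beta>"
proof -
  assume i: "i < n" "k < n"
  have "\<bar>B i k\<bar> \<le> (\<Sum>k<n. \<bar>B i k\<bar>)" using i by (intro member_le_sum) auto
  then show ?thesis using B_row_le[OF i(1)] by simp
qed

text \<open>Newton's method would need completeness. Instead the distance to the target is minimised over a
  box: at a minimum with nonzero residual \<open>v\<close> the step \<open>-v\<close> would improve it.\<close>

lemma solve_system:
  "\<exists>d0>0. \<forall>d t. 0 \<le> d \<longrightarrow> d \<le> d0 \<longrightarrow> (\<forall>k<n. \<bar>t k\<bar> \<le> d) \<longrightarrow>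
    (\<exists>x. (\<forall>k<n. q k x = t k) \<and> in_box n (2 * \<beta> * d) a x)"
proof (cases "n = 0")
  case True
  then show ?thesis by (intro exI[of _ 1]) (auto simp: in_box_def)
next
  case False
  then have n0: "n > 0" by simp
  define \<Phi> where "\<Phi> = (\<lambda>i x. \<Sum>k<n. B i k * q k x)"
  have \<Phi>S: "\<Phi> i \<in> S" for i unfolding \<Phi>_def by (intro polyfuns_sum polyfuns.intros q_poly) auto
  have \<Phi>a: "\<Phi> i a = 0" for i unfolding \<Phi>_def using q_zero by simp
  have gsum: "has_gradient n (\<lambda>x. \<Sum>k<m. B i k * q k x) a (\<lambda>j. \<Sum>k<m. B i k * G k j)" if "m \<le> n" for m i
    using that
  proof (induction m)
    case 0
    then show ?case using has_gradient_const[of n 0 a] by simp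
  next
    case (Suc m)
    have "has_gradient n (\<lambda>x. B i m * q m x) a (\<lambda>j. B i m * G m j + q m a * 0)"
      by (rule has_gradient_mult[OF has_gradient_const polyfuns_const q_grad q_poly]) (use Suc in auto)
    then show ?case using has_gradient_add[OF Suc.IH, of "\<lambda>x. B i m * q m x" "\<lambda>j. B i m * G m j"] Suc.prems by simp
  qed
  define e :: 'a where "e = 1 / (4 * (of_nat n + 1))"
  have np: "(of_nat n :: 'a) + 1 > 0" by (simp add: add_nonneg_pos)
  have e: "e > 0" "e \<le> 1 / 2" "of_nat n * e \<le> 1 / 4"
    using np unfolding e_def by (auto simp: field_simps)
  have "\<exists>d>0. \<forall>i\<in>{..<n}. linear_within n (\<Phi> i) a (\<lambda>j. \<Sum>k<n. B i k * G k j) e d"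
    by (rule ex_common_radius) (use gsum[OF order_refl] e(1) linear_within_mono in \<open>auto simp: has_gradient_def \<Phi>_def\<close>)
  then obtain d where d: "d > 0" "\<And>i. i < n \<Longrightarrow> linear_within n (\<Phi> i) a (\<lambda>j. \<Sum>k<n. B i k * G k j) e d" by blast
  have lin: "\<bar>\<Phi> i x - \<Phi> i y - (x i - y i)\<bar> \<le> e * s"
    if "i < n" "in_box n d a x" "in_box n d a y" "in_box n s y x" "0 \<le> s" for i x y s
  proof -
    have "(\<Sum>j<n. (\<Sum>k<n. B i k * G k j) * (x j - y j)) = (\<Sum>j<n. (if i = j then 1 else 0) * (x j - y j))"
      using BG[OF that(1)] by (intro sum.cong) auto
    also have "\<dots> = x i - y i" using that(1) by (simp add: if_distrib[of "\<lambda>t. t * _"] cong: if_cong)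
    finally show ?thesis using linear_withinD[OF d(2)[OF that(1)] that(2-5)] by simp
  qed
  have close: "in_box n (2 * M) a x" if x: "in_box n d a x" and M: "\<And>i. i < n \<Longrightarrow> \<bar>\<Phi> i x\<bar> \<le> M" for x M
  proof -
    obtain i where i: "i < n" "\<And>j. j < n \<Longrightarrow> \<bar>x j - a j\<bar> \<le> \<bar>x i - a i\<bar>"
      using ex_max_abs[OF n0, of "\<lambda>i. x i - a i"] by blast
    have "in_box n d a a" using d(1) unfolding in_box_def by simp
    then have "\<bar>\<Phi> i x - \<Phi> i a - (x i - a i)\<bar> \<le> e * \<bar>x i - a i\<bar>"
      using i by (intro lin[OF i(1) x]) (auto simp: in_box_def)
    also have "\<dots> \<le> 1 / 2 * \<bar>x i - a i\<bar>" using e by (intro mult_right_mono) auto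
    finally have "\<bar>\<Phi> i x - (x i - a i)\<bar> \<le> \<bar>x i - a i\<bar> / 2" using \<Phi>a by simp
    moreover have "\<bar>x i - a i\<bar> \<le> \<bar>\<Phi> i x\<bar> + \<bar>\<Phi> i x - (x i - a i)\<bar>" by (simp add: abs_if)
    ultimately have "\<bar>x i - a i\<bar> \<le> 2 * M" using M[OF i(1)] by (simp add: field_simps)
    then show ?thesis using i(2) unfolding in_box_def by (meson order_trans)
  qed
  define d0 where "d0 = d / (4 * (of_nat n + 1) * \<beta>)"
  have d0: "d0 > 0" using d(1) np \<beta>_pos unfolding d0_def by simp
  have "\<exists>x. (\<forall>k<n. q k x = t k) \<and> in_box n (2 * \<beta> * \<delta>) a x"
    if \<delta>: "0 \<le> \<delta>" "\<delta> \<le> d0" and t: "\<And>k. k < n \<Longrightarrow> \<bar>t k\<bar> \<le> \<delta>" for \<delta> t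
  proof -
    define y where "y = (\<lambda>i. \<Sum>k<n. B i k * t k)"
    define h where "h = \<beta> * \<delta>"
    have h0: "h \<ge> 0" unfolding h_def using \<beta>_pos \<delta> by simp
    have yle: "\<bar>y i\<bar> \<le> h" if "i < n" for i
    proof -
      have "\<bar>y i\<bar> \<le> (\<Sum>k<n. \<bar>B i k\<bar>) * \<delta>" unfolding y_def using t by (intro abs_sum_mult_le) auto
      also have "\<dots> \<le> \<beta> * \<delta>" using B_row_le[OF that] \<delta> by (intro mult_right_mono) auto
      finally show ?thesis unfolding h_def .
    qed
    have hd: "(of_nat n + 1) * h \<le> d / 4"
    proof -
      have "(of_nat n + 1) * h \<le> (of_nat n + 1) * (\<beta> * d0)"
        unfolding h_def using \<delta> \<beta>_pos np by (intro mult_left_mono) auto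
      also have "\<dots> = d / 4"
      proof -
        have "d0 * (4 * (of_nat n + 1) * \<beta>) = d" using \<beta>_pos np unfolding d0_def by simp
        then show ?thesis by (simp add: field_simps)
      qed
      finally show ?thesis .
    qed
    define H where "H = (\<lambda>x. \<Sum>i<n. (\<Phi> i x - y i) ^ 2)"
    have "H \<in> S" unfolding H_def by (intro polyfuns_sum polyfuns_power polyfuns_diff polyfuns_const \<Phi>S)
    then obtain x where x: "in_box n d a x" "\<And>x'. in_box n d a x' \<Longrightarrow> H x \<le> H x'"
      using polyfun_attains_min[of H n d a] d(1) by auto
    define v where "v = (\<lambda>i. \<Phi> i x - y i)"
    have vle: "\<bar>v i\<bar> \<le> of_nat n * h" if "i < n" for i
    proof -
      have "(v i)\<^sup>2 \<le> H x" unfolding H_def v_def using that by (intro member_le_sum) auto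
      also have "\<dots> \<le> H a" using d(1) by (intro x(2)) (simp add: in_box_def)
      also have "H a = (\<Sum>i<n. (y i)\<^sup>2)" unfolding H_def \<Phi>a by simp
      also have "\<dots> \<le> (\<Sum>i<n. h\<^sup>2)" using yle by (intro sum_mono) (metis abs_le_square_iff abs_of_nonneg h0 lessThan_iff)
      also have "\<dots> = of_nat n * h\<^sup>2" by simp
      also have "\<dots> \<le> (of_nat n * h)\<^sup>2"
      proof -
        have "(of_nat n :: 'a) * 1 \<le> of_nat n * of_nat n" using n0 by (intro mult_left_mono) auto
        then have "of_nat n * 1 * h\<^sup>2 \<le> of_nat n * of_nat n * h\<^sup>2" by (intro mult_right_mono) auto
        then show ?thesis by (simp add: power2_eq_square mult_ac)
      qed
      finally show ?thesis using h0 by (simp add: abs_le_square_iff[symmetric])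
    qed
    have "in_box n (2 * ((of_nat n + 1) * h)) a x"
    proof (rule close[OF x(1)])
      fix i assume i: "i < n"
      have "\<bar>\<Phi> i x\<bar> \<le> \<bar>v i\<bar> + \<bar>y i\<bar>" unfolding v_def by (simp add: abs_if)
      also have "\<dots> \<le> of_nat n * h + h" using vle[OF i] yle[OF i] by (rule add_mono)
      finally show "\<bar>\<Phi> i x\<bar> \<le> (of_nat n + 1) * h" by (simp add: algebra_simps)
    qed
    then have xd: "in_box n (d / 2) a x" using hd by (elim in_box_mono) (simp add: field_simps)
    have v0: "v i = 0" if "i < n" for i
    proof (rule ccontr)
      assume "v i \<noteq> 0"
      obtain m where m: "m < n" "\<And>j. j < n \<Longrightarrow> \<bar>v j\<bar> \<le> \<bar>v m\<bar>" using ex_max_abs[OF n0] by blast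
      have vm: "\<bar>v m\<bar> > 0" using m(2)[OF that] \<open>v i \<noteq> 0\<close> by auto
      define x' where "x' = (\<lambda>i. x i - v i)"
      have "in_box n d a x'"
        unfolding in_box_def
      proof (intro allI impI)
        fix j assume j: "j < n"
        have "\<bar>v j\<bar> \<le> d / 4"
        proof -
          have "of_nat n * h \<le> (of_nat n + 1) * h" using h0 by (intro mult_right_mono) auto
          then show ?thesis using vle[OF j] hd by simp
        qed
        moreover have "\<bar>x j - a j\<bar> \<le> d / 2" using xd j unfolding in_box_def by blast
        moreover have "\<bar>x' j - a j\<bar> \<le> \<bar>x j - a j\<bar> + \<bar>v j\<bar>" unfolding x'_def by (simp add: abs_if)
        ultimately show "\<bar>x' j - a j\<bar> \<le> d" using d(1) by (simp add: field_simps)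
      qed
      note x'd = this
      have "\<bar>\<Phi> j x' - y j\<bar> \<le> e * \<bar>v m\<bar>" if j: "j < n" for j
      proof -
        have "\<bar>\<Phi> j x' - \<Phi> j x - (x' j - x j)\<bar> \<le> e * \<bar>v m\<bar>"
          by (rule lin[OF j x'd x(1)]) (use m(2) in \<open>auto simp: in_box_def x'_def\<close>)
        moreover have "\<Phi> j x' - \<Phi> j x - (x' j - x j) = \<Phi> j x' - y j" unfolding x'_def v_def by simp
        ultimately show ?thesis by simp
      qed
      then have "H x' \<le> (\<Sum>j<n. (e * \<bar>v m\<bar>)\<^sup>2)"
        unfolding H_def using e(1) vm
        by (intro sum_mono) (metis abs_ge_zero abs_le_square_iff abs_of_nonneg lessThan_iff less_imp_le mult_nonneg_nonneg)
      also have "\<dots> = (of_nat n * e) * (e * \<bar>v m\<bar>\<^sup>2)" by (simp add: power2_eq_square mult_ac)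
      also have "\<dots> \<le> 1 / 4 * (1 / 2 * \<bar>v m\<bar>\<^sup>2)"
        using e by (intro mult_mono mult_right_mono) auto
      also have "\<dots> < \<bar>v m\<bar>\<^sup>2" using vm by simp
      also have "\<dots> = (v m)\<^sup>2" by simp
      also have "\<dots> \<le> H x" unfolding H_def v_def using m(1) by (intro member_le_sum) auto
      finally show False using x(2)[OF x'd] by simp
    qed
    have \<Phi>x: "\<Phi> i x = y i" if "i < n" for i using v0[OF that] unfolding v_def by simp
    have "q k x = t k" if k: "k < n" for k
    proof -
      have inv: "(\<Sum>i<n. G k i * (\<Sum>l<n. B i l * u l)) = u k" for u :: "nat \<Rightarrow> 'a"
      proof -
        have "(\<Sum>i<n. G k i * (\<Sum>l<n. B i l * u l)) = (\<Sum>i<n. \<Sum>l<n. G k i * B i l * u l)"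
          by (simp add: sum_distrib_left mult.assoc)
        also have "\<dots> = (\<Sum>l<n. (\<Sum>i<n. G k i * B i l) * u l)"
          by (subst sum.swap) (simp add: sum_distrib_right)
        also have "\<dots> = (\<Sum>l<n. (if k = l then 1 else 0) * u l)" using GB[OF k] by (intro sum.cong) auto
        also have "\<dots> = u k" using k by (simp add: if_distrib[of "\<lambda>t. t * _"] cong: if_cong)
        finally show ?thesis .
      qed
      have "q k x = (\<Sum>i<n. G k i * \<Phi> i x)" unfolding \<Phi>_def using inv[of "\<lambda>l. q l x"] by simp
      also have "\<dots> = (\<Sum>i<n. G k i * y i)" using \<Phi>x by simp
      also have "\<dots> = t k" unfolding y_def by (rule inv)
      finally show ?thesis .
    qed
    moreover have "in_box n (2 * h) a x" by (rule close[OF x(1)]) (use \<Phi>x yle in auto)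
    ultimately show ?thesis unfolding h_def by (intro exI[of _ x]) (auto simp: mult.assoc)
  qed
  then show ?thesis using d0 by (intro exI[of _ d0]) auto
qed

text \<open>Independence is witnessed at \<open>a\<close> by the inverse matrix \<open>B\<close>, and gradients of polynomials
  depend continuously on the point.\<close>

lemma gradients_independent_near:
  "\<exists>\<rho>>0. \<forall>x l g. in_box n \<rho> a x \<longrightarrow> (\<forall>k<r. has_gradient n (q k) x (g k)) \<longrightarrow>
     (\<forall>j<n. (\<Sum>k<r. l k * g k j) = 0) \<longrightarrow> (\<forall>k<r. l k = 0)"
proof -
  define e :: 'a where "e = 1 / (4 * (of_nat r + 1) * \<beta>)"
  have rp: "(of_nat r :: 'a) + 1 > 0" by (simp add: add_nonneg_pos)
  have e: "e > 0" using rp \<beta>_pos unfolding e_def by simp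
  have "\<exists>d>0. \<forall>k\<in>{..<r}. linear_within n (q k) a (G k) e d"
    by (rule ex_common_radius) (use q_grad rn e linear_within_mono in \<open>auto simp: has_gradient_def\<close>)
  then obtain d where d: "d > 0" "\<And>k. k < r \<Longrightarrow> linear_within n (q k) a (G k) e d" by blast
  have "l k = 0" if x: "in_box n (d / 2) a x" and g: "\<And>k. k < r \<Longrightarrow> has_gradient n (q k) x (g k)"
    and rel: "\<And>j. j < n \<Longrightarrow> (\<Sum>k<r. l k * g k j) = 0" and k: "k < r" for x l g k
  proof (rule ccontr)
    assume "l k \<noteq> 0"
    obtain m where m: "m < r" "\<And>j. j < r \<Longrightarrow> \<bar>l j\<bar> \<le> \<bar>l m\<bar>" using ex_max_abs[of r l] k by auto
    have lm: "\<bar>l m\<bar> > 0" using m(2)[OF k] \<open>l k \<noteq> 0\<close> by auto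
    have mn: "m < n" using m rn by simp
    have "\<exists>d>0. \<forall>k\<in>{..<r}. linear_within n (q k) x (g k) e d"
      by (rule ex_common_radius) (use g e linear_within_mono in \<open>auto simp: has_gradient_def\<close>)
    then obtain d' where d': "d' > 0" "\<And>k. k < r \<Longrightarrow> linear_within n (q k) x (g k) e d'" by blast
    define h where "h = min (d / 2) d' / \<beta>"
    have h: "h > 0" "h * \<beta> \<le> d / 2" "h * \<beta> \<le> d'" using d(1) d'(1) \<beta>_pos unfolding h_def by auto
    define x' where "x' = (\<lambda>j. x j + h * B j m)"
    have step: "in_box n (h * \<beta>) x x'"
      unfolding in_box_def x'_def using h(1) B_le[OF _ mn] by (auto simp: abs_mult)
    have x'd: "in_box n d a x'"
      unfolding in_box_def
    proof (intro allI impI)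
      fix j assume j: "j < n"
      have "\<bar>x' j - x j\<bar> \<le> d / 2" "\<bar>x j - a j\<bar> \<le> d / 2"
        using step x j h(2) unfolding in_box_def by (auto intro: order_trans)
      then have "\<bar>(x' j - x j) + (x j - a j)\<bar> \<le> d / 2 + d / 2" by (intro order_trans[OF abs_triangle_ineq add_mono])
      then show "\<bar>x' j - a j\<bar> \<le> d" by simp
    qed
    have xd: "in_box n d a x" by (rule in_box_mono[OF x]) (use d in simp)
    have near: "\<bar>(if k = m then 1 else 0) - (\<Sum>j<n. g k j * B j m)\<bar> \<le> 2 * e * \<beta>" if k: "k < r" for k
    proof -
      have lin: "(\<Sum>j<n. w j * (x' j - x j)) = h * (\<Sum>j<n. w j * B j m)" for w :: "nat \<Rightarrow> 'a"
        unfolding x'_def by (simp add: sum_distrib_left mult_ac)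
      have "k < n" using k rn by simp
      then have "(\<Sum>j<n. G k j * (x' j - x j)) = h * (if k = m then 1 else 0)" unfolding lin using GB mn by simp
      then have 1: "\<bar>q k x' - q k x - h * (if k = m then 1 else 0)\<bar> \<le> e * (h * \<beta>)"
        using linear_withinD[OF d(2)[OF k] x'd xd step] h \<beta>_pos by simp
      have 2: "\<bar>q k x' - q k x - h * (\<Sum>j<n. g k j * B j m)\<bar> \<le> e * (h * \<beta>)"
        using linear_withinD[OF d'(2)[OF k] in_box_mono[OF step h(3)] _ step] h \<beta>_pos d'(1)
        unfolding lin by (simp add: in_box_def)
      have "\<bar>(q k x' - q k x - h * (\<Sum>j<n. g k j * B j m)) - (q k x' - q k x - h * (if k = m then 1 else 0))\<bar>
          \<le> e * (h * \<beta>) + e * (h * \<beta>)"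
        by (rule order_trans[OF abs_triangle_ineq4 add_mono[OF 2 1]])
      then have "\<bar>h * ((if k = m then 1 else 0) - (\<Sum>j<n. g k j * B j m))\<bar> \<le> h * (2 * e * \<beta>)"
        by (simp add: algebra_simps)
      then show ?thesis using h(1) by (simp add: abs_mult)
    qed
    have "(\<Sum>k<r. l k * (\<Sum>j<n. g k j * B j m)) = (\<Sum>j<n. (\<Sum>k<r. l k * g k j) * B j m)"
      unfolding sum_distrib_left sum_distrib_right by (subst sum.swap) (simp add: mult.assoc)
    also have "\<dots> = 0" using rel by simp
    finally have z: "(\<Sum>k<r. l k * (\<Sum>j<n. g k j * B j m)) = 0" .
    have "l m = (\<Sum>k<r. l k * (if k = m then 1 else 0))"
      using m(1) by (simp add: if_distrib[of "\<lambda>t. _ * t"] cong: if_cong)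
    also have "\<dots> = (\<Sum>k<r. l k * ((if k = m then 1 else 0) - (\<Sum>j<n. g k j * B j m)))"
      using z by (simp add: right_diff_distrib sum_subtractf)
    finally have "\<bar>l m\<bar> \<le> (\<Sum>k<r. \<bar>l k\<bar>) * (2 * e * \<beta>)"
      using abs_sum_mult_le[of r "\<lambda>k. (if k = m then 1 else 0) - (\<Sum>j<n. g k j * B j m)" "2 * e * \<beta>" l] near by simp
    also have "\<dots> \<le> (of_nat r * \<bar>l m\<bar>) * (2 * e * \<beta>)"
      using sum_bounded_above[of "{..<r}" "\<lambda>k. \<bar>l k\<bar>" "\<bar>l m\<bar>"] m(2) e \<beta>_pos by (intro mult_right_mono) auto
    also have "\<dots> = (of_nat r * (2 * e * \<beta>)) * \<bar>l m\<bar>" by (simp only: mult_ac)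
    also have "\<dots> \<le> 1 / 2 * \<bar>l m\<bar>"
    proof (rule mult_right_mono)
      have "e * (4 * (of_nat r + 1) * \<beta>) = 1" using \<beta>_pos rp unfolding e_def by simp
      then have "(of_nat r + 1) * (2 * e * \<beta>) = 1 / 2" by (simp add: field_simps)
      moreover have "of_nat r * (2 * e * \<beta>) \<le> (of_nat r + 1) * (2 * e * \<beta>)"
        using e \<beta>_pos by (intro mult_right_mono) auto
      ultimately show "of_nat r * (2 * e * \<beta>) \<le> 1 / 2" by simp
    qed simp
    also have "\<dots> < \<bar>l m\<bar>" using lm by simp
    finally show False by simp
  qed
  then show ?thesis using d(1) by (intro exI[of _ "d / 2"]) auto
qed

end

context regular_system
begin

definition J where "J = ideal_gen S (q ` {..<r})"

definition on_branch where "on_branch x \<longleftrightarrow> (\<forall>k<r. q k x = 0)"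

lemma is_ideal_J: "is_ideal S J"
  unfolding J_def by (rule is_ideal_ideal_gen[OF polyfuns_subring]) (use q_poly rn in auto)

lemmas J_ideal = is_idealD[OF is_ideal_J]

lemma J_vanishes: "f \<in> J \<Longrightarrow> on_branch x \<Longrightarrow> f x = 0"
  unfolding J_def by (induction rule: ideal_gen.induct) (auto simp: on_branch_def)

lemma q_in_J: "k < r \<Longrightarrow> q k \<in> J"
  unfolding J_def by (rule ideal_gen_superset[OF polyfuns_subring]) auto

text \<open>The forms of degree \<open>k\<close> in \<open>q\<^sub>r, \<dots>, q\<^bsub>n-1\<^esub>\<close>, the local coordinates of the branch.\<close>

primrec tforms :: "nat \<Rightarrow> ((nat \<Rightarrow> 'a) \<Rightarrow> 'a) set" where
  "tforms 0 = {(\<lambda>t. c) | c. True}"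
| "tforms (Suc k) = {(\<lambda>t. \<Sum>j\<in>{r..<n}. t j * g j t) | g. \<forall>j. g j \<in> tforms k}"

definition pull :: "((nat \<Rightarrow> 'a) \<Rightarrow> 'a) \<Rightarrow> (nat \<Rightarrow> 'a) \<Rightarrow> 'a" where
  "pull F x = F (\<lambda>j. q j x)"

lemma tforms_polyfuns: "F \<in> tforms k \<Longrightarrow> F \<in> polyfuns {r..<n}"
proof (induction k arbitrary: F)
  case 0
  then show ?case by (auto intro: polyfuns.intros)
next
  case (Suc k)
  then show ?case by (auto intro!: polyfuns_sum polyfuns.polyfuns_mult intro: polyfuns.intros)
qed

lemma tforms_zero: "(\<lambda>t. 0) \<in> tforms k"
proof (induction k)
  case (Suc k)
  then show ?case by (auto intro!: exI[of _ "\<lambda>_ _. 0"])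
qed auto

lemma tforms_add: "F \<in> tforms k \<Longrightarrow> F' \<in> tforms k \<Longrightarrow> (\<lambda>t. F t + F' t) \<in> tforms k"
proof (induction k arbitrary: F F')
  case 0
  then show ?case by auto
next
  case (Suc k)
  then obtain g g' where g: "\<And>j. g j \<in> tforms k" "F = (\<lambda>t. \<Sum>j\<in>{r..<n}. t j * g j t)"
    and g': "\<And>j. g' j \<in> tforms k" "F' = (\<lambda>t. \<Sum>j\<in>{r..<n}. t j * g' j t)" by auto
  have "(\<lambda>t. F t + F' t) = (\<lambda>t. \<Sum>j\<in>{r..<n}. t j * (g j t + g' j t))"
    unfolding g(2) g'(2) by (simp add: distrib_left sum.distrib)
  moreover have "(\<lambda>t. g j t + g' j t) \<in> tforms k" for j using Suc.IH[OF g(1) g'(1)] .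
  ultimately show ?case by (auto intro!: exI[of _ "\<lambda>j t. g j t + g' j t"])
qed

lemma tforms_cmult: "F \<in> tforms k \<Longrightarrow> (\<lambda>t. c * F t) \<in> tforms k"
proof (induction k arbitrary: F)
  case 0
  then show ?case by auto
next
  case (Suc k)
  then obtain g where g: "\<And>j. g j \<in> tforms k" "F = (\<lambda>t. \<Sum>j\<in>{r..<n}. t j * g j t)" by auto
  have "(\<lambda>t. c * F t) = (\<lambda>t. \<Sum>j\<in>{r..<n}. t j * (c * g j t))"
    unfolding g(2) by (auto simp: sum_distrib_left mult.left_commute)
  moreover have "(\<lambda>t. c * g j t) \<in> tforms k" for j using Suc.IH[OF g(1)] .
  ultimately show ?case by (auto intro!: exI[of _ "\<lambda>j t. c * g j t"])
qed

lemma tforms_var_mult: "F \<in> tforms k \<Longrightarrow> l \<in> {r..<n} \<Longrightarrow> (\<lambda>t. t l * F t) \<in> tforms (Suc k)"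
proof -
  assume F: "F \<in> tforms k" and l: "l \<in> {r..<n}"
  have "(\<lambda>t. t l * F t) = (\<lambda>t. \<Sum>j\<in>{r..<n}. t j * (if j = l then F else (\<lambda>t. 0)) t)"
    using l by (auto simp: fun_eq_iff if_distrib[of "\<lambda>g. g _"] if_distrib[of "\<lambda>s. _ * s"] cong: if_cong)
  moreover have "(if j = l then F else (\<lambda>t. 0)) \<in> tforms k" for j using F tforms_zero by auto
  ultimately show ?thesis
    unfolding tforms.simps by (intro CollectI exI[of _ "\<lambda>j. if j = l then F else (\<lambda>t. 0)"]) blast
qed

lemma tforms_mult: "F \<in> tforms k \<Longrightarrow> F' \<in> tforms l \<Longrightarrow> (\<lambda>t. F t * F' t) \<in> tforms (k + l)"
proof (induction k arbitrary: F)
  case 0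
  then show ?case using tforms_cmult by auto
next
  case (Suc k)
  then obtain g where g: "\<And>j. g j \<in> tforms k" "F = (\<lambda>t. \<Sum>j\<in>{r..<n}. t j * g j t)" by auto
  have "(\<lambda>t. F t * F' t) = (\<lambda>t. \<Sum>j\<in>{r..<n}. t j * (g j t * F' t))"
    unfolding g(2) by (auto simp: sum_distrib_right mult.assoc)
  moreover have "(\<lambda>t. g j t * F' t) \<in> tforms (k + l)" for j using Suc.IH[OF g(1) Suc.prems(2)] .
  ultimately show ?case by (auto intro!: exI[of _ "\<lambda>j t. g j t * F' t"])
qed

lemma tforms_scale: "F \<in> tforms k \<Longrightarrow> F (\<lambda>j. s * t j) = s ^ k * F t"
proof (induction k arbitrary: F)
  case 0
  then show ?case by auto
next
  case (Suc k)
  then obtain g where g: "\<And>j. g j \<in> tforms k" "F = (\<lambda>t. \<Sum>j\<in>{r..<n}. t j * g j t)" by auto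
  have "F (\<lambda>j. s * t j) = (\<Sum>j\<in>{r..<n}. (s * t j) * (s ^ k * g j t))"
    unfolding g(2) using Suc.IH[OF g(1)] by simp
  also have "\<dots> = s ^ Suc k * F t"
    unfolding g(2) sum_distrib_left by (rule sum.cong) (auto simp: mult_ac)
  finally show ?case .
qed

lemma linear_taylor: "k < n \<Longrightarrow> \<exists>m\<in>ideal_power n a 2. q k = (\<Sum>i<n. (\<lambda>x. G k i * (x i - a i))) + m"
proof -
  assume k: "k < n"
  obtain g where g: "has_gradient n (q k) a g"
    "q k - (\<lambda>_. q k a) - (\<Sum>i<n. (\<lambda>x. g i * (x i - a i))) \<in> ideal_power n a 2"
    using polyfuns_has_gradient[OF q_poly[OF k] order_refl, of a] by blast
  have "g i = G k i" if "i < n" for i using has_gradient_unique[OF g(1) q_grad[OF k] that] .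
  then have "(\<Sum>i<n. (\<lambda>x. g i * (x i - a i))) = (\<Sum>i<n. (\<lambda>x. G k i * (x i - a i)))" by (intro sum.cong) auto
  moreover have "(\<lambda>_. q k a) = (0 :: (nat \<Rightarrow> 'a) \<Rightarrow> 'a)" using q_zero[OF k] by (simp add: zero_fun_def)
  ultimately have "q k - (\<Sum>i<n. (\<lambda>x. G k i * (x i - a i))) \<in> ideal_power n a 2" using g(2) by simp
  then show ?thesis by (intro bexI[of _ "q k - (\<Sum>i<n. (\<lambda>x. G k i * (x i - a i)))"]) (simp_all only: add_diff_cancel_left' diff_add_cancel add_diff_cancel_left' add.commute[of "sum _ _"] )
qed

lemma linear_in_power: "(\<Sum>i<n. (\<lambda>x. c i * (x i - a i))) \<in> ideal_power n a 1"
proof -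
  have "(\<lambda>x. c i * (x i - a i)) = (\<lambda>x. x i - a i) * (\<lambda>_. c i)" for i by (auto simp: fun_eq_iff)
  moreover have "(\<lambda>_. c i) \<in> S" for i by (rule polyfuns.intros)
  ultimately have "\<exists>g. (\<Sum>i<n. (\<lambda>x. c i * (x i - a i))) = (\<Sum>i<n. (\<lambda>x. x i - a i) * g i) \<and> (\<forall>i. g i \<in> S)"
    by (intro exI[of _ "\<lambda>i _. c i"]) simp
  then show ?thesis by (auto simp: One_nat_def)
qed

lemma q_in_power: "k < n \<Longrightarrow> q k \<in> ideal_power n a 1"
proof -
  assume k: "k < n"
  obtain m where m: "m \<in> ideal_power n a 2" "q k = (\<Sum>i<n. (\<lambda>x. G k i * (x i - a i))) + m"
    using linear_taylor[OF k] by blast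
  have "m \<in> ideal_power n a 1" using ideal_power_antimono[of 1 2 n a] m(1) by auto
  then show ?thesis using ideal_powerD(3)[OF linear_in_power] unfolding m(2) by blast
qed

lemma pull_power: "F \<in> tforms k \<Longrightarrow> pull F \<in> ideal_power n a k"
proof (induction k arbitrary: F)
  case 0
  then show ?case unfolding pull_def by (auto intro: polyfuns.intros)
next
  case (Suc k)
  then obtain g where g: "\<And>j. g j \<in> tforms k" "F = (\<lambda>t. \<Sum>j\<in>{r..<n}. t j * g j t)" by auto
  have "pull F = (\<Sum>j\<in>{r..<n}. q j * pull (g j))" unfolding g(2) pull_def by (auto simp: fun_eq_iff)
  moreover have "q j * pull (g j) \<in> ideal_power n a (Suc k)" if "j \<in> {r..<n}" for j
    using ideal_power_mult[OF q_in_power[of j] Suc.IH[OF g(1)], of j] that by auto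
  ultimately show ?case by (simp only: is_ideal_sum[OF is_ideal_ideal_power])
qed

lemma centred_expansion:
  assumes i: "i < n"
  shows "\<exists>m\<in>ideal_power n a 2. (\<lambda>x. x i - a i) = (\<Sum>k<n. (\<lambda>x. B i k * q k x)) + m"
proof -
  have "\<forall>k\<in>{..<n}. \<exists>m. m \<in> ideal_power n a 2 \<and> q k = (\<Sum>i<n. (\<lambda>x. G k i * (x i - a i))) + m"
    using linear_taylor by blast
  from bchoice[OF this] obtain m where m: "\<And>k. k < n \<Longrightarrow> m k \<in> ideal_power n a 2"
    "\<And>k. k < n \<Longrightarrow> q k = (\<Sum>i<n. (\<lambda>x. G k i * (x i - a i))) + m k" by auto
  have mS: "(\<lambda>_. c) * m k \<in> ideal_power n a 2" if "k < n" for k c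
    using ideal_powerD(4)[OF polyfuns_const m(1)[OF that]] .
  have "x i - a i = (\<Sum>k<n. B i k * q k x) + (\<Sum>k<n. ((\<lambda>_. - B i k) * m k) x)" for x
  proof -
    have "(\<Sum>k<n. B i k * q k x) = (\<Sum>k<n. B i k * (\<Sum>j<n. G k j * (x j - a j)) + B i k * m k x)"
      using m(2) by (intro sum.cong) (auto simp: distrib_left)
    also have "\<dots> = (\<Sum>k<n. \<Sum>j<n. B i k * G k j * (x j - a j)) + (\<Sum>k<n. B i k * m k x)"
      by (simp add: sum.distrib sum_distrib_left mult.assoc)
    also have "(\<Sum>k<n. \<Sum>j<n. B i k * G k j * (x j - a j)) = (\<Sum>j<n. (\<Sum>k<n. B i k * G k j) * (x j - a j))"
      by (subst sum.swap) (simp add: sum_distrib_right)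
    also have "\<dots> = (\<Sum>j<n. (if i = j then 1 else 0) * (x j - a j))" using BG[OF i] by (intro sum.cong) auto
    also have "\<dots> = x i - a i" using i by (simp add: if_distrib[of "\<lambda>t. t * _"] cong: if_cong)
    finally show ?thesis by (simp add: sum_negf)
  qed
  then have "(\<lambda>x. x i - a i) = (\<Sum>k<n. (\<lambda>x. B i k * q k x)) + (\<Sum>k<n. (\<lambda>_. - B i k) * m k)"
    by (auto simp: fun_eq_iff)
  moreover have "(\<Sum>k<n. (\<lambda>_. - B i k) * m k) \<in> ideal_power n a 2"
    by (rule is_ideal_sum[OF is_ideal_ideal_power]) (use mS in auto)
  ultimately show ?thesis by blast
qed

definition expandable where
  "expandable k = {f. \<exists>j\<in>J. \<exists>F\<in>tforms k. \<exists>m\<in>ideal_power n a (Suc k). f = j + pull F + m}"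

lemma expandable_zero: "0 \<in> expandable k"
  unfolding expandable_def
  using J_ideal(2) tforms_zero[of k] ideal_powerD(2)[of n a "Suc k"]
  by (intro CollectI bexI[of _ 0] bexI[of _ "\<lambda>t. 0"]) (auto simp: fun_eq_iff pull_def)

lemma expandable_add:
  assumes "f \<in> expandable k" "f' \<in> expandable k" shows "f + f' \<in> expandable k"
proof -
  obtain j F m where f: "j \<in> J" "F \<in> tforms k" "m \<in> ideal_power n a (Suc k)" "f = j + pull F + m"
    using assms(1) unfolding expandable_def by blast
  obtain j' F' m' where f': "j' \<in> J" "F' \<in> tforms k" "m' \<in> ideal_power n a (Suc k)" "f' = j' + pull F' + m'"
    using assms(2) unfolding expandable_def by blast
  have "f + f' = (j + j') + pull (\<lambda>t. F t + F' t) + (m + m')"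
    unfolding f(4) f'(4) by (auto simp: fun_eq_iff pull_def)
  then show ?thesis unfolding expandable_def
    using J_ideal(3)[OF f(1) f'(1)] tforms_add[OF f(2) f'(2)] ideal_powerD(3)[OF f(3) f'(3)] by blast
qed

lemma expandable_sum: "(\<And>i. i \<in> I \<Longrightarrow> f i \<in> expandable k) \<Longrightarrow> sum f I \<in> expandable k"
  by (induction I rule: infinite_finite_induct) (auto intro: expandable_zero expandable_add)

lemma expandable_parts:
  "j \<in> J \<Longrightarrow> j \<in> expandable k" "F \<in> tforms k \<Longrightarrow> pull F \<in> expandable k" "m \<in> ideal_power n a (Suc k) \<Longrightarrow> m \<in> expandable k"
proof -
  have p0: "pull (\<lambda>t. 0) = 0" by (auto simp: fun_eq_iff pull_def)
  note z = J_ideal(2) tforms_zero[of k] ideal_powerD(2)[of n a "Suc k"]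
  show "j \<in> J \<Longrightarrow> j \<in> expandable k" unfolding expandable_def
    using z p0 by (intro CollectI bexI[of _ j] bexI[of _ "\<lambda>t. 0"] bexI[of _ 0]) auto
  show "F \<in> tforms k \<Longrightarrow> pull F \<in> expandable k" unfolding expandable_def
    using z by (intro CollectI bexI[of _ 0] bexI[of _ F]) auto
  show "m \<in> ideal_power n a (Suc k) \<Longrightarrow> m \<in> expandable k" unfolding expandable_def
    using z p0 by (intro CollectI bexI[of _ 0] bexI[of _ "\<lambda>t. 0"] bexI[of _ m]) auto
qed

lemma ideal_power_expandable: "f \<in> ideal_power n a k \<Longrightarrow> f \<in> expandable k"
proof (induction k arbitrary: f)
  case 0
  then have fS: "f \<in> S" by simp
  obtain g where g: "f - (\<lambda>_. f a) - (\<Sum>i<n. (\<lambda>x. g i * (x i - a i))) \<in> ideal_power n a 2"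
    using polyfuns_has_gradient[OF fS order_refl, of a] by blast
  define m where "m = f - (\<lambda>_. f a) - (\<Sum>i<n. (\<lambda>x. g i * (x i - a i)))"
  have "m \<in> ideal_power n a 1" using g ideal_power_antimono[of 1 2 n a] unfolding m_def by auto
  then have e1: "(\<Sum>i<n. (\<lambda>x. g i * (x i - a i))) + m \<in> expandable 0"
    using ideal_powerD(3)[OF linear_in_power] by (intro expandable_parts(3)) simp
  have e2: "pull (\<lambda>t. f a) \<in> expandable 0" by (intro expandable_parts(2)) auto
  have eq: "f = pull (\<lambda>t. f a) + ((\<Sum>i<n. (\<lambda>x. g i * (x i - a i))) + m)"
    unfolding m_def pull_def by (auto simp: fun_eq_iff)
  show ?case by (rule ssubst[OF eq], rule expandable_add[OF e2 e1])
next
  case (Suc k)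
  then obtain g where g: "\<And>i. g i \<in> ideal_power n a k" "f = (\<Sum>i<n. (\<lambda>x. x i - a i) * g i)" by auto
  have "(\<lambda>x. x i - a i) * g i \<in> expandable (Suc k)" if i: "i < n" for i
  proof -
    obtain j F m where gi: "j \<in> J" "F \<in> tforms k" "m \<in> ideal_power n a (Suc k)" "g i = j + pull F + m"
      using Suc.IH[OF g(1)] unfolding expandable_def by blast
    obtain m2 where m2: "m2 \<in> ideal_power n a 2" "(\<lambda>x. x i - a i) = (\<Sum>k<n. (\<lambda>x. B i k * q k x)) + m2"
      using centred_expansion[OF i] by blast
    have 1: "(\<lambda>x. x i - a i) * j \<in> expandable (Suc k)"
      by (intro expandable_parts(1) J_ideal(4) gi(1) polyfuns_centred i)
    have 2: "(\<lambda>x. x i - a i) * m \<in> expandable (Suc k)"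
      by (intro expandable_parts(3) ideal_power_centred_mult i gi(3))
    have 3: "m2 * pull F \<in> expandable (Suc k)"
      using ideal_power_mult[OF m2(1) pull_power[OF gi(2)]] by (intro expandable_parts(3)) simp
    have 4: "(\<lambda>x. B i l * q l x) * pull F \<in> expandable (Suc k)" if l: "l < n" for l
    proof (cases "l < r")
      case True
      have e1: "((\<lambda>_. B i l) * pull F) * q l \<in> J"
        using pull_power[OF gi(2)] ideal_powerD(1) q_in_J[OF True]
        by (intro J_ideal(4) is_subringD(5)[OF polyfuns_subring] polyfuns_const) auto
      have e2: "((\<lambda>_. B i l) * pull F) * q l = (\<lambda>x. B i l * q l x) * pull F" by (auto simp: fun_eq_iff)
      show ?thesis using expandable_parts(1)[OF e1] unfolding e2 .
    next
      case False
      have e1: "(\<lambda>t. t l * (B i l * F t)) \<in> tforms (Suc k)"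
        by (rule tforms_var_mult[OF tforms_cmult[OF gi(2)]]) (use False l in auto)
      have e2: "pull (\<lambda>t. t l * (B i l * F t)) = (\<lambda>x. B i l * q l x) * pull F"
        by (auto simp: fun_eq_iff pull_def)
      show ?thesis using expandable_parts(2)[OF e1] unfolding e2 .
    qed
    have "(\<lambda>x. x i - a i) * g i
        = (\<lambda>x. x i - a i) * j + ((\<Sum>l<n. (\<lambda>x. B i l * q l x) * pull F) + m2 * pull F) + (\<lambda>x. x i - a i) * m"
    proof -
      have "(\<lambda>x. x i - a i) * pull F = (\<Sum>l<n. (\<lambda>x. B i l * q l x) * pull F) + m2 * pull F"
        unfolding m2(2) by (simp add: distrib_right sum_distrib_right)
      then show ?thesis unfolding gi(4) by (simp add: distrib_left)
    qed
    also have "\<dots> \<in> expandable (Suc k)"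
      by (intro expandable_add 1 2 3 expandable_sum 4) auto
    finally show ?thesis .
  qed
  then show ?case unfolding g(2) by (intro expandable_sum) auto
qed

text \<open>Expand \<open>f\<close> in the local coordinates one degree at a time, discarding multiples of
  \<open>q\<^sub>0, \<dots>, q\<^bsub>r-1\<^esub>\<close>; the process stops at the first form that is not the zero function.\<close>

lemma initial_form:
  assumes "f \<in> S"
  shows "(\<forall>k. \<exists>h\<in>ideal_power n a k. f - h \<in> J) \<or>
    (\<exists>k. \<exists>F\<in>tforms k. \<exists>m\<in>ideal_power n a (Suc k). \<exists>j\<in>J. \<exists>t. F t \<noteq> 0 \<and> f = j + pull F + m)"
proof (rule disjCI)
  assume no: "\<not> (\<exists>k. \<exists>F\<in>tforms k. \<exists>m\<in>ideal_power n a (Suc k). \<exists>j\<in>J. \<exists>t. F t \<noteq> 0 \<and> f = j + pull F + m)"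
  show "\<forall>k. \<exists>h\<in>ideal_power n a k. f - h \<in> J"
  proof
    fix k show "\<exists>h\<in>ideal_power n a k. f - h \<in> J"
    proof (induction k)
      case 0
      have "f - f \<in> J" using J_ideal(2) by simp
      then show ?case using assms unfolding ideal_power.simps by blast
    next
      case (Suc k)
      then obtain h where h: "h \<in> ideal_power n a k" "f - h \<in> J" by blast
      obtain j F m where hj: "j \<in> J" "F \<in> tforms k" "m \<in> ideal_power n a (Suc k)" "h = j + pull F + m"
        using ideal_power_expandable[OF h(1)] unfolding expandable_def by blast
      have f: "f = ((f - h) + j) + pull F + m" unfolding hj(4) by simp
      have fj: "(f - h) + j \<in> J" using J_ideal(3)[OF h(2) hj(1)] .
      have "F t = 0" for t using no hj(2,3) fj f by blast
      then have p0: "pull F = 0" unfolding pull_def by (simp add: fun_eq_iff)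
      have "f - m = (f - h) + j" unfolding hj(4) p0 by simp
      then have "f - m \<in> J" using fj by (simp only:)
      then show ?case using hj(3) by blast
    qed
  qed
qed

text \<open>Along the ray with local coordinates \<open>s t\<close> the form contributes \<open>s\<^sup>k F(t)\<close>, which dominates
  the remainder of order \<open>k + 1\<close> for small \<open>s\<close>.\<close>

lemma nonzero_if_initial_form:
  assumes F: "F \<in> tforms k" "F t \<noteq> 0" and m: "m \<in> ideal_power n a (Suc k)" and j: "j \<in> J"
    and "\<rho> > 0"
  shows "\<exists>x. in_box n \<rho> a x \<and> on_branch x \<and> (j + pull F + m) x \<noteq> 0"
proof -
  obtain d0 where d0: "d0 > 0" "\<And>d t. 0 \<le> d \<Longrightarrow> d \<le> d0 \<Longrightarrow> (\<forall>k<n. \<bar>t k\<bar> \<le> d) \<Longrightarrow>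
    (\<exists>x. (\<forall>k<n. q k x = t k) \<and> in_box n (2 * \<beta> * d) a x)" using solve_system by blast
  obtain C where C: "C > 0" "\<And>r x. 0 \<le> r \<Longrightarrow> r \<le> 1 \<Longrightarrow> in_box n r a x \<Longrightarrow> \<bar>m x\<bar> \<le> C * r ^ Suc k"
    using ideal_power_bound[OF m] by blast
  define T where "T = (\<Sum>j<n. \<bar>t j\<bar>) + 1"
  have T: "T > 0" unfolding T_def by (intro add_nonneg_pos sum_nonneg) auto
  have tT: "\<bar>t j\<bar> \<le> T" if "j < n" for j
  proof -
    have "\<bar>t j\<bar> \<le> (\<Sum>j<n. \<bar>t j\<bar>)" using that by (intro member_le_sum) auto
    then show ?thesis unfolding T_def by simp
  qed
  define D where "D = 2 * \<beta> * T"
  have D: "D > 0" unfolding D_def using \<beta>_pos T by simp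
  define E where "E = C * D ^ Suc k"
  have E: "E > 0" unfolding E_def using C(1) D by simp
  define s where "s = min (min (d0 / T) (\<rho> / D)) (min (1 / D) (\<bar>F t\<bar> / (2 * E)))"
  have s: "s > 0" "s * T \<le> d0" "s * D \<le> \<rho>" "s * D \<le> 1" "s * (2 * E) \<le> \<bar>F t\<bar>"
  proof -
    show "s > 0" unfolding s_def using d0(1) T D E F(2) \<open>\<rho> > 0\<close> by simp
    have "s \<le> d0 / T" "s \<le> \<rho> / D" "s \<le> 1 / D" "s \<le> \<bar>F t\<bar> / (2 * E)" unfolding s_def by auto
    then show "s * T \<le> d0" "s * D \<le> \<rho>" "s * D \<le> 1" "s * (2 * E) \<le> \<bar>F t\<bar>"
      using T D E by (simp_all add: pos_le_divide_eq)
  qed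
  define u where "u = (\<lambda>k. if k < r then 0 else s * t k)"
  have "\<forall>k<n. \<bar>u k\<bar> \<le> s * T" unfolding u_def using s(1) T tT by (auto simp: abs_mult)
  then obtain x where x: "\<And>k. k < n \<Longrightarrow> q k x = u k" "in_box n (2 * \<beta> * (s * T)) a x"
    using d0(2)[of "s * T" u] s T by auto
  have box: "in_box n (s * D) a x" using x(2) unfolding D_def by (simp add: mult_ac)
  have br: "on_branch x" unfolding on_branch_def using x(1) rn unfolding u_def by auto
  have "pull F x = F (\<lambda>j. s * t j)"
    unfolding pull_def by (rule polyfuns_cong[OF tforms_polyfuns[OF F(1)]]) (use x(1) in \<open>auto simp: u_def\<close>)
  then have pF: "pull F x = s ^ k * F t" using tforms_scale[OF F(1)] by simp
  have "\<bar>m x\<bar> \<le> C * (s * D) ^ Suc k" using C(2)[OF _ s(4) box] s(1) D by simp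
  also have "\<dots> = s ^ k * (s * E)" unfolding E_def by (simp add: power_mult_distrib mult_ac)
  also have "\<dots> < s ^ k * \<bar>F t\<bar>"
  proof (rule mult_strict_left_mono)
    have "s * E < s * (2 * E)" using s(1) E by simp
    then show "s * E < \<bar>F t\<bar>" using s(5) by (rule less_le_trans)
  qed (use s(1) in simp)
  also have "\<dots> = \<bar>pull F x\<bar>" unfolding pF using s(1) by (simp add: abs_mult)
  finally have "\<bar>m x\<bar> < \<bar>pull F x\<bar>" .
  then have "pull F x + m x \<noteq> 0" by (auto simp: add_eq_0_iff)
  then have "(j + pull F + m) x \<noteq> 0" using J_vanishes[OF j br] by simp
  then show ?thesis using br in_box_mono[OF box s(3)] by blast
qed

definition germ_ideal where
  "germ_ideal = {f \<in> S. \<exists>\<rho>>0. \<forall>x. in_box n \<rho> a x \<longrightarrow> on_branch x \<longrightarrow> f x = 0}"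

lemma is_ideal_germ_ideal: "is_ideal S germ_ideal"
  unfolding is_ideal_def
proof (intro conjI ballI)
  show "germ_ideal \<subseteq> S" unfolding germ_ideal_def by blast
  show "0 \<in> germ_ideal" unfolding germ_ideal_def
    using is_subringD(1)[OF polyfuns_subring] by (auto intro!: exI[of _ 1])
  fix f assume f: "f \<in> germ_ideal"
  then obtain \<rho> where \<rho>: "\<rho> > 0" "\<And>x. in_box n \<rho> a x \<Longrightarrow> on_branch x \<Longrightarrow> f x = 0" "f \<in> S"
    unfolding germ_ideal_def by blast
  show "s * f \<in> germ_ideal" if "s \<in> S" for s
    unfolding germ_ideal_def using \<rho> is_subringD(5)[OF polyfuns_subring that \<rho>(3)] by auto
  fix f' assume "f' \<in> germ_ideal"
  then obtain \<rho>' where \<rho>': "\<rho>' > 0" "\<And>x. in_box n \<rho>' a x \<Longrightarrow> on_branch x \<Longrightarrow> f' x = 0" "f' \<in> S"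
    unfolding germ_ideal_def by blast
  have "(f + f') x = 0" if x: "in_box n (min \<rho> \<rho>') a x" "on_branch x" for x
    using \<rho>(2)[OF in_box_mono[OF x(1)] x(2)] \<rho>'(2)[OF in_box_mono[OF x(1)] x(2)] by simp
  then show "f + f' \<in> germ_ideal"
    unfolding germ_ideal_def using \<rho>(1,3) \<rho>'(1,3) is_subringD(3)[OF polyfuns_subring \<rho>(3) \<rho>'(3)]
    by (intro CollectI conjI exI[of _ "min \<rho> \<rho>'"]) auto
qed

lemma krull_germ:
  assumes "f \<in> S" "\<And>k. \<exists>h\<in>ideal_power n a k. f - h \<in> J"
  shows "\<exists>w\<in>S. w a = 1 \<and> w * f \<in> J"
  using krull_intersection[OF is_ideal_J assms] .

lemma initial_form_if_not_germ:
  assumes "f \<in> S" "f \<notin> germ_ideal"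
  shows "\<exists>k. \<exists>F\<in>tforms k. \<exists>m\<in>ideal_power n a (Suc k). \<exists>j\<in>J. \<exists>t. F t \<noteq> 0 \<and> f = j + pull F + m"
proof (rule ccontr)
  assume "\<not> ?thesis"
  then have "\<forall>k. \<exists>h\<in>ideal_power n a k. f - h \<in> J" using initial_form[OF assms(1)] by blast
  then obtain w where w: "w \<in> S" "w a = 1" "w * f \<in> J" using krull_germ[OF assms(1)] by blast
  obtain d where d: "d > 0" "\<And>x. in_box n d a x \<Longrightarrow> \<bar>w x - w a\<bar> \<le> 1 / 2"
    using polyfuns_continuous[OF w(1), of "1 / 2" a] by auto
  have "f x = 0" if x: "in_box n d a x" "on_branch x" for x
  proof -
    have "w x \<noteq> 0" using d(2)[OF x(1)] w(2) by auto
    moreover have "w x * f x = 0" using J_vanishes[OF w(3) x(2)] by simp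
    ultimately show ?thesis by simp
  qed
  then show False using assms d(1) unfolding germ_ideal_def by blast
qed

text \<open>The product of two nonzero initial forms is a nonzero initial form of the product.\<close>

lemma is_prime_germ_ideal: "is_prime S germ_ideal"
  unfolding is_prime_def
proof (intro conjI ballI impI)
  show "is_ideal S germ_ideal" by (rule is_ideal_germ_ideal)
  have "on_branch a" unfolding on_branch_def using q_zero rn by auto
  moreover have "in_box n \<rho> a a" if "\<rho> > 0" for \<rho> using that unfolding in_box_def by simp
  ultimately show "1 \<notin> germ_ideal" unfolding germ_ideal_def by fastforce
  fix f f' assume f: "f \<in> S" "f' \<in> S" "f * f' \<in> germ_ideal"
  show "f \<in> germ_ideal \<or> f' \<in> germ_ideal"
  proof (rule ccontr)
    assume no: "\<not> (f \<in> germ_ideal \<or> f' \<in> germ_ideal)"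
    then obtain k F m j t where F: "F \<in> tforms k" "m \<in> ideal_power n a (Suc k)" "j \<in> J" "F t \<noteq> 0" "f = j + pull F + m"
      using initial_form_if_not_germ[OF f(1)] by blast
    obtain k' F' m' j' t' where F': "F' \<in> tforms k'" "m' \<in> ideal_power n a (Suc k')" "j' \<in> J" "F' t' \<noteq> 0" "f' = j' + pull F' + m'"
      using initial_form_if_not_germ[OF f(2)] no by blast
    obtain u where u: "F u \<noteq> 0" "F' u \<noteq> 0"
      using polyfuns_common_nonzero[OF tforms_polyfuns[OF F(1)] tforms_polyfuns[OF F'(1)] F(4) F'(4)] by blast
    define FF where "FF = (\<lambda>t. F t * F' t)"
    have FF: "FF \<in> tforms (k + k')" "FF u \<noteq> 0" unfolding FF_def using tforms_mult[OF F(1) F'(1)] u by auto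
    define M where "M = pull F * m' + m * pull F' + m * m'"
    have "pull F * m' \<in> ideal_power n a (Suc (k + k'))"
      using ideal_power_mult[OF pull_power[OF F(1)] F'(2)] by simp
    moreover have "m * pull F' \<in> ideal_power n a (Suc (k + k'))"
      using ideal_power_mult[OF F(2) pull_power[OF F'(1)]] by simp
    moreover have "m * m' \<in> ideal_power n a (Suc (k + k'))"
      using ideal_power_mult[OF F(2) F'(2)] ideal_power_Suc_subset[of n a "Suc (k + k')"] by auto
    ultimately have M: "M \<in> ideal_power n a (Suc (k + k'))" unfolding M_def by (intro ideal_powerD(3))
    define j2 where "j2 = f' * j + (pull F + m) * j'"
    have "pull F + m \<in> S"
      using pull_power[OF F(1)] F(2) ideal_powerD(1) is_subringD(3)[OF polyfuns_subring] by blast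
    then have j2: "j2 \<in> J" unfolding j2_def by (intro J_ideal(3,4) f(2) F(3) F'(3))
    have eq: "f * f' = j2 + pull FF + M"
      unfolding j2_def M_def FF_def F(5) F'(5) by (auto simp: fun_eq_iff pull_def algebra_simps)
    have "\<exists>x. in_box n \<rho> a x \<and> on_branch x \<and> (f * f') x \<noteq> 0" if "\<rho> > 0" for \<rho>
      using nonzero_if_initial_form[OF FF M j2 that] unfolding eq .
    then show False using f(3) unfolding germ_ideal_def by blast
  qed
qed

text \<open>By Krull's theorem a member of the germ ideal lies in \<open>J\<close> after multiplication by some \<open>w\<close>
  with \<open>w a = 1\<close>, and such a \<open>w\<close> is not in \<open>I\<close>.\<close>

lemma germ_ideal_subset_prime:
  assumes I: "is_prime S I" and qI: "\<And>k. k < r \<Longrightarrow> q k \<in> I" and Ia: "\<And>f. f \<in> I \<Longrightarrow> f a = 0"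
  shows "germ_ideal \<subseteq> I"
proof
  fix f assume f: "f \<in> germ_ideal"
  then have fS: "f \<in> S" unfolding germ_ideal_def by blast
  have "\<forall>k. \<exists>h\<in>ideal_power n a k. f - h \<in> J"
  proof (rule ccontr)
    assume "\<not> ?thesis"
    then obtain k F m j t where F: "F \<in> tforms k" "m \<in> ideal_power n a (Suc k)" "j \<in> J" "F t \<noteq> 0" "f = j + pull F + m"
      using initial_form[OF fS] by blast
    show False using nonzero_if_initial_form[OF F(1,4,2,3)] f unfolding germ_ideal_def F(5)[symmetric] by blast
  qed
  then obtain w where w: "w \<in> S" "w a = 1" "w * f \<in> J" using krull_germ[OF fS] by blast
  have "J \<subseteq> I" unfolding J_def by (rule ideal_gen_least[OF is_primeD(1)[OF I]]) (use qI in auto)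
  then have "w \<in> I \<or> f \<in> I" using is_primeD(3)[OF I w(1) fS] w(3) by blast
  then show "f \<in> I" using Ia w(2) by force
qed

lemma combination_gradient:
  fixes f :: "(nat \<Rightarrow> 'a) \<Rightarrow> 'a"
  assumes "finite Ps" "f \<in> ideal_gen (polyfuns {..<N}) Ps" "Ps \<subseteq> polyfuns {..<N}"
    and P0: "\<And>P. P \<in> Ps \<Longrightarrow> P z = 0" and V: "\<And>P. P \<in> Ps \<Longrightarrow> has_gradient N P z (V P)"
  shows "\<exists>c. has_gradient N f z (\<lambda>j. \<Sum>P\<in>Ps. c P * V P j)"
  using assms(2)
proof (induction rule: ideal_gen.induct)
  case ideal_gen_0
  show ?case using has_gradient_const[of N 0 z] by (intro exI[of _ "\<lambda>_. 0"]) (simp add: zero_fun_def)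
next
  case (ideal_gen_add s P g)
  then obtain c where c: "has_gradient N g z (\<lambda>j. \<Sum>P\<in>Ps. c P * V P j)" by blast
  obtain s' where s': "has_gradient N s z s'" using polyfuns_has_gradient[OF ideal_gen_add(1) order_refl] by blast
  have "has_gradient N (\<lambda>x. s x * P x) z (\<lambda>j. s z * V P j + P z * s' j)"
    using has_gradient_mult[OF s' ideal_gen_add(1) V[OF ideal_gen_add(2)]] assms(3) ideal_gen_add(2) by blast
  from has_gradient_add[OF this c]
  have "has_gradient N (s * P + g) z (\<lambda>j. (s z * V P j + P z * s' j) + (\<Sum>P\<in>Ps. c P * V P j))"
    unfolding plus_fun_def times_fun_def .
  moreover have "(s z * V P j + P z * s' j) + (\<Sum>P\<in>Ps. c P * V P j)
      = (\<Sum>R\<in>Ps. (c R + (if R = P then s z else 0)) * V R j)" for j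
    using P0[OF ideal_gen_add(2)] ideal_gen_add(2) assms(1)
    by (simp add: distrib_right sum.distrib if_distrib[of "\<lambda>t. t * _"] cong: if_cong)
  ultimately have "has_gradient N (s * P + g) z (\<lambda>j. \<Sum>R\<in>Ps. (c R + (if R = P then s z else 0)) * V R j)"
    by (simp only:)
  then show ?case by (intro exI[of _ "\<lambda>R. c R + (if R = P then s z else 0)"])
qed

lemma shifted_gradient:
  fixes f :: "(nat \<Rightarrow> 'a) \<Rightarrow> 'a"
  assumes "has_gradient n f x g"
  shows "has_gradient (e + n) (\<lambda>v. f (\<lambda>k. v (e + k))) (\<lambda>i. if i < e then y i else x (i - e))
    (\<lambda>j. if j < e then 0 else g (j - e))"
  unfolding has_gradient_def
proof (intro allI impI)
  fix \<epsilon> :: 'a assume "\<epsilon> > 0"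
  then obtain d where d: "d > 0" "linear_within n f x g \<epsilon> d" using assms unfolding has_gradient_def by blast
  let ?z = "\<lambda>i. if i < e then y i else x (i - e)"
  have sh: "in_box n s (\<lambda>k. w (e + k)) (\<lambda>k. v (e + k))" if "in_box (e + n) s w v" for s v w
    using that unfolding in_box_def by auto
  have zs: "(\<lambda>k. ?z (e + k)) = x" by auto
  have sum: "(\<Sum>i<e + n. (if i < e then 0 else g (i - e)) * (v i - w i)) = (\<Sum>i<n. g i * (v (e + i) - w (e + i)))" for v w
  proof -
    have "(\<Sum>i<e + n. (if i < e then 0 else g (i - e)) * (v i - w i))
        = (\<Sum>i\<in>{e..<e + n}. g (i - e) * (v i - w i))"
      by (rule sum.mono_neutral_cong_right) auto
    also have "\<dots> = (\<Sum>i<n. g i * (v (e + i) - w (e + i)))"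
      by (rule sum.reindex_bij_witness[of _ "\<lambda>i. e + i" "\<lambda>i. i - e"]) auto
    finally show ?thesis .
  qed
  have "linear_within (e + n) (\<lambda>v. f (\<lambda>k. v (e + k))) ?z (\<lambda>j. if j < e then 0 else g (j - e)) \<epsilon> d"
    unfolding linear_within_def
  proof (intro allI impI)
    fix v w s assume *: "in_box (e + n) d ?z v" "in_box (e + n) d ?z w" "in_box (e + n) s w v" "0 \<le> s"
    show "\<bar>f (\<lambda>k. v (e + k)) - f (\<lambda>k. w (e + k)) - (\<Sum>i<e + n. (if i < e then 0 else g (i - e)) * (v i - w i))\<bar> \<le> \<epsilon> * s"
      unfolding sum using linear_withinD[OF d(2) sh[OF *(1), unfolded zs] sh[OF *(2), unfolded zs] sh[OF *(3)] *(4)] .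
  qed
  then show "\<exists>d>0. linear_within (e + n) (\<lambda>v. f (\<lambda>k. v (e + k))) ?z (\<lambda>j. if j < e then 0 else g (j - e)) \<epsilon> d"
    using d(1) by blast
qed

text \<open>Jacobian criterion: in the \<open>e + n\<close> variables \<open>(Y, x)\<close> the ideal of relations contains the
  \<open>e + r = n + 1\<close> members \<open>Y\<^sub>i - y\<^sub>i(x)\<close> and \<open>q\<^sub>k(x)\<close> with independent gradients, but is generically
  generated by \<open>n\<close> members.\<close>

lemma no_independent_elements:
  assumes e: "e = Suc (n - r)" and y: "\<And>i. i < e \<Longrightarrow> y i \<in> S"
    and indep: "\<And>F c. F \<in> polyfuns {..<e} \<Longrightarrow> (\<lambda>x. F (\<lambda>i. y i x)) \<in> germ_ideal \<Longrightarrow> F c = 0"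
  shows False
proof -
  let ?T = "polyfuns {..<e + n} :: ((nat \<Rightarrow> 'a) \<Rightarrow> 'a) set"
  define \<sigma> where "\<sigma> = (\<lambda>x i. if i < e then y i x else x (i - e))"
  have comp: "(\<lambda>x. F (\<sigma> x)) \<in> S" if "F \<in> ?T" for F
  proof (rule polyfuns_compose[OF that, where g = "\<lambda>i x. \<sigma> x i"])
    fix i assume "i \<in> {..<e + n}"
    then show "(\<lambda>x. \<sigma> x i) \<in> S" unfolding \<sigma>_def using y by (cases "i < e") (auto intro: polyfuns.intros)
  qed
  note Gp = is_primeD[OF is_prime_germ_ideal] and Gi = is_idealD[OF is_ideal_germ_ideal]
  define Q where "Q = {F \<in> ?T. (\<lambda>x. F (\<sigma> x)) \<in> germ_ideal}"
  have cadd: "(\<lambda>x. (F + H) (\<sigma> x)) = (\<lambda>x. F (\<sigma> x)) + (\<lambda>x. H (\<sigma> x))" for F H by (auto simp: fun_eq_iff)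
  have cmul: "(\<lambda>x. (F * H) (\<sigma> x)) = (\<lambda>x. F (\<sigma> x)) * (\<lambda>x. H (\<sigma> x))" for F H by (auto simp: fun_eq_iff)
  have Q: "is_prime ?T Q"
    unfolding is_prime_def is_ideal_def
  proof (intro conjI ballI impI)
    show "Q \<subseteq> ?T" unfolding Q_def by blast
    show "0 \<in> Q" unfolding Q_def using is_subringD(1)[OF polyfuns_subring] Gi(2)
      by (auto simp: zero_fun_def)
    show "F + H \<in> Q" if "F \<in> Q" "H \<in> Q" for F H
      using that Gi(3) is_subringD(3)[OF polyfuns_subring] unfolding Q_def mem_Collect_eq cadd by blast
    show "F * H \<in> Q" if "F \<in> ?T" "H \<in> Q" for F H
      using that Gi(4)[OF comp] is_subringD(5)[OF polyfuns_subring] unfolding Q_def mem_Collect_eq cmul by blast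
    show "1 \<notin> Q" unfolding Q_def using Gp(2) by (auto simp: one_fun_def)
    show "F \<in> Q \<or> H \<in> Q" if "F \<in> ?T" "H \<in> ?T" "F * H \<in> Q" for F H
      using that Gp(3)[OF comp comp, of F H] unfolding Q_def mem_Collect_eq cmul by blast
  qed
  have "F = 0" if F: "F \<in> polyfuns {..<e}" "F \<in> Q" for F
  proof -
    have "(\<lambda>x. F (\<sigma> x)) = (\<lambda>x. F (\<lambda>i. y i x))"
      by (rule ext, rule polyfuns_cong[OF F(1)]) (auto simp: \<sigma>_def)
    then have "F c = 0" for c using indep[OF F(1)] F(2) unfolding Q_def by simp
    then show ?thesis by (auto simp: fun_eq_iff)
  qed
  from generically_generated_polyfuns[OF Q this order_refl]
  obtain Ps where Ps: "finite Ps" "card Ps \<le> n" "generically_generated ?T Q Ps" by blast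
  have PsQ: "Ps \<subseteq> Q" "Ps \<subseteq> ?T" using Ps(3) unfolding generically_generated_def by auto
  define u where "u = (\<lambda>i. if i < e then (\<lambda>v. v i - y i (\<lambda>k. v (e + k))) else (\<lambda>v. q (i - e) (\<lambda>k. v (e + k))))"
  have shift_poly: "(\<lambda>v. f (\<lambda>k. v (e + k))) \<in> polyfuns {e..<e + n}" if "f \<in> S" for f
    by (rule polyfuns_compose[OF that]) (auto intro: polyfuns.intros)
  have shT: "(\<lambda>v. f (\<lambda>k. v (e + k))) \<in> ?T" if "f \<in> S" for f
    using shift_poly[OF that] by (rule polyfuns_mono) auto
  have qS: "q (i - e) \<in> S" if "\<not> i < e" "i < e + r" for i using q_poly[of "i - e"] that rn by auto
  have sh\<sigma>: "(\<lambda>k. \<sigma> x (e + k)) = x" for x unfolding \<sigma>_def by auto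
  have uT: "u i \<in> ?T" if "i < e + r" for i
  proof (cases "i < e")
    case True
    have "(\<lambda>v. v i) \<in> ?T" using True by (auto intro: polyfuns.intros)
    then show ?thesis unfolding u_def using True polyfuns_diff[OF _ shT[OF y[OF True]]] by simp
  next
    case False
    then show ?thesis unfolding u_def using shT[OF qS[OF False that]] by simp
  qed
  have uQ: "u i \<in> Q" if "i < e + r" for i
  proof -
    have "(\<lambda>x. u i (\<sigma> x)) \<in> germ_ideal"
    proof (cases "i < e")
      case True
      then have "u i (\<sigma> x) = 0" for x unfolding u_def using sh\<sigma>[of x] by (simp add: \<sigma>_def)
      then show ?thesis using Gi(2) by (simp add: zero_fun_def)
    next
      case False
      then have "(\<lambda>x. u i (\<sigma> x)) = q (i - e)" unfolding u_def by (simp add: sh\<sigma>)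
      moreover have "q (i - e) \<in> germ_ideal"
        using qS[OF False that] that False unfolding germ_ideal_def on_branch_def by (auto intro!: exI[of _ 1])
      ultimately show ?thesis by simp
    qed
    then show ?thesis unfolding Q_def using uT[OF that] by blast
  qed
  have "\<exists>w. w \<in> ?T - Q \<and> w * u i \<in> ideal_gen ?T Ps" if "i < e + r" for i
    using Ps(3) uQ[OF that] uT[OF that] unfolding generically_generated_def by blast
  then obtain w where w: "\<And>i. i < e + r \<Longrightarrow> w i \<in> ?T - Q" "\<And>i. i < e + r \<Longrightarrow> w i * u i \<in> ideal_gen ?T Ps" by metis
  define W where "W = (\<Prod>i<e + r. w i)"
  have "(\<Prod>i<m. w i) \<in> ?T - Q" if "m \<le> e + r" for m
    using that
  proof (induction m)
    case 0
    show ?case unfolding lessThan_0 prod.empty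
      using is_subringD(2)[OF polyfuns_subring] is_primeD(2)[OF Q] by blast
  next
    case (Suc m)
    then have A: "(\<Prod>i<m. w i) \<in> ?T - Q" by simp
    have B: "w m \<in> ?T - Q" using w(1)[of m] Suc.prems by simp
    have "(\<Prod>i<m. w i) * w m \<in> ?T - Q"
      using A B is_primeD(3)[OF Q, of "\<Prod>i<m. w i" "w m"] is_subringD(5)[OF polyfuns_subring] by blast
    then show ?case by (simp only: prod.lessThan_Suc)
  qed
  then have W: "W \<in> ?T" "W \<notin> Q" unfolding W_def by auto
  have "\<exists>d>0. \<forall>P\<in>Ps. \<forall>x. in_box n d a x \<longrightarrow> on_branch x \<longrightarrow> P (\<sigma> x) = 0"
    by (rule ex_common_radius[OF Ps(1)])
      (use PsQ in \<open>auto simp: Q_def germ_ideal_def intro: in_box_mono\<close>)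
  then obtain d1 where d1: "d1 > 0" "\<And>P x. P \<in> Ps \<Longrightarrow> in_box n d1 a x \<Longrightarrow> on_branch x \<Longrightarrow> P (\<sigma> x) = 0" by blast
  obtain d2 where d2: "d2 > 0" "\<And>x l g. in_box n d2 a x \<Longrightarrow> (\<forall>k<r. has_gradient n (q k) x (g k)) \<Longrightarrow>
     (\<forall>j<n. (\<Sum>k<r. l k * g k j) = 0) \<Longrightarrow> (\<forall>k<r. l k = 0)" using gradients_independent_near by blast
  have "\<not> (\<forall>x. in_box n (min d1 d2) a x \<longrightarrow> on_branch x \<longrightarrow> W (\<sigma> x) = 0)"
  proof
    assume "\<forall>x. in_box n (min d1 d2) a x \<longrightarrow> on_branch x \<longrightarrow> W (\<sigma> x) = 0"
    then have "(\<lambda>x. W (\<sigma> x)) \<in> germ_ideal" unfolding germ_ideal_def using comp[OF W(1)] d1(1) d2(1)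
      by (intro CollectI conjI exI[of _ "min d1 d2"]) simp_all
    then show False using W unfolding Q_def by blast
  qed
  then obtain x where x: "in_box n (min d1 d2) a x" "on_branch x" "W (\<sigma> x) \<noteq> 0" by blast
  have xd: "in_box n d1 a x" "in_box n d2 a x" using in_box_mono[OF x(1)] by auto
  define z where "z = \<sigma> x"
  have z_eq: "z = (\<lambda>i. if i < e then y i x else x (i - e))" unfolding z_def \<sigma>_def ..
  have "\<exists>V. has_gradient (e + n) P z V" if "P \<in> Ps" for P
    using polyfuns_has_gradient[of P "{..<e + n}" "e + n" z] PsQ(2) that by blast
  then obtain V where V: "\<And>P. P \<in> Ps \<Longrightarrow> has_gradient (e + n) P z (V P)" by metis
  have "\<exists>g. has_gradient n (q k) x g" if "k < r" for k
    using polyfuns_has_gradient[OF q_poly order_refl, of k x] that rn by force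
  then obtain g where g: "\<And>k. k < r \<Longrightarrow> has_gradient n (q k) x (g k)" by metis
  have "\<exists>U. has_gradient (e + n) (u i) z U \<and> (\<forall>j<e. U j = (if j = i then 1 else 0))" if i: "i < e" for i
  proof -
    have "{e..<e + n} \<subseteq> {..<e + n}" by auto
    from polyfuns_has_gradient[OF shift_poly[OF y[OF i]] this, of z]
    obtain Y where Y: "has_gradient (e + n) (\<lambda>v. y i (\<lambda>k. v (e + k))) z Y" "\<And>j. j \<notin> {e..<e + n} \<Longrightarrow> Y j = 0"
      by blast
    have "has_gradient (e + n) (\<lambda>v. (- 1) * y i (\<lambda>k. v (e + k))) z (\<lambda>j. (- 1) * Y j + y i (\<lambda>k. z (e + k)) * 0)"
      by (rule has_gradient_mult[OF has_gradient_const polyfuns_const Y(1) shT[OF y[OF i]]])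
    from has_gradient_add[OF has_gradient_var[of i "e + n" z] this]
    have "has_gradient (e + n) (u i) z (\<lambda>j. (if j = i then 1 else 0) + ((- 1) * Y j + y i (\<lambda>k. z (e + k)) * 0))"
      using i unfolding u_def by simp
    then show ?thesis using Y(2) by (intro exI conjI) auto
  qed
  then obtain U0 where U0: "\<And>i. i < e \<Longrightarrow> has_gradient (e + n) (u i) z (U0 i)"
    "\<And>i j. i < e \<Longrightarrow> j < e \<Longrightarrow> U0 i j = (if j = i then 1 else 0)" by metis
  define U where "U = (\<lambda>i j. if i < e then U0 i j else if j < e then 0 else g (i - e) (j - e))"
  have U: "has_gradient (e + n) (u i) z (U i)" if "i < e + r" for i
  proof (cases "i < e")
    case True
    then show ?thesis using U0(1) unfolding U_def by simp
  next
    case False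
    then have "i - e < r" using that by auto
    from shifted_gradient[OF g[OF this], of e "\<lambda>i. y i x"]
    show ?thesis using False unfolding U_def u_def z_eq by simp
  qed
  have "\<exists>c. \<forall>j<e + n. U i j = (\<Sum>P\<in>Ps. c P * V P j)" if i: "i < e + r" for i
  proof -
    obtain c where c: "has_gradient (e + n) (w i * u i) z (\<lambda>j. \<Sum>P\<in>Ps. c P * V P j)"
      using combination_gradient[OF Ps(1) w(2)[OF i] PsQ(2) _ V] d1(2) xd(1) x(2) unfolding z_def by blast
    have wT: "w i \<in> ?T" using w(1)[OF i] by blast
    obtain w' where w': "has_gradient (e + n) (w i) z w'" using polyfuns_has_gradient[OF wT order_refl] by blast
    have "u i z = 0"
    proof (cases "i < e")
      case True
      then show ?thesis unfolding u_def z_def by (simp add: sh\<sigma>) (simp add: \<sigma>_def)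
    next
      case False
      then have "i - e < r" using i by auto
      then show ?thesis using False x(2) unfolding u_def z_def on_branch_def by (simp add: sh\<sigma>)
    qed
    then have "has_gradient (e + n) (w i * u i) z (\<lambda>j. w i z * U i j)"
      using has_gradient_mult[OF w' wT U[OF i] uT[OF i]] unfolding times_fun_def by simp
    then have "w i z * U i j = (\<Sum>P\<in>Ps. c P * V P j)" if "j < e + n" for j
      using has_gradient_unique[OF _ c that] by blast
    moreover have "w i z \<noteq> 0"
    proof -
      have "(\<Prod>i<m. w i) z = (\<Prod>i<m. w i z)" for m by (induction m) auto
      then have "W z = (\<Prod>i<e + r. w i z)" unfolding W_def .
      then show ?thesis using x(3) i unfolding z_def by auto
    qed
    ultimately have "U i j = (\<Sum>P\<in>Ps. (c P / w i z) * V P j)" if "j < e + n" for j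
      using that by (simp add: sum_divide_distrib[symmetric] field_simps)
    then show ?thesis by (intro exI[of _ "\<lambda>P. c P / w i z"]) blast
  qed
  then obtain c where c: "\<And>i j. i < e + r \<Longrightarrow> j < e + n \<Longrightarrow> U i j = (\<Sum>P\<in>Ps. c i P * V P j)" by metis
  have "card Ps < card {..<e + r}" using Ps(2) e rn by simp
  then obtain l where l: "\<exists>i\<in>{..<e + r}. l i \<noteq> 0" "\<And>P. P \<in> Ps \<Longrightarrow> (\<Sum>i<e + r. l i * c i P) = 0"
    using ex_kernel_vector[OF Ps(1), of "{..<e + r}" c] by blast
  have rel: "(\<Sum>i<e + r. l i * U i j) = 0" if "j < e + n" for j
  proof -
    have "(\<Sum>i<e + r. l i * U i j) = (\<Sum>i<e + r. \<Sum>P\<in>Ps. l i * c i P * V P j)"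
      using c that by (intro sum.cong) (auto simp: sum_distrib_left mult.assoc)
    also have "\<dots> = (\<Sum>P\<in>Ps. (\<Sum>i<e + r. l i * c i P) * V P j)"
      by (subst sum.swap) (simp add: sum_distrib_right)
    finally show ?thesis using l(2) by simp
  qed
  have l0: "l j = 0" if j: "j < e" for j
  proof -
    have "(\<Sum>i<e + r. l i * U i j) = (\<Sum>i<e + r. if i = j then l i else 0)"
      using j U0(2) unfolding U_def by (intro sum.cong) auto
    then show ?thesis using rel[of j] j by simp
  qed
  have split: "(\<Sum>i<e + r. h i) = (\<Sum>k<r. h (e + k))" if "\<And>i. i < e \<Longrightarrow> h i = 0" for h :: "nat \<Rightarrow> 'a"
  proof -
    have "(\<Sum>i<e + r. h i) = (\<Sum>i\<in>{e..<e + r}. h i)" using that by (intro sum.mono_neutral_right) auto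
    also have "\<dots> = (\<Sum>k<r. h (e + k))"
      by (rule sum.reindex_bij_witness[of _ "\<lambda>i. e + i" "\<lambda>i. i - e"]) auto
    finally show ?thesis .
  qed
  have "(\<Sum>k<r. l (e + k) * g k j) = 0" if "j < n" for j
    using rel[of "e + j"] split[of "\<lambda>i. l i * U i (e + j)"] l0 that unfolding U_def by simp
  then have "\<forall>k<r. l (e + k) = 0" using d2(2)[OF xd(2), of g "\<lambda>k. l (e + k)"] g by blast
  then have "l i = 0" if "i < e + r" for i
    using that l0[of i] by (cases "i < e") (metis add_diff_inverse_nat nat_add_left_cancel_less)+
  then show False using l(1) by auto
qed

theorem dense_near:
  assumes I: "is_prime S I" and qI: "\<And>k. k < r \<Longrightarrow> q k \<in> I" and Ia: "\<And>f. f \<in> I \<Longrightarrow> f a = 0"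
    and P: "\<And>i. i \<le> n - r \<Longrightarrow> is_prime S (P i)" "\<And>i. i < n - r \<Longrightarrow> P i \<subset> P (Suc i)" "I \<subseteq> P 0"
    and g: "g \<in> S" "g \<notin> I" and "\<rho> > 0"
  shows "\<exists>x. in_box n \<rho> a x \<and> (\<forall>f\<in>I. f x = 0) \<and> g x \<noteq> 0"
proof -
  have sub: "germ_ideal \<subseteq> I" by (rule germ_ideal_subset_prime[OF I], erule qI, erule Ia)
  have eq: "germ_ideal = I"
  proof (rule ccontr)
    assume "germ_ideal \<noteq> I"
    then have "germ_ideal \<subset> P 0" using sub P(3) by blast
    define P' where "P' = (\<lambda>i. if i = 0 then germ_ideal else P (i - 1))"
    have "is_prime S (P' i)" if "i \<le> Suc (n - r)" for i
      using that is_prime_germ_ideal P(1)[of "i - 1"] unfolding P'_def by auto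
    moreover have "P' i \<subset> P' (Suc i)" if "i < Suc (n - r)" for i
      using that \<open>germ_ideal \<subset> P 0\<close> P(2)[of "i - 1"] unfolding P'_def by (cases i) auto
    ultimately obtain y where "\<And>i. i < Suc (n - r) \<Longrightarrow> y i \<in> S"
      "\<And>F c. F \<in> polyfuns {..<Suc (n - r)} \<Longrightarrow> (\<lambda>x. F (\<lambda>i. y i x)) \<in> P' 0 \<Longrightarrow> F c = 0"
      using independent_if_prime_chain[of "Suc (n - r)" n P'] by blast
    then show False using no_independent_elements[OF refl, of y] unfolding P'_def by simp
  qed
  obtain F where F: "finite F" "F \<subseteq> I" "I \<subseteq> ideal_gen S F"
    using noetherian_fg[OF polyfuns_subring polyfuns_noetherian is_primeD(1)[OF I]] by blast
  have "\<exists>d>0. \<forall>f\<in>F. \<forall>x. in_box n d a x \<longrightarrow> on_branch x \<longrightarrow> f x = 0"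
    by (rule ex_common_radius[OF F(1)])
      (use F(2) eq in \<open>auto simp: germ_ideal_def intro: in_box_mono\<close>)
  then obtain d where d: "d > 0" "\<And>f x. f \<in> F \<Longrightarrow> in_box n d a x \<Longrightarrow> on_branch x \<Longrightarrow> f x = 0" by blast
  have "\<not> (\<forall>x. in_box n (min d \<rho>) a x \<longrightarrow> on_branch x \<longrightarrow> g x = 0)"
  proof
    assume "\<forall>x. in_box n (min d \<rho>) a x \<longrightarrow> on_branch x \<longrightarrow> g x = 0"
    then have "g \<in> germ_ideal" unfolding germ_ideal_def using g(1) d(1) \<open>\<rho> > 0\<close>
      by (intro CollectI conjI exI[of _ "min d \<rho>"]) simp_all
    then show False using g(2) eq by blast
  qed
  then obtain x where x: "in_box n (min d \<rho>) a x" "on_branch x" "g x \<noteq> 0" by blast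
  have "f x = 0" if "f \<in> ideal_gen S F" for f
    using that by (induction rule: ideal_gen.induct) (use d(2)[OF _ in_box_mono[OF x(1)] x(2)] in auto)
  then show ?thesis using x(3) in_box_mono[OF x(1), of \<rho>] F(3) by (intro exI[of _ x]) auto
qed

end

section \<open>Polynomials as functions\<close>

definition monom_fun :: "(nat \<Rightarrow>\<^sub>0 nat) \<Rightarrow> (nat \<Rightarrow> 'a::comm_ring_1) \<Rightarrow> 'a" where
  "monom_fun m x = (\<Prod>i\<in>Poly_Mapping.keys m. x i ^ Poly_Mapping.lookup m i)"

definition mpol_fun :: "'a::comm_ring_1 mpol \<Rightarrow> (nat \<Rightarrow> 'a) \<Rightarrow> 'a" where
  "mpol_fun p x = (\<Sum>m\<in>Poly_Mapping.keys p. Poly_Mapping.lookup p m * monom_fun m x)"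

abbreviation mpol_const :: "'a::comm_ring_1 \<Rightarrow> 'a mpol" where
  "mpol_const c \<equiv> Poly_Mapping.single 0 c"

abbreviation mpol_var :: "nat \<Rightarrow> 'a::comm_ring_1 mpol" where
  "mpol_var i \<equiv> Poly_Mapping.single (Poly_Mapping.single i 1) 1"

lemma mpol_eval_eq_mpol_fun: "mpol_eval p v = mpol_fun p (($) v)"
  unfolding mpol_eval_def mpol_fun_def monom_fun_def ..

lemma monom_fun_superset:
  "finite A \<Longrightarrow> Poly_Mapping.keys m \<subseteq> A \<Longrightarrow> monom_fun m x = (\<Prod>i\<in>A. x i ^ Poly_Mapping.lookup m i)"
  unfolding monom_fun_def by (intro prod.mono_neutral_left) (auto simp: in_keys_iff)

lemma monom_fun_add: "monom_fun (m + m') x = monom_fun m x * monom_fun m' x"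
proof -
  let ?A = "Poly_Mapping.keys m \<union> Poly_Mapping.keys m'"
  have "monom_fun (m + m') x = (\<Prod>i\<in>?A. x i ^ Poly_Mapping.lookup (m + m') i)"
    by (intro monom_fun_superset keys_add) auto
  also have "\<dots> = (\<Prod>i\<in>?A. x i ^ Poly_Mapping.lookup m i) * (\<Prod>i\<in>?A. x i ^ Poly_Mapping.lookup m' i)"
    by (simp add: lookup_add power_add prod.distrib)
  finally show ?thesis by (simp add: monom_fun_superset[of ?A])
qed

lemma monom_fun_zero [simp]: "monom_fun 0 x = 1"
  unfolding monom_fun_def by simp

lemma monom_fun_single [simp]: "monom_fun (Poly_Mapping.single i k) x = x i ^ k"
  by (subst monom_fun_superset[of "{i}"]) auto

lemma mpol_fun_superset:
  "finite A \<Longrightarrow> Poly_Mapping.keys p \<subseteq> A \<Longrightarrow> mpol_fun p x = (\<Sum>m\<in>A. Poly_Mapping.lookup p m * monom_fun m x)"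
  unfolding mpol_fun_def by (intro sum.mono_neutral_left) (auto simp: in_keys_iff)

lemma mpol_fun_add: "mpol_fun (p + q) x = mpol_fun p x + mpol_fun q x"
proof -
  let ?A = "Poly_Mapping.keys p \<union> Poly_Mapping.keys q"
  have "mpol_fun (p + q) x = (\<Sum>m\<in>?A. Poly_Mapping.lookup (p + q) m * monom_fun m x)"
    by (intro mpol_fun_superset keys_add) auto
  also have "\<dots> = (\<Sum>m\<in>?A. Poly_Mapping.lookup p m * monom_fun m x) + (\<Sum>m\<in>?A. Poly_Mapping.lookup q m * monom_fun m x)"
    by (simp add: lookup_add distrib_right sum.distrib)
  finally show ?thesis by (simp add: mpol_fun_superset[of ?A])
qed

lemma mpol_fun_zero [simp]: "mpol_fun 0 x = 0"
  unfolding mpol_fun_def by simp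

lemma mpol_fun_sum: "mpol_fun (\<Sum>i\<in>I. p i) x = (\<Sum>i\<in>I. mpol_fun (p i) x)"
  by (induction I rule: infinite_finite_induct) (auto simp: mpol_fun_add)

lemma mpol_fun_single [simp]: "mpol_fun (Poly_Mapping.single m c) x = c * monom_fun m x"
  by (subst mpol_fun_superset[of "{m}"]) auto

lemma mpol_eq_sum_monomials:
  "p = (\<Sum>m\<in>Poly_Mapping.keys p. Poly_Mapping.single m (Poly_Mapping.lookup p m))"
  by (rule poly_mapping_eqI) (auto simp: lookup_sum lookup_single when_def in_keys_iff)

lemma mpol_fun_mult: "mpol_fun (p * q) x = mpol_fun p x * mpol_fun q x"
proof -
  let ?s = "\<lambda>p. (\<Sum>m\<in>Poly_Mapping.keys p. Poly_Mapping.single m (Poly_Mapping.lookup p m))"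
  have "p * q = ?s p * ?s q" by (metis mpol_eq_sum_monomials)
  also have "\<dots> = (\<Sum>m\<in>Poly_Mapping.keys p. \<Sum>m'\<in>Poly_Mapping.keys q.
      Poly_Mapping.single (m + m') (Poly_Mapping.lookup p m * Poly_Mapping.lookup q m'))"
    by (simp add: sum_product mult_single)
  also have "mpol_fun \<dots> x = (\<Sum>m\<in>Poly_Mapping.keys p. \<Sum>m'\<in>Poly_Mapping.keys q.
      (Poly_Mapping.lookup p m * monom_fun m x) * (Poly_Mapping.lookup q m' * monom_fun m' x))"
    by (simp add: mpol_fun_sum monom_fun_add mult_ac)
  also have "\<dots> = mpol_fun p x * mpol_fun q x" unfolding mpol_fun_def sum_product ..
  finally show ?thesis .
qed

lemma mpol_fun_one [simp]: "mpol_fun 1 x = 1"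
  unfolding Poly_Mapping.single_one[symmetric] mpol_fun_single by simp

lemma mpol_fun_uminus: "mpol_fun (- p) x = - mpol_fun p x"
  using mpol_fun_add[of p "- p" x] by (simp add: eq_neg_iff_add_eq_0 add.commute)

lemma mpol_fun_diff: "mpol_fun (p - q) x = mpol_fun p x - mpol_fun q x"
  using mpol_fun_add[of p "- q" x] by (simp add: mpol_fun_uminus)

lemmas mpol_fun_simps = mpol_fun_add mpol_fun_mult mpol_fun_diff mpol_fun_uminus

lemma mpolsI: "(\<And>m i. m \<in> Poly_Mapping.keys p \<Longrightarrow> i \<in> Poly_Mapping.keys m \<Longrightarrow> i < n) \<Longrightarrow> p \<in> mpols n"
  unfolding mpols_def mpol_vars_def by auto

lemma mpolsD: "p \<in> mpols n \<Longrightarrow> m \<in> Poly_Mapping.keys p \<Longrightarrow> Poly_Mapping.keys m \<subseteq> {..<n}"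
  unfolding mpols_def mpol_vars_def by auto

lemma mpols_add: "p \<in> mpols n \<Longrightarrow> q \<in> mpols n \<Longrightarrow> p + q \<in> mpols n"
  using keys_add[of p q] mpolsD by (intro mpolsI) blast

lemma mpols_mult: "p \<in> mpols n \<Longrightarrow> q \<in> mpols n \<Longrightarrow> p * q \<in> mpols n"
proof (rule mpolsI)
  fix m i assume pq: "p \<in> mpols n" "q \<in> mpols n" and "m \<in> Poly_Mapping.keys (p * q)" and i: "i \<in> Poly_Mapping.keys m"
  from this(3) obtain a b where "m = a + b" "a \<in> Poly_Mapping.keys p" "b \<in> Poly_Mapping.keys q"
    using keys_mult[of p q] by blast
  moreover then have "i \<in> Poly_Mapping.keys a \<union> Poly_Mapping.keys b" using i keys_add[of a b] by blast
  ultimately show "i < n" using mpolsD[OF pq(1)] mpolsD[OF pq(2)] by blast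
qed

lemma mpols_single: "Poly_Mapping.keys m \<subseteq> {..<n} \<Longrightarrow> Poly_Mapping.single m c \<in> mpols n"
  by (intro mpolsI) (auto split: if_splits)

lemma mpols_const: "mpol_const c \<in> mpols n"
  by (intro mpols_single) auto

lemma mpols_var: "i < n \<Longrightarrow> mpol_var i \<in> mpols n"
  by (intro mpols_single) auto

lemma mpols_zero: "(0 :: 'a::comm_ring_1 mpol) \<in> mpols n"
  using mpols_const[of 0 n] by simp

lemma mpols_one: "(1 :: 'a::comm_ring_1 mpol) \<in> mpols n"
  using mpols_const[of 1 n] by simp

lemma mpols_uminus: "p \<in> mpols n \<Longrightarrow> - p \<in> mpols n" for p :: "'a::comm_ring_1 mpol"
  using mpolsD[of p n] by (intro mpolsI) auto

lemma mpols_diff: "p \<in> mpols n \<Longrightarrow> q \<in> mpols n \<Longrightarrow> p - q \<in> mpols n"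
  for p q :: "'a::comm_ring_1 mpol"
  using mpols_add[OF _ mpols_uminus, of p n q] by simp

lemma mpols_subring: "is_subring (mpols n :: 'a::comm_ring_1 mpol set)"
  unfolding is_subring_def by (simp add: mpols_zero mpols_one mpols_add mpols_mult mpols_diff)

lemma monom_fun_polyfuns: "Poly_Mapping.keys m \<subseteq> {..<n} \<Longrightarrow> monom_fun m \<in> polyfuns {..<n}"
  unfolding monom_fun_def[abs_def] by (intro polyfuns_prod polyfuns_power polyfuns_var) auto

lemma mpol_fun_polyfuns: "p \<in> mpols n \<Longrightarrow> mpol_fun p \<in> polyfuns {..<n}"
  unfolding mpol_fun_def[abs_def]
  by (intro polyfuns_sum polyfuns_mult polyfuns_const monom_fun_polyfuns) (auto dest: mpolsD)

lemma polyfuns_mpol: "f \<in> polyfuns {..<n} \<Longrightarrow> \<exists>p\<in>mpols n. mpol_fun p = f"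
proof (induction rule: polyfuns.induct)
  case (polyfuns_const c)
  show ?case by (intro bexI[of _ "mpol_const c"] ext) (auto intro: mpols_const)
next
  case (polyfuns_var i)
  then show ?case by (intro bexI[of _ "mpol_var i"] ext) (auto simp: mpols_var[unfolded One_nat_def])
next
  case (polyfuns_add f g)
  then obtain p q where pq: "p \<in> mpols n" "mpol_fun p = f" "q \<in> mpols n" "mpol_fun q = g" by blast
  show ?case by (intro bexI[of _ "p + q"] ext mpols_add) (auto simp: mpol_fun_add pq)
next
  case (polyfuns_mult f g)
  then obtain p q where pq: "p \<in> mpols n" "mpol_fun p = f" "q \<in> mpols n" "mpol_fun q = g" by blast
  show ?case by (intro bexI[of _ "p * q"] ext mpols_mult) (auto simp: mpol_fun_mult pq)
qed

lemma mpol_fun_plus_fun: "mpol_fun (p + q) = mpol_fun p + mpol_fun q"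
  by (rule ext) (simp add: mpol_fun_add)

lemma mpol_fun_times_fun: "mpol_fun (p * q) = mpol_fun p * mpol_fun q"
  by (rule ext) (simp add: mpol_fun_mult)

lemma mpol_eval_vec: "p \<in> mpols n \<Longrightarrow> mpol_eval p (vec n x) = mpol_fun p x"
  unfolding mpol_eval_eq_mpol_fun by (rule polyfuns_cong[OF mpol_fun_polyfuns]) auto

subsection \<open>The formal derivative is the gradient\<close>

definition monom_deriv :: "nat \<Rightarrow> (nat \<Rightarrow>\<^sub>0 nat) \<Rightarrow> (nat \<Rightarrow> 'a::comm_ring_1) \<Rightarrow> 'a" where
  "monom_deriv j m x = of_nat (Poly_Mapping.lookup m j) * monom_fun (m - Poly_Mapping.single j 1) x"

lemma monom_split:
  assumes "Poly_Mapping.lookup m i > 0" shows "(m :: nat \<Rightarrow>\<^sub>0 nat) = (m - Poly_Mapping.single i 1) + Poly_Mapping.single i 1"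
  using assms by (intro poly_mapping_eqI) (auto simp: lookup_add lookup_minus lookup_single when_def)

lemma monom_deriv_mult_var:
  "monom_deriv j (m + Poly_Mapping.single i 1) x = monom_fun m x * (if j = i then 1 else 0) + x i * monom_deriv j m x"
proof (cases "Poly_Mapping.lookup m j = 0")
  case True
  have "m + Poly_Mapping.single i 1 - Poly_Mapping.single i 1 = m" by simp
  then show ?thesis using True unfolding monom_deriv_def by (auto simp: lookup_add lookup_single when_def)
next
  case False
  define m' where "m' = m - Poly_Mapping.single j 1"
  have m: "m = m' + Poly_Mapping.single j 1" using monom_split[of m j] False unfolding m'_def by simp
  have 1: "m + Poly_Mapping.single i 1 - Poly_Mapping.single j 1 = m' + Poly_Mapping.single i 1"
    unfolding m by (rule poly_mapping_eqI) (simp add: lookup_add lookup_minus)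
  show ?thesis unfolding monom_deriv_def 1 m'_def[symmetric] monom_fun_add
    by (auto simp: m monom_fun_add lookup_add lookup_single when_def algebra_simps)
qed

lemma monom_has_gradient:
  fixes a :: "nat \<Rightarrow> 'a::linordered_field"
  assumes "Poly_Mapping.keys m \<subseteq> {..<n}"
  shows "has_gradient n (monom_fun m) a (\<lambda>j. monom_deriv j m a)"
  using assms
proof (induction "\<Sum>i<n. Poly_Mapping.lookup m i" arbitrary: m rule: less_induct)
  case less
  show ?case
  proof (cases "m = 0")
    case True
    have eq: "(monom_fun m :: (nat \<Rightarrow> 'a) \<Rightarrow> 'a) = (\<lambda>_. 1)" "(\<lambda>j. monom_deriv j m a) = (\<lambda>_. 0)"
      unfolding True monom_deriv_def by auto
    show ?thesis unfolding eq by (rule has_gradient_const)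
  next
    case False
    then obtain i where i0: "i \<in> Poly_Mapping.keys m" by fastforce
    then have i: "i < n" "Poly_Mapping.lookup m i > 0" using less.prems by (blast, simp add: in_keys_iff)
    define m' where "m' = m - Poly_Mapping.single i 1"
    have m: "m = m' + Poly_Mapping.single i 1" unfolding m'_def by (rule monom_split[OF i(2)])
    have le: "Poly_Mapping.lookup m' j \<le> Poly_Mapping.lookup m j" for j unfolding m by (simp add: lookup_add)
    have keys: "Poly_Mapping.keys m' \<subseteq> {..<n}"
    proof
      fix j assume "j \<in> Poly_Mapping.keys m'"
      then have "j \<in> Poly_Mapping.keys m" using le[of j] by (simp add: in_keys_iff)
      then show "j \<in> {..<n}" using less.prems by blast
    qed
    have "(\<Sum>i<n. Poly_Mapping.lookup m' i) < (\<Sum>i<n. Poly_Mapping.lookup m i)"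
      by (rule sum_strict_mono_ex1) (use le i m in \<open>auto simp: lookup_add intro!: bexI[of _ i]\<close>)
    from less.hyps[OF this keys]
    have "has_gradient n (\<lambda>x. monom_fun m' x * x i) a
        (\<lambda>j. monom_fun m' a * (if j = i then 1 else 0) + a i * monom_deriv j m' a)"
      using i by (intro has_gradient_mult has_gradient_var monom_fun_polyfuns keys polyfuns_var) auto
    moreover have "(monom_fun m :: (nat \<Rightarrow> 'a) \<Rightarrow> 'a) = (\<lambda>x. monom_fun m' x * x i)" unfolding m by (auto simp: monom_fun_add)
    ultimately show ?thesis unfolding m monom_deriv_mult_var by simp
  qed
qed

lemma has_gradient_sum:
  "(\<And>i. i \<in> I \<Longrightarrow> has_gradient n (f i) a (g i)) \<Longrightarrow>
    has_gradient n (\<lambda>x. \<Sum>i\<in>I. f i x) a (\<lambda>j. \<Sum>i\<in>I. g i j)"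
proof (induction I rule: infinite_finite_induct)
  case (insert i I)
  then show ?case using has_gradient_add[of n "f i" a "g i"] by simp
qed (use has_gradient_const[of n 0 a] in auto)

lemma has_gradient_cmult:
  fixes f :: "(nat \<Rightarrow> 'a::linordered_field) \<Rightarrow> 'a"
  assumes "has_gradient n f a g" "f \<in> polyfuns {..<n}"
  shows "has_gradient n (\<lambda>x. c * f x) a (\<lambda>i. c * g i)"
  using has_gradient_mult[OF has_gradient_const[of n c a] polyfuns_const assms] by simp

lemma mpol_has_gradient:
  fixes p :: "'a::linordered_field mpol"
  assumes "p \<in> mpols n"
  shows "has_gradient n (mpol_fun p) a (\<lambda>j. mpol_fun (mpol_deriv j p) a)"
proof -
  have "has_gradient n (\<lambda>x. \<Sum>m\<in>Poly_Mapping.keys p. Poly_Mapping.lookup p m * monom_fun m x) a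
      (\<lambda>j. \<Sum>m\<in>Poly_Mapping.keys p. Poly_Mapping.lookup p m * monom_deriv j m a)"
    using mpolsD[OF assms] by (intro has_gradient_sum has_gradient_cmult monom_has_gradient monom_fun_polyfuns) auto
  moreover have "mpol_fun (mpol_deriv j p) a = (\<Sum>m\<in>Poly_Mapping.keys p. Poly_Mapping.lookup p m * monom_deriv j m a)" for j
    unfolding mpol_deriv_def mpol_fun_sum monom_deriv_def by (simp add: mult_ac)
  ultimately show ?thesis unfolding mpol_fun_def[abs_def] by simp
qed

section \<open>Bases of a row space\<close>

definition delta :: "nat \<Rightarrow> nat \<Rightarrow> 'a::comm_ring_1" where
  "delta i j = (if i = j then 1 else 0)"

lemma sum_delta:
  "i < n \<Longrightarrow> (\<Sum>l<n. delta i l * f l) = f i" "i < n \<Longrightarrow> (\<Sum>l<n. f l * delta l i) = f i"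
  unfolding delta_def by (auto simp: if_distrib[of "\<lambda>t. t * _"] if_distrib[of "\<lambda>t. _ * t"] cong: if_cong)

definition mutually_inverse :: "nat \<Rightarrow> (nat \<Rightarrow> nat \<Rightarrow> 'a::comm_ring_1) \<Rightarrow> (nat \<Rightarrow> nat \<Rightarrow> 'a) \<Rightarrow> bool" where
  "mutually_inverse n B G \<longleftrightarrow> (\<forall>i<n. \<forall>j<n. (\<Sum>l<n. B i l * G l j) = delta i j) \<and>
     (\<forall>i<n. \<forall>j<n. (\<Sum>l<n. G i l * B l j) = delta i j)"

lemma sum_remove_lessThan: "p < n \<Longrightarrow> (\<Sum>l<n. f l) = f p + (\<Sum>l\<in>{..<n}-{p}. f (l::nat) :: 'a::comm_ring_1)"
  by (subst sum.remove[of _ p]) auto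

text \<open>The exchange step of Steinitz: \<open>u\<close> holds the coordinates of the new row \<open>v\<close> in the old basis,
  and the row \<open>p\<close> with \<open>u p \<noteq> 0\<close> is replaced.\<close>

lemma exchange_row:
  fixes B G :: "nat \<Rightarrow> nat \<Rightarrow> 'a::field"
  assumes BG: "mutually_inverse n B G" and p: "p < n" "u p \<noteq> 0"
    and u: "\<And>l. u l = (\<Sum>j<n. v j * B j l)"
  shows "mutually_inverse n (\<lambda>j l. if l = p then B j p / u p else B j l - B j p * u l / u p)
      (\<lambda>l. if l = p then v else G l)" (is "mutually_inverse n ?B ?G")
proof -
  have v: "(\<Sum>l<n. u l * G l j) = v j" if "j < n" for j
  proof -
    have "(\<Sum>l<n. u l * G l j) = (\<Sum>l<n. \<Sum>i<n. v i * (B i l * G l j))"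
      unfolding u sum_distrib_right by (simp add: mult_ac)
    also have "\<dots> = (\<Sum>i<n. v i * (\<Sum>l<n. B i l * G l j))"
      unfolding sum_distrib_left by (rule sum.swap)
    also have "\<dots> = (\<Sum>i<n. v i * delta i j)"
      using BG that unfolding mutually_inverse_def by (intro sum.cong) auto
    finally show ?thesis using sum_delta(2)[OF that] by simp
  qed
  have 1: "(\<Sum>l<n. ?B i l * ?G l j) = delta i j" if ij: "i < n" "j < n" for i j
  proof -
    have "(\<Sum>l<n. ?B i l * ?G l j) = B i p / u p * v j + (\<Sum>l\<in>{..<n}-{p}. ?B i l * ?G l j)"
      by (subst sum_remove_lessThan[OF p(1)]) simp
    also have "(\<Sum>l\<in>{..<n}-{p}. ?B i l * ?G l j) = (\<Sum>l\<in>{..<n}-{p}. B i l * G l j - B i p / u p * (u l * G l j))"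
      by (intro sum.cong) (auto simp: algebra_simps)
    also have "\<dots> = (\<Sum>l\<in>{..<n}-{p}. B i l * G l j) - B i p / u p * (\<Sum>l\<in>{..<n}-{p}. u l * G l j)"
      by (simp add: sum_subtractf sum_distrib_left)
    also have "(\<Sum>l\<in>{..<n}-{p}. B i l * G l j) = delta i j - B i p * G p j"
      using BG ij sum_remove_lessThan[OF p(1), of "\<lambda>l. B i l * G l j"] unfolding mutually_inverse_def by simp
    also have "(\<Sum>l\<in>{..<n}-{p}. u l * G l j) = v j - u p * G p j"
      using v[OF ij(2)] sum_remove_lessThan[OF p(1), of "\<lambda>l. u l * G l j"] by (metis add_diff_cancel_left')
    finally show ?thesis using p(2) by (simp add: field_simps)
  qed
  have 2: "(\<Sum>l<n. ?G i l * ?B l j) = delta i j" if ij: "i < n" "j < n" for i j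
  proof -
    define w where "w = (\<lambda>l. (\<Sum>j<n. ?G i j * B j l))"
    have w: "w l = (if i = p then u l else delta i l)" if "l < n" for l
      using BG ij that unfolding mutually_inverse_def w_def u by auto
    have "(\<Sum>l<n. ?G i l * ?B l j) = (if j = p then w p / u p else w j - w p * u j / u p)"
    proof (cases "j = p")
      case True
      then show ?thesis unfolding w_def sum_divide_distrib by simp
    next
      case False
      then have "(\<Sum>l<n. ?G i l * ?B l j) = (\<Sum>l<n. ?G i l * B l j - ?G i l * B l p * (u j / u p))"
        by (intro sum.cong) (auto simp: algebra_simps)
      also have "\<dots> = w j - w p * (u j / u p)"
        unfolding w_def sum_subtractf sum_distrib_right[symmetric] ..
      finally show ?thesis using False by simp
    qed
    also have "\<dots> = delta i j"
      unfolding w[OF p(1)] w[OF ij(2)] using p by (auto simp: delta_def)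
    finally show ?thesis .
  qed
  from 1 2 show ?thesis unfolding mutually_inverse_def by blast
qed

lemma ex_row_basis:
  fixes M :: "nat \<Rightarrow> nat \<Rightarrow> 'a::field"
  shows "\<exists>U B G. U \<subseteq> {..<n} \<and> mutually_inverse n B G \<and> (\<forall>l\<in>U. \<exists>i<k. \<forall>j<n. G l j = M i j) \<and>
    (\<forall>i<k. \<exists>c. \<forall>j<n. M i j = (\<Sum>l\<in>U. c l * G l j))"
proof (induction k)
  case 0
  have "mutually_inverse n delta (delta :: nat \<Rightarrow> nat \<Rightarrow> 'a)"
    unfolding mutually_inverse_def using sum_delta by auto
  then show ?case by (intro exI[of _ "{}"]) auto
next
  case (Suc k)
  then obtain U B G where U: "U \<subseteq> {..<n}" and BG: "mutually_inverse n B G"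
    and GM: "\<forall>l\<in>U. \<exists>i<k. \<forall>j<n. G l j = M i j" and MG: "\<forall>i<k. \<exists>c. \<forall>j<n. M i j = (\<Sum>l\<in>U. c l * G l j)"
    by blast
  have finU: "finite U" using U finite_subset by blast
  define u where "u = (\<lambda>l. \<Sum>j<n. M k j * B j l)"
  show ?case
  proof (cases "\<exists>p<n. p \<notin> U \<and> u p \<noteq> 0")
    case True
    then obtain p where p: "p < n" "p \<notin> U" "u p \<noteq> 0" by blast
    define G' where "G' = (\<lambda>l. if l = p then M k else G l)"
    have "mutually_inverse n (\<lambda>j l. if l = p then B j p / u p else B j l - B j p * u l / u p) G'"
      unfolding G'_def by (rule exchange_row[of n B G p u "M k", OF BG p(1,3)]) (simp add: u_def)
    moreover have "insert p U \<subseteq> {..<n}" using U p by auto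
    moreover have "\<forall>l\<in>insert p U. \<exists>i<Suc k. \<forall>j<n. G' l j = M i j"
    proof
      fix l assume l: "l \<in> insert p U"
      show "\<exists>i<Suc k. \<forall>j<n. G' l j = M i j"
      proof (cases "l = p")
        case False
        then obtain i where "i < k" "\<forall>j<n. G l j = M i j" using GM l by blast
        then show ?thesis using False unfolding G'_def by (intro exI[of _ i]) auto
      qed (auto simp: G'_def)
    qed
    moreover have "\<exists>c. \<forall>j<n. M i j = (\<Sum>l\<in>insert p U. c l * G' l j)" if i: "i < Suc k" for i
    proof (cases "i = k")
      case True
      have "(\<Sum>l\<in>U. (if l = p then 1 else 0) * G' l j) = 0" for j
        using p(2) by (intro sum.neutral) auto
      then show ?thesis using True p(2) finU by (intro exI[of _ "\<lambda>l. if l = p then 1 else 0"]) (auto simp: G'_def)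
    next
      case False
      then obtain c where c: "\<forall>j<n. M i j = (\<Sum>l\<in>U. c l * G l j)" using MG i by (metis less_SucE)
      have "(\<Sum>l\<in>U. (if l = p then 0 else c l) * G' l j) = (\<Sum>l\<in>U. c l * G l j)" for j
        using p(2) unfolding G'_def by (intro sum.cong) auto
      then show ?thesis using c p(2) finU by (intro exI[of _ "\<lambda>l. if l = p then 0 else c l"]) auto
    qed
    ultimately show ?thesis by blast
  next
    case False
    have "M k j = (\<Sum>l\<in>U. u l * G l j)" if "j < n" for j
    proof -
      have "M k j = (\<Sum>i<n. M k i * (\<Sum>l<n. B i l * G l j))"
        using BG that sum_delta(2)[OF that, of "M k"] unfolding mutually_inverse_def by simp
      also have "\<dots> = (\<Sum>l<n. \<Sum>i<n. M k i * (B i l * G l j))"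
        unfolding sum_distrib_left by (rule sum.swap)
      also have "\<dots> = (\<Sum>l<n. u l * G l j)" unfolding u_def sum_distrib_right by (simp add: mult_ac)
      also have "\<dots> = (\<Sum>l\<in>U. u l * G l j)"
        using U False by (intro sum.mono_neutral_right) auto
      finally show ?thesis .
    qed
    then have MG': "\<forall>i<Suc k. \<exists>c. \<forall>j<n. M i j = (\<Sum>l\<in>U. c l * G l j)" using MG by (metis less_SucE)
    have GM': "\<forall>l\<in>U. \<exists>i<Suc k. \<forall>j<n. G l j = M i j" using GM less_SucI by meson
    show ?thesis by (rule exI[of _ U], rule exI[of _ B], rule exI[of _ G]) (intro conjI U BG GM' MG')
  qed
qed

text \<open>Such a matrix is a sum of \<open>card U\<close> matrices of rank at most \<open>1\<close>.\<close>

lemma rank_sum_products_le: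
  fixes c G :: "nat \<Rightarrow> nat \<Rightarrow> 'a::field"
  assumes "finite U"
  shows "vec_space.rank k (mat k n (\<lambda>(i, j). \<Sum>l\<in>U. c i l * G l j)) \<le> card U"
  using assms
proof (induction U)
  case empty
  have eq: "mat k n (\<lambda>(i, j). \<Sum>l\<in>{}. c i l * G l j) = 0\<^sub>m k n" by auto
  show ?case unfolding eq using vec_space.rank_0I[of k n] by simp
next
  case (insert p U)
  have "mat k n (\<lambda>(i, j). \<Sum>l\<in>insert p U. c i l * G l j)
      = mat k n (\<lambda>(i, j). c i p * G p j) + mat k n (\<lambda>(i, j). \<Sum>l\<in>U. c i l * G l j)"
    using insert.hyps by auto
  then have "vec_space.rank k (mat k n (\<lambda>(i, j). \<Sum>l\<in>insert p U. c i l * G l j))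
      \<le> vec_space.rank k (mat k n (\<lambda>(i, j). c i p * G p j)) + vec_space.rank k (mat k n (\<lambda>(i, j). \<Sum>l\<in>U. c i l * G l j))"
    using vec_space.rank_subadditive[of "mat k n (\<lambda>(i, j). c i p * G p j)" k n] by simp
  also have "vec_space.rank k (mat k n (\<lambda>(i, j). c i p * G p j)) \<le> 1"
    by (rule vec_space.rank_le_1_product_entries[of _ k n "\<lambda>i. c i p" "G p"]) auto
  finally show ?case using insert by simp
qed

lemma ex_bij_to_initial_segment:
  assumes "U \<subseteq> {..<n::nat}"
  shows "\<exists>\<sigma>. bij_betw \<sigma> {..<n} {..<n} \<and> \<sigma> ` {..<card U} = U"
proof -
  have fin: "finite U" using assms finite_subset by blast
  have le: "card U \<le> n" using card_mono[OF _ assms] by simp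
  have "card ({..<n} - U) = card {card U..<n}" using card_Diff_subset[OF fin assms] by simp
  then obtain h where h: "bij_betw h {card U..<n} ({..<n} - U)"
    using finite_same_card_bij[of "{card U..<n}" "{..<n} - U"] by auto
  obtain f where f: "bij_betw f {..<card U} U"
    using finite_same_card_bij[of "{..<card U}" U] fin by auto
  define \<sigma> where "\<sigma> = (\<lambda>i. if i < card U then f i else h i)"
  have f': "bij_betw \<sigma> {..<card U} U" using bij_betw_cong[of "{..<card U}" f \<sigma>] f unfolding \<sigma>_def by simp
  have h': "bij_betw \<sigma> {card U..<n} ({..<n} - U)"
    using bij_betw_cong[of "{card U..<n}" h \<sigma>] h unfolding \<sigma>_def by simp
  have "bij_betw \<sigma> ({..<card U} \<union> {card U..<n}) (U \<union> ({..<n} - U))"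
    by (rule bij_betw_combine[OF f' h']) auto
  moreover have "{..<card U} \<union> {card U..<n} = {..<n}" "U \<union> ({..<n} - U) = {..<n}" using le assms by auto
  ultimately show ?thesis using bij_betw_imp_surj_on[OF f'] by metis
qed

text \<open>A matrix has at least as many independent rows as its rank, and they extend to an
  invertible matrix.\<close>

lemma independent_rows_extend:
  fixes M :: "nat \<Rightarrow> nat \<Rightarrow> 'a::field"
  shows "\<exists>r B G s. vec_space.rank k (mat k n (\<lambda>(i, j). M i j)) \<le> r \<and> r \<le> n \<and> mutually_inverse n B G \<and>
    (\<forall>l<r. s l < k \<and> (\<forall>j<n. G l j = M (s l) j))"
proof -
  obtain U B G where U: "U \<subseteq> {..<n}" and BG: "mutually_inverse n B G"
    and GM: "\<forall>l\<in>U. \<exists>i<k. \<forall>j<n. G l j = M i j" and MG: "\<forall>i<k. \<exists>c. \<forall>j<n. M i j = (\<Sum>l\<in>U. c l * G l j)"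
    using ex_row_basis[of n k M] by blast
  have finU: "finite U" using U finite_subset by blast
  from MG obtain c where c: "\<And>i j. i < k \<Longrightarrow> j < n \<Longrightarrow> M i j = (\<Sum>l\<in>U. c i l * G l j)" by metis
  have "mat k n (\<lambda>(i, j). M i j) = mat k n (\<lambda>(i, j). \<Sum>l\<in>U. c i l * G l j)" using c by (intro cong_mat) auto
  then have rank: "vec_space.rank k (mat k n (\<lambda>(i, j). M i j)) \<le> card U"
    using rank_sum_products_le[OF finU, of k n c G] by simp
  obtain \<sigma> where \<sigma>: "bij_betw \<sigma> {..<n} {..<n}" "\<sigma> ` {..<card U} = U"
    using ex_bij_to_initial_segment[OF U] by blast
  have \<sigma>n: "\<sigma> i < n" if "i < n" for i using bij_betwE[OF \<sigma>(1)] that by auto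
  have \<sigma>_eq: "\<sigma> i = \<sigma> j \<longleftrightarrow> i = j" if "i < n" "j < n" for i j
    using bij_betw_imp_inj_on[OF \<sigma>(1)] that unfolding inj_on_def by auto
  have "(\<Sum>l<n. B i (\<sigma> l) * G (\<sigma> l) j) = delta i j" if "i < n" "j < n" for i j
    using sum.reindex_bij_betw[OF \<sigma>(1), of "\<lambda>l. B i l * G l j"] BG that unfolding mutually_inverse_def by simp
  moreover have "(\<Sum>l<n. G (\<sigma> i) l * B l (\<sigma> j)) = delta i j" if "i < n" "j < n" for i j
    using BG \<sigma>n[OF that(1)] \<sigma>n[OF that(2)] \<sigma>_eq[OF that] unfolding mutually_inverse_def delta_def by simp
  ultimately have inv: "mutually_inverse n (\<lambda>i l. B i (\<sigma> l)) (\<lambda>l. G (\<sigma> l))"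
    unfolding mutually_inverse_def by blast
  from GM have "\<forall>l\<in>{..<card U}. \<exists>i. i < k \<and> (\<forall>j<n. G (\<sigma> l) j = M i j)" using \<sigma>(2) by blast
  then obtain s where s: "\<forall>l\<in>{..<card U}. s l < k \<and> (\<forall>j<n. G (\<sigma> l) j = M (s l) j)" by (rule bchoice[THEN exE])
  have "card U \<le> n" using card_mono[OF _ U] by simp
  with rank inv s show ?thesis
    by (intro exI[of _ "card U"] exI[of _ "\<lambda>i l. B i (\<sigma> l)"] exI[of _ "\<lambda>l. G (\<sigma> l)"] exI[of _ s] conjI) auto
qed


section \<open>Ideals of polynomials and of polynomial functions\<close>

lemma mpol_ring_simps [simp]:
  "carrier (mpol_ring n) = mpols n" "monoid.mult (mpol_ring n) = (*)" "monoid.one (mpol_ring n) = 1"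
  "ring.zero (mpol_ring n) = 0" "ring.add (mpol_ring n) = (+)"
  unfolding mpol_ring_def by auto

lemma cring_mpol_ring: "cring (mpol_ring n :: 'a::comm_ring_1 mpol ring)"
proof (rule cringI)
  show "abelian_group (mpol_ring n :: 'a mpol ring)"
  proof (rule abelian_groupI)
    fix p :: "'a mpol" assume "p \<in> carrier (mpol_ring n)"
    then show "\<exists>q\<in>carrier (mpol_ring n). q \<oplus>\<^bsub>mpol_ring n\<^esub> p = \<zero>\<^bsub>mpol_ring n\<^esub>"
      by (intro bexI[of _ "- p"]) (simp_all add: mpols_uminus)
  qed (simp_all add: mpols_add mpols_zero add_ac)
  show "comm_monoid (mpol_ring n :: 'a mpol ring)"
    by (rule comm_monoidI) (simp_all add: mpols_mult mpols_one mult_ac)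
qed (simp add: distrib_right)

lemma is_ideal_uminus: "is_subring S \<Longrightarrow> is_ideal S I \<Longrightarrow> a \<in> I \<Longrightarrow> - a \<in> I"
  using is_ideal_diff[of S I 0 a] is_idealD(2)[of S I] by simp

lemma ideal_if_is_ideal:
  fixes J :: "'a::comm_ring_1 mpol set"
  assumes J: "is_ideal (mpols n) J"
  shows "ideal J (mpol_ring n)"
proof -
  interpret cring "mpol_ring n :: 'a mpol ring" by (rule cring_mpol_ring)
  show ?thesis
  proof (rule idealI)
    show "ring (mpol_ring n :: 'a mpol ring)" by (rule ring_axioms)
    show "subgroup J (add_monoid (mpol_ring n))"
    proof
      fix p assume p: "p \<in> J"
      then have pn: "p \<in> mpols n" using is_idealD(1)[OF J] by blast
      have "\<ominus>\<^bsub>mpol_ring n\<^esub> p = - p" by (rule minus_equality) (simp_all add: pn mpols_uminus)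
      then have "m_inv (add_monoid (mpol_ring n)) p = - p" unfolding a_inv_def .
      then show "m_inv (add_monoid (mpol_ring n)) p \<in> J" using is_ideal_uminus[OF mpols_subring J p] by simp
    qed (use is_idealD[OF J] in auto)
  next
    fix p q :: "'a mpol" assume pq: "p \<in> J" "q \<in> carrier (mpol_ring n)"
    then have "q * p \<in> J" using is_idealD(4)[OF J] by simp
    then show "q \<otimes>\<^bsub>mpol_ring n\<^esub> p \<in> J" "p \<otimes>\<^bsub>mpol_ring n\<^esub> q \<in> J" by (simp_all add: mult.commute)
  qed
qed

lemma is_prime_if_primeideal:
  fixes J :: "'a::comm_ring_1 mpol set"
  assumes "primeideal J (mpol_ring n)"
  shows "is_prime (mpols n) J"
proof -
  interpret primeideal J "mpol_ring n :: 'a mpol ring" by fact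
  have "is_ideal (mpols n) J"
    unfolding is_ideal_def using a_subset additive_subgroup.zero_closed[OF additive_subgroup_axioms]
      additive_subgroup.a_closed[OF additive_subgroup_axioms] I_l_closed by auto
  moreover have "1 \<notin> J" using one_imp_carrier I_notcarr by auto
  ultimately show ?thesis unfolding is_prime_def using I_prime by auto
qed

definition zero_funs :: "nat \<Rightarrow> 'a::comm_ring_1 vec set \<Rightarrow> ((nat \<Rightarrow> 'a) \<Rightarrow> 'a) set" where
  "zero_funs n X = {f \<in> polyfuns {..<n}. \<forall>x\<in>X. f (($) x) = 0}"

lemma mpol_fun_zero_funs_iff:
  "p \<in> mpols n \<Longrightarrow> mpol_fun p \<in> zero_funs n X \<longleftrightarrow> p \<in> vanishing_ideal n X"
  unfolding zero_funs_def vanishing_ideal_def by (auto simp: mpol_eval_eq_mpol_fun mpol_fun_polyfuns)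

lemma is_ideal_vanishing_ideal: "is_ideal (mpols n) (vanishing_ideal n X)"
  unfolding is_ideal_def vanishing_ideal_def
  by (auto simp: mpols_zero mpols_add mpols_mult mpol_eval_eq_mpol_fun mpol_fun_simps)

lemma is_ideal_zero_funs: "is_ideal (polyfuns {..<n}) (zero_funs n X)"
  unfolding is_ideal_def zero_funs_def using is_subringD[OF polyfuns_subring[of "{..<n}"]] by auto

lemma algebraic_setE:
  assumes "algebraic_set n X"
  obtains S where "S \<subseteq> mpols n" "X = {x \<in> carrier_vec n. \<forall>p\<in>S. mpol_eval p x = 0}"
  using assms unfolding algebraic_set_def by blast

lemma algebraic_set_zero_locus:
  "algebraic_set n X \<Longrightarrow> p \<in> mpols n \<Longrightarrow> algebraic_set n {x \<in> X. mpol_eval p x = 0}"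
proof (erule algebraic_setE)
  fix S assume "p \<in> mpols n" "S \<subseteq> mpols n" "X = {x \<in> carrier_vec n. \<forall>p\<in>S. mpol_eval p x = 0}"
  then show ?thesis unfolding algebraic_set_def by (intro exI[of _ "insert p S"]) auto
qed

lemma nonzero_outside_algebraic_set:
  assumes "algebraic_set n A" "y \<in> carrier_vec n" "y \<notin> A"
  shows "\<exists>p\<in>vanishing_ideal n A. mpol_eval p y \<noteq> 0"
  using assms(1) by (rule algebraic_setE) (use assms in \<open>auto simp: vanishing_ideal_def\<close>)

lemma mem_algebraic_set:
  assumes "algebraic_set n A" "y \<in> carrier_vec n" "\<And>p. p \<in> vanishing_ideal n A \<Longrightarrow> mpol_eval p y = 0"
  shows "y \<in> A"
  using nonzero_outside_algebraic_set[OF assms(1,2)] assms(3) by blast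

lemma vanishing_product:
  fixes X :: "'a::idom vec set"
  assumes X: "irreducible_set n X" and pq: "p \<in> mpols n" "q \<in> mpols n" "p * q \<in> vanishing_ideal n X"
  shows "p \<in> vanishing_ideal n X \<or> q \<in> vanishing_ideal n X"
proof -
  define A where "A = {x \<in> X. mpol_eval p x = 0}"
  define B where "B = {x \<in> X. mpol_eval q x = 0}"
  have alg: "algebraic_set n X"
    and irr: "\<And>A B. algebraic_set n A \<Longrightarrow> algebraic_set n B \<Longrightarrow> X = A \<union> B \<Longrightarrow> X = A \<or> X = B"
    using X unfolding irreducible_set_def by auto
  have "algebraic_set n A" "algebraic_set n B"
    unfolding A_def B_def using algebraic_set_zero_locus[OF alg] pq(1,2) by auto
  moreover have "X = A \<union> B"
    using pq(3) unfolding A_def B_def vanishing_ideal_def by (auto simp: mpol_eval_eq_mpol_fun mpol_fun_mult)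
  ultimately have "X = A \<or> X = B" by (rule irr)
  then have "(\<forall>x\<in>X. mpol_eval p x = 0) \<or> (\<forall>x\<in>X. mpol_eval q x = 0)" unfolding A_def B_def by fast
  then show ?thesis using pq(1,2) unfolding vanishing_ideal_def by auto
qed

lemma one_not_vanishing: "irreducible_set n X \<Longrightarrow> 1 \<notin> vanishing_ideal n X"
  unfolding irreducible_set_def vanishing_ideal_def mpol_eval_eq_mpol_fun by auto

lemma is_prime_vanishing_ideal:
  fixes X :: "'a::idom vec set"
  assumes X: "irreducible_set n X" shows "is_prime (mpols n) (vanishing_ideal n X)"
  unfolding is_prime_def using is_ideal_vanishing_ideal one_not_vanishing[OF X] vanishing_product[OF X] by blast

text \<open>Polynomials modulo a prime containing a vanishing ideal are the same as polynomial functions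
  modulo its image: two polynomials that define the same function differ by an element of every
  vanishing ideal.\<close>

lemma mpol_fun_image_mem_iff:
  assumes J: "is_ideal (mpols n) J" "vanishing_ideal n X \<subseteq> J" and p: "p \<in> mpols n"
  shows "mpol_fun p \<in> mpol_fun ` J \<longleftrightarrow> p \<in> J"
proof
  assume "mpol_fun p \<in> mpol_fun ` J"
  then obtain q where q: "q \<in> J" "mpol_fun p = mpol_fun q" by blast
  have "q \<in> mpols n" using q(1) is_idealD(1)[OF J(1)] by blast
  then have "p - q \<in> vanishing_ideal n X"
    using p q(2) unfolding vanishing_ideal_def mpol_eval_eq_mpol_fun by (simp add: mpol_fun_diff mpols_diff)
  then have "(p - q) + q \<in> J" using J q(1) is_idealD(3)[OF J(1)] by blast
  then show "p \<in> J" by simp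
qed blast

lemma is_prime_mpol_fun_image:
  fixes J :: "'a::comm_ring_1 mpol set"
  assumes J: "is_prime (mpols n) J" "vanishing_ideal n X \<subseteq> J"
  shows "is_prime (polyfuns {..<n}) (mpol_fun ` J)"
proof -
  note Ji = is_primeD(1)[OF J(1)]
  note iff = mpol_fun_image_mem_iff[OF Ji J(2)]
  have JS: "p \<in> mpols n" if "p \<in> J" for p using that is_idealD(1)[OF Ji] by blast
  have "is_ideal (polyfuns {..<n}) (mpol_fun ` J)"
    unfolding is_ideal_def
  proof (intro conjI ballI)
    show "mpol_fun ` J \<subseteq> polyfuns {..<n}" using JS mpol_fun_polyfuns by blast
    have "mpol_fun 0 \<in> mpol_fun ` J" using is_idealD(2)[OF Ji] by blast
    moreover have "mpol_fun 0 = (0 :: (nat \<Rightarrow> 'a) \<Rightarrow> 'a)" by (rule ext) simp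
    ultimately show "0 \<in> mpol_fun ` J" by simp
  next
    fix f g :: "(nat \<Rightarrow> 'a) \<Rightarrow> 'a" assume "f \<in> mpol_fun ` J" "g \<in> mpol_fun ` J"
    then obtain p q where pq: "p \<in> J" "f = mpol_fun p" "q \<in> J" "g = mpol_fun q" by blast
    show "f + g \<in> mpol_fun ` J"
      unfolding pq(2,4) mpol_fun_plus_fun[symmetric] using is_idealD(3)[OF Ji pq(1,3)] by (rule imageI)
  next
    fix f g :: "(nat \<Rightarrow> 'a) \<Rightarrow> 'a" assume f: "f \<in> polyfuns {..<n}" and "g \<in> mpol_fun ` J"
    then obtain q where q: "q \<in> J" "g = mpol_fun q" by blast
    obtain p where p: "p \<in> mpols n" "mpol_fun p = f" using polyfuns_mpol[OF f] by blast
    show "f * g \<in> mpol_fun ` J"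
      unfolding p(2)[symmetric] q(2) mpol_fun_times_fun[symmetric] using is_idealD(4)[OF Ji p(1) q(1)] by (rule imageI)
  qed
  moreover have "1 \<notin> mpol_fun ` J"
  proof
    assume "1 \<in> mpol_fun ` J"
    moreover have "mpol_fun 1 = (1 :: (nat \<Rightarrow> 'a) \<Rightarrow> 'a)" by (rule ext) simp
    ultimately have "mpol_fun 1 \<in> mpol_fun ` J" by simp
    then show False using iff[OF mpols_one] is_primeD(2)[OF J(1)] by blast
  qed
  moreover have "f \<in> mpol_fun ` J \<or> g \<in> mpol_fun ` J"
    if fg: "f \<in> polyfuns {..<n}" "g \<in> polyfuns {..<n}" "f * g \<in> mpol_fun ` J" for f g :: "(nat \<Rightarrow> 'a) \<Rightarrow> 'a"
  proof -
    obtain p where p: "p \<in> mpols n" "mpol_fun p = f" using polyfuns_mpol[OF fg(1)] by blast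
    obtain q where q: "q \<in> mpols n" "mpol_fun q = g" using polyfuns_mpol[OF fg(2)] by blast
    have "mpol_fun (p * q) \<in> mpol_fun ` J"
      using fg(3) unfolding p(2)[symmetric] q(2)[symmetric] mpol_fun_times_fun[symmetric] .
    then have "p * q \<in> J" using iff[OF mpols_mult[OF p(1) q(1)]] by blast
    then have "p \<in> J \<or> q \<in> J" by (rule is_primeD(3)[OF J(1) p(1) q(1)])
    then show ?thesis unfolding p(2)[symmetric] q(2)[symmetric] by blast
  qed
  ultimately show ?thesis unfolding is_prime_def by blast
qed

lemma mpol_fun_image_vanishing_ideal: "mpol_fun ` vanishing_ideal n X = zero_funs n X"
proof
  show "mpol_fun ` vanishing_ideal n X \<subseteq> zero_funs n X"
    using mpol_fun_zero_funs_iff unfolding vanishing_ideal_def by blast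
  show "zero_funs n X \<subseteq> mpol_fun ` vanishing_ideal n X"
  proof
    fix f assume f: "f \<in> zero_funs n X"
    then obtain p where p: "p \<in> mpols n" "mpol_fun p = f" using polyfuns_mpol unfolding zero_funs_def by blast
    then have "p \<in> vanishing_ideal n X" using f mpol_fun_zero_funs_iff by blast
    then show "f \<in> mpol_fun ` vanishing_ideal n X" using p(2) by blast
  qed
qed

lemma krull_dim_chain:
  assumes "krull_dim A = enat d" "d > 0"
  shows "\<exists>P. (\<forall>i\<le>d. primeideal (P i) A) \<and> (\<forall>i<d. P i \<subset> P (Suc i))"
proof -
  define K where "K = {enat k | k. \<exists>P :: nat \<Rightarrow> 'a set. (\<forall>i\<le>k. primeideal (P i) A) \<and> (\<forall>i<k. P i \<subset> P (Suc i))}"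
  have sup: "Sup K = enat d" using assms(1) unfolding krull_dim_def K_def .
  have "K \<noteq> {}"
  proof
    assume "K = {}"
    then have "Sup K = 0" unfolding Sup_enat_def by simp
    then show False using sup assms(2) by (simp add: zero_enat_def)
  qed
  moreover have "finite K"
  proof (rule ccontr)
    assume "infinite K"
    then have "Sup K = \<infinity>" using \<open>K \<noteq> {}\<close> unfolding Sup_enat_def by simp
    then show False using sup by simp
  qed
  ultimately have "enat d \<in> K" using sup Max_in[of K] unfolding Sup_enat_def by simp
  then show ?thesis unfolding K_def by blast
qed

lemma primeideal_coordinate_ring_pullback:
  fixes X :: "'a::comm_ring_1 vec set"
  assumes P: "primeideal P (coordinate_ring n X)"
  shows "is_prime (mpols n) {p \<in> mpols n. vanishing_ideal n X +>\<^bsub>mpol_ring n\<^esub> p \<in> P}"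
    and "vanishing_ideal n X \<subseteq> {p \<in> mpols n. vanishing_ideal n X +>\<^bsub>mpol_ring n\<^esub> p \<in> P}"
proof -
  let ?R = "mpol_ring n :: 'a mpol ring" and ?I = "vanishing_ideal n X"
  interpret cring ?R by (rule cring_mpol_ring)
  have I: "ideal ?I ?R" by (rule ideal_if_is_ideal[OF is_ideal_vanishing_ideal])
  note P = P[unfolded coordinate_ring_def]
  have "primeideal {r \<in> carrier ?R. a_r_coset ?R ?I r \<in> P} ?R"
    by (rule ring_hom_ring.primeideal_vimage[OF ideal.rcos_ring_hom_ring[OF I] cring_mpol_ring P])
  then show "is_prime (mpols n) {p \<in> mpols n. ?I +>\<^bsub>?R\<^esub> p \<in> P}"
    using is_prime_if_primeideal by simp
  show "?I \<subseteq> {p \<in> mpols n. ?I +>\<^bsub>?R\<^esub> p \<in> P}"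
  proof
    fix p assume p: "p \<in> ?I"
    have "p \<in> carrier ?R" using p unfolding vanishing_ideal_def by simp
    from a_coset_join2[OF this additive_subgroup.a_subgroup[OF ideal.axioms(1)[OF I]] p]
    have "?I +>\<^bsub>?R\<^esub> p = \<zero>\<^bsub>?R Quot ?I\<^esub>" unfolding FactRing_def by simp
    moreover have "\<zero>\<^bsub>?R Quot ?I\<^esub> \<in> P"
      using P unfolding primeideal_def ideal_def by (blast intro: additive_subgroup.zero_closed)
    ultimately show "p \<in> {p \<in> mpols n. ?I +>\<^bsub>?R\<^esub> p \<in> P}" using p unfolding vanishing_ideal_def by simp
  qed
qed

lemma carrier_coordinate_ring:
  "C \<in> carrier (coordinate_ring n X) \<Longrightarrow> \<exists>p\<in>mpols n. C = vanishing_ideal n X +>\<^bsub>mpol_ring n\<^esub> p"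
  unfolding coordinate_ring_def FactRing_def A_RCOSETS_def' by auto

text \<open>Primes of the coordinate ring pull back to primes of polynomials that contain the vanishing
  ideal, and these correspond to primes of polynomial functions.\<close>

lemma prime_chain_zero_funs:
  fixes X :: "'a::idom vec set"
  assumes X: "irreducible_set n X" and d: "krull_dim (coordinate_ring n X) = enat d"
  shows "\<exists>P. (\<forall>i\<le>d. is_prime (polyfuns {..<n}) (P i)) \<and> (\<forall>i<d. P i \<subset> P (Suc i)) \<and> zero_funs n X \<subseteq> P 0"
proof (cases "d = 0")
  case True
  have "is_prime (polyfuns {..<n}) (zero_funs n X)"
    unfolding mpol_fun_image_vanishing_ideal[symmetric]
    by (rule is_prime_mpol_fun_image[OF is_prime_vanishing_ideal[OF X] subset_refl])
  then show ?thesis using True by (intro exI[of _ "\<lambda>_. zero_funs n X"]) auto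
next
  case False
  then obtain Q where Q: "\<And>i. i \<le> d \<Longrightarrow> primeideal (Q i) (coordinate_ring n X)" "\<And>i. i < d \<Longrightarrow> Q i \<subset> Q (Suc i)"
    using krull_dim_chain[OF d] by blast
  define J where "J = (\<lambda>i. {p \<in> mpols n. vanishing_ideal n X +>\<^bsub>mpol_ring n\<^esub> p \<in> Q i})"
  have J: "is_prime (mpols n) (J i)" "vanishing_ideal n X \<subseteq> J i" if "i \<le> d" for i
    using primeideal_coordinate_ring_pullback[OF Q(1)[OF that]] unfolding J_def by blast+
  have strict: "mpol_fun ` J i \<subset> mpol_fun ` J (Suc i)" if i: "i < d" for i
  proof -
    have sub: "J i \<subseteq> J (Suc i)" using Q(2)[OF i] unfolding J_def by blast
    obtain C where C: "C \<in> Q (Suc i)" "C \<notin> Q i" using Q(2)[OF i] by blast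
    have "Q (Suc i) \<subseteq> carrier (coordinate_ring n X)"
      using Q(1)[of "Suc i"] i unfolding primeideal_def ideal_def by (intro additive_subgroup.a_subset) auto
    then obtain p where p: "p \<in> mpols n" "C = vanishing_ideal n X +>\<^bsub>mpol_ring n\<^esub> p"
      using carrier_coordinate_ring C(1) by blast
    have "p \<in> J (Suc i)" "p \<notin> J i" using C p unfolding J_def by auto
    moreover have "i \<le> d" using i by simp
    ultimately have "mpol_fun p \<notin> mpol_fun ` J i"
      using mpol_fun_image_mem_iff[OF is_primeD(1)[OF J(1)] J(2) p(1)] by blast
    then show ?thesis using sub \<open>p \<in> J (Suc i)\<close> by blast
  qed
  have prime: "is_prime (polyfuns {..<n}) (mpol_fun ` J i)" if "i \<le> d" for i
    by (rule is_prime_mpol_fun_image[OF J[OF that]])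
  have "zero_funs n X \<subseteq> mpol_fun ` J 0"
    unfolding mpol_fun_image_vanishing_ideal[symmetric] using J(2)[of 0] by (intro image_mono) simp
  then show ?thesis using prime strict by (intro exI[of _ "\<lambda>i. mpol_fun ` J i"] conjI allI impI)
qed

section \<open>Density near a non-singular point\<close>

lemma has_gradient_cong: "(\<And>i. i < n \<Longrightarrow> g i = g' i) \<Longrightarrow> has_gradient n f a g \<Longrightarrow> has_gradient n f a g'"
  unfolding has_gradient_def linear_within_def by simp

lemma has_gradient_linear:
  fixes c a b :: "nat \<Rightarrow> 'a::linordered_field"
  shows "has_gradient n (\<lambda>x. \<Sum>j<n. c j * (x j - b j)) a c"
proof -
  have "has_gradient n (\<lambda>x. \<Sum>j<n. c j * (x j + - b j)) a (\<lambda>i. \<Sum>j<n. c j * ((if i = j then 1 else 0) + 0))"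
    by (intro has_gradient_sum has_gradient_cmult has_gradient_add has_gradient_const has_gradient_var
        polyfuns_add polyfuns_const polyfuns_var) auto
  then have "has_gradient n (\<lambda>x. \<Sum>j<n. c j * (x j - b j)) a (\<lambda>i. \<Sum>j<n. c j * (if i = j then 1 else 0))"
    by simp
  then show ?thesis by (rule has_gradient_cong[rotated]) (simp add: if_distrib[of "\<lambda>t. _ * t"] cong: if_cong)
qed

text \<open>The rank of the Jacobian gives \<open>r\<close> generators of the vanishing ideal with independent gradients,
  the Krull dimension a chain of primes of length at least \<open>n - r\<close>.\<close>

theorem nonsingular_dense:
  fixes X :: "'a::real_closed_field vec set"
  assumes X: "irreducible_set n X" "nonsingular n X" and x0: "x0 \<in> X"
    and g: "g \<in> mpols n" "g \<notin> vanishing_ideal n X" and \<rho>: "\<rho> > 0"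
  shows "\<exists>x\<in>X. in_box n \<rho> (($) x0) (($) x) \<and> mpol_eval g x \<noteq> 0"
proof -
  let ?S = "polyfuns {..<n} :: ((nat \<Rightarrow> 'a) \<Rightarrow> 'a) set"
  define a where "a = ($) x0"
  have alg: "algebraic_set n X" using X(1) unfolding irreducible_set_def by blast
  obtain W where W: "irreducible_component n X W" "nonsingular_point n W x0"
    using X(2) x0 unfolding nonsingular_def by meson
  have "W = X" using W(1) X(1) unfolding irreducible_component_def by blast
  with W(2) obtain ps where ps: "set ps \<subseteq> mpols n" "vanishing_ideal n X = Idl\<^bsub>mpol_ring n\<^esub> (set ps)"
    "enat (vec_space.rank (length ps) (jacobian n ps x0)) + krull_dim (coordinate_ring n X) = enat n"
    unfolding nonsingular_point_def by auto
  interpret R: cring "mpol_ring n :: 'a mpol ring" by (rule cring_mpol_ring)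
  have ps_van: "set ps \<subseteq> vanishing_ideal n X" unfolding ps(2) by (rule R.genideal_self) (simp add: ps(1))
  obtain d where d: "krull_dim (coordinate_ring n X) = enat d"
    using ps(3) by (cases "krull_dim (coordinate_ring n X)") auto
  define M where "M = (\<lambda>i j. mpol_fun (mpol_deriv j (ps ! i)) a)"
  have "jacobian n ps x0 = mat (length ps) n (\<lambda>(i, j). M i j)"
    unfolding jacobian_def M_def a_def mpol_eval_eq_mpol_fun ..
  then have rank: "vec_space.rank (length ps) (mat (length ps) n (\<lambda>(i, j). M i j)) + d = n"
    using ps(3) d by simp
  obtain r B G s where r: "vec_space.rank (length ps) (mat (length ps) n (\<lambda>(i, j). M i j)) \<le> r" "r \<le> n"
    and BG: "mutually_inverse n B G" and s: "\<forall>l<r. s l < length ps \<and> (\<forall>j<n. G l j = M (s l) j)"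
    using independent_rows_extend[of "length ps" n M] by blast
  define q where "q = (\<lambda>l. if l < r then mpol_fun (ps ! s l) else (\<lambda>x. \<Sum>j<n. G l j * (x j - a j)))"
  have psl: "ps ! s l \<in> mpols n" "ps ! s l \<in> vanishing_ideal n X" if "l < r" for l
    using s that ps(1) ps_van nth_mem by blast+
  have qI: "q l \<in> zero_funs n X" if "l < r" for l
    using mpol_fun_zero_funs_iff[OF psl(1)[OF that]] psl(2)[OF that] that unfolding q_def by simp
  have zero: "f a = 0" if "f \<in> zero_funs n X" for f using that x0 unfolding zero_funs_def a_def by blast
  interpret regular_system n r a q G B
  proof
    show "q l \<in> ?S" if "l < n" for l
    proof (cases "l < r")
      case True
      then show ?thesis using mpol_fun_polyfuns[OF psl(1)[OF True]] unfolding q_def by simp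
    next
      case False
      have "(\<lambda>x. \<Sum>j<n. G l j * (x j - a j)) \<in> ?S"
        by (intro polyfuns_sum polyfuns_mult polyfuns_const polyfuns_diff polyfuns_var) auto
      then show ?thesis using False unfolding q_def by simp
    qed
    show "has_gradient n (q l) a (G l)" if "l < n" for l
    proof (cases "l < r")
      case True
      have "has_gradient n (mpol_fun (ps ! s l)) a (M (s l))"
        unfolding M_def by (rule mpol_has_gradient[OF psl(1)[OF True]])
      then have "has_gradient n (mpol_fun (ps ! s l)) a (G l)"
        by (rule has_gradient_cong[rotated]) (use s True in auto)
      then show ?thesis using True unfolding q_def by simp
    next
      case False
      then show ?thesis using has_gradient_linear[of n "G l" a a] unfolding q_def by simp
    qed
    show "q l a = 0" if "l < n" for l
    proof (cases "l < r")
      case True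
      then show ?thesis using zero[OF qI[OF True]] by simp
    qed (simp add: q_def)
  qed (use r(2) BG in \<open>auto simp: mutually_inverse_def delta_def\<close>)
  obtain P where P: "\<And>i. i \<le> d \<Longrightarrow> is_prime ?S (P i)" "\<And>i. i < d \<Longrightarrow> P i \<subset> P (Suc i)" "zero_funs n X \<subseteq> P 0"
    using prime_chain_zero_funs[OF X(1) d] by blast
  have nd: "n - r \<le> d" using rank r by linarith
  have prime: "is_prime ?S (zero_funs n X)"
    unfolding mpol_fun_image_vanishing_ideal[symmetric]
    by (rule is_prime_mpol_fun_image[OF is_prime_vanishing_ideal[OF X(1)] subset_refl])
  have g': "mpol_fun g \<in> ?S" "mpol_fun g \<notin> zero_funs n X"
    using mpol_fun_polyfuns[OF g(1)] mpol_fun_zero_funs_iff[OF g(1)] g(2) by blast+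
  have P1: "is_prime ?S (P i)" if "i \<le> n - r" for i using that nd by (intro P(1)) simp
  have P2: "P i \<subset> P (Suc i)" if "i < n - r" for i using that nd by (intro P(2)) simp
  have "\<exists>x. in_box n \<rho> a x \<and> (\<forall>f\<in>zero_funs n X. f x = 0) \<and> mpol_fun g x \<noteq> 0"
  proof (rule dense_near[of "zero_funs n X" P])
    show "f a = 0" if "f \<in> zero_funs n X" for f by (rule zero[OF that])
  qed (fact prime qI P1 P2 P(3) g' \<rho>)+
  then obtain x where x: "in_box n \<rho> a x" "\<forall>f\<in>zero_funs n X. f x = 0" "mpol_fun g x \<noteq> 0" by blast
  have "vec n x \<in> X"
  proof (rule mem_algebraic_set[OF alg])
    fix p assume p: "p \<in> vanishing_ideal n X"
    then have pn: "p \<in> mpols n" unfolding vanishing_ideal_def by blast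
    then have "mpol_fun p \<in> zero_funs n X" using p mpol_fun_zero_funs_iff by blast
    then show "mpol_eval p (vec n x) = 0" using x(2) by (simp add: mpol_eval_vec[OF pn])
  qed simp
  moreover have "in_box n \<rho> a (($) (vec n x))" using x(1) unfolding in_box_def by simp
  moreover have "mpol_eval g (vec n x) \<noteq> 0" using x(3) mpol_eval_vec[OF g(1)] by simp
  ultimately show ?thesis unfolding a_def by blast
qed

section \<open>Regular functions\<close>

lemma mpols_mono: "p \<in> mpols n \<Longrightarrow> n \<le> N \<Longrightarrow> p \<in> mpols N"
  unfolding mpols_def by auto

lemma regular_functionE:
  assumes "regular_function n X h"
  obtains p q where "p \<in> mpols n" "q \<in> mpols n"
    "\<And>x. x \<in> X \<Longrightarrow> mpol_eval q x \<noteq> 0" "\<And>x. x \<in> X \<Longrightarrow> h x = mpol_eval p x / mpol_eval q x"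
  using assms unfolding regular_function_def by blast

lemma regular_functionI:
  assumes "p \<in> mpols n" "q \<in> mpols n" "\<And>x. x \<in> X \<Longrightarrow> mpol_eval q x \<noteq> 0"
    "\<And>x. x \<in> X \<Longrightarrow> h x = mpol_eval p x / mpol_eval q x"
  shows "regular_function n X h"
  unfolding regular_function_def using assms by blast

lemma regular_function_cong:
  "regular_function n X h \<Longrightarrow> (\<And>x. x \<in> X \<Longrightarrow> h x = h' x) \<Longrightarrow> regular_function n X h'"
  by (erule regular_functionE, erule (1) regular_functionI) auto

lemma regular_function_subset: "regular_function n X h \<Longrightarrow> X' \<subseteq> X \<Longrightarrow> regular_function n X' h"
  by (erule regular_functionE, erule (1) regular_functionI) auto

lemma regular_function_mpol: "p \<in> mpols n \<Longrightarrow> regular_function n X (mpol_eval p)"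
  by (rule regular_functionI[of p n 1]) (auto simp: mpols_one mpol_eval_eq_mpol_fun)

lemma regular_function_const: "regular_function n X (\<lambda>x. c)"
  by (rule regular_function_cong[OF regular_function_mpol[OF mpols_const[of c]]])
    (simp add: mpol_eval_eq_mpol_fun)

lemma regular_function_var: "i < n \<Longrightarrow> regular_function n X (\<lambda>x. x $ i)"
  by (rule regular_function_cong[OF regular_function_mpol[OF mpols_var[of i n]]])
    (simp_all add: mpol_eval_eq_mpol_fun)

lemma regular_function_add:
  assumes "regular_function n X h" "regular_function n X k"
  shows "regular_function n X (\<lambda>x. h x + k x)"
proof -
  obtain p q where pq: "p \<in> mpols n" "q \<in> mpols n"
    "\<And>x. x \<in> X \<Longrightarrow> mpol_eval q x \<noteq> 0" "\<And>x. x \<in> X \<Longrightarrow> h x = mpol_eval p x / mpol_eval q x"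
    by (rule regular_functionE[OF assms(1)]) blast
  obtain r s where rs: "r \<in> mpols n" "s \<in> mpols n"
    "\<And>x. x \<in> X \<Longrightarrow> mpol_eval s x \<noteq> 0" "\<And>x. x \<in> X \<Longrightarrow> k x = mpol_eval r x / mpol_eval s x"
    by (rule regular_functionE[OF assms(2)]) blast
  show ?thesis
    using pq(3,4) rs(3,4) by (intro regular_functionI[of "p * s + r * q" n "q * s"] mpols_add mpols_mult pq(1,2) rs(1,2))
      (auto simp: mpol_eval_eq_mpol_fun mpol_fun_simps field_simps)
qed

lemma regular_function_mult:
  assumes "regular_function n X h" "regular_function n X k"
  shows "regular_function n X (\<lambda>x. h x * k x)"
proof -
  obtain p q where pq: "p \<in> mpols n" "q \<in> mpols n"
    "\<And>x. x \<in> X \<Longrightarrow> mpol_eval q x \<noteq> 0" "\<And>x. x \<in> X \<Longrightarrow> h x = mpol_eval p x / mpol_eval q x"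
    by (rule regular_functionE[OF assms(1)]) blast
  obtain r s where rs: "r \<in> mpols n" "s \<in> mpols n"
    "\<And>x. x \<in> X \<Longrightarrow> mpol_eval s x \<noteq> 0" "\<And>x. x \<in> X \<Longrightarrow> k x = mpol_eval r x / mpol_eval s x"
    by (rule regular_functionE[OF assms(2)]) blast
  show ?thesis
    using pq(3,4) rs(3,4) by (intro regular_functionI[of "p * r" n "q * s"] mpols_mult pq(1,2) rs(1,2))
      (auto simp: mpol_eval_eq_mpol_fun mpol_fun_simps)
qed

lemma regular_function_divide:
  assumes "regular_function n X h" "regular_function n X k" "\<And>x. x \<in> X \<Longrightarrow> k x \<noteq> 0"
  shows "regular_function n X (\<lambda>x. h x / k x)"
proof -
  obtain r s where rs: "r \<in> mpols n" "s \<in> mpols n"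
    "\<And>x. x \<in> X \<Longrightarrow> mpol_eval s x \<noteq> 0" "\<And>x. x \<in> X \<Longrightarrow> k x = mpol_eval r x / mpol_eval s x"
    by (rule regular_functionE[OF assms(2)]) blast
  have "mpol_eval r x \<noteq> 0" if "x \<in> X" for x using assms(3)[OF that] rs(4)[OF that] by auto
  then have "regular_function n X (\<lambda>x. inverse (k x))"
    using rs(3,4) by (intro regular_functionI[of s n r] rs(1,2)) auto
  from regular_function_mult[OF assms(1) this] show ?thesis by (simp add: divide_inverse)
qed

lemma regular_function_sum:
  "(\<And>i. i \<in> I \<Longrightarrow> regular_function n X (h i)) \<Longrightarrow> regular_function n X (\<lambda>x. \<Sum>i\<in>I. h i x)"
  by (induction I rule: infinite_finite_induct) (auto intro: regular_function_const regular_function_add)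

lemma regular_function_mpol_compose:
  assumes "p \<in> mpols n" "\<And>i. i < n \<Longrightarrow> regular_function m Y (\<lambda>y. s y $ i)"
  shows "regular_function m Y (\<lambda>y. mpol_eval p (s y))"
  unfolding mpol_eval_eq_mpol_fun using mpol_fun_polyfuns[OF assms(1)]
proof (induction rule: polyfuns.induct)
  case (polyfuns_var i)
  then show ?case using assms(2) by simp
qed (auto intro: regular_function_const regular_function_add regular_function_mult)

lemma regular_function_compose:
  assumes h: "regular_function n X h" and s: "\<And>i. i < n \<Longrightarrow> regular_function m Y (\<lambda>y. s y $ i)"
    and "\<And>y. y \<in> Y \<Longrightarrow> s y \<in> X"
  shows "regular_function m Y (\<lambda>y. h (s y))"
proof -
  obtain p q where pq: "p \<in> mpols n" "q \<in> mpols n"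
    "\<And>x. x \<in> X \<Longrightarrow> mpol_eval q x \<noteq> 0" "\<And>x. x \<in> X \<Longrightarrow> h x = mpol_eval p x / mpol_eval q x"
    by (rule regular_functionE[OF h]) blast
  have "regular_function m Y (\<lambda>y. mpol_eval p (s y) / mpol_eval q (s y))"
  proof (rule regular_function_divide)
    show "regular_function m Y (\<lambda>y. mpol_eval p (s y))"
      by (rule regular_function_mpol_compose[OF pq(1)]) (rule s)
    show "regular_function m Y (\<lambda>y. mpol_eval q (s y))"
      by (rule regular_function_mpol_compose[OF pq(2)]) (rule s)
    show "mpol_eval q (s y) \<noteq> 0" if "y \<in> Y" for y by (rule pq(3)[OF assms(3)[OF that]])
  qed
  then show ?thesis by (rule regular_function_cong) (simp add: pq(4) assms(3))
qed

section \<open>Points of a blow-up\<close>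

lemma zariski_closure_eq:
  assumes "S \<subseteq> carrier_vec n"
  shows "zariski_closure n S = {v \<in> carrier_vec n. \<forall>p\<in>vanishing_ideal n S. mpol_eval p v = 0}" (is "_ = ?C")
proof
  have "algebraic_set n ?C"
    unfolding algebraic_set_def by (intro exI[of _ "vanishing_ideal n S"]) (auto simp: vanishing_ideal_def)
  moreover have "S \<subseteq> ?C" using assms unfolding vanishing_ideal_def by auto
  ultimately show "zariski_closure n S \<subseteq> ?C" unfolding zariski_closure_def by blast
  show "?C \<subseteq> zariski_closure n S"
  proof
    fix v assume v: "v \<in> ?C"
    have "v \<in> V" if V: "algebraic_set n V" "S \<subseteq> V" for V
      using V(2) v by (intro mem_algebraic_set[OF V(1)]) (auto simp: vanishing_ideal_def)
    then show "v \<in> zariski_closure n S" unfolding zariski_closure_def by blast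
  qed
qed

lemma sum_square_index:
  "(\<Sum>k<l * l. f (k div l) (k mod l)) = (\<Sum>i<l. \<Sum>j<l. f i j :: 'b::comm_monoid_add)" for l :: nat
proof -
  have "bij_betw (\<lambda>(i, j). i * l + j) ({..<l} \<times> {..<l}) {..<l * l}"
  proof (rule bij_betw_byWitness[where f' = "\<lambda>k. (k div l, k mod l)"])
    show "(\<lambda>(i, j). i * l + j) ` ({..<l} \<times> {..<l}) \<subseteq> {..<l * l}"
    proof clarsimp
      fix i j assume "i < l" "j < l"
      then have "i * l + j < Suc i * l" by simp
      also have "\<dots> \<le> l * l" using \<open>i < l\<close> by (intro mult_le_mono1) simp
      finally show "i * l + j < l * l" .
    qed
    show "(\<lambda>k. (k div l, k mod l)) ` {..<l * l} \<subseteq> {..<l} \<times> {..<l}"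
    proof clarsimp
      fix k assume k: "k < l * l"
      then have "l > 0" by (cases l) auto
      then show "k div l < l \<and> k mod l < l" using k by (simp add: less_mult_imp_div_less)
    qed
  qed auto
  from sum.reindex_bij_betw[OF this, of "\<lambda>k. f (k div l) (k mod l)"]
  have "(\<Sum>k<l * l. f (k div l) (k mod l)) = (\<Sum>(i, j)\<in>{..<l} \<times> {..<l}. f ((i * l + j) div l) ((i * l + j) mod l))"
    by (simp add: case_prod_unfold)
  also have "\<dots> = (\<Sum>(i, j)\<in>{..<l} \<times> {..<l}. f i j)" by (rule sum.cong) auto
  finally show ?thesis by (simp add: sum.cartesian_product)
qed

lemma projection_point_norm:
  assumes "(\<Sum>i<length u. (u ! i)\<^sup>2) \<noteq> 0"
  shows "(\<Sum>k<length u * length u. (projection_point u $ k)\<^sup>2) = 1"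
proof -
  let ?s = "\<Sum>i<length u. (u ! i)\<^sup>2"
  have "(\<Sum>k<length u * length u. (projection_point u $ k)\<^sup>2)
      = (\<Sum>k<length u * length u. (u ! (k div length u) * u ! (k mod length u) / ?s)\<^sup>2)"
    unfolding projection_point_def Let_def by (intro sum.cong) auto
  also have "\<dots> = (\<Sum>i<length u. \<Sum>j<length u. (u ! i * u ! j / ?s)\<^sup>2)" by (rule sum_square_index)
  also have "\<dots> = (\<Sum>i<length u. \<Sum>j<length u. (u ! i)\<^sup>2 * (u ! j)\<^sup>2) / ?s\<^sup>2"
    by (simp add: power_divide power_mult_distrib sum_divide_distrib)
  also have "\<dots> = ?s * ?s / ?s\<^sup>2" by (simp add: sum_product)
  finally show ?thesis using assms by (simp add: power2_eq_square)
qed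

lemma projection_point_dim: "dim_vec (projection_point u) = length u * length u"
  unfolding projection_point_def Let_def by simp

definition graph_point :: "'a::field mpol list \<Rightarrow> 'a vec \<Rightarrow> 'a vec" where
  "graph_point gs y = y @\<^sub>v projection_point (map (\<lambda>g. mpol_eval g y) gs)"

lemma graph_point_carrier: "y \<in> carrier_vec m \<Longrightarrow> graph_point gs y \<in> carrier_vec (m + length gs * length gs)"
  unfolding graph_point_def carrier_vec_def by (simp add: projection_point_dim)

lemma graph_point_index:
  assumes "y \<in> carrier_vec m"
  shows "i < m \<Longrightarrow> graph_point gs y $ i = y $ i"
    and "k < length gs * length gs \<Longrightarrow>
      graph_point gs y $ (m + k) = projection_point (map (\<lambda>g. mpol_eval g y) gs) $ k"
  using assms unfolding graph_point_def by (auto simp: projection_point_dim)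

lemma vec_first_graph_point: "y \<in> carrier_vec m \<Longrightarrow> vec_first (graph_point gs y) m = y"
  unfolding vec_first_def using graph_point_index(1)[of y m _ gs] by (intro eq_vecI) auto

locale blowup_centre =
  fixes m :: nat and Y Z :: "'a::real_closed_field vec set" and gs :: "'a mpol list"
  assumes Y: "algebraic_set m Y" and Z: "algebraic_set m Z" and ZY: "Z \<subseteq> Y"
    and gs: "set gs \<subseteq> mpols m"
    and gen: "vanishing_ideal m Z = Idl\<^bsub>mpol_ring m\<^esub> (vanishing_ideal m Y \<union> set gs)"
begin

definition N :: nat where "N = m + length gs * length gs"

definition model :: "'a vec set" where "model = blowup_model m Y Z gs"

lemma Y_carrier: "Y \<subseteq> carrier_vec m"
  using Y unfolding algebraic_set_def by blast

text \<open>The polynomials vanishing at \<open>y\<close> form an ideal; if it contained all generators it would contain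
  the vanishing ideal of \<open>Z\<close>.\<close>

lemma generator_nonzero:
  assumes y: "y \<in> Y" "y \<notin> Z" shows "\<exists>g\<in>set gs. mpol_eval g y \<noteq> 0"
proof (rule ccontr)
  assume none: "\<not> ?thesis"
  define J where "J = {p \<in> mpols m. mpol_eval p y = 0}"
  have "is_ideal (mpols m) J"
    unfolding is_ideal_def J_def by (auto simp: mpols_zero mpols_add mpols_mult mpol_eval_eq_mpol_fun mpol_fun_simps)
  then have J: "ideal J (mpol_ring m)" by (rule ideal_if_is_ideal)
  interpret cring "mpol_ring m :: 'a mpol ring" by (rule cring_mpol_ring)
  have "vanishing_ideal m Y \<union> set gs \<subseteq> J"
    using none y(1) gs unfolding J_def vanishing_ideal_def by auto
  then have "vanishing_ideal m Z \<subseteq> J" unfolding gen by (rule genideal_minimal[OF J])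
  moreover have "y \<in> carrier_vec m" using y(1) Y_carrier by blast
  ultimately have "y \<in> Z" by (intro mem_algebraic_set[OF Z]) (auto simp: J_def)
  then show False using y(2) by blast
qed

lemma generator_norm_nonzero:
  assumes "y \<in> Y" "y \<notin> Z" shows "(\<Sum>i<length gs. (mpol_eval (gs ! i) y)\<^sup>2) \<noteq> 0"
proof
  assume "(\<Sum>i<length gs. (mpol_eval (gs ! i) y)\<^sup>2) = 0"
  then have "\<forall>i\<in>{..<length gs}. (mpol_eval (gs ! i) y)\<^sup>2 = 0" by (subst (asm) sum_nonneg_eq_0_iff) auto
  then have "mpol_eval g y = 0" if "g \<in> set gs" for g using that by (auto simp: in_set_conv_nth)
  then show False using generator_nonzero[OF assms] by blast
qed

lemma graph_subset: "graph_point gs ` (Y - Z) \<subseteq> carrier_vec N"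
  using graph_point_carrier Y_carrier unfolding N_def by blast

lemma model_eq: "model = {v \<in> carrier_vec N. \<forall>p\<in>vanishing_ideal N (graph_point gs ` (Y - Z)). mpol_eval p v = 0}"
proof -
  have "{y @\<^sub>v projection_point (map (\<lambda>g. mpol_eval g y) gs) | y. y \<in> Y - Z} = graph_point gs ` (Y - Z)"
    unfolding graph_point_def by blast
  then have "model = zariski_closure N (graph_point gs ` (Y - Z))"
    unfolding model_def blowup_model_def N_def by simp
  then show ?thesis using zariski_closure_eq[OF graph_subset] by simp
qed

lemma graph_point_model: "y \<in> Y \<Longrightarrow> y \<notin> Z \<Longrightarrow> graph_point gs y \<in> model"
  unfolding model_eq using graph_subset unfolding vanishing_ideal_def by blast

lemma model_vanish:
  assumes "v \<in> model" "p \<in> mpols N" "\<And>y. y \<in> Y \<Longrightarrow> y \<notin> Z \<Longrightarrow> mpol_eval p (graph_point gs y) = 0"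
  shows "mpol_eval p v = 0"
proof -
  have "p \<in> vanishing_ideal N (graph_point gs ` (Y - Z))" using assms(2,3) unfolding vanishing_ideal_def by blast
  then show ?thesis using assms(1) unfolding model_eq by blast
qed

text \<open>A polynomial vanishing on \<open>Y\<close>, read as one in more variables, vanishes on the graph and hence on
  its Zariski closure.\<close>

lemma model_over_Y: assumes v: "v \<in> model" shows "vec_first v m \<in> Y"
proof (rule mem_algebraic_set[OF Y])
  fix p assume p: "p \<in> vanishing_ideal m Y"
  then have pm: "p \<in> mpols m" unfolding vanishing_ideal_def by blast
  have eval: "mpol_eval p w = mpol_eval p (vec_first w m)" for w
    unfolding mpol_eval_eq_mpol_fun by (rule polyfuns_cong[OF mpol_fun_polyfuns[OF pm]]) (simp add: vec_first_def)
  have "mpol_eval p (graph_point gs y) = 0" if "y \<in> Y" "y \<notin> Z" for y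
  proof -
    have "y \<in> carrier_vec m" using that(1) Y_carrier by blast
    then show ?thesis unfolding eval[of "graph_point gs y"] using that p vec_first_graph_point[of y m gs]
      unfolding vanishing_ideal_def by simp
  qed
  then have "mpol_eval p v = 0"
    by (intro model_vanish[OF v mpols_mono[OF pm]]) (simp_all add: N_def)
  then show "mpol_eval p (vec_first v m) = 0" using eval by simp
qed (simp add: vec_first_def)

text \<open>The matrix entries of an orthogonal projection onto a line have square sum \<open>1\<close>; this polynomial
  identity persists on the Zariski closure, so the fibres of the model are bounded.\<close>

lemma model_projection_bounded:
  assumes v: "v \<in> model" and k: "k < length gs * length gs" shows "\<bar>v $ (m + k)\<bar> \<le> 1"
proof -
  define p :: "'a mpol" where "p = (\<Sum>k<length gs * length gs. mpol_var (m + k) * mpol_var (m + k)) - 1"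
  have eval: "mpol_eval p w = (\<Sum>k<length gs * length gs. (w $ (m + k))\<^sup>2) - 1" for w
    unfolding p_def mpol_eval_eq_mpol_fun by (simp add: mpol_fun_simps mpol_fun_sum power2_eq_square)
  have "p \<in> mpols N"
    unfolding p_def by (intro mpols_diff is_subring_sum[OF mpols_subring] mpols_mult mpols_var mpols_one) (auto simp: N_def)
  moreover have "mpol_eval p (graph_point gs y) = 0" if y: "y \<in> Y" "y \<notin> Z" for y
  proof -
    have yc: "y \<in> carrier_vec m" using y(1) Y_carrier by blast
    have "(\<Sum>k<length gs * length gs. (graph_point gs y $ (m + k))\<^sup>2)
        = (\<Sum>k<length gs * length gs. (projection_point (map (\<lambda>g. mpol_eval g y) gs) $ k)\<^sup>2)"
      using graph_point_index(2)[OF yc, of _ gs] by (intro sum.cong) auto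
    also have "\<dots> = 1"
      using projection_point_norm[of "map (\<lambda>g. mpol_eval g y) gs"] generator_norm_nonzero[OF y] by simp
    finally show ?thesis using eval by simp
  qed
  ultimately have "mpol_eval p v = 0" by (rule model_vanish[OF v])
  then have "(\<Sum>k<length gs * length gs. (v $ (m + k))\<^sup>2) = 1" using eval by simp
  moreover have "(v $ (m + k))\<^sup>2 \<le> (\<Sum>k<length gs * length gs. (v $ (m + k))\<^sup>2)"
    using k by (intro member_le_sum) auto
  ultimately show ?thesis by (simp add: abs_square_le_1)
qed

end

section \<open>Compositions of blow-ups are proper and generically invertible\<close>

text \<open>The two properties of a composition of blow-ups that matter: regular functions upstairs are
  bounded over small boxes downstairs, and there is a rational section with Zariski dense image.\<close>

definition bounded_over :: "nat \<Rightarrow> 'a::linordered_field vec set \<Rightarrow> nat \<Rightarrow> 'a vec set \<Rightarrow> ('a vec \<Rightarrow> 'a vec) \<Rightarrow> bool" where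
  "bounded_over n X m Y \<phi> \<longleftrightarrow> (\<forall>h. regular_function m Y h \<longrightarrow> (\<forall>x\<in>X. \<exists>\<rho>>0. \<exists>C\<ge>0.
     \<forall>y\<in>Y. in_box n \<rho> (($) x) (($) (\<phi> y)) \<longrightarrow> \<bar>h y\<bar> \<le> C))"

definition generic_section ::
    "nat \<Rightarrow> 'a::field vec set \<Rightarrow> nat \<Rightarrow> 'a vec set \<Rightarrow> ('a vec \<Rightarrow> 'a vec) \<Rightarrow> 'a mpol \<Rightarrow> ('a vec \<Rightarrow> 'a vec) \<Rightarrow> bool" where
  "generic_section n X m Y \<phi> g s \<longleftrightarrow> g \<in> mpols n \<and> g \<notin> vanishing_ideal n X \<and>
     (\<forall>j<m. regular_function n {x \<in> X. mpol_eval g x \<noteq> 0} (\<lambda>x. s x $ j)) \<and>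
     (\<forall>x\<in>X. mpol_eval g x \<noteq> 0 \<longrightarrow> s x \<in> Y \<and> \<phi> (s x) = x) \<and>
     (\<forall>p\<in>mpols m. \<forall>k\<in>mpols n. k \<notin> vanishing_ideal n X \<longrightarrow>
        (\<forall>x\<in>X. mpol_eval g x \<noteq> 0 \<longrightarrow> mpol_eval k x \<noteq> 0 \<longrightarrow> mpol_eval p (s x) = 0) \<longrightarrow> p \<in> vanishing_ideal m Y)"

lemma bounded_overD:
  assumes "bounded_over n X m Y \<phi>" "regular_function m Y h" "x \<in> X"
  shows "\<exists>\<rho>>0. \<exists>C\<ge>0. \<forall>y\<in>Y. in_box n \<rho> (($) x) (($) (\<phi> y)) \<longrightarrow> \<bar>h y\<bar> \<le> C"
  using assms unfolding bounded_over_def by (elim allE[of _ h]) blast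

lemma bounded_over_id:
  fixes X :: "'a::linordered_field vec set"
  shows "bounded_over n X n X (\<lambda>x. x)"
  unfolding bounded_over_def
proof (intro allI impI ballI)
  fix h x assume h: "regular_function n X h" and x: "x \<in> X"
  obtain p q where pq: "p \<in> mpols n" "q \<in> mpols n"
    "\<And>x. x \<in> X \<Longrightarrow> mpol_eval q x \<noteq> 0" "\<And>x. x \<in> X \<Longrightarrow> h x = mpol_eval p x / mpol_eval q x"
    by (rule regular_functionE[OF h]) blast
  define b where "b = \<bar>mpol_eval q x\<bar> / 2"
  have b: "b > 0" using pq(3)[OF x] unfolding b_def by simp
  obtain d where d: "d > 0" "\<And>y. in_box n d (($) x) y \<Longrightarrow> \<bar>mpol_fun q y - mpol_fun q (($) x)\<bar> \<le> b"
    using polyfuns_continuous[OF mpol_fun_polyfuns[OF pq(2)] b] by blast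
  obtain C where C: "C > 0" "\<And>y. in_box n d (($) x) y \<Longrightarrow> \<bar>mpol_fun p y\<bar> \<le> C"
    using polyfuns_bounded[OF mpol_fun_polyfuns[OF pq(1)]] by blast
  have "\<bar>h y\<bar> \<le> C / b" if y: "y \<in> X" "in_box n d (($) x) (($) y)" for y
  proof -
    have "\<bar>mpol_eval q y\<bar> \<ge> b" using d(2)[OF y(2)] unfolding b_def mpol_eval_eq_mpol_fun by linarith
    moreover have "\<bar>mpol_eval p y\<bar> \<le> C" using C(2)[OF y(2)] unfolding mpol_eval_eq_mpol_fun .
    ultimately show ?thesis unfolding pq(4)[OF y(1)] abs_divide using b C(1) by (intro frac_le) auto
  qed
  then show "\<exists>\<rho>>0. \<exists>C\<ge>0. \<forall>y\<in>X. in_box n \<rho> (($) x) (($) y) \<longrightarrow> \<bar>h y\<bar> \<le> C"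
    using d(1) b C(1) by (intro exI[of _ d] conjI exI[of _ "C / b"]) auto
qed

context blowup_centre
begin

lemma model_boundary_polynomials:
  "\<exists>F. finite F \<and> F \<subseteq> polyfuns {..<N} \<and> (\<forall>z. (\<forall>f\<in>F. f z = 0) \<longrightarrow> vec N z \<in> model) \<and> (\<forall>v\<in>model. \<forall>f\<in>F. f (($) v) = 0)"
proof -
  let ?S = "polyfuns {..<N} :: ((nat \<Rightarrow> 'a) \<Rightarrow> 'a) set"
  obtain F where F: "finite F" "F \<subseteq> zero_funs N model" "zero_funs N model \<subseteq> ideal_gen ?S F"
    using noetherian_fg[OF polyfuns_subring polyfuns_noetherian is_ideal_zero_funs, of N model] by blast
  have "vec N z \<in> model" if z: "\<forall>f\<in>F. f z = 0" for z
  proof -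
    have vanish: "f z = 0" if "f \<in> ideal_gen ?S F" for f
      using that by (induction rule: ideal_gen.induct) (use z in auto)
    have "mpol_eval p (vec N z) = 0" if p: "p \<in> vanishing_ideal N (graph_point gs ` (Y - Z))" for p
    proof -
      have pN: "p \<in> mpols N" using p unfolding vanishing_ideal_def by blast
      have "p \<in> vanishing_ideal N model" using p pN unfolding model_eq vanishing_ideal_def by blast
      then have "mpol_fun p \<in> zero_funs N model" using mpol_fun_zero_funs_iff[OF pN] by blast
      then have "mpol_fun p z = 0" using vanish F(3) by blast
      then show ?thesis by (simp add: mpol_eval_vec[OF pN])
    qed
    then show ?thesis unfolding model_eq by simp
  qed
  moreover have "F \<subseteq> ?S" "\<forall>v\<in>model. \<forall>f\<in>F. f (($) v) = 0" using F(2) unfolding zero_funs_def by blast+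
  ultimately show ?thesis using F(1) by blast
qed

text \<open>The model is closed and lies over \<open>Y\<close> with bounded fibres, so a denominator without zeros on
  it is bounded away from zero over a bounded set.\<close>

lemma regular_function_model_bounded:
  assumes h: "regular_function N model h"
  shows "\<exists>C\<ge>0. \<forall>v\<in>model. (\<forall>i<m. \<bar>v $ i\<bar> \<le> K) \<longrightarrow> \<bar>h v\<bar> \<le> C"
proof -
  obtain p q where pq: "p \<in> mpols N" "q \<in> mpols N"
    "\<And>x. x \<in> model \<Longrightarrow> mpol_eval q x \<noteq> 0" "\<And>x. x \<in> model \<Longrightarrow> h x = mpol_eval p x / mpol_eval q x"
    by (rule regular_functionE[OF h]) blast
  obtain F where F: "finite F" "F \<subseteq> polyfuns {..<N}" "\<And>z. \<forall>f\<in>F. f z = 0 \<Longrightarrow> vec N z \<in> model"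
    "\<And>v f. v \<in> model \<Longrightarrow> f \<in> F \<Longrightarrow> f (($) v) = 0"
    using model_boundary_polynomials by blast
  define H where "H = (\<lambda>z. (\<Sum>f\<in>F. (f z)\<^sup>2) + (mpol_fun q z)\<^sup>2)"
  have H_poly: "H \<in> polyfuns {..<N}"
    unfolding H_def using F(2) by (intro polyfuns_add polyfuns_sum polyfuns_power mpol_fun_polyfuns pq(2)) blast
  have H_pos: "H z > 0" for z
  proof (rule ccontr)
    assume "\<not> H z > 0"
    moreover have nonneg: "(\<Sum>f\<in>F. (f z)\<^sup>2) \<ge> 0" "(mpol_fun q z)\<^sup>2 \<ge> 0" by (auto intro: sum_nonneg)
    ultimately have 0: "(\<Sum>f\<in>F. (f z)\<^sup>2) = 0" "(mpol_fun q z)\<^sup>2 = 0" unfolding H_def by linarith+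
    then have "\<forall>f\<in>F. f z = 0" using F(1) by (simp add: sum_nonneg_eq_0_iff)
    from pq(3)[OF F(3)[OF this]] show False using 0(2) by (simp add: mpol_eval_vec[OF pq(2)])
  qed
  define R where "R = max 1 K"
  obtain e where e: "e > 0" "\<And>z. in_box N R (\<lambda>_. 0) z \<Longrightarrow> e \<le> H z"
    using polyfun_bounded_below[OF H_poly, of R "\<lambda>_. 0"] H_pos by blast
  obtain C where C: "C > 0" "\<And>z. in_box N R (\<lambda>_. 0) z \<Longrightarrow> \<bar>mpol_fun p z\<bar> \<le> C"
    using polyfuns_bounded[OF mpol_fun_polyfuns[OF pq(1)]] by blast
  have "\<bar>h v\<bar> \<le> 1 + C\<^sup>2 / e" if v: "v \<in> model" "\<forall>i<m. \<bar>v $ i\<bar> \<le> K" for v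
  proof -
    have "\<bar>v $ i\<bar> \<le> R" if "i < N" for i
    proof (cases "i < m")
      case True
      then show ?thesis using v(2) unfolding R_def by (simp add: le_max_iff_disj)
    next
      case False
      then have "\<bar>v $ (m + (i - m))\<bar> \<le> 1" using that unfolding N_def by (intro model_projection_bounded[OF v(1)]) auto
      then show ?thesis using False unfolding R_def by (simp add: le_max_iff_disj)
    qed
    then have box: "in_box N R (\<lambda>_. 0) (($) v)" unfolding in_box_def by simp
    have "e \<le> (mpol_eval q v)\<^sup>2"
      using e(2)[OF box] F(4)[OF v(1)] unfolding H_def mpol_eval_eq_mpol_fun by simp
    moreover have "(mpol_eval p v)\<^sup>2 \<le> C\<^sup>2"
      using C(2)[OF box] C(1) unfolding mpol_eval_eq_mpol_fun by (simp add: abs_le_square_iff[symmetric])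
    ultimately have "(h v)\<^sup>2 \<le> C\<^sup>2 / e"
      unfolding pq(4)[OF v(1)] power_divide using e(1) by (intro frac_le) auto
    moreover have "\<bar>h v\<bar> \<le> 1 + (h v)\<^sup>2"
    proof (cases "\<bar>h v\<bar> \<le> 1")
      case True
      then show ?thesis using zero_le_power2[of "h v"] by linarith
    next
      case False
      then have "\<bar>h v\<bar> * 1 \<le> \<bar>h v\<bar> * \<bar>h v\<bar>" by (intro mult_left_mono) auto
      then show ?thesis by (simp add: power2_eq_square)
    qed
    ultimately show ?thesis by linarith
  qed
  moreover have "1 + C\<^sup>2 / e \<ge> 0" using e(1) by simp
  ultimately show ?thesis by blast
qed

text \<open>Over a small box the coordinates of points of \<open>Y\<close> are bounded, being regular functions; so is the
  part of the model over it.\<close>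

lemma bounded_over_blowup:
  assumes \<phi>: "bounded_over n X m Y \<phi>" and \<psi>: "biregular k W N model \<psi>"
    and \<pi>: "\<And>w. w \<in> W \<Longrightarrow> \<pi> w = vec_first (\<psi> w) m"
  shows "bounded_over n X k W (\<phi> \<circ> \<pi>)"
  unfolding bounded_over_def
proof (intro allI impI ballI)
  fix h x assume h: "regular_function k W h" and x: "x \<in> X"
  have "\<forall>j\<in>{..<m}. \<exists>\<rho>C. fst \<rho>C > 0 \<and> (\<forall>y\<in>Y. in_box n (fst \<rho>C) (($) x) (($) (\<phi> y)) \<longrightarrow> \<bar>y $ j\<bar> \<le> snd \<rho>C)"
  proof
    fix j assume "j \<in> {..<m}"
    then have "regular_function m Y (\<lambda>y. y $ j)" by (intro regular_function_var) simp
    then obtain \<rho> C where "\<rho> > 0" "\<forall>y\<in>Y. in_box n \<rho> (($) x) (($) (\<phi> y)) \<longrightarrow> \<bar>y $ j\<bar> \<le> C"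
      using bounded_overD[OF \<phi> _ x] by blast
    then show "\<exists>\<rho>C. fst \<rho>C > 0 \<and> (\<forall>y\<in>Y. in_box n (fst \<rho>C) (($) x) (($) (\<phi> y)) \<longrightarrow> \<bar>y $ j\<bar> \<le> snd \<rho>C)"
      by (intro exI[of _ "(\<rho>, C)"]) simp
  qed
  then obtain \<rho>C where
    \<rho>C: "\<forall>j\<in>{..<m}. fst (\<rho>C j) > 0 \<and> (\<forall>y\<in>Y. in_box n (fst (\<rho>C j)) (($) x) (($) (\<phi> y)) \<longrightarrow> \<bar>y $ j\<bar> \<le> snd (\<rho>C j))"
    by (rule bchoice[THEN exE])
  define \<rho> where "\<rho> = Min (insert 1 ((\<lambda>j. fst (\<rho>C j)) ` {..<m}))"
  define K where "K = Max (insert 0 ((\<lambda>j. snd (\<rho>C j)) ` {..<m}))"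
  have \<rho>: "\<rho> > 0" "\<And>j. j < m \<Longrightarrow> \<rho> \<le> fst (\<rho>C j)" unfolding \<rho>_def using \<rho>C by (auto intro!: Min_le)
  have K: "\<And>j. j < m \<Longrightarrow> snd (\<rho>C j) \<le> K" unfolding K_def by (auto intro!: Max_ge)
  have bij: "bij_betw \<psi> W model" and inv_reg: "regular_map N model k W (inv_into W \<psi>)"
    using \<psi> unfolding biregular_def by blast+
  have "regular_function N model (\<lambda>v. h (inv_into W \<psi> v))"
    using inv_reg unfolding regular_map_def by (intro regular_function_compose[OF h, of _ _ "inv_into W \<psi>"]) auto
  then obtain C where C: "C \<ge> 0" "\<And>v. v \<in> model \<Longrightarrow> \<forall>i<m. \<bar>v $ i\<bar> \<le> K \<Longrightarrow> \<bar>h (inv_into W \<psi> v)\<bar> \<le> C"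
    using regular_function_model_bounded by blast
  have "\<bar>h w\<bar> \<le> C" if w: "w \<in> W" "in_box n \<rho> (($) x) (($) ((\<phi> \<circ> \<pi>) w))" for w
  proof -
    have v: "\<psi> w \<in> model" using bij_betwE[OF bij] w(1) by blast
    have y: "vec_first (\<psi> w) m \<in> Y" by (rule model_over_Y[OF v])
    have "\<bar>\<psi> w $ j\<bar> \<le> K" if j: "j < m" for j
    proof -
      have "in_box n (fst (\<rho>C j)) (($) x) (($) (\<phi> (vec_first (\<psi> w) m)))"
        using in_box_mono[OF w(2) \<rho>(2)[OF j]] \<pi>[OF w(1)] by simp
      then have "\<bar>vec_first (\<psi> w) m $ j\<bar> \<le> snd (\<rho>C j)" using \<rho>C j y by blast
      then show ?thesis using K[OF j] j by (simp add: vec_first_def)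
    qed
    then have "\<bar>h (inv_into W \<psi> (\<psi> w))\<bar> \<le> C" using C(2)[OF v] by blast
    then show ?thesis using bij_betw_inv_into_left[OF bij w(1)] by simp
  qed
  then show "\<exists>\<rho>>0. \<exists>C\<ge>0. \<forall>w\<in>W. in_box n \<rho> (($) x) (($) ((\<phi> \<circ> \<pi>) w)) \<longrightarrow> \<bar>h w\<bar> \<le> C"
    using \<rho>(1) C(1) by blast
qed

end

lemma nonvanishing_mult:
  fixes X :: "'a::idom vec set"
  assumes "irreducible_set n X" "p \<in> mpols n" "q \<in> mpols n" "p \<notin> vanishing_ideal n X" "q \<notin> vanishing_ideal n X"
  shows "p * q \<notin> vanishing_ideal n X"
  using vanishing_product[OF assms(1-3)] assms(4,5) by blast

lemma mpol_eval_mult_nonzero: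
  fixes p q :: "'a::idom mpol"
  shows "mpol_eval (p * q) x \<noteq> 0 \<longleftrightarrow> mpol_eval p x \<noteq> 0 \<and> mpol_eval q x \<noteq> 0"
  unfolding mpol_eval_eq_mpol_fun mpol_fun_mult by simp

lemma generic_sectionD:
  assumes "generic_section n X m Y \<phi> g s"
  shows "g \<in> mpols n" "g \<notin> vanishing_ideal n X"
    "\<And>j. j < m \<Longrightarrow> regular_function n {x \<in> X. mpol_eval g x \<noteq> 0} (\<lambda>x. s x $ j)"
    "\<And>x. x \<in> X \<Longrightarrow> mpol_eval g x \<noteq> 0 \<Longrightarrow> s x \<in> Y"
    "\<And>x. x \<in> X \<Longrightarrow> mpol_eval g x \<noteq> 0 \<Longrightarrow> \<phi> (s x) = x"
    "\<And>p k. p \<in> mpols m \<Longrightarrow> k \<in> mpols n \<Longrightarrow> k \<notin> vanishing_ideal n X \<Longrightarrow>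
      (\<And>x. x \<in> X \<Longrightarrow> mpol_eval g x \<noteq> 0 \<Longrightarrow> mpol_eval k x \<noteq> 0 \<Longrightarrow> mpol_eval p (s x) = 0) \<Longrightarrow>
      p \<in> vanishing_ideal m Y"
  using assms unfolding generic_section_def by auto

lemma generic_sectionI:
  assumes "g \<in> mpols n" "g \<notin> vanishing_ideal n X"
    "\<And>j. j < m \<Longrightarrow> regular_function n {x \<in> X. mpol_eval g x \<noteq> 0} (\<lambda>x. s x $ j)"
    "\<And>x. x \<in> X \<Longrightarrow> mpol_eval g x \<noteq> 0 \<Longrightarrow> s x \<in> Y"
    "\<And>x. x \<in> X \<Longrightarrow> mpol_eval g x \<noteq> 0 \<Longrightarrow> \<phi> (s x) = x"
    "\<And>p k. p \<in> mpols m \<Longrightarrow> k \<in> mpols n \<Longrightarrow> k \<notin> vanishing_ideal n X \<Longrightarrow>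
      (\<And>x. x \<in> X \<Longrightarrow> mpol_eval g x \<noteq> 0 \<Longrightarrow> mpol_eval k x \<noteq> 0 \<Longrightarrow> mpol_eval p (s x) = 0) \<Longrightarrow>
      p \<in> vanishing_ideal m Y"
  shows "generic_section n X m Y \<phi> g s"
  unfolding generic_section_def
proof (intro conjI ballI allI impI)
  fix p k assume p: "p \<in> mpols m" "k \<in> mpols n" "k \<notin> vanishing_ideal n X"
    and zero: "\<forall>x\<in>X. mpol_eval g x \<noteq> 0 \<longrightarrow> mpol_eval k x \<noteq> 0 \<longrightarrow> mpol_eval p (s x) = 0"
  show "p \<in> vanishing_ideal m Y"
  proof (rule assms(6)[OF p])
    fix x assume "x \<in> X" "mpol_eval g x \<noteq> 0" "mpol_eval k x \<noteq> 0"
    then show "mpol_eval p (s x) = 0" using zero by blast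
  qed
qed (use assms(1-5) in \<open>assumption | blast\<close>)+

lemma generic_section_id:
  fixes X :: "'a::field vec set"
  assumes X: "irreducible_set n X"
  shows "generic_section n X n X (\<lambda>x. x) 1 (\<lambda>x. x)"
proof -
  have one: "mpol_eval (1 :: 'a mpol) x = 1" for x unfolding mpol_eval_eq_mpol_fun by simp
  have "p \<in> vanishing_ideal n X"
    if "p \<in> mpols n" "k \<in> mpols n" "k \<notin> vanishing_ideal n X" "\<And>x. x \<in> X \<Longrightarrow> mpol_eval k x \<noteq> 0 \<Longrightarrow> mpol_eval p x = 0"
    for p k
  proof -
    have "mpol_eval (p * k) x = 0" if "x \<in> X" for x
      using \<open>\<And>x. x \<in> X \<Longrightarrow> mpol_eval k x \<noteq> 0 \<Longrightarrow> mpol_eval p x = 0\<close>[OF that]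
      unfolding mpol_eval_eq_mpol_fun mpol_fun_mult by auto
    then have "p * k \<in> vanishing_ideal n X"
      using mpols_mult[OF that(1,2)] unfolding vanishing_ideal_def by blast
    then show ?thesis using vanishing_product[OF X that(1,2)] that(3) by blast
  qed
  note dense = this
  show ?thesis
  proof (rule generic_sectionI)
    show "p \<in> vanishing_ideal n X" if p: "p \<in> mpols n" "k \<in> mpols n" "k \<notin> vanishing_ideal n X"
      and zero: "\<And>x. x \<in> X \<Longrightarrow> mpol_eval (1 :: 'a mpol) x \<noteq> 0 \<Longrightarrow> mpol_eval k x \<noteq> 0 \<Longrightarrow> mpol_eval p x = 0" for p k
    proof (rule dense[OF p])
      fix x assume "x \<in> X" "mpol_eval k x \<noteq> 0"
      then show "mpol_eval p x = 0" using zero[of x] one[of x] by simp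
    qed
    show "regular_function n {x \<in> X. mpol_eval (1 :: 'a mpol) x \<noteq> 0} (\<lambda>x. x $ j)" if "j < n" for j
      by (rule regular_function_var[OF that])
  qed (rule mpols_one one_not_vanishing[OF X] refl | assumption)+
qed

context blowup_centre
begin

lemma graph_point_regular:
  assumes i: "i < N"
  shows "regular_function m (Y - Z) (\<lambda>y. graph_point gs y $ i)"
proof (cases "i < m")
  case True
  have "graph_point gs y $ i = y $ i" if "y \<in> Y - Z" for y
    using graph_point_index(1)[of y m i gs] True Y_carrier that by blast
  then show ?thesis by (intro regular_function_cong[OF regular_function_var[OF True]]) simp
next
  case False
  define k where "k = i - m"
  have k: "i = m + k" "k < length gs * length gs" using False i unfolding k_def N_def by auto
  have l: "length gs > 0" using k(2) by (cases gs) auto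
  have dm: "k div length gs < length gs" "k mod length gs < length gs"
    using k(2) l by (auto simp: less_mult_imp_div_less)
  have gm: "gs ! j \<in> mpols m" if "j < length gs" for j using gs that nth_mem by blast
  have "regular_function m (Y - Z) (\<lambda>y. mpol_eval (gs ! (k div length gs)) y * mpol_eval (gs ! (k mod length gs)) y /
      (\<Sum>j<length gs. mpol_eval (gs ! j) y * mpol_eval (gs ! j) y))"
  proof (rule regular_function_divide)
    show "regular_function m (Y - Z) (\<lambda>y. mpol_eval (gs ! (k div length gs)) y * mpol_eval (gs ! (k mod length gs)) y)"
      by (intro regular_function_mult regular_function_mpol gm dm)
    show "regular_function m (Y - Z) (\<lambda>y. \<Sum>j<length gs. mpol_eval (gs ! j) y * mpol_eval (gs ! j) y)"
      by (intro regular_function_sum regular_function_mult regular_function_mpol gm) auto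
    show "(\<Sum>j<length gs. mpol_eval (gs ! j) y * mpol_eval (gs ! j) y) \<noteq> 0" if "y \<in> Y - Z" for y
      using generator_norm_nonzero[of y] that by (simp add: power2_eq_square)
  qed
  then show ?thesis
  proof (rule regular_function_cong)
    fix y assume "y \<in> Y - Z"
    then have "y \<in> carrier_vec m" using Y_carrier by blast
    from graph_point_index(2)[OF this k(2)]
    have "graph_point gs y $ i = projection_point (map (\<lambda>g. mpol_eval g y) gs) $ k" unfolding k(1) .
    then show "mpol_eval (gs ! (k div length gs)) y * mpol_eval (gs ! (k mod length gs)) y /
        (\<Sum>j<length gs. mpol_eval (gs ! j) y * mpol_eval (gs ! j) y) = graph_point gs y $ i"
      using k(2) dm unfolding projection_point_def Let_def by (simp add: power2_eq_square)
  qed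
qed

text \<open>The section leaves the centre generically, because its image is dense and a polynomial
  vanishing on the centre does not vanish everywhere; there it lifts through the graph.\<close>

lemma generic_section_blowup:
  assumes X: "irreducible_set n X" and sec: "generic_section n X m Y \<phi> g s" and proper: "Z \<noteq> Y"
    and \<psi>: "biregular k W N model \<psi>" and \<pi>: "\<And>w. w \<in> W \<Longrightarrow> \<pi> w = vec_first (\<psi> w) m"
  shows "\<exists>g' s'. generic_section n X k W (\<phi> \<circ> \<pi>) g' s'"
proof -
  note sec = generic_sectionD[OF sec]
  let ?D = "{x \<in> X. mpol_eval g x \<noteq> 0}"
  obtain y0 where y0: "y0 \<in> Y" "y0 \<notin> Z" using proper ZY by blast
  have "y0 \<in> carrier_vec m" using y0(1) Y_carrier by blast
  from nonzero_outside_algebraic_set[OF Z this y0(2)] obtain q where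
    q: "q \<in> vanishing_ideal m Z" "mpol_eval q y0 \<noteq> 0" by blast
  have qm: "q \<in> mpols m" and qZ: "\<And>y. y \<in> Z \<Longrightarrow> mpol_eval q y = 0" using q(1) unfolding vanishing_ideal_def by auto
  have qY: "q \<notin> vanishing_ideal m Y" using q(2) y0(1) unfolding vanishing_ideal_def by auto
  have "regular_function n ?D (\<lambda>x. mpol_eval q (s x))"
    by (rule regular_function_mpol_compose[OF qm]) (rule sec(3))
  then obtain a b where ab: "a \<in> mpols n" "b \<in> mpols n"
    "\<And>x. x \<in> ?D \<Longrightarrow> mpol_eval b x \<noteq> 0" "\<And>x. x \<in> ?D \<Longrightarrow> mpol_eval q (s x) = mpol_eval a x / mpol_eval b x"
    by (rule regular_functionE) blast
  have av: "a \<notin> vanishing_ideal n X"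
  proof
    assume "a \<in> vanishing_ideal n X"
    then have zero: "mpol_eval q (s x) = 0" if "x \<in> X" "mpol_eval g x \<noteq> 0" for x
      using ab(4)[of x] that unfolding vanishing_ideal_def by simp
    have "q \<in> vanishing_ideal m Y" by (rule sec(6)[OF qm sec(1,2)]) (rule zero)
    then show False using qY by blast
  qed
  define g1 where "g1 = g * a"
  have g1: "g1 \<in> mpols n" "g1 \<notin> vanishing_ideal n X"
    unfolding g1_def using mpols_mult[OF sec(1) ab(1)] nonvanishing_mult[OF X sec(1) ab(1) sec(2) av] by blast+
  let ?D1 = "{x \<in> X. mpol_eval g1 x \<noteq> 0}"
  have g1_nz: "mpol_eval g1 x \<noteq> 0 \<longleftrightarrow> mpol_eval g x \<noteq> 0 \<and> mpol_eval a x \<noteq> 0" for x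
    unfolding g1_def by (rule mpol_eval_mult_nonzero)
  have sYZ: "s x \<in> Y - Z" if x: "x \<in> X" "mpol_eval g1 x \<noteq> 0" for x
  proof -
    have "x \<in> ?D" "mpol_eval a x \<noteq> 0" using x g1_nz by auto
    then have "mpol_eval q (s x) \<noteq> 0" using ab(3,4)[of x] by simp
    then show ?thesis using qZ sec(4)[of x] \<open>x \<in> ?D\<close> by blast
  qed
  define v where "v = (\<lambda>x. graph_point gs (s x))"
  define s1 where "s1 = (\<lambda>x. inv_into W \<psi> (v x))"
  have bij: "bij_betw \<psi> W model" and inv_reg: "regular_map N model k W (inv_into W \<psi>)"
    using \<psi> unfolding biregular_def by blast+
  have inv_comp: "regular_function N model (\<lambda>v. inv_into W \<psi> v $ j)" if "j < k" for j
    using inv_reg that unfolding regular_map_def by blast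
  have invW: "inv_into W \<psi> u \<in> W" if "u \<in> model" for u
    using inv_reg that unfolding regular_map_def by blast
  have vM: "v x \<in> model" if x: "x \<in> X" "mpol_eval g1 x \<noteq> 0" for x
    using graph_point_model sYZ[OF x] unfolding v_def by blast
  have v_reg: "regular_function n ?D1 (\<lambda>x. v x $ i)" if "i < N" for i
    unfolding v_def
  proof (rule regular_function_compose[OF graph_point_regular[OF that]])
    show "regular_function n ?D1 (\<lambda>x. s x $ j)" if "j < m" for j
      by (rule regular_function_subset[OF sec(3)[OF that]]) (use g1_nz in auto)
    show "s x \<in> Y - Z" if "x \<in> ?D1" for x using sYZ that by blast
  qed
  have s1_reg: "regular_function n ?D1 (\<lambda>x. s1 x $ j)" if "j < k" for j
    unfolding s1_def
  proof (rule regular_function_compose[OF inv_comp[OF that]])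
    show "regular_function n ?D1 (\<lambda>x. v x $ i)" if "i < N" for i by (rule v_reg[OF that])
    show "v x \<in> model" if "x \<in> ?D1" for x using vM that by blast
  qed
  have s1W: "s1 x \<in> W" and s1_section: "(\<phi> \<circ> \<pi>) (s1 x) = x" if x: "x \<in> X" "mpol_eval g1 x \<noteq> 0" for x
  proof -
    show W: "s1 x \<in> W" unfolding s1_def by (rule invW[OF vM[OF x]])
    have "\<psi> (s1 x) = v x" unfolding s1_def by (rule bij_betw_inv_into_right[OF bij vM[OF x]])
    moreover have "s x \<in> carrier_vec m" using sYZ[OF x] Y_carrier by blast
    ultimately have "\<pi> (s1 x) = s x" using \<pi>[OF W] vec_first_graph_point unfolding v_def by simp
    then show "(\<phi> \<circ> \<pi>) (s1 x) = x" using sec(5)[OF x(1)] x(2) g1_nz by simp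
  qed
  have dense: "p \<in> vanishing_ideal k W"
    if p: "p \<in> mpols k" and c: "c \<in> mpols n" "c \<notin> vanishing_ideal n X"
      and zero: "\<And>x. x \<in> X \<Longrightarrow> mpol_eval g1 x \<noteq> 0 \<Longrightarrow> mpol_eval c x \<noteq> 0 \<Longrightarrow> mpol_eval p (s1 x) = 0" for p c
  proof -
    have "regular_function N model (\<lambda>u. mpol_eval p (inv_into W \<psi> u))"
      by (rule regular_function_mpol_compose[OF p]) (rule inv_comp)
    then obtain P Q where PQ: "P \<in> mpols N" "Q \<in> mpols N" "\<And>u. u \<in> model \<Longrightarrow> mpol_eval Q u \<noteq> 0"
      "\<And>u. u \<in> model \<Longrightarrow> mpol_eval p (inv_into W \<psi> u) = mpol_eval P u / mpol_eval Q u"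
      by (rule regular_functionE) blast
    have "regular_function m (Y - Z) (\<lambda>y. mpol_eval P (graph_point gs y))"
      by (rule regular_function_mpol_compose[OF PQ(1)]) (rule graph_point_regular)
    then obtain A B where AB: "A \<in> mpols m" "B \<in> mpols m" "\<And>y. y \<in> Y - Z \<Longrightarrow> mpol_eval B y \<noteq> 0"
      "\<And>y. y \<in> Y - Z \<Longrightarrow> mpol_eval P (graph_point gs y) = mpol_eval A y / mpol_eval B y"
      by (rule regular_functionE) blast
    have "A \<in> vanishing_ideal m Y"
    proof (rule sec(6)[OF AB(1)])
      show "a * c \<in> mpols n" by (rule mpols_mult[OF ab(1) c(1)])
      show "a * c \<notin> vanishing_ideal n X" by (rule nonvanishing_mult[OF X ab(1) c(1) av c(2)])
      fix x assume x: "x \<in> X" "mpol_eval g x \<noteq> 0" "mpol_eval (a * c) x \<noteq> 0"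
      then have x1: "mpol_eval g1 x \<noteq> 0" and cx: "mpol_eval c x \<noteq> 0"
        unfolding g1_nz mpol_eval_mult_nonzero by blast+
      have "mpol_eval P (v x) / mpol_eval Q (v x) = 0"
        using zero[OF x(1) x1 cx] PQ(4)[OF vM[OF x(1) x1]] unfolding s1_def by simp
      then have "mpol_eval P (graph_point gs (s x)) = 0" using PQ(3)[OF vM[OF x(1) x1]] unfolding v_def by simp
      then show "mpol_eval A (s x) = 0" using AB(3,4)[OF sYZ[OF x(1) x1]] by simp
    qed
    then have P_graph: "mpol_eval P (graph_point gs y) = 0" if "y \<in> Y" "y \<notin> Z" for y
      using AB(4)[of y] that unfolding vanishing_ideal_def by simp
    have P0: "mpol_eval P u = 0" if "u \<in> model" for u by (rule model_vanish[OF that PQ(1)]) (rule P_graph)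
    have "mpol_eval p w = 0" if w: "w \<in> W" for w
    proof -
      have "\<psi> w \<in> model" using bij_betwE[OF bij] w by blast
      then show ?thesis using PQ(4)[of "\<psi> w"] P0[of "\<psi> w"] bij_betw_inv_into_left[OF bij w] by simp
    qed
    then show ?thesis using p unfolding vanishing_ideal_def by blast
  qed
  have "generic_section n X k W (\<phi> \<circ> \<pi>) g1 s1"
    by (rule generic_sectionI) (fact g1 s1_reg s1W s1_section dense)+
  then show ?thesis by blast
qed

end

lemma blowup_sequence_properties:
  fixes X :: "'a::real_closed_field vec set"
  assumes "blowup_sequence n X m Y \<phi>" and X: "irreducible_set n X"
  shows "algebraic_set m Y \<and> bounded_over n X m Y \<phi> \<and> (\<exists>g s. generic_section n X m Y \<phi> g s)"
  using assms(1)
proof (induction rule: blowup_sequence.induct)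
  case blowup_sequence_Nil
  have "algebraic_set n X" using X unfolding irreducible_set_def by blast
  then show ?case using bounded_over_id[of n X] generic_section_id[OF X] by blast
next
  case (blowup_sequence_snoc m Y \<phi> Z k W \<pi>)
  from \<open>is_blowup m Y Z k W \<pi>\<close> obtain gs \<psi> where W: "algebraic_set k W" and gs: "set gs \<subseteq> mpols m"
    "vanishing_ideal m Z = Idl\<^bsub>mpol_ring m\<^esub> (vanishing_ideal m Y \<union> set gs)"
    and \<psi>: "biregular k W (m + length gs * length gs) (blowup_model m Y Z gs) \<psi>"
    and \<pi>: "\<And>w. w \<in> W \<Longrightarrow> \<pi> w = vec_first (\<psi> w) m"
    unfolding is_blowup_def by blast
  have Z: "algebraic_set m Z" using \<open>nonsingular m Z\<close> unfolding nonsingular_def by blast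
  have sub: "Z \<subseteq> Y" and proper: "Z \<noteq> Y" using \<open>Z \<subset> Y\<close> by blast+
  have Yalg: "algebraic_set m Y" using blowup_sequence_snoc.IH by blast
  interpret blowup_centre m Y Z gs by (rule blowup_centre.intro[OF Yalg Z sub gs])
  have \<psi>': "biregular k W N model \<psi>" using \<psi> unfolding N_def model_def .
  obtain g s where sec: "generic_section n X m Y \<phi> g s" and bd: "bounded_over n X m Y \<phi>"
    using blowup_sequence_snoc.IH by blast
  show ?case
  proof (intro conjI)
    show "algebraic_set k W" by (rule W)
    show "bounded_over n X k W (\<phi> \<circ> \<pi>)" by (rule bounded_over_blowup[OF bd \<psi>']) (rule \<pi>)
    show "\<exists>g s. generic_section n X k W (\<phi> \<circ> \<pi>) g s"
      by (rule generic_section_blowup[OF X sec proper \<psi>']) (rule \<pi>)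
  qed
qed

section \<open>Local boundedness\<close>

text \<open>Both fractions agree with a fixed representative \<open>p / q\<close> wherever \<open>q\<close> does not vanish; as \<open>X\<close>
  is irreducible, \<open>q\<close> can be cancelled.\<close>

lemma rational_function_cross:
  fixes X :: "'a::field vec set"
  assumes X: "irreducible_set n X" and f: "f \<in> rational_functions n X"
    and pq: "(p1, q1) \<in> f" "(p2, q2) \<in> f" and x: "x \<in> X"
  shows "mpol_eval p1 x * mpol_eval q2 x = mpol_eval p2 x * mpol_eval q1 x"
proof -
  obtain c where "c \<in> fractions n X" "f = fraction_rel n X `` {c}"
    using f unfolding rational_functions_def by (rule quotientE) blast
  then obtain p q where rel: "((p, q), (p1, q1)) \<in> fraction_rel n X" "((p, q), (p2, q2)) \<in> fraction_rel n X"
    using pq by (cases c) auto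
  then have mem: "p1 \<in> mpols n" "q1 \<in> mpols n" "p2 \<in> mpols n" "q2 \<in> mpols n" "q \<in> mpols n" "q \<notin> vanishing_ideal n X"
    and 1: "\<And>x. x \<in> X \<Longrightarrow> mpol_eval p x * mpol_eval q1 x = mpol_eval p1 x * mpol_eval q x"
    and 2: "\<And>x. x \<in> X \<Longrightarrow> mpol_eval p x * mpol_eval q2 x = mpol_eval p2 x * mpol_eval q x"
    unfolding fraction_rel_def fractions_def vanishing_ideal_def
    by (auto simp: mpol_eval_eq_mpol_fun mpol_fun_simps)
  let ?c = "p1 * q2 - p2 * q1"
  have c: "?c \<in> mpols n" by (intro mpols_diff mpols_mult mem)
  have "mpol_eval (?c * q) z = 0" if z: "z \<in> X" for z
  proof -
    have "mpol_eval (?c * q) z = mpol_eval q2 z * (mpol_eval p1 z * mpol_eval q z) - mpol_eval q1 z * (mpol_eval p2 z * mpol_eval q z)"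
      unfolding mpol_eval_eq_mpol_fun mpol_fun_simps by (simp add: algebra_simps)
    also have "\<dots> = 0" unfolding 1[OF z, symmetric] 2[OF z, symmetric] by simp
    finally show ?thesis .
  qed
  then have "?c * q \<in> vanishing_ideal n X" using mpols_mult[OF c mem(5)] unfolding vanishing_ideal_def by blast
  then have "?c \<in> vanishing_ideal n X" using vanishing_product[OF X c mem(5)] mem(6) by blast
  then show ?thesis using x unfolding vanishing_ideal_def mpol_eval_eq_mpol_fun by (simp add: mpol_fun_simps)
qed

lemma rat_value_eq:
  fixes X :: "'a::field vec set"
  assumes X: "irreducible_set n X" and f: "f \<in> rational_functions n X"
    and pq: "(p, q) \<in> f" and x: "x \<in> X" "mpol_eval q x \<noteq> 0"
  shows "rat_value f x = mpol_eval p x / mpol_eval q x"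
  unfolding rat_value_def
proof (rule the_equality)
  show "\<exists>(p', q')\<in>f. mpol_eval q' x \<noteq> 0 \<and> mpol_eval p x / mpol_eval q x = mpol_eval p' x / mpol_eval q' x"
    using pq x(2) by blast
  fix v assume "\<exists>(p', q')\<in>f. mpol_eval q' x \<noteq> 0 \<and> v = mpol_eval p' x / mpol_eval q' x"
  then obtain p' q' where v: "(p', q') \<in> f" "mpol_eval q' x \<noteq> 0" "v = mpol_eval p' x / mpol_eval q' x" by blast
  show "v = mpol_eval p x / mpol_eval q x"
    using rational_function_cross[OF X f v(1) pq x(1)] v(2,3) x(2) by (simp add: frac_eq_eq)
qed

lemma euclidean_open_box:
  fixes c :: "nat \<Rightarrow> 'a::linordered_field"
  shows "euclidean_open n {y \<in> carrier_vec n. \<forall>i<n. \<bar>y $ i - c i\<bar> < \<rho>}"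
  unfolding euclidean_open_def
proof (intro conjI ballI)
  fix x assume x: "x \<in> {y \<in> carrier_vec n. \<forall>i<n. \<bar>y $ i - c i\<bar> < \<rho>}"
  define r where "r = Min (insert 1 ((\<lambda>i. \<rho> - \<bar>x $ i - c i\<bar>) ` {..<n}))"
  have r: "r > 0" "\<And>i. i < n \<Longrightarrow> r \<le> \<rho> - \<bar>x $ i - c i\<bar>"
    unfolding r_def using x by (auto intro!: Min_le)
  have "\<bar>y $ i - c i\<bar> < \<rho>" if y: "(\<Sum>i<n. (y $ i - x $ i)\<^sup>2) < r\<^sup>2" and i: "i < n" for y i
  proof -
    have "(y $ i - x $ i)\<^sup>2 \<le> (\<Sum>i<n. (y $ i - x $ i)\<^sup>2)" using i by (intro member_le_sum) auto
    then have "\<bar>y $ i - x $ i\<bar>\<^sup>2 < r\<^sup>2" using y by simp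
    then have "\<bar>y $ i - x $ i\<bar> < r" using r(1) by (intro power_less_imp_less_base[of _ 2 r]) auto
    then show ?thesis using r(2)[OF i] by linarith
  qed
  then show "\<exists>r>0. {y \<in> carrier_vec n. (\<Sum>i<n. (y $ i - x $ i)\<^sup>2) < r\<^sup>2} \<subseteq> {y \<in> carrier_vec n. \<forall>i<n. \<bar>y $ i - c i\<bar> < \<rho>}"
    using r(1) by (intro exI[of _ r]) blast
qed blast

text \<open>A value larger than the bound would, by continuity, persist on a neighbourhood; but points in
  the image of the section, where the bound holds, are dense around every point.\<close>

lemma rational_function_bounded:
  fixes X :: "'a::real_closed_field vec set"
  assumes X: "irreducible_set n X" "nonsingular n X" and f: "f \<in> rational_functions n X"
    and sec: "generic_section n X m Y \<phi> g s"
    and h: "\<And>y. y \<in> Y \<Longrightarrow> \<phi> y \<in> rat_dom n X f \<Longrightarrow> h y = rat_value f (\<phi> y)"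
    and C: "C \<ge> 0" "\<And>y. y \<in> Y \<Longrightarrow> in_box n \<rho> c (($) (\<phi> y)) \<Longrightarrow> \<bar>h y\<bar> \<le> C"
    and x: "x \<in> X" "x \<in> rat_dom n X f" "\<And>i. i < n \<Longrightarrow> \<bar>x $ i - c i\<bar> < \<rho>"
  shows "\<bar>rat_value f x\<bar> \<le> C"
proof (rule ccontr)
  assume big: "\<not> \<bar>rat_value f x\<bar> \<le> C"
  note sec = generic_sectionD[OF sec]
  obtain U where U: "zariski_open_in n X U" "zariski_dense_in n X U" "rat_regular_on f U" "x \<in> U"
    using x(2) unfolding rat_dom_def by blast
  obtain A where A: "algebraic_set n A" "U = X - A" using U(1) unfolding zariski_open_in_def by blast
  obtain p q where pq: "(p, q) \<in> f" "\<And>y. y \<in> U \<Longrightarrow> mpol_eval q y \<noteq> 0"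
    using U(3) unfolding rat_regular_on_def by blast
  have "f \<subseteq> fractions n X" using f unfolding rational_functions_def quotient_def fraction_rel_def by auto
  then have mem: "p \<in> mpols n" "q \<in> mpols n" "q \<notin> vanishing_ideal n X" using pq(1) unfolding fractions_def by auto
  have val: "rat_value f y = mpol_eval p y / mpol_eval q y" if "y \<in> U" for y
    using that A(2) by (intro rat_value_eq[OF X(1) f pq(1) _ pq(2)]) auto
  have "X \<subseteq> carrier_vec n" using X(1) unfolding irreducible_set_def algebraic_set_def by blast
  then have "x \<in> carrier_vec n" "x \<notin> A" using x(1) U(4) A(2) by blast+
  then obtain a where a: "a \<in> vanishing_ideal n A" "mpol_eval a x \<noteq> 0"
    using nonzero_outside_algebraic_set[OF A(1)] by blast
  have a': "a \<in> mpols n" "a \<notin> vanishing_ideal n X" using a x(1) unfolding vanishing_ideal_def by auto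
  define \<Delta> where "\<Delta> = \<bar>mpol_eval p x\<bar> - C * \<bar>mpol_eval q x\<bar>"
  have "C < \<bar>mpol_eval p x\<bar> / \<bar>mpol_eval q x\<bar>" using big val[OF U(4)] by (simp add: abs_divide)
  then have \<Delta>: "\<Delta> > 0" using pq(2)[OF U(4)] unfolding \<Delta>_def by (simp add: field_simps)
  define e where "e = \<Delta> / (2 * (1 + C))"
  have e: "e > 0" "e + C * e < \<Delta>"
  proof -
    show "e > 0" using \<Delta> C(1) unfolding e_def by simp
    have "e + C * e = (1 + C) * e" by (simp add: algebra_simps)
    also have "\<dots> = \<Delta> / 2" using C(1) unfolding e_def by (simp add: field_simps)
    finally show "e + C * e < \<Delta>" using \<Delta> by simp
  qed
  obtain d1 where d1: "d1 > 0" "\<And>y. in_box n d1 (($) x) y \<Longrightarrow> \<bar>mpol_fun p y - mpol_fun p (($) x)\<bar> \<le> e"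
    using polyfuns_continuous[OF mpol_fun_polyfuns[OF mem(1)] e(1)] by blast
  obtain d2 where d2: "d2 > 0" "\<And>y. in_box n d2 (($) x) y \<Longrightarrow> \<bar>mpol_fun q y - mpol_fun q (($) x)\<bar> \<le> e"
    using polyfuns_continuous[OF mpol_fun_polyfuns[OF mem(2)] e(1)] by blast
  define d3 where "d3 = Min (insert 1 ((\<lambda>i. \<rho> - \<bar>x $ i - c i\<bar>) ` {..<n}))"
  have d3: "d3 > 0" "\<And>i. i < n \<Longrightarrow> d3 \<le> \<rho> - \<bar>x $ i - c i\<bar>"
    unfolding d3_def using x(3) by (auto intro!: Min_le)
  define \<delta> where "\<delta> = min d1 (min d2 d3)"
  have \<delta>: "\<delta> > 0" "\<delta> \<le> d1" "\<delta> \<le> d2" "\<delta> \<le> d3" using d1(1) d2(1) d3(1) unfolding \<delta>_def by auto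
  have "g * a \<in> mpols n" "g * a \<notin> vanishing_ideal n X"
    using mpols_mult[OF sec(1) a'(1)] nonvanishing_mult[OF X(1) sec(1) a'(1) sec(2) a'(2)] by blast+
  from nonsingular_dense[OF X x(1) this \<delta>(1)] obtain y where
    y: "y \<in> X" "in_box n \<delta> (($) x) (($) y)" "mpol_eval (g * a) y \<noteq> 0" by blast
  have gy: "mpol_eval g y \<noteq> 0" and ay: "mpol_eval a y \<noteq> 0" using y(3) unfolding mpol_eval_mult_nonzero by blast+
  have "y \<notin> A" using ay a(1) unfolding vanishing_ideal_def by blast
  then have yU: "y \<in> U" using y(1) A(2) by blast
  then have "y \<in> rat_dom n X f" using U(1-3) unfolding rat_dom_def by blast
  then have hs: "h (s y) = mpol_eval p y / mpol_eval q y"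
    using h[OF sec(4)[OF y(1) gy]] sec(5)[OF y(1) gy] val[OF yU] by simp
  have "in_box n \<rho> c (($) y)"
    unfolding in_box_def
  proof (intro allI impI)
    fix i assume i: "i < n"
    have "\<bar>y $ i - x $ i\<bar> \<le> \<delta>" using y(2) i unfolding in_box_def by blast
    then show "\<bar>y $ i - c i\<bar> \<le> \<rho>" using d3(2)[OF i] \<delta>(4) by linarith
  qed
  then have "\<bar>h (s y)\<bar> \<le> C" using C(2)[OF sec(4)[OF y(1) gy]] sec(5)[OF y(1) gy] by simp
  then have "\<bar>mpol_eval p y\<bar> \<le> C * \<bar>mpol_eval q y\<bar>"
    using pq(2)[OF yU] unfolding hs abs_divide by (simp add: field_simps)
  moreover have "\<bar>mpol_eval p y - mpol_eval p x\<bar> \<le> e" "\<bar>mpol_eval q y - mpol_eval q x\<bar> \<le> e"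
    using d1(2)[OF in_box_mono[OF y(2) \<delta>(2)]] d2(2)[OF in_box_mono[OF y(2) \<delta>(3)]]
    unfolding mpol_eval_eq_mpol_fun by blast+
  moreover have "C * \<bar>mpol_eval q y\<bar> \<le> C * \<bar>mpol_eval q x\<bar> + C * e"
  proof -
    have "\<bar>mpol_eval q y\<bar> \<le> \<bar>mpol_eval q x\<bar> + e"
      using \<open>\<bar>mpol_eval q y - mpol_eval q x\<bar> \<le> e\<close> by linarith
    from mult_left_mono[OF this C(1)] show ?thesis by (simp add: algebra_simps)
  qed
  ultimately show False using e(2) unfolding \<Delta>_def by linarith
qed

theorem theorem3p9:
  fixes X :: "'a::real_closed_field vec set" and n :: nat and f :: "('a mpol \<times> 'a mpol) set"
  assumes "irreducible_set n X"
    and "nonsingular n X"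
    and "f \<in> rational_functions n X"
    and "\<exists>m Y \<phi>. blowup_sequence n X m Y \<phi> \<and> regular_composition n X f m Y \<phi>"
  shows "f \<in> locally_bounded_functions n X"
proof -
  obtain m Y \<phi> where seq: "blowup_sequence n X m Y \<phi>" and comp: "regular_composition n X f m Y \<phi>"
    using assms(4) by blast
  obtain h where h: "regular_function m Y h"
    "\<And>y. y \<in> Y \<Longrightarrow> \<phi> y \<in> rat_dom n X f \<Longrightarrow> h y = rat_value f (\<phi> y)"
    using comp unfolding regular_composition_def by blast
  obtain g s where bd: "bounded_over n X m Y \<phi>" and sec: "generic_section n X m Y \<phi> g s"
    using blowup_sequence_properties[OF seq assms(1)] by blast
  have main: "\<exists>V. euclidean_nhd n X x V \<and> bdd_above (rat_value f ` (V \<inter> rat_dom n X f)) \<and>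
      bdd_below (rat_value f ` (V \<inter> rat_dom n X f))" if x: "x \<in> X" for x
  proof -
    obtain \<rho> C where \<rho>: "\<rho> > 0" and C: "C \<ge> 0" "\<And>y. y \<in> Y \<Longrightarrow> in_box n \<rho> (($) x) (($) (\<phi> y)) \<Longrightarrow> \<bar>h y\<bar> \<le> C"
      using bounded_overD[OF bd h(1) x] by blast
    define U where "U = {y \<in> carrier_vec n. \<forall>i<n. \<bar>y $ i - x $ i\<bar> < \<rho>}"
    have "X \<subseteq> carrier_vec n" using assms(1) unfolding irreducible_set_def algebraic_set_def by blast
    then have "x \<in> U" using x \<rho> unfolding U_def by auto
    moreover have "euclidean_open n U" unfolding U_def by (rule euclidean_open_box)
    ultimately have nhd: "euclidean_nhd n X x (U \<inter> X)" unfolding euclidean_nhd_def by blast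
    have bound: "\<bar>rat_value f z\<bar> \<le> C" if z: "z \<in> U \<inter> X \<inter> rat_dom n X f" for z
    proof (rule rational_function_bounded[where h = h and C = C and \<rho> = \<rho> and c = "($) x", OF assms(1-3) sec])
      show "h y = rat_value f (\<phi> y)" if "y \<in> Y" "\<phi> y \<in> rat_dom n X f" for y using h(2)[OF that] .
      show "\<bar>h y\<bar> \<le> C" if "y \<in> Y" "in_box n \<rho> (($) x) (($) (\<phi> y))" for y using C(2)[OF that] .
      show "\<bar>z $ i - x $ i\<bar> < \<rho>" if "i < n" for i using z that unfolding U_def by blast
    qed (use C(1) z in blast)+
    have "rat_value f z \<le> C" "- C \<le> rat_value f z" if "z \<in> U \<inter> X \<inter> rat_dom n X f" for z
      using bound[OF that] by linarith+
    then have "bdd_above (rat_value f ` (U \<inter> X \<inter> rat_dom n X f))" "bdd_below (rat_value f ` (U \<inter> X \<inter> rat_dom n X f))"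
      unfolding bdd_above_def bdd_below_def by blast+
    with nhd show ?thesis by blast
  qed
  show ?thesis
    unfolding locally_bounded_functions_def
  proof (intro CollectI conjI ballI)
    show "f \<in> rational_functions n X" by (rule assms(3))
  qed (rule main)
qed

end
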